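(* Let $\sigma_x>0$. Let $F_n,G_n:\mathbb{R}^d\times\mathcal{P}_2(\mathbb{R}^d)\times\mathbb{R}^d\to\mathbb{R}^d$ ($n\in\mathbb{N}$) be continuous functions such that, for a constant $C$ independent of $n$, $|F_n(x,\mu,u)|+|G_n(x,\mu,u)|\le C(1+|x|+|u|+\sqrt{E_2(\mu)})$ for all $(x,\mu,u)$; let $(\sigma_n)_n\subset\mathbb{R}^+$, and let $W_n$ be, for each $n$, a monotone solution on $[0,T]$ associated with the data $(F_n,G_n,\sigma_n)$. Suppose that $(F_n,G_n,\sigma_n)$ converges locally uniformly to $(F,G,\sigma_x)$, that $(W_n)_n$ converges locally uniformly in $C([0,T]\times\mathbb{R}^d\times\mathcal{P}_2(\mathbb{R}^d),\mathbb{R}^d)$ to a function $W$, and that there exists $C>0$ such that for all $n$ and all $(t,x,\mu)\in[0,T]\times\mathbb{R}^d\times\mathcal{P}_2(\mathbb{R}^d)$, $|W_n(t,x,\mu)|\le C(1+|x|+\sqrt{E_2(\mu)})$. Then $W$ is a monotone solution associated with the data $(F,G,\sigma_x)$.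
   Context: Fix $d\ge1$, $T>0$. $\mathcal{P}_2(\mathbb{R}^k)$ carries the Wasserstein distance $\mathcal{W}_2$; $E_q(\mu)=\int|y|^q\mu(dy)$. For $m\in\mathcal{P}_2(\mathbb{R}^{2d})$, $\pi_dm$ and $\pi_{-d}m$ denote its marginals over the first $d$ and last $d$ variables; points of $\mathbb{R}^{2d}$ are written $(x,y)$. Locally uniform convergence means uniform convergence on compact subsets. The entropy is $\mathcal{E}(m)=\int\log(m(z))\,m(dz)$ if $m$ has a Lebesgue density (also denoted $m$), and $+\infty$ otherwise. The master equation with idiosyncratic noise associated with $(F,G,\sigma)$ is $$\partial_tW+F(x,m,W)\cdot\nabla_xW-\sigma\Delta_xW+\int F(y,m,W(t,y,m))\cdot D_mW(t,x,m)(y)m(dy)-\sigma\int\mathrm{div}_y(D_mW(t,x,m)(y))m(dy)=G(x,m,W)$$ in $(0,T)\times\mathbb{R}^d\times\mathcal{P}_2(\mathbb{R}^d)$. Test functions: $H_{test}$ is the set of $\varphi(t,m)=\psi(t)+\int f_\varphi\,dm-\alpha e^{\lambda t}(E_3(\pi_dm)+E_3(\pi_{-d}m))$ on $[0,T)\times\mathcal{P}_2(\mathbb{R}^{2d})$ with $\psi$ bounded in $C^1([0,\tau],\mathbb{R})$ for every $\tau<T$, $\alpha,\lambda>0$, $f_\varphi\in C^2(\mathbb{R}^{2d},\mathbb{R})$ with $\|f_\varphi\|_\infty+\|Df_\varphi\|_\infty+\|D^2f_\varphi\|_\infty<\infty$. Up to an additive constant, $\nabla_m\varphi(t,m)(x,y)=f_\varphi(x,y)-\alpha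 e^{\lambda t}(|x|^3+|y|^3)$. Monotone solution associated with $(F,G,\sigma)$: a function $W\in C([0,T]\times\mathbb{R}^d\times\mathcal{P}_2(\mathbb{R}^d),\mathbb{R}^d)$ such that for every continuous $V:\mathbb{R}^d\times\mathcal{P}_2(\mathbb{R}^d)\to\mathbb{R}^d$ with at most linear growth ($|V(y,\mu)|\le C(1+|y|+\sqrt{E_2(\mu)})$), setting $Z(t,m)=\int_{\mathbb{R}^{2d}}(W(t,x,\pi_dm)-V(y,\pi_{-d}m))\cdot(x-y)\,m(dx,dy)$, for every $\varphi\in H_{test}$, $\kappa>0$ and every point of minimum $(t^*,m^* )\in(0,T)\times\mathcal{P}_2(\mathbb{R}^{2d})$ of $(t,m)\mapsto Z(t,m)-\varphi(t,m)+\kappa\mathcal{E}(m)$, one has $\int|\nabla_x\log(m^*(x,y))|^2m^*(dx,dy)<+\infty$ and, writing $W^*(x)=W(t^*,x,\pi_dm^* )$, $F^*(x)=F(x,\pi_dm^*,W^*(x))$, $G^*(x)=G(x,\pi_dm^*,W^*(x))$, all integrals being over $\mathbb{R}^{2d}$ against $m^*(dx,dy)$, $$\partial_t\varphi(t^*,m^* )+\int F^*(x)\cdot\nabla_x\nabla_m\varphi(t^*,m^* )(x,y)\,dm^*-\sigma\int\Delta_x\nabla_m\varphi(t^*,m^* )(x,y)\,dm^*-2\sigma\int W^*(x)\cdot\nabla_x\log(m^*(x,y))\,dm^*$$ $$-\sigma\kappa\int|\nabla_x\log(m^*(x,y))|^2dm^*-\kappa\int F^*(x)\cdot\nabla_x\log(m^*(x,y))\,dm^*\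 \ge\ \int F^*(x)\cdot(W^*(x)-V(y,\pi_{-d}m^* ))\,dm^*+\int G^*(x)\cdot(x-y)\,dm^*.$$ *)

theory Defs
  imports "HOL-Probability.Probability"
begin

definition abs_moment :: "nat \<Rightarrow> 'a::euclidean_space measure \<Rightarrow> ennreal" where
  "abs_moment q \<mu> = (\<integral>\<^sup>+ y. ennreal (norm y ^ q) \<partial>\<mu>)"

text \<open>Borel probability measures with finite second moment.  On \<^typ>\<open>'a \<times> 'a\<close> the library
  norm is the Euclidean one, so \<open>('a \<times> 'a) P2\<close> models the case of dimension \<open>2d\<close>.\<close>

typedef (overloaded) 'a P2 =
  "{\<mu> :: 'a::euclidean_space measure. prob_space \<mu> \<and> sets \<mu> = sets borel \<and> abs_moment 2 \<mu> < \<infinity>}"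
  morphisms meas P2_of
proof
  show "return borel 0 \<in> {\<mu> :: 'a measure. prob_space \<mu> \<and> sets \<mu> = sets borel \<and> abs_moment 2 \<mu> < \<infinity>}"
    by (simp add: prob_space_return abs_moment_def nn_integral_return)
qed

lemma meas_props [simp]:
  "prob_space (meas m)" "sets (meas m) = sets borel" "space (meas m) = UNIV"
  "abs_moment 2 (meas m) < \<infinity>"
  using meas[of m] sets_eq_imp_space_eq[of "meas m" borel] by auto

lemma measurable_meas [simp]:
  "measurable (meas m) N = measurable borel N"
  by (rule measurable_cong_sets) auto

lemma borel_measurable_fst_comp [measurable (raw)]:
  fixes f :: "'c \<Rightarrow> 'a::euclidean_space \<times> 'b::euclidean_space"
  assumes "f \<in> borel_measurable M"
  shows "(\<lambda>x. fst (f x)) \<in> borel_measurable M"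
  by (rule measurable_compose[OF assms]) (intro borel_measurable_continuous_onI continuous_intros)

lemma borel_measurable_snd_comp [measurable (raw)]:
  fixes f :: "'c \<Rightarrow> 'a::euclidean_space \<times> 'b::euclidean_space"
  assumes "f \<in> borel_measurable M"
  shows "(\<lambda>x. snd (f x)) \<in> borel_measurable M"
  by (rule measurable_compose[OF assms]) (intro borel_measurable_continuous_onI continuous_intros)

lemma borel_measurable_fst_snd [measurable, simp]:
  "fst \<in> borel_measurable (borel :: ('a::euclidean_space \<times> 'b::euclidean_space) measure)"
  "snd \<in> borel_measurable (borel :: ('a::euclidean_space \<times> 'b::euclidean_space) measure)"
  by (intro borel_measurable_continuous_onI continuous_intros)+

definition couplings ::
  "'a::euclidean_space measure \<Rightarrow> 'a measure \<Rightarrow> ('a \<times> 'a) measure set" where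
  "couplings \<mu> \<nu> = {\<gamma>. sets \<gamma> = sets borel \<and> distr \<gamma> borel fst = \<mu> \<and> distr \<gamma> borel snd = \<nu>}"

definition transport_cost :: "('a::euclidean_space \<times> 'a) measure \<Rightarrow> ennreal" where
  "transport_cost \<gamma> = (\<integral>\<^sup>+ z. ennreal ((dist (fst z) (snd z))\<^sup>2) \<partial>\<gamma>)"

definition W2_squared :: "'a::euclidean_space measure \<Rightarrow> 'a measure \<Rightarrow> ennreal" where
  "W2_squared \<mu> \<nu> = (INF \<gamma>\<in>couplings \<mu> \<nu>. transport_cost \<gamma>)"

definition W2 :: "'a::euclidean_space measure \<Rightarrow> 'a measure \<Rightarrow> real" where
  "W2 \<mu> \<nu> = sqrt (enn2real (W2_squared \<mu> \<nu>))"

text \<open>The rest of this part shows that \<^term>\<open>W2\<close> is a metric on \<^typ>\<open>'a P2\<close>, so that continuity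
  and compactness on \<open>P2\<close> are those of the library.\<close>

lemma couplingsD:
  assumes "\<gamma> \<in> couplings (meas m) (meas n)"
  shows "prob_space \<gamma>" "sets \<gamma> = sets borel" "space \<gamma> = UNIV"
    "distr \<gamma> borel fst = meas m" "distr \<gamma> borel snd = meas n"
    "measurable \<gamma> N = measurable borel N"
proof -
  show s: "sets \<gamma> = sets borel" and d: "distr \<gamma> borel fst = meas m" "distr \<gamma> borel snd = meas n"
    using assms by (auto simp: couplings_def)
  show "measurable \<gamma> N = measurable borel N"
    by (rule measurable_cong_sets) (use s in auto)
  show "space \<gamma> = UNIV"
    using sets_eq_imp_space_eq[OF s] by simp
  have f: "fst \<in> measurable \<gamma> borel"
    by (subst measurable_cong_sets[OF s refl]) simp
  show "prob_space \<gamma>"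
    by (rule prob_space_distrD[OF f]) (simp add: d)
qed

lemma nn_integral_coupling_fst:
  assumes "\<gamma> \<in> couplings (meas m) (meas n)" "f \<in> borel_measurable borel"
  shows "(\<integral>\<^sup>+ z. f (fst z) \<partial>\<gamma>) = (\<integral>\<^sup>+ x. f x \<partial>meas m)"
  unfolding couplingsD(4)[OF assms(1), symmetric]
  by (subst nn_integral_distr) (simp_all add: couplingsD(6)[OF assms(1)] assms(2))

lemma nn_integral_coupling_snd:
  assumes "\<gamma> \<in> couplings (meas m) (meas n)" "f \<in> borel_measurable borel"
  shows "(\<integral>\<^sup>+ z. f (snd z) \<partial>\<gamma>) = (\<integral>\<^sup>+ x. f x \<partial>meas n)"
  unfolding couplingsD(5)[OF assms(1), symmetric]
  by (subst nn_integral_distr) (simp_all add: couplingsD(6)[OF assms(1)] assms(2))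

lemma couplings_swap:
  assumes "\<gamma> \<in> couplings (meas m) (meas n)"
  shows "\<exists>\<gamma>'\<in>couplings (meas n) (meas m). transport_cost \<gamma>' = transport_cost \<gamma>"
proof
  let ?s = "\<lambda>z. (snd z, fst z)"
  have ms: "?s \<in> measurable \<gamma> borel"
    unfolding couplingsD(6)[OF assms] by measurable
  show "distr \<gamma> borel ?s \<in> couplings (meas n) (meas m)"
    using ms couplingsD(4,5)[OF assms]
    by (simp add: couplings_def distr_distr comp_def)
  show "transport_cost (distr \<gamma> borel ?s) = transport_cost \<gamma>"
    unfolding transport_cost_def
    by (subst nn_integral_distr[OF ms]) (auto simp: dist_commute)
qed

lemma W2_squared_commute: "W2_squared (meas m) (meas n) = W2_squared (meas n) (meas m)"
proof -
  have "W2_squared (meas m) (meas n) \<le> W2_squared (meas n) (meas m)" for m n :: "'a P2"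
    unfolding W2_squared_def
  proof (rule INF_greatest)
    fix \<gamma> assume "\<gamma> \<in> couplings (meas n) (meas m)"
    then obtain \<gamma>' where "\<gamma>' \<in> couplings (meas m) (meas n)" "transport_cost \<gamma>' = transport_cost \<gamma>"
      using couplings_swap by blast
    then show "(INF \<gamma>\<in>couplings (meas m) (meas n). transport_cost \<gamma>) \<le> transport_cost \<gamma>"
      by (metis INF_lower)
  qed
  then show ?thesis by (simp add: antisym)
qed

lemma transport_cost_finite:
  assumes "\<gamma> \<in> couplings (meas m) (meas n)"
  shows "transport_cost \<gamma> < \<infinity>"
proof -
  have "transport_cost \<gamma> \<le> (\<integral>\<^sup>+ z. 2 * ennreal ((norm (fst z))\<^sup>2) + 2 * ennreal ((norm (snd z))\<^sup>2) \<partial>\<gamma>)"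
    unfolding transport_cost_def
  proof (rule nn_integral_mono)
    fix z :: "'a \<times> 'a"
    have "(dist (fst z) (snd z))\<^sup>2 \<le> (norm (fst z) + norm (snd z))\<^sup>2"
      by (intro power_mono) (auto simp: dist_norm norm_triangle_ineq4)
    also have "\<dots> \<le> 2 * (norm (fst z))\<^sup>2 + 2 * (norm (snd z))\<^sup>2"
      using sum_squares_bound[of "norm (fst z)" "norm (snd z)"] by (simp add: power2_sum)
    finally have "ennreal ((dist (fst z) (snd z))\<^sup>2) \<le> ennreal (2 * (norm (fst z))\<^sup>2 + 2 * (norm (snd z))\<^sup>2)"
      by (rule ennreal_leI)
    then show "ennreal ((dist (fst z) (snd z))\<^sup>2) \<le> 2 * ennreal ((norm (fst z))\<^sup>2) + 2 * ennreal ((norm (snd z))\<^sup>2)"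
      by (simp add: ennreal_mult)
  qed
  also have "\<dots> = 2 * abs_moment 2 (meas m) + 2 * abs_moment 2 (meas n)"
  proof -
    have "(\<integral>\<^sup>+ z. 2 * ennreal ((norm (fst z))\<^sup>2) + 2 * ennreal ((norm (snd z))\<^sup>2) \<partial>\<gamma>) =
      2 * (\<integral>\<^sup>+ z. ennreal ((norm (fst z))\<^sup>2) \<partial>\<gamma>) + 2 * (\<integral>\<^sup>+ z. ennreal ((norm (snd z))\<^sup>2) \<partial>\<gamma>)"
      by (subst nn_integral_add; (subst nn_integral_cmult)?; (subst nn_integral_cmult)?;
        simp add: couplingsD(6)[OF assms])
    then show ?thesis
      using nn_integral_coupling_fst[OF assms, of "\<lambda>x. ennreal ((norm x)\<^sup>2)"]
        nn_integral_coupling_snd[OF assms, of "\<lambda>x. ennreal ((norm x)\<^sup>2)"]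
      by (simp add: abs_moment_def)
  qed
  also have "\<dots> < \<infinity>"
    using meas_props(4)[of m] meas_props(4)[of n] by (simp add: ennreal_mult_less_top)
  finally show ?thesis .
qed

lemma couplings_nonempty: "couplings (meas m) (meas n) \<noteq> {}"
proof -
  interpret m: prob_space "meas m" by simp
  interpret n: prob_space "meas n" by simp
  interpret pair_prob_space "meas m" "meas n" ..
  have s: "sets (meas m \<Otimes>\<^sub>M meas n) = sets borel"
    by (simp add: borel_prod[symmetric] cong: sets_pair_measure_cong)
  have 1: "distr (meas m \<Otimes>\<^sub>M meas n) borel fst = meas m"
  proof -
    have "distr (meas m \<Otimes>\<^sub>M meas n) borel fst = distr (meas m \<Otimes>\<^sub>M meas n) (meas m) fst"
      by (rule distr_cong) simp_all
    then show ?thesis by (simp only: n.distr_pair_fst)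
  qed
  have 2: "distr (meas m \<Otimes>\<^sub>M meas n) borel snd = meas n"
  proof (rule measure_eqI)
    fix A assume "A \<in> sets (distr (meas m \<Otimes>\<^sub>M meas n) borel snd)"
    then have A: "A \<in> sets borel" by simp
    have "snd -` A \<inter> space (meas m \<Otimes>\<^sub>M meas n) = UNIV \<times> A"
      by (auto simp: space_pair_measure)
    then show "emeasure (distr (meas m \<Otimes>\<^sub>M meas n) borel snd) A = emeasure (meas n) A"
      using A m.emeasure_space_1
      by (subst emeasure_distr) (auto simp: n.emeasure_pair_measure_Times measurable_cong_sets[OF s refl])
  qed simp
  show ?thesis using s 1 2 by (auto simp: couplings_def)
qed

lemma W2_squared_finite: "W2_squared (meas m) (meas n) < \<infinity>"
proof -
  obtain \<gamma> where "\<gamma> \<in> couplings (meas m) (meas n)" using couplings_nonempty by blast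
  then show ?thesis
    unfolding W2_squared_def by (meson INF_lower transport_cost_finite order_le_less_trans)
qed

lemma W2_le_if:
  assumes "\<gamma> \<in> couplings (meas m) (meas n)" "transport_cost \<gamma> \<le> ennreal (r\<^sup>2)" "0 \<le> r"
  shows "W2 (meas m) (meas n) \<le> r"
proof -
  have "W2_squared (meas m) (meas n) \<le> ennreal (r\<^sup>2)"
    unfolding W2_squared_def using assms by (meson INF_lower order_trans)
  then have "enn2real (W2_squared (meas m) (meas n)) \<le> r\<^sup>2"
    by (simp add: enn2real_leI)
  then show ?thesis using assms(3) unfolding W2_def by (simp add: real_le_lsqrt)
qed

lemma W2_lessD:
  assumes "W2 (meas m) (meas n) < r"
  shows "\<exists>\<gamma>\<in>couplings (meas m) (meas n). transport_cost \<gamma> \<le> ennreal (r\<^sup>2)"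
proof -
  have r: "0 < r" using assms unfolding W2_def
    by (smt (verit) enn2real_nonneg real_sqrt_ge_zero)
  have "sqrt (enn2real (W2_squared (meas m) (meas n))) < sqrt (r\<^sup>2)"
    using assms r unfolding W2_def by simp
  then have "enn2real (W2_squared (meas m) (meas n)) < r\<^sup>2"
    by (simp only: real_sqrt_less_iff)
  then have "W2_squared (meas m) (meas n) < ennreal (r\<^sup>2)"
    using W2_squared_finite[of m n] r by (cases "W2_squared (meas m) (meas n)") (auto intro: ennreal_lessI)
  then show ?thesis
    unfolding W2_squared_def by (auto simp: INF_less_iff intro: less_imp_le)
qed

lemma W2_commute: "W2 (meas m) (meas n) = W2 (meas n) (meas m)"
  by (simp add: W2_def W2_squared_commute)

lemma W2_self: "W2 (meas m) (meas m) = 0"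
proof -
  let ?g = "distr (meas m) borel (\<lambda>x. (x, x))"
  have mm: "(\<lambda>x. (x, x)) \<in> measurable (meas m) borel" by simp
  have i: "distr (meas m) borel (\<lambda>x. x) = meas m"
    by (rule distr_id2) simp
  have "?g \<in> couplings (meas m) (meas m)"
    using i by (simp add: couplings_def distr_distr[OF _ mm] comp_def)
  moreover have "transport_cost ?g \<le> ennreal (0\<^sup>2)"
    unfolding transport_cost_def by (subst nn_integral_distr[OF mm]) auto
  ultimately have "W2 (meas m) (meas m) \<le> 0" by (rule W2_le_if) simp
  then show ?thesis by (simp add: W2_def antisym)
qed

lemma W2_zero_le_closed:
  assumes "W2 (meas m) (meas n) = 0" "closed A"
  shows "emeasure (meas m) A \<le> emeasure (meas n) A"
proof (cases "A = {}")
  case False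
  interpret n: prob_space "meas n" by simp
  define B where "B k = {y. infdist y A \<le> inverse (real (Suc k))}" for k
  have cB: "closed (B k)" for k
    unfolding B_def by (intro closed_Collect_le continuous_intros)
  have le: "emeasure (meas m) A \<le> emeasure (meas n) (B k)" for k
  proof (rule ennreal_le_epsilon)
    fix e :: real assume e: "0 < e"
    define r where "r = sqrt e * inverse (real (Suc k))"
    have r: "0 < r" "r\<^sup>2 * (real (Suc k))\<^sup>2 = e"
      using e by (auto simp: r_def power_mult_distrib field_simps)
    obtain \<gamma> where g: "\<gamma> \<in> couplings (meas m) (meas n)" "transport_cost \<gamma> \<le> ennreal (r\<^sup>2)"
      using W2_lessD[of m n r] assms r by auto
    have "emeasure (meas m) A = (\<integral>\<^sup>+ x. indicator A x \<partial>meas m)"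
      using assms(2) by simp
    also have "\<dots> = (\<integral>\<^sup>+ z. indicator A (fst z) \<partial>\<gamma>)"
      by (rule nn_integral_coupling_fst[OF g(1), symmetric]) (use assms(2) in auto)
    also have "\<dots> \<le> (\<integral>\<^sup>+ z. indicator (B k) (snd z) +
        ennreal ((real (Suc k))\<^sup>2) * ennreal ((dist (fst z) (snd z))\<^sup>2) \<partial>\<gamma>)"
    proof (rule nn_integral_mono)
      fix z :: "'a \<times> 'a"
      show "indicator A (fst z) \<le> indicator (B k) (snd z) +
        ennreal ((real (Suc k))\<^sup>2) * ennreal ((dist (fst z) (snd z))\<^sup>2)"
      proof (cases "fst z \<in> A \<and> snd z \<notin> B k")
        case True
        have "infdist (snd z) A \<le> dist (fst z) (snd z)"
          using infdist_le[of "fst z" A "snd z"] True by (simp add: dist_commute)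
        then have "inverse (real (Suc k)) \<le> dist (fst z) (snd z)"
          using True unfolding B_def by auto
        then have "1 \<le> real (Suc k) * dist (fst z) (snd z)"
          by (simp add: field_simps)
        then have "1 \<le> (real (Suc k))\<^sup>2 * (dist (fst z) (snd z))\<^sup>2"
          by (metis one_le_power power_mult_distrib)
        then show ?thesis
          using True by (simp flip: ennreal_mult')
      qed (auto simp: indicator_def)
    qed
    also have "\<dots> = emeasure (meas n) (B k) + ennreal ((real (Suc k))\<^sup>2) * transport_cost \<gamma>"
    proof -
      have "(\<integral>\<^sup>+ z. indicator (B k) (snd z) \<partial>\<gamma>) = (\<integral>\<^sup>+ x. indicator (B k) x \<partial>meas n)"
        by (rule nn_integral_coupling_snd[OF g(1)]) (use cB in auto)
      also have "\<dots> = emeasure (meas n) (B k)" using cB by simp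
      moreover have "(\<lambda>z. indicator (B k) (snd z) :: ennreal) \<in> borel_measurable (borel :: ('a \<times> 'a) measure)"
        by (rule measurable_compose[OF borel_measurable_fst_snd(2)]) (use cB in auto)
      ultimately show ?thesis unfolding transport_cost_def
        by (subst nn_integral_add; (subst nn_integral_cmult)?; simp add: couplingsD(6)[OF g(1)])
    qed
    also have "\<dots> \<le> emeasure (meas n) (B k) + ennreal ((real (Suc k))\<^sup>2) * ennreal (r\<^sup>2)"
      by (intro add_left_mono mult_left_mono g) simp
    also have "\<dots> = emeasure (meas n) (B k) + ennreal e"
      using r by (simp add: mult.commute flip: ennreal_mult')
    finally show "emeasure (meas m) A \<le> emeasure (meas n) (B k) + ennreal e" .
  qed
  have "(INF k. emeasure (meas n) (B k)) = emeasure (meas n) (\<Inter>k. B k)"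
  proof (rule INF_emeasure_decseq)
    show "range B \<subseteq> sets (meas n)" using cB by auto
    show "decseq B"
    proof (rule decseq_SucI)
      fix k
      have "inverse (real (Suc (Suc k))) \<le> inverse (real (Suc k))"
        by (simp add: field_simps)
      then show "B (Suc k) \<subseteq> B k" unfolding B_def by (blast intro: order_trans)
    qed
  qed simp
  moreover have "(\<Inter>k. B k) = A"
  proof
    show "(\<Inter>k. B k) \<subseteq> A"
    proof
      fix y assume "y \<in> (\<Inter>k. B k)"
      then have *: "infdist y A \<le> inverse (real (Suc k))" for k by (auto simp: B_def)
      have "infdist y A \<le> 0"
        by (rule LIMSEQ_le_const[OF LIMSEQ_inverse_real_of_nat]) (use * in auto)
      then show "y \<in> A"
        using in_closed_iff_infdist_zero[OF assms(2) False] infdist_nonneg[of y A] by simp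
    qed
    show "A \<subseteq> (\<Inter>k. B k)" by (auto simp: B_def)
  qed
  ultimately show ?thesis
    using le by (metis INF_greatest)
qed simp

lemma W2_zero_imp_eq:
  assumes "W2 (meas m) (meas n) = 0"
  shows "m = n"
proof -
  interpret m: prob_space "meas m" by simp
  have "meas m = meas n"
  proof (rule measure_eqI_generator_eq)
    show "Int_stable (Collect closed :: 'a set set)" by (auto simp: Int_stable_def)
    show "emeasure (meas m) X = emeasure (meas n) X" if "X \<in> Collect closed" for X
      using W2_zero_le_closed[of m n X] W2_zero_le_closed[of n m X] that assms
      by (simp add: W2_commute antisym)
    show "sets (meas m) = sigma_sets UNIV (Collect closed)"
      "sets (meas n) = sigma_sets UNIV (Collect closed)"
      by (simp_all add: borel_eq_closed sets_measure_of)
    show "range (\<lambda>_::nat. UNIV) \<subseteq> (Collect closed :: 'a set set)" by auto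
  qed auto
  then show ?thesis by (simp add: meas_inject)
qed

lemma square_sum_weighted:
  fixes u v a b :: real
  assumes "0 < a" "0 < b"
  shows "(u + v)\<^sup>2 \<le> (a + b) * (u\<^sup>2 / a + v\<^sup>2 / b)"
proof -
  have "(a + b) * (u\<^sup>2 / a + v\<^sup>2 / b) - (u + v)\<^sup>2 = (b * u - a * v)\<^sup>2 / (a * b)"
    using assms by (simp add: field_simps power2_eq_square)
  also have "\<dots> \<ge> 0" using assms by simp
  finally show ?thesis by simp
qed

lemma if_eq_measurable:
  fixes i j :: "'c \<Rightarrow> nat" and k :: "'c \<Rightarrow> ennreal"
  assumes [measurable]: "i \<in> measurable M (count_space UNIV)" "j \<in> measurable M (count_space UNIV)"
    "k \<in> borel_measurable M"
  shows "(\<lambda>z. if i z = j z then k z else 0) \<in> borel_measurable M"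
proof (rule measurable_If)
  have "{z \<in> space M. i z = j z} = (\<Union>n. (i -` {n} \<inter> space M) \<inter> (j -` {n} \<inter> space M))"
    by auto
  also have "\<dots> \<in> sets M"
    using assms(1,2)[THEN measurable_sets] by (intro sets.countable_UN sets.Int) auto
  finally show "{z \<in> space M. i z = j z} \<in> sets M" .
qed (use assms in auto)

lemma ennreal_lin:
  assumes "0 \<le> p" "0 \<le> q" "0 \<le> r" "0 \<le> u" "0 \<le> v"
  shows "ennreal (p * u + (q * v + r)) = ennreal p * ennreal u + (ennreal q * ennreal v + ennreal r)"
  using assms by (simp add: ennreal_mult)

text \<open>Gluing of two couplings along a countable partition of the intermediate space:
  no disintegration is needed, at the price of an arbitrarily small error in the cost.\<close>

lemma gluing:
  fixes m n k :: "'a::euclidean_space P2"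
  assumes g1: "g1 \<in> couplings (meas m) (meas n)" and g2: "g2 \<in> couplings (meas n) (meas k)"
    and a: "0 < a" "transport_cost g1 \<le> ennreal (a\<^sup>2)"
    and b: "0 < b" "transport_cost g2 \<le> ennreal (b\<^sup>2)"
    and c: "0 < c"
  shows "W2 (meas m) (meas k) \<le> a + b + c"
proof -
  interpret g1: prob_space g1 by (rule couplingsD[OF g1])
  interpret g2: prob_space g2 by (rule couplingsD[OF g2])
  interpret n: prob_space "meas n" by simp
  interpret P: pair_prob_space g1 g2 ..
  note ms [simp] = couplingsD(6)[OF g1] couplingsD(6)[OF g2]
  have sP: "sets (g1 \<Otimes>\<^sub>M g2) = sets borel"
    using couplingsD(2)[OF g1] couplingsD(2)[OF g2]
    by (simp add: borel_prod[symmetric] cong: sets_pair_measure_cong)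
  have mP [simp]: "measurable (g1 \<Otimes>\<^sub>M g2) N = measurable borel N" for N :: "ennreal measure"
    by (rule measurable_cong_sets[OF sP refl])
  obtain D :: "'a set" where D: "countable D" "\<And>X. open X \<Longrightarrow> X \<noteq> {} \<Longrightarrow> \<exists>d\<in>D. d \<in> X"
    by (erule countable_dense_setE)
  have "D \<noteq> {}" using D(2)[of UNIV] by auto
  define d where "d = from_nat_into D"
  define idx where "idx y = (LEAST i. dist y (d i) < c / 2)" for y
  have idx: "dist y (d (idx y)) < c / 2" for y
  proof -
    obtain x where "x \<in> D" "x \<in> ball y (c / 2)" using D(2)[of "ball y (c/2)"] c by auto
    moreover obtain i where "d i = x" using \<open>x \<in> D\<close> D(1) by (metis d_def from_nat_into_surj)
    ultimately have "dist y (d i) < c / 2" by simp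
    then show ?thesis unfolding idx_def by (rule LeastI)
  qed
  have idx_m [measurable]: "idx \<in> measurable borel (count_space UNIV)"
    unfolding idx_def by measurable
  define w where "w i = emeasure (meas n) (idx -` {i})" for i
  have w_sets: "idx -` {i} \<in> sets borel" for i
    using measurable_sets[OF idx_m, of "{i}"] by simp
  have w_fin: "w i \<noteq> \<infinity>" for i unfolding w_def by simp
  have w_pos: "AE y in meas n. w (idx y) \<noteq> 0"
  proof -
    have "AE y in meas n. \<forall>i. w i = 0 \<longrightarrow> idx y \<noteq> i"
    proof (subst AE_all_countable, intro allI)
      fix i
      show "AE y in meas n. w i = 0 \<longrightarrow> idx y \<noteq> i"
      proof (cases "w i = 0")
        case True
        show ?thesis
          by (rule AE_I[where N = "idx -` {i}"]) (use True w_sets in \<open>auto simp: w_def\<close>)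
      qed simp
    qed
    then show ?thesis by (rule AE_mp) auto
  qed
  define h :: "('a \<times> 'a) \<times> ('a \<times> 'a) \<Rightarrow> ennreal" where
    "h z = (if idx (snd (fst z)) = idx (fst (snd z)) then 1 / w (idx (snd (fst z))) else 0)" for z
  have wm [measurable]: "w \<in> measurable (count_space UNIV) borel" by simp
  have h_m [measurable]: "h \<in> borel_measurable borel"
  proof -
    have 1: "(\<lambda>z :: ('a \<times> 'a) \<times> ('a \<times> 'a). idx (snd (fst z))) \<in> measurable borel (count_space UNIV)"
      by (rule measurable_compose[OF _ idx_m]) (intro borel_measurable_continuous_onI continuous_intros)
    have 2: "(\<lambda>z :: ('a \<times> 'a) \<times> ('a \<times> 'a). idx (fst (snd z))) \<in> measurable borel (count_space UNIV)"
      by (rule measurable_compose[OF _ idx_m]) (intro borel_measurable_continuous_onI continuous_intros)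
    have 3: "(\<lambda>z :: ('a \<times> 'a) \<times> ('a \<times> 'a). 1 / w (idx (snd (fst z)))) \<in> borel_measurable borel"
      by (rule measurable_compose[OF 1]) simp
    show ?thesis
      unfolding h_def by (rule if_eq_measurable[OF 1 2 3])
  qed
  have ind: "(\<integral>\<^sup>+ x. (if idx x = i then 1 / w i else 0) \<partial>meas n) = 1" if "w i \<noteq> 0" for i
  proof -
    have "(\<integral>\<^sup>+ x. (if idx x = i then 1 / w i else 0) \<partial>meas n) =
       (\<integral>\<^sup>+ x. 1 / w i * indicator (idx -` {i}) x \<partial>meas n)"
      by (intro nn_integral_cong) (auto simp: indicator_def)
    also have "\<dots> = 1 / w i * w i"
      using w_sets by (simp add: w_def nn_integral_cmult_indicator)
    also have "\<dots> = 1"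
      using that w_fin[of i] by (simp add: ennreal_divide_times less_top)
    finally show ?thesis .
  qed
  have int1: "(\<integral>\<^sup>+ z. f (fst z) * h z \<partial>(g1 \<Otimes>\<^sub>M g2)) = (\<integral>\<^sup>+ p. f p \<partial>g1)"
    if f: "f \<in> borel_measurable borel" for f
  proof -
    have fm: "(\<lambda>z. f (fst z) * h z) \<in> borel_measurable borel"
      by (rule borel_measurable_times_ennreal[OF measurable_compose[OF borel_measurable_fst_snd(1) f] h_m])
    have "(\<integral>\<^sup>+ z. f (fst z) * h z \<partial>(g1 \<Otimes>\<^sub>M g2)) = (\<integral>\<^sup>+ p. (\<integral>\<^sup>+ q. f p * h (p, q) \<partial>g2) \<partial>g1)"
      using g2.nn_integral_fst[of "\<lambda>z. f (fst z) * h z" g1] fm by simp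
    also have "\<dots> = (\<integral>\<^sup>+ p. f p \<partial>g1)"
    proof (rule nn_integral_cong_AE)
      have "AE p in g1. w (idx (snd p)) \<noteq> 0"
      proof -
        have "AE y in distr g1 borel snd. w (idx y) \<noteq> 0"
          using w_pos by (simp only: couplingsD(5)[OF g1])
        then show ?thesis by (rule AE_distrD[rotated]) simp
      qed
      then show "AE p in g1. (\<integral>\<^sup>+ q. f p * h (p, q) \<partial>g2) = f p"
      proof (rule AE_mp, intro AE_I2 impI)
        fix p :: "'a \<times> 'a" assume p: "w (idx (snd p)) \<noteq> 0"
        have "(\<integral>\<^sup>+ q. f p * h (p, q) \<partial>g2) = f p * (\<integral>\<^sup>+ q. h (p, q) \<partial>g2)"
          by (rule nn_integral_cmult) simp
        also have "(\<integral>\<^sup>+ q. h (p, q) \<partial>g2) =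
            (\<integral>\<^sup>+ q. (if idx (fst q) = idx (snd p) then 1 / w (idx (snd p)) else 0) \<partial>g2)"
          by (intro nn_integral_cong) (auto simp: h_def)
        also have "\<dots> = 1"
          using nn_integral_coupling_fst[OF g2, of "\<lambda>x. if idx x = idx (snd p) then 1 / w (idx (snd p)) else 0"]
            ind[OF p] by simp
        finally show "(\<integral>\<^sup>+ q. f p * h (p, q) \<partial>g2) = f p" by simp
      qed
    qed
    finally show ?thesis .
  qed
  have int2: "(\<integral>\<^sup>+ z. f (snd z) * h z \<partial>(g1 \<Otimes>\<^sub>M g2)) = (\<integral>\<^sup>+ p. f p \<partial>g2)"
    if f: "f \<in> borel_measurable borel" for f
  proof -
    have fm: "(\<lambda>z. f (snd z) * h z) \<in> borel_measurable borel"
      by (rule borel_measurable_times_ennreal[OF measurable_compose[OF borel_measurable_fst_snd(2) f] h_m])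
    have "(\<integral>\<^sup>+ z. f (snd z) * h z \<partial>(g1 \<Otimes>\<^sub>M g2)) = (\<integral>\<^sup>+ q. (\<integral>\<^sup>+ p. f q * h (p, q) \<partial>g1) \<partial>g2)"
      using P.nn_integral_snd[of "\<lambda>z. f (snd z) * h z"] fm by simp
    also have "\<dots> = (\<integral>\<^sup>+ p. f p \<partial>g2)"
    proof (rule nn_integral_cong_AE)
      have "AE q in g2. w (idx (fst q)) \<noteq> 0"
      proof -
        have "AE y in distr g2 borel fst. w (idx y) \<noteq> 0"
          using w_pos by (simp only: couplingsD(4)[OF g2])
        then show ?thesis by (rule AE_distrD[rotated]) simp
      qed
      then show "AE q in g2. (\<integral>\<^sup>+ p. f q * h (p, q) \<partial>g1) = f q"
      proof (rule AE_mp, intro AE_I2 impI)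
        fix q :: "'a \<times> 'a" assume q: "w (idx (fst q)) \<noteq> 0"
        have "(\<integral>\<^sup>+ p. f q * h (p, q) \<partial>g1) = f q * (\<integral>\<^sup>+ p. h (p, q) \<partial>g1)"
          by (rule nn_integral_cmult) simp
        also have "(\<integral>\<^sup>+ p. h (p, q) \<partial>g1) =
            (\<integral>\<^sup>+ p. (if idx (snd p) = idx (fst q) then 1 / w (idx (fst q)) else 0) \<partial>g1)"
          by (intro nn_integral_cong) (auto simp: h_def)
        also have "\<dots> = 1"
          using nn_integral_coupling_snd[OF g1, of "\<lambda>x. if idx x = idx (fst q) then 1 / w (idx (fst q)) else 0"]
            ind[OF q] by simp
        finally show "(\<integral>\<^sup>+ p. f q * h (p, q) \<partial>g1) = f q" by simp
      qed
    qed
    finally show ?thesis .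
  qed
  define Q where "Q = density (g1 \<Otimes>\<^sub>M g2) h"
  define t :: "('a \<times> 'a) \<times> ('a \<times> 'a) \<Rightarrow> 'a \<times> 'a" where "t = (\<lambda>z. (fst (fst z), snd (snd z)))"
  have t_m [measurable]: "t \<in> measurable borel borel" unfolding t_def
    by (intro borel_measurable_continuous_onI continuous_intros)
  have sQ: "sets Q = sets borel" using sP by (simp add: Q_def)
  have mQ [simp]: "measurable Q N = measurable borel N" for N :: "ennreal measure"
    by (rule measurable_cong_sets[OF sQ refl])
  have mQ' [simp]: "measurable Q N = measurable borel N" for N :: "('a \<times> 'a) measure"
    by (rule measurable_cong_sets[OF sQ refl])
  have intQ: "(\<integral>\<^sup>+ z. f z \<partial>Q) = (\<integral>\<^sup>+ z. f z * h z \<partial>(g1 \<Otimes>\<^sub>M g2))"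
    if "f \<in> borel_measurable borel" for f
    unfolding Q_def using that by (subst nn_integral_density) (auto simp: mult.commute)
  define g where "g = distr Q borel t"
  have mg: "measurable g N = measurable borel N" for N :: "'a measure"
    by (rule measurable_cong_sets) (simp_all add: g_def)
  have "distr g borel fst = meas m"
  proof (rule measure_eqI)
    fix A :: "'a set" assume "A \<in> sets (distr g borel fst)"
    then have A [measurable]: "A \<in> sets borel" by simp
    have mA: "(\<lambda>p. indicator A (fst p) :: ennreal) \<in> borel_measurable (borel :: ('a \<times> 'a) measure)"
      by (rule measurable_compose[OF borel_measurable_fst_snd(1)]) simp
    have mA1: "(\<lambda>z. indicator A (fst (fst z)) :: ennreal) \<in> borel_measurable (borel :: (('a \<times> 'a) \<times> ('a \<times> 'a)) measure)"
      by (rule measurable_compose[OF borel_measurable_fst_snd(1) mA])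
    have "emeasure (distr g borel fst) A = (\<integral>\<^sup>+ x. indicator A x \<partial>distr g borel fst)" by simp
    also have "\<dots> = (\<integral>\<^sup>+ z. indicator A (fst z) \<partial>g)"
      by (rule nn_integral_distr) (simp_all add: mg)
    also have "\<dots> = (\<integral>\<^sup>+ z. indicator A (fst (t z)) \<partial>Q)"
      unfolding g_def by (rule nn_integral_distr) (simp_all add: measurable_compose[OF borel_measurable_fst_snd(1)])
    also have "\<dots> = (\<integral>\<^sup>+ z. indicator A (fst (fst z)) \<partial>Q)" by (simp add: t_def)
    also have "\<dots> = (\<integral>\<^sup>+ p. indicator A (fst p) \<partial>g1)"
      by (subst intQ, rule mA1, rule int1[of "\<lambda>p. indicator A (fst p)"], rule mA)
    also have "\<dots> = (\<integral>\<^sup>+ x. indicator A x \<partial>meas m)"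
      by (rule nn_integral_coupling_fst[OF g1]) simp
    finally show "emeasure (distr g borel fst) A = emeasure (meas m) A" by simp
  qed simp
  moreover have "distr g borel snd = meas k"
  proof (rule measure_eqI)
    fix A :: "'a set" assume "A \<in> sets (distr g borel snd)"
    then have A [measurable]: "A \<in> sets borel" by simp
    have mA: "(\<lambda>p. indicator A (snd p) :: ennreal) \<in> borel_measurable (borel :: ('a \<times> 'a) measure)"
      by (rule measurable_compose[OF borel_measurable_fst_snd(2)]) simp
    have mA2: "(\<lambda>z. indicator A (snd (snd z)) :: ennreal) \<in> borel_measurable (borel :: (('a \<times> 'a) \<times> ('a \<times> 'a)) measure)"
      by (rule measurable_compose[OF borel_measurable_fst_snd(2) mA])
    have "emeasure (distr g borel snd) A = (\<integral>\<^sup>+ x. indicator A x \<partial>distr g borel snd)" by simp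
    also have "\<dots> = (\<integral>\<^sup>+ z. indicator A (snd z) \<partial>g)"
      by (rule nn_integral_distr) (simp_all add: mg)
    also have "\<dots> = (\<integral>\<^sup>+ z. indicator A (snd (t z)) \<partial>Q)"
      unfolding g_def by (rule nn_integral_distr) (simp_all add: measurable_compose[OF borel_measurable_fst_snd(2)])
    also have "\<dots> = (\<integral>\<^sup>+ z. indicator A (snd (snd z)) \<partial>Q)" by (simp add: t_def)
    also have "\<dots> = (\<integral>\<^sup>+ p. indicator A (snd p) \<partial>g2)"
      by (subst intQ, rule mA2, rule int2[of "\<lambda>p. indicator A (snd p)"], rule mA)
    also have "\<dots> = (\<integral>\<^sup>+ x. indicator A x \<partial>meas k)"
      by (rule nn_integral_coupling_snd[OF g2]) simp
    finally show "emeasure (distr g borel snd) A = emeasure (meas k) A" by simp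
  qed simp
  ultimately have g: "g \<in> couplings (meas m) (meas k)"
    by (simp add: couplings_def g_def)
  define S where "S = a + b + c"
  have S: "0 < S" using a b c by (simp add: S_def)
  have pw: "(dist x z)\<^sup>2 \<le> S * ((dist x y)\<^sup>2 / a + (dist y' z)\<^sup>2 / b + c)" if "idx y = idx y'" for x y y' z
  proof -
    have "dist y y' < c" using idx[of y] idx[of y'] that
      by (metis dist_commute dist_triangle_half_l)
    then have "dist x z \<le> dist x y + (c + dist y' z)"
      using dist_triangle[of x z y] dist_triangle[of y z y'] by linarith
    then have "(dist x z)\<^sup>2 \<le> (dist x y + (c + dist y' z))\<^sup>2"
      by (rule power_mono) simp
    also have "\<dots> \<le> (a + (c + b)) * ((dist x y)\<^sup>2 / a + (c + dist y' z)\<^sup>2 / (c + b))"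
      by (rule square_sum_weighted) (use a(1) b(1) c in linarith)+
    also have "\<dots> \<le> (a + (c + b)) * ((dist x y)\<^sup>2 / a + (c\<^sup>2 / c + (dist y' z)\<^sup>2 / b))"
    proof -
      have "(c + dist y' z)\<^sup>2 / (c + b) \<le> c\<^sup>2 / c + (dist y' z)\<^sup>2 / b"
        using square_sum_weighted[OF c b(1), of c "dist y' z"] b(1) c by (simp add: pos_divide_le_eq mult.commute)
      then show ?thesis using a(1) b(1) c by (intro mult_left_mono add_left_mono) auto
    qed
    also have "\<dots> = S * ((dist x y)\<^sup>2 / a + (dist y' z)\<^sup>2 / b + c)"
    proof -
      have "c\<^sup>2 / c = c" using c by (simp add: power2_eq_square)
      moreover have "a + (c + b) = S" by (simp add: S_def)
      ultimately show ?thesis by (simp add: add_ac)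
    qed
    finally show ?thesis .
  qed
  let ?u = "\<lambda>p::'a \<times> 'a. ennreal (S / a) * ennreal ((dist (fst p) (snd p))\<^sup>2)"
  let ?v = "\<lambda>q::'a \<times> 'a. ennreal (S / b) * ennreal ((dist (fst q) (snd q))\<^sup>2) + ennreal (S * c)"
  have cm: "(\<lambda>p. ennreal ((dist (fst p) (snd p))\<^sup>2)) \<in> borel_measurable (borel :: ('a \<times> 'a) measure)"
    by (intro measurable_compose[OF _ measurable_ennreal] borel_measurable_continuous_onI continuous_intros)
  have um: "?u \<in> borel_measurable (borel :: ('a \<times> 'a) measure)"
    by (intro borel_measurable_times_ennreal cm) simp
  have vm: "?v \<in> borel_measurable (borel :: ('a \<times> 'a) measure)"
    by (intro borel_measurable_times_ennreal borel_measurable_add cm) simp_all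
  have uh: "(\<lambda>z. ?u (fst z) * h z) \<in> borel_measurable borel"
    by (rule borel_measurable_times_ennreal[OF measurable_compose[OF borel_measurable_fst_snd(1) um] h_m])
  have vh: "(\<lambda>z. ?v (snd z) * h z) \<in> borel_measurable borel"
    by (rule borel_measurable_times_ennreal[OF measurable_compose[OF borel_measurable_fst_snd(2) vm] h_m])
  have "transport_cost g = (\<integral>\<^sup>+ z. ennreal ((dist (fst (t z)) (snd (t z)))\<^sup>2) \<partial>Q)"
    unfolding transport_cost_def g_def by (rule nn_integral_distr) (simp_all only: mQ' t_m cm measurable_distr_eq1)
  also have "\<dots> = (\<integral>\<^sup>+ z. ennreal ((dist (fst (fst z)) (snd (snd z)))\<^sup>2) \<partial>Q)"
    by (simp only: t_def fst_conv snd_conv)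
  also have "\<dots> = (\<integral>\<^sup>+ z. ennreal ((dist (fst (fst z)) (snd (snd z)))\<^sup>2) * h z \<partial>(g1 \<Otimes>\<^sub>M g2))"
    using intQ[OF measurable_compose[OF t_m cm]] by (simp only: t_def fst_conv snd_conv)
  also have "\<dots> \<le> (\<integral>\<^sup>+ z. ?u (fst z) * h z + ?v (snd z) * h z \<partial>(g1 \<Otimes>\<^sub>M g2))"
  proof (rule nn_integral_mono)
    fix z :: "('a \<times> 'a) \<times> ('a \<times> 'a)"
    obtain x y y' x' where z: "z = ((x, y), (y', x'))" by (metis surj_pair)
    show "ennreal ((dist (fst (fst z)) (snd (snd z)))\<^sup>2) * h z \<le> ?u (fst z) * h z + ?v (snd z) * h z"
    proof (cases "idx y = idx y'")
      case True
      have "ennreal ((dist x x')\<^sup>2) \<le> ennreal (S / a * (dist x y)\<^sup>2 + (S / b * (dist y' x')\<^sup>2 + S * c))"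
        using pw[OF True, of x x'] by (intro ennreal_leI) (simp add: algebra_simps)
      also have "\<dots> = ?u (x, y) + ?v (y', x')"
        unfolding fst_conv snd_conv using S a(1) b(1) c by (intro ennreal_lin) auto
      finally show ?thesis
        unfolding z fst_conv snd_conv distrib_right[symmetric] by (rule mult_right_mono) simp
    qed (simp add: z h_def)
  qed
  also have "\<dots> = (\<integral>\<^sup>+ z. ?u (fst z) * h z \<partial>(g1 \<Otimes>\<^sub>M g2)) + (\<integral>\<^sup>+ z. ?v (snd z) * h z \<partial>(g1 \<Otimes>\<^sub>M g2))"
    by (rule nn_integral_add) (simp_all only: mP uh vh)
  also have "\<dots> = (\<integral>\<^sup>+ p. ?u p \<partial>g1) + (\<integral>\<^sup>+ q. ?v q \<partial>g2)"
    by (simp only: int1[OF um] int2[OF vm])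
  also have "\<dots> = ennreal (S / a) * transport_cost g1 + (ennreal (S / b) * transport_cost g2 + ennreal (S * c))"
  proof -
    have "(\<integral>\<^sup>+ p. ?u p \<partial>g1) = ennreal (S / a) * transport_cost g1"
      unfolding transport_cost_def by (rule nn_integral_cmult) (simp only: ms cm)
    moreover have "(\<integral>\<^sup>+ q. ?v q \<partial>g2) =
        (\<integral>\<^sup>+ q. ennreal (S / b) * ennreal ((dist (fst q) (snd q))\<^sup>2) \<partial>g2) + (\<integral>\<^sup>+ q. ennreal (S * c) \<partial>g2)"
      by (rule nn_integral_add) (simp_all only: ms borel_measurable_times_ennreal borel_measurable_const cm)
    moreover have "(\<integral>\<^sup>+ q. ennreal (S / b) * ennreal ((dist (fst q) (snd q))\<^sup>2) \<partial>g2) = ennreal (S / b) * transport_cost g2"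
      unfolding transport_cost_def by (rule nn_integral_cmult) (simp only: ms cm)
    moreover have "(\<integral>\<^sup>+ q. ennreal (S * c) \<partial>g2) = ennreal (S * c)"
      by (simp add: g2.emeasure_space_1)
    ultimately show ?thesis by (simp only:)
  qed
  also have "\<dots> \<le> ennreal (S / a) * ennreal (a\<^sup>2) + (ennreal (S / b) * ennreal (b\<^sup>2) + ennreal (S * c))"
    by (intro add_mono mult_left_mono a b) auto
  also have "\<dots> = ennreal (S / a * a\<^sup>2 + (S / b * b\<^sup>2 + S * c))"
    using S a(1) b(1) c by (intro ennreal_lin[symmetric]) auto
  also have "S / a * a\<^sup>2 + (S / b * b\<^sup>2 + S * c) = S\<^sup>2"
  proof -
    have "S / a * a\<^sup>2 = S * a" "S / b * b\<^sup>2 = S * b"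
      using a(1) b(1) by (simp_all add: power2_eq_square)
    then have "S / a * a\<^sup>2 + (S / b * b\<^sup>2 + S * c) = S * (a + b + c)"
      by (simp add: distrib_left)
    then show ?thesis by (simp only: S_def power2_eq_square)
  qed
  finally show ?thesis using W2_le_if[OF g] S by (simp add: S_def)
qed

lemma W2_triangle: "W2 (meas m) (meas k) \<le> W2 (meas m) (meas n) + W2 (meas n) (meas k)"
proof (rule field_le_epsilon)
  fix e :: real assume e: "0 < e"
  let ?a = "W2 (meas m) (meas n) + e / 3" and ?b = "W2 (meas n) (meas k) + e / 3"
  have pos: "0 < ?a" "0 < ?b" using e by (simp_all add: W2_def add_nonneg_pos)
  obtain g1 where g1: "g1 \<in> couplings (meas m) (meas n)" "transport_cost g1 \<le> ennreal (?a\<^sup>2)"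
    using W2_lessD[of m n ?a] e by auto
  obtain g2 where g2: "g2 \<in> couplings (meas n) (meas k)" "transport_cost g2 \<le> ennreal (?b\<^sup>2)"
    using W2_lessD[of n k ?b] e by auto
  show "W2 (meas m) (meas k) \<le> W2 (meas m) (meas n) + W2 (meas n) (meas k) + e"
    using gluing[OF g1(1) g2(1) pos(1) g1(2) pos(2) g2(2), of "e / 3"] e by simp
qed

instantiation P2 :: (euclidean_space) metric_space
begin

definition dist_P2 :: "'a P2 \<Rightarrow> 'a P2 \<Rightarrow> real" where
  "dist_P2 m n = W2 (meas m) (meas n)"

definition uniformity_P2 :: "('a P2 \<times> 'a P2) filter" where
  "uniformity_P2 = (INF e\<in>{0 <..}. principal {(x, y). dist x y < e})"

definition open_P2 :: "'a P2 set \<Rightarrow> bool" where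
  "open_P2 S = (\<forall>x\<in>S. \<forall>\<^sub>F (x', y) in uniformity. x' = x \<longrightarrow> y \<in> S)"

instance
proof
  fix x y z :: "'a P2"
  show "(dist x y = 0) = (x = y)"
    by (auto simp: dist_P2_def W2_self dest: W2_zero_imp_eq)
  show "dist x y \<le> dist x z + dist y z"
    unfolding dist_P2_def using W2_triangle[of x y z] by (simp add: W2_commute[of z y])
qed (simp_all add: uniformity_P2_def open_P2_def)

end


definition E2 :: "'a::euclidean_space P2 \<Rightarrow> real" where
  "E2 \<mu> = enn2real (abs_moment 2 (meas \<mu>))"

definition marg1 :: "('a::euclidean_space \<times> 'b::euclidean_space) P2 \<Rightarrow> 'a P2" where
  "marg1 m = P2_of (distr (meas m) borel fst)"

definition marg2 :: "('a::euclidean_space \<times> 'b::euclidean_space) P2 \<Rightarrow> 'b P2" where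
  "marg2 m = P2_of (distr (meas m) borel snd)"

lemma meas_marg1: "meas (marg1 m) = distr (meas m) borel fst"
proof -
  interpret prob_space "meas m" by simp
  have f: "fst \<in> measurable (meas m) borel" by simp
  have "abs_moment 2 (distr (meas m) borel fst) \<le> abs_moment 2 (meas m)"
    unfolding abs_moment_def
    by (subst nn_integral_distr[OF f], simp)
       (auto intro!: nn_integral_mono ennreal_leI power_mono norm_fst_le)
  then have "distr (meas m) borel fst \<in>
      {\<mu>. prob_space \<mu> \<and> sets \<mu> = sets borel \<and> abs_moment 2 \<mu> < \<infinity>}"
    using prob_space_distr[OF f] meas_props(4)[of m] by (auto intro: le_less_trans)
  then show ?thesis unfolding marg1_def by (rule P2_of_inverse)
qed

lemma meas_marg2: "meas (marg2 m) = distr (meas m) borel snd"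
proof -
  interpret prob_space "meas m" by simp
  have f: "snd \<in> measurable (meas m) borel" by simp
  have "abs_moment 2 (distr (meas m) borel snd) \<le> abs_moment 2 (meas m)"
    unfolding abs_moment_def
    by (subst nn_integral_distr[OF f], simp)
       (auto intro!: nn_integral_mono ennreal_leI power_mono norm_snd_le)
  then have "distr (meas m) borel snd \<in>
      {\<mu>. prob_space \<mu> \<and> sets \<mu> = sets borel \<and> abs_moment 2 \<mu> < \<infinity>}"
    using prob_space_distr[OF f] meas_props(4)[of m] by (auto intro: le_less_trans)
  then show ?thesis unfolding marg2_def by (rule P2_of_inverse)
qed

definition locally_uniform_limit ::
  "'a::topological_space set \<Rightarrow> (nat \<Rightarrow> 'a \<Rightarrow> 'b::metric_space) \<Rightarrow> ('a \<Rightarrow> 'b) \<Rightarrow> bool" where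
  "locally_uniform_limit S f g \<longleftrightarrow>
     (\<forall>K. compact K \<and> K \<subseteq> S \<longrightarrow> uniform_limit K f g sequentially)"

definition has_leb_density :: "'a::euclidean_space measure \<Rightarrow> bool" where
  "has_leb_density m \<longleftrightarrow> (\<exists>f\<in>borel_measurable lborel. density lborel f = m)"

definition leb_density :: "'a::euclidean_space measure \<Rightarrow> 'a \<Rightarrow> real" where
  "leb_density m z = enn2real (RN_deriv lborel m z)"

text \<open>The integral of \<open>log m\<close> against \<open>m\<close> as a difference of positive and negative parts; on
  \<open>P2\<close> the negative part is always finite, so the value lies in \<open>(-\<infinity>, \<infinity>]\<close>.\<close>

definition boltzmann_entropy :: "'a::euclidean_space measure \<Rightarrow> ereal" where
  "boltzmann_entropy m =
     (if has_leb_density m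
      then enn2ereal (\<integral>\<^sup>+ z. ennreal (ln (leb_density m z)) \<partial>m)
         - enn2ereal (\<integral>\<^sup>+ z. ennreal (- ln (leb_density m z)) \<partial>m)
      else \<infinity>)"

definition grad :: "('a::euclidean_space \<Rightarrow> real) \<Rightarrow> 'a \<Rightarrow> 'a" where
  "grad f x = (\<Sum>b\<in>Basis. frechet_derivative f (at x) b *\<^sub>R b)"

definition laplacian :: "('a::euclidean_space \<Rightarrow> real) \<Rightarrow> 'a \<Rightarrow> real" where
  "laplacian f x =
     (\<Sum>b\<in>Basis. frechet_derivative (\<lambda>z. frechet_derivative f (at z) b) (at x) b)"

fun Ck :: "nat \<Rightarrow> ('a::euclidean_space \<Rightarrow> real) \<Rightarrow> bool" where
  "Ck 0 f \<longleftrightarrow> continuous_on UNIV f"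
| "Ck (Suc k) f \<longleftrightarrow>
     (\<exists>f'. (\<forall>x. (f has_derivative f' x) (at x)) \<and> (\<forall>v. Ck k (\<lambda>x. f' x v)))"

definition C_c_infinity :: "('a::euclidean_space \<Rightarrow> real) \<Rightarrow> bool" where
  "C_c_infinity \<eta> \<longleftrightarrow> (\<forall>k. Ck k \<eta>) \<and> compact (closure {z. \<eta> z \<noteq> 0})"

text \<open>\<open>q\<close> is the weak gradient of \<open>p(x, y)\<close> in the variable \<open>x\<close>.\<close>

definition weak_grad_x ::
  "('a::euclidean_space \<times> 'a \<Rightarrow> real) \<Rightarrow> ('a \<times> 'a \<Rightarrow> 'a) \<Rightarrow> bool" where
  "weak_grad_x p q \<longleftrightarrow>
     (\<forall>K. compact K \<longrightarrow> set_integrable lborel K p \<and> set_integrable lborel K q) \<and>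
     (\<forall>\<eta>. C_c_infinity \<eta> \<longrightarrow>
        (LINT z|lborel. p z *\<^sub>R grad (\<lambda>x. \<eta> (x, snd z)) (fst z)) =
        - (LINT z|lborel. \<eta> z *\<^sub>R q z))"

text \<open>\<open>g\<close> is a version of \<open>\<nabla>\<^sub>x log m = \<nabla>\<^sub>x m / m\<close>.  It is unique up to \<open>m\<close>-null sets; the
  points where the density vanishes form such a set.\<close>

definition is_grad_x_log :: "('a::euclidean_space \<times> 'a) measure \<Rightarrow> ('a \<times> 'a \<Rightarrow> 'a) \<Rightarrow> bool" where
  "is_grad_x_log m g \<longleftrightarrow> has_leb_density m \<and>
     (\<exists>q. weak_grad_x (leb_density m) q \<and> g = (\<lambda>z. q z /\<^sub>R leb_density m z))"

text \<open>A test function is stored by its data \<open>(\<psi>, f, \<alpha>, \<lambda>)\<close>.\<close>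

datatype 'a test_fun =
  Test (psi: "real \<Rightarrow> real") (fpart: "'a \<times> 'a \<Rightarrow> real") (alpha: real) (lam: real)

definition C1_bounded_on_initial :: "real \<Rightarrow> (real \<Rightarrow> real) \<Rightarrow> bool" where
  "C1_bounded_on_initial T \<psi> \<longleftrightarrow>
     (\<forall>\<tau>. 0 < \<tau> \<and> \<tau> < T \<longrightarrow>
        (\<exists>\<psi>'. (\<forall>t\<in>{0..\<tau>}. (\<psi> has_real_derivative \<psi>' t) (at t within {0..\<tau>})) \<and>
              continuous_on {0..\<tau>} \<psi>' \<and> bounded (\<psi> ` {0..\<tau>}) \<and> bounded (\<psi>' ` {0..\<tau>})))"

definition C2_bounded :: "('b::euclidean_space \<Rightarrow> real) \<Rightarrow> bool" where
  "C2_bounded f \<longleftrightarrow>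
     (\<exists>(Df :: 'b \<Rightarrow> 'b \<Rightarrow>\<^sub>L real) (D2f :: 'b \<Rightarrow> 'b \<Rightarrow>\<^sub>L 'b \<Rightarrow>\<^sub>L real).
        (\<forall>z. (f has_derivative blinfun_apply (Df z)) (at z)) \<and>
        (\<forall>z. (Df has_derivative blinfun_apply (D2f z)) (at z)) \<and>
        continuous_on UNIV D2f \<and>
        bounded (range f) \<and> bounded (range Df) \<and> bounded (range D2f))"

definition H_test :: "real \<Rightarrow> 'a::euclidean_space test_fun set" where
  "H_test T = {\<phi>. C1_bounded_on_initial T (psi \<phi>) \<and> C2_bounded (fpart \<phi>) \<and>
                  0 < alpha \<phi> \<and> 0 < lam \<phi>}"

text \<open>The third moments may be infinite on \<open>P2\<close>, so the value lies in \<open>[-\<infinity>, \<infinity>)\<close>.\<close>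

definition test_val :: "'a::euclidean_space test_fun \<Rightarrow> real \<Rightarrow> ('a \<times> 'a) P2 \<Rightarrow> ereal" where
  "test_val \<phi> t m =
     ereal (psi \<phi> t + (LINT z|meas m. fpart \<phi> z))
     - ereal (alpha \<phi> * exp (lam \<phi> * t)) *
       (enn2ereal (abs_moment 3 (meas (marg1 m))) + enn2ereal (abs_moment 3 (meas (marg2 m))))"

text \<open>The measure derivative \<open>\<nabla>\<^sub>m \<phi>(t, m)(x, y)\<close>, normalised to have no additive constant (only
  its derivatives in \<open>x\<close> are used); it does not depend on \<open>m\<close>.\<close>

definition test_grad_m :: "'a::euclidean_space test_fun \<Rightarrow> real \<Rightarrow> 'a \<times> 'a \<Rightarrow> real" where
  "test_grad_m \<phi> t z =
     fpart \<phi> z - alpha \<phi> * exp (lam \<phi> * t) * (norm (fst z) ^ 3 + norm (snd z) ^ 3)"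

definition Zfun ::
  "(real \<times> 'a \<times> 'a P2 \<Rightarrow> 'a) \<Rightarrow> ('a \<times> 'a P2 \<Rightarrow> 'a) \<Rightarrow> real \<Rightarrow> ('a::euclidean_space \<times> 'a) P2 \<Rightarrow> real" where
  "Zfun W V t m =
     (LINT z|meas m. (W (t, fst z, marg1 m) - V (snd z, marg2 m)) \<bullet> (fst z - snd z))"

definition objective ::
  "(real \<times> 'a \<times> 'a P2 \<Rightarrow> 'a) \<Rightarrow> ('a \<times> 'a P2 \<Rightarrow> 'a) \<Rightarrow> 'a test_fun \<Rightarrow> real \<Rightarrow>
   real \<Rightarrow> ('a::euclidean_space \<times> 'a) P2 \<Rightarrow> ereal" where
  "objective W V \<phi> \<kappa> t m =
     ereal (Zfun W V t m) - test_val \<phi> t m + ereal \<kappa> * boltzmann_entropy (meas m)"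

definition is_min_point ::
  "real \<Rightarrow> (real \<Rightarrow> ('a::euclidean_space \<times> 'a) P2 \<Rightarrow> ereal) \<Rightarrow> real \<Rightarrow> ('a \<times> 'a) P2 \<Rightarrow> bool" where
  "is_min_point T J t m \<longleftrightarrow> 0 < t \<and> t < T \<and> (\<forall>s\<in>{0..<T}. \<forall>\<mu>. J t m \<le> J s \<mu>)"

definition linear_growth :: "('a::euclidean_space \<times> 'a P2 \<Rightarrow> 'a) \<Rightarrow> bool" where
  "linear_growth V \<longleftrightarrow> (\<exists>C. \<forall>y \<mu>. norm (V (y, \<mu>)) \<le> C * (1 + norm y + sqrt (E2 \<mu>)))"

definition monotone_ineq ::
  "('a::euclidean_space \<times> 'a P2 \<times> 'a \<Rightarrow> 'a) \<Rightarrow> ('a \<times> 'a P2 \<times> 'a \<Rightarrow> 'a) \<Rightarrow> real \<Rightarrow>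
   (real \<times> 'a \<times> 'a P2 \<Rightarrow> 'a) \<Rightarrow> ('a \<times> 'a P2 \<Rightarrow> 'a) \<Rightarrow> 'a test_fun \<Rightarrow> real \<Rightarrow>
   real \<Rightarrow> ('a \<times> 'a) P2 \<Rightarrow> ('a \<times> 'a \<Rightarrow> 'a) \<Rightarrow> bool" where
  "monotone_ineq F G \<sigma> W V \<phi> \<kappa> t m g \<longleftrightarrow>
     (let Ws = (\<lambda>x. W (t, x, marg1 m));
          Fs = (\<lambda>x. F (x, marg1 m, Ws x));
          Gs = (\<lambda>x. G (x, marg1 m, Ws x))
      in
        deriv (\<lambda>s. real_of_ereal (test_val \<phi> s m)) t
        + (LINT z|meas m. Fs (fst z) \<bullet> grad (\<lambda>x. test_grad_m \<phi> t (x, snd z)) (fst z))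
        - \<sigma> * (LINT z|meas m. laplacian (\<lambda>x. test_grad_m \<phi> t (x, snd z)) (fst z))
        - 2 * \<sigma> * (LINT z|meas m. Ws (fst z) \<bullet> g z)
        - \<sigma> * \<kappa> * (LINT z|meas m. (norm (g z))\<^sup>2)
        - \<kappa> * (LINT z|meas m. Fs (fst z) \<bullet> g z)
        \<ge> (LINT z|meas m. Fs (fst z) \<bullet> (Ws (fst z) - V (snd z, marg2 m)))
          + (LINT z|meas m. Gs (fst z) \<bullet> (fst z - snd z)))"

definition monotone_solution ::
  "real \<Rightarrow> ('a::euclidean_space \<times> 'a P2 \<times> 'a \<Rightarrow> 'a) \<Rightarrow> ('a \<times> 'a P2 \<times> 'a \<Rightarrow> 'a) \<Rightarrow> real \<Rightarrow>
   (real \<times> 'a \<times> 'a P2 \<Rightarrow> 'a) \<Rightarrow> bool" where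
  "monotone_solution T F G \<sigma> W \<longleftrightarrow>
     continuous_on ({0..T} \<times> UNIV \<times> UNIV) W \<and>
     (\<forall>V. continuous_on UNIV V \<and> linear_growth V \<longrightarrow>
        (\<forall>\<phi>\<in>H_test T. \<forall>\<kappa>>0. \<forall>t m. is_min_point T (objective W V \<phi> \<kappa>) t m \<longrightarrow>
           (\<exists>g. is_grad_x_log (meas m) g \<and>
                integrable (meas m) (\<lambda>z. (norm (g z))\<^sup>2) \<and>
                monotone_ineq F G \<sigma> W V \<phi> \<kappa> t m g)))"

end

(*
  Minimum points are not stable under the convergence of W_n, so the functional is perturbed.  Given a
  minimiser (t0, m0) for W, one adds (t - t0)^2 / (T - t) and a small multiple of the relative entropy
  of m with respect to exp(f - beta (|x|^3 + |y|^3)), where f is C^2 with bounded derivatives and m0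
  almost minimises this relative entropy; the sum is again given by a test function and a larger kappa.
  The perturbed functional for W_n has minimisers, with entropies and third moments bounded uniformly,
  and comparison with (t0, m0) forces their relative entropy to vanish in the limit.  They therefore
  converge to m0 setwise, and their third moments converge, which controls the cubic terms of the
  inequality.  The inequality bounds the Fisher information because sigma_n stays away from 0; weak
  compactness of the logarithmic gradients and lower semicontinuity then give the limit inequality.
*)
theory Submission
  imports Defs "HOL-Library.Diagonal_Subsequence"
begin

section \<open>Setwise convergence of measures\<close>

text \<open>Setwise rather than weak convergence suits the data: along the minimisers the fields
  \<open>x \<mapsto> W_n(t_n, x, m_n)\<close> are known to converge pointwise in \<open>x\<close>,
  and gradients are tested on truncations of their own limits, which are merely measurable.
  Pointwise limits pass under varying measures once these are uniformly countably additive, and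
  bounds on entropy and third moments provide that. Integrands of quadratic growth are then
  harmless. The critical one is \<open>F\<close>, of linear growth, times the gradient of the cubic
  weight: it has the order of the available moment, so third moments have to converge and not merely
  stay bounded. The order of choices matters: \<open>f\<close> depends on the accuracy, the strength
  \<epsilon> of the perturbation on \<open>f\<close>, so that \<epsilon> f is small in C^2, and the
  index n on \<epsilon>, so that replacing W by W_n costs o(\<epsilon>). Dividing the comparison by
  \<epsilon> isolates the relative entropy. The penalty in time is singular at T because test
  functions are controlled only on [0, \<tau>] with \<tau> < T.\<close>

definition setwise :: "(nat => 'b::topological_space measure) => 'b measure => bool" where
  "setwise \<mu> \<nu> \<longleftrightarrow> (\<forall>A\<in>sets borel. (\<lambda>j. measure (\<mu> j) A) \<longlonglongrightarrow> measure \<nu> A)"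

text \<open>Continuity at the empty set, uniformly along the sequence. It is the compactness
  criterion of \<open>setwise_compact\<close>, and it replaces Egorov's theorem when the measures
  vary.\<close>

definition ucadd :: "(nat => 'b::topological_space measure) => bool" where
  "ucadd \<mu> \<longleftrightarrow> (\<forall>A. range A \<subseteq> sets borel \<and> decseq A \<and> (\<Inter>i. A i) = {} \<longrightarrow>
     (\<forall>e>0. \<exists>N. \<forall>n\<ge>N. \<forall>j. measure (\<mu> j) (A n) < e))"

text \<open>General finite mass instead of probability measures, because the positive and negative
  parts of gradient components, taken as densities, are treated as measures too.\<close>

definition finb :: "'b::topological_space measure => bool" where
  "finb M \<longleftrightarrow> finite_measure M \<and> sets M = sets borel"

lemma finbD: "finb M ==> finite_measure M" "finb M ==> sets M = sets borel" "finb M ==> space M = UNIV"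
  "finb M ==> measurable M N = measurable borel N"
  using sets_eq_imp_space_eq[of M borel] by (auto simp: finb_def intro!: measurable_cong_sets)

lemma finb_meas [simp]: "finb (meas m)"
  using meas_props(1)[of m] unfolding finb_def prob_space_def by auto

lemma setwise_subseq: "setwise \<mu> \<nu> ==> strict_mono r ==> setwise (\<lambda>j. \<mu> (r j)) \<nu>"
  unfolding setwise_def using LIMSEQ_subseq_LIMSEQ[of _ _ r] unfolding comp_def by blast

lemma ucadd_reindex: "ucadd \<mu> ==> ucadd (\<lambda>j. \<mu> (r j))"
  unfolding ucadd_def by meson

lemma real_count_less:
  fixes u :: real
  assumes "0 <= u" "u <= real N"
  shows "\<bar>u - (\<Sum>i=1..N. if real i < u then 1 else 0)\<bar> <= 1"
  using assms(2)
proof (induction N)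
  case 0
  then show ?case using assms(1) by simp
next
  case (Suc N)
  show ?case
  proof (cases "u <= real N")
    case True
    then show ?thesis using Suc.IH by simp
  next
    case False
    then have "(\<Sum>i=1..N. if real i < u then 1 else (0::real)) = (\<Sum>i=1..N. 1)"
      by (intro sum.cong) auto
    then show ?thesis using Suc.prems False by simp
  qed
qed

text \<open>A uniform approximation by a combination of indicators whose value stays in \<open>[-M, M]\<close> when
  the indicators are replaced by functions with values in \<open>[0, 1]\<close>.\<close>

lemma layer_approx:
  fixes f :: "'b => real"
  assumes "\<bar>f x\<bar> <= M" "0 < M" "0 < N"
  shows "\<bar>f x - (- M + 2 * M / real N * (\<Sum>i=1..N. indicat_real {z. f z > - M + 2 * M * real i / real N} x))\<bar>
           <= 2 * M / real N"
proof -
  define u where "u = (f x + M) * real N / (2 * M)"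
  have fM: "0 <= f x + M" "f x + M <= 2 * M" using assms(1) by linarith+
  have u0: "0 <= u" using fM assms by (simp add: u_def)
  have "u <= (2 * M) * real N / (2 * M)"
    unfolding u_def using fM assms by (intro divide_right_mono mult_right_mono) auto
  then have u: "0 <= u" "u <= real N" using u0 assms by simp_all
  have "(f x > - M + 2 * M * real i / real N) \<longleftrightarrow> real i < u" for i
    using assms by (simp add: u_def field_simps)
  then have "(\<Sum>i=1..N. indicat_real {z. f z > - M + 2 * M * real i / real N} x) =
      (\<Sum>i=1..N. if real i < u then 1 else 0)"
    by (intro sum.cong) (auto simp: indicator_def)
  moreover have "f x = - M + 2 * M / real N * u"
    using assms by (simp add: u_def)
  ultimately have "f x - (- M + 2 * M / real N * (\<Sum>i=1..N. indicat_real {z. f z > - M + 2 * M * real i / real N} x))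
      = 2 * M / real N * (u - (\<Sum>i=1..N. if real i < u then 1 else 0))"
    by (simp add: algebra_simps)
  also have "\<bar>\<dots>\<bar> <= 2 * M / real N * 1"
    unfolding abs_mult using real_count_less[OF u] assms by (intro mult_mono) auto
  finally show ?thesis by simp
qed

lemma finb_integrable_bounded:
  assumes "finb M" "f \<in> borel_measurable borel" "!!x. norm (f x :: 'c::{banach, second_countable_topology}) <= B"
  shows "integrable M f"
  using assms finbD[OF assms(1)] by (intro finite_measure.integrable_const_bound[where B = B]) auto

text \<open>\<open>layer_approx\<close> brings \<open>f\<close> uniformly within \<open>2M/N\<close>
  of a finite combination of indicators of superlevel sets, for which convergence is the definition
  of \<open>setwise\<close>; the masses stay bounded because they converge on
  \<open>UNIV\<close>.\<close>

lemma setwise_integral_bounded: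
  fixes f :: "'b::topological_space => real"
  assumes s: "setwise \<mu> \<nu>" and fb: "!!j. finb (\<mu> j)" "finb \<nu>"
    and f: "f \<in> borel_measurable borel" "!!x. \<bar>f x\<bar> <= B"
  shows "(\<lambda>j. LINT x|\<mu> j. f x) \<longlonglongrightarrow> (LINT x|\<nu>. f x)"
proof (rule LIMSEQ_I)
  fix e :: real assume e: "0 < e"
  define M where "M = max B 1"
  have M: "0 < M" "\<bar>f x\<bar> <= M" for x using f(2)[of x] by (auto simp: M_def)
  have cU: "(\<lambda>j. measure (\<mu> j) UNIV) \<longlonglongrightarrow> measure \<nu> UNIV" using s by (auto simp: setwise_def)
  define K where "K = measure \<nu> UNIV + 1"
  have K: "0 < K" unfolding K_def by (simp add: add_nonneg_pos)
  \<comment> \<open>\<open>6MK/e < N\<close> makes the layer error \<open>2M/N\<close> times any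
    mass up to \<open>K\<close> less than \<open>e/3\<close>; two such errors and the convergence of
    the layer sums make up \<open>e\<close>.\<close>
  obtain N :: nat where N': "max 1 (2 * M * (3 * K) / e) < real N"
    using reals_Archimedean2 by blast
  then have N: "0 < N" "2 * M * (3 * K) / e < real N" by auto
  define A where "A i = {z. f z > - M + 2 * M * real i / real N}" for i
  define s where "s x = - M + 2 * M / real N * (\<Sum>i=1..N. indicat_real (A i) x)" for x
  have A[measurable]: "A i \<in> sets borel" for i unfolding A_def using f(1) by simp
  have sf: "\<bar>f x - s x\<bar> <= 2 * M / real N" for x
    unfolding s_def A_def using layer_approx[of f x M N] M N by auto
  have sm: "s \<in> borel_measurable borel" unfolding s_def by measurable
  have si: "integral\<^sup>L m s = - M * measure m UNIV + 2 * M / real N * (\<Sum>i=1..N. measure m (A i))" if "finb m" for m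
  proof -
    interpret finite_measure m using that by (rule finbD)
    note [simp] = finbD(2,3,4)[OF that]
    have ii: "integrable m (indicat_real (A i))" for i
      by (rule finb_integrable_bounded[OF that, where B = 1]) (auto simp: indicator_def)
    have "integral\<^sup>L m s = (LINT x|m. - M) + (LINT x|m. 2 * M / real N * (\<Sum>i=1..N. indicat_real (A i) x))"
      unfolding s_def using ii by (intro Bochner_Integration.integral_add) auto
    also have "(LINT x|m. 2 * M / real N * (\<Sum>i=1..N. indicat_real (A i) x)) = 2 * M / real N * (\<Sum>i=1..N. measure m (A i))"
      using ii by (simp add: Bochner_Integration.integral_sum)
    finally show ?thesis by simp
  qed
  have d: "\<bar>integral\<^sup>L m f - integral\<^sup>L m s\<bar> <= 2 * M / real N * measure m UNIV" if "finb m" for m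
  proof -
    interpret finite_measure m using that by (rule finbD)
    note [simp] = finbD(2,3,4)[OF that]
    have i: "integrable m f" using finb_integrable_bounded[OF that f(1), of M] M by auto
    have i2: "integrable m s"
    proof (rule finb_integrable_bounded[OF that sm, where B = "M + 2 * M / real N"])
      show "norm (s x) <= M + 2 * M / real N" for x using sf[of x] M(2)[of x] by auto
    qed
    have "\<bar>integral\<^sup>L m f - integral\<^sup>L m s\<bar> = \<bar>(LINT x|m. f x - s x)\<bar>" using i i2 by simp
    also have "\<dots> <= (LINT x|m. \<bar>f x - s x\<bar>)" by (rule integral_abs_bound)
    also have "\<dots> <= (LINT x|m. 2 * M / real N)" using i i2 sf by (intro integral_mono) auto
    finally show ?thesis by (simp add: mult_ac)
  qed
  have "(\<lambda>j. integral\<^sup>L (\<mu> j) s) \<longlonglongrightarrow> integral\<^sup>L \<nu> s"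
    unfolding si[OF fb(1)] si[OF fb(2)] using assms(1) cU A
    by (intro tendsto_intros) (auto simp: setwise_def)
  then have "\<forall>\<^sub>F j in sequentially. \<bar>integral\<^sup>L (\<mu> j) s - integral\<^sup>L \<nu> s\<bar> < e / 3"
    using e by (auto dest!: tendstoD[where e = "e/3"] simp: dist_real_def)
  moreover have "\<forall>\<^sub>F j in sequentially. measure (\<mu> j) UNIV < K"
    using cU by (rule order_tendstoD) (simp add: K_def)
  ultimately have "\<forall>\<^sub>F j in sequentially. norm (integral\<^sup>L (\<mu> j) f - integral\<^sup>L \<nu> f) < e"
  proof eventually_elim
    case (elim j)
    have "2 * M / real N * K < e / 3"
      using N M K e by (simp add: field_simps)
    moreover have "2 * M / real N * measure (\<mu> j) UNIV <= 2 * M / real N * K"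
      "2 * M / real N * measure \<nu> UNIV <= 2 * M / real N * K"
      by (rule mult_left_mono; use elim M N in \<open>simp add: K_def\<close>)+
    ultimately show ?case using elim d[OF fb(1), of j] d[OF fb(2)] unfolding real_norm_def by linarith
  qed
  then show "\<exists>no. \<forall>n\<ge>no. norm ((LINT x|\<mu> n. f x) - (LINT x|\<nu>. f x)) < e"
    by (simp add: eventually_sequentially)
qed

text \<open>Fatou's lemma for setwise convergence: the truncations \<open>min (g x) L\<close> are
  bounded, so their integrals converge, and \<open>L\<close> is removed by monotone
  convergence.\<close>

lemma setwise_integral_le:
  fixes g :: "'b::topological_space => real"
  assumes s: "setwise \<mu> \<nu>" and fb: "!!j. finb (\<mu> j)" "finb \<nu>"
    and g: "g \<in> borel_measurable borel" "!!x. 0 <= g x"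
    and le: "\<forall>\<^sub>F j in sequentially. integrable (\<mu> j) g \<and> integral\<^sup>L (\<mu> j) g <= C"
  shows "integrable \<nu> g" "integral\<^sup>L \<nu> g <= C"
proof -
  note [simp] = finbD(2,3,4)[OF fb(2)]
  have b: "(LINT x|\<nu>. min (g x) L) <= C" if "0 <= L" for L
  proof (rule tendsto_upperbound)
    show "(\<lambda>j. LINT x|\<mu> j. min (g x) L) \<longlonglongrightarrow> (LINT x|\<nu>. min (g x) L)"
      by (rule setwise_integral_bounded[OF s fb, where B = L]) (use g that in auto)
    show "\<forall>\<^sub>F j in sequentially. (LINT x|\<mu> j. min (g x) L) <= C"
      using le
    proof eventually_elim
      case (elim j)
      have "(LINT x|\<mu> j. min (g x) L) <= integral\<^sup>L (\<mu> j) g"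
      proof (rule integral_mono)
        show "integrable (\<mu> j) (\<lambda>x. min (g x) L)"
          by (rule finb_integrable_bounded[OF fb(1), where B = L]) (use g that in auto)
      qed (use elim in auto)
      then show ?case using elim by simp
    qed
  qed simp
  have mi: "integrable \<nu> (\<lambda>x. min (g x) (real n))" for n
    by (rule finb_integrable_bounded[OF fb(2), where B = "real n"]) (use g in auto)
  have "(\<integral>\<^sup>+ x. ennreal (g x) \<partial>\<nu>) = (SUP n. \<integral>\<^sup>+ x. ennreal (min (g x) (real n)) \<partial>\<nu>)"
  proof (subst nn_integral_monotone_convergence_SUP[symmetric])
    show "incseq (\<lambda>n x. ennreal (min (g x) (real n)))"
      by (auto simp: incseq_def le_fun_def intro!: ennreal_leI)
    have "(SUP n. ennreal (min (g x) (real n))) = ennreal (g x)" for x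
    proof (rule antisym)
      show "(SUP n. ennreal (min (g x) (real n))) <= ennreal (g x)"
        by (intro SUP_least ennreal_leI) simp
      obtain n where "g x <= real n" using real_arch_simple by blast
      then have "ennreal (g x) = ennreal (min (g x) (real n))" by simp
      also have "\<dots> <= (SUP n. ennreal (min (g x) (real n)))" by (rule SUP_upper) simp
      finally show "ennreal (g x) <= (SUP n. ennreal (min (g x) (real n)))" .
    qed
    then show "(\<integral>\<^sup>+ x. ennreal (g x) \<partial>\<nu>) = (\<integral>\<^sup>+ x. (SUP n. ennreal (min (g x) (real n))) \<partial>\<nu>)" by simp
  qed (use g in auto)
  also have "\<dots> <= ennreal C"
  proof (rule SUP_least)
    fix n
    have "(\<integral>\<^sup>+ x. ennreal (min (g x) (real n)) \<partial>\<nu>) = ennreal (LINT x|\<nu>. min (g x) (real n))"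
      by (rule nn_integral_eq_integral[OF mi]) (use g in auto)
    also have "\<dots> <= ennreal C" using b[of "real n"] by (intro ennreal_leI) simp
    finally show "(\<integral>\<^sup>+ x. ennreal (min (g x) (real n)) \<partial>\<nu>) <= ennreal C" .
  qed
  finally have nn: "(\<integral>\<^sup>+ x. ennreal (g x) \<partial>\<nu>) <= ennreal C" .
  show i: "integrable \<nu> g"
    using g nn by (intro integrableI_bounded) (auto simp: le_less_trans[OF nn])
  have C: "0 <= C" using b[of 0] g by (simp add: min_absorb2)
  show "integral\<^sup>L \<nu> g <= C"
    using nn_integral_eq_integral[OF i] g nn C by simp
qed

text \<open>Uniform integrability through the excess over \<open>K\<close>, which equals
  \<open>g - min g K\<close> and so involves, for nonnegative \<open>g\<close>, only a bounded
  truncation besides \<open>g\<close> itself. Smallness is asked for late \<open>j\<close> only,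
  which is what a convergence of moments can supply.\<close>

definition ui :: "(nat => 'b measure) => ('b => real) => bool" where
  "ui \<mu> g \<longleftrightarrow> (\<forall>j. integrable (\<mu> j) g) \<and>
     (\<forall>e>0. \<exists>K. \<forall>\<^sub>F j in sequentially. (LINT x|\<mu> j. max 0 (g x - K)) <= e)"

text \<open>An Egorov argument: the sets on which some later \<open>h j\<close> differs from
  \<open>f\<close> by more than \<open>d\<close> decrease to the empty set, so \<open>ucadd\<close>
  makes their mass small for all measures at once. Off them the error is at most \<open>d\<close>
  times the mass, and what remains is the integral of the fixed \<open>f\<close>.\<close>

lemma setwise_integral_pointwise_bounded:
  fixes f :: "'b::topological_space => real"
  assumes s: "setwise \<mu> \<nu>" and uc: "ucadd \<mu>" and fb: "!!j. finb (\<mu> j)" "finb \<nu>"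
    and h: "!!j. h j \<in> borel_measurable borel" "f \<in> borel_measurable borel"
    and p: "!!x. (\<lambda>j. h j x) \<longlonglongrightarrow> f x" and B: "!!j x. \<bar>h j x\<bar> <= B"
  shows "(\<lambda>j. LINT x|\<mu> j. h j x) \<longlonglongrightarrow> (LINT x|\<nu>. f x)"
proof -
  have fB: "\<bar>f x\<bar> <= B" for x
    by (rule tendsto_upperbound[OF tendsto_rabs[OF p[of x]]]) (use B in auto)
  have hi: "integrable (\<mu> j) (h k)" "integrable (\<mu> j) f" for j k
    by (rule finb_integrable_bounded[OF fb(1), where B = B]; use h B fB in auto)+
  have B0: "0 <= B" using B[of 0 undefined] by simp
  have cU: "(\<lambda>j. measure (\<mu> j) UNIV) \<longlonglongrightarrow> measure \<nu> UNIV" using s by (auto simp: setwise_def)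
  have 0: "(\<lambda>j. LINT x|\<mu> j. \<bar>h j x - f x\<bar>) \<longlonglongrightarrow> 0"
  proof (rule LIMSEQ_I)
    fix e :: real assume e: "0 < e"
    define K where "K = measure \<nu> UNIV + 1"
    have K: "0 < K" unfolding K_def by (simp add: add_nonneg_pos)
    define d where "d = e / (2 * K)"
    have d: "0 < d" using e K by (simp add: d_def)
    define A where "A N = {x. \<exists>j\<ge>N. \<bar>h j x - f x\<bar> > d}" for N :: nat
    have Aeq: "A N = (\<Union>j\<in>{N..}. {x. \<bar>h j x - f x\<bar> > d})" for N unfolding A_def by auto
    have A[measurable]: "A N \<in> sets borel" for N
      unfolding Aeq using h by (intro sets.countable_UN' countableI_type) auto
    have "decseq A" unfolding A_def decseq_def by (auto intro: order_trans)
    moreover have "(\<Inter>i. A i) = {}"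
    proof -
      have "\<exists>N. x \<notin> A N" for x
        using LIMSEQ_D[OF p[of x] d] unfolding A_def by (force simp: not_less)
      then show ?thesis by auto
    qed
    moreover have "range A \<subseteq> sets borel" by auto
    moreover have "0 < e / (2 * (2 * B + 1))" using e B0 by simp
    ultimately obtain N where N: "!!n j. n >= N ==> measure (\<mu> j) (A n) < e / (2 * (2 * B + 1))"
      using uc[unfolded ucadd_def, rule_format, of A "e / (2 * (2 * B + 1))"] by blast
    have "\<forall>\<^sub>F j in sequentially. measure (\<mu> j) UNIV < K"
      using cU by (rule order_tendstoD) (simp add: K_def)
    then have "\<forall>\<^sub>F j in sequentially. norm ((LINT x|\<mu> j. \<bar>h j x - f x\<bar>) - 0) < e"
      using eventually_ge_at_top[of N]
    proof eventually_elim
      case (elim j)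
      note [simp] = finbD(2,3,4)[OF fb(1)]
      interpret finite_measure "\<mu> j" using fb(1) by (rule finbD)
      have "(LINT x|\<mu> j. \<bar>h j x - f x\<bar>) <= (LINT x|\<mu> j. d + 2 * B * indicat_real (A N) x)"
      proof (rule integral_mono)
        show "integrable (\<mu> j) (\<lambda>x. \<bar>h j x - f x\<bar>)" using hi by auto
        show "integrable (\<mu> j) (\<lambda>x. d + 2 * B * indicat_real (A N) x)"
          by (rule finb_integrable_bounded[OF fb(1), where B = "d + 2 * B"]) (use d B0 in \<open>auto simp: indicator_def\<close>)
        fix x
        have "\<bar>h j x - f x\<bar> <= 2 * B" using B[of j x] fB[of x] by linarith
        then show "\<bar>h j x - f x\<bar> <= d + 2 * B * indicat_real (A N) x"
          using elim d by (auto simp: A_def indicator_def not_less)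
      qed
      also have "\<dots> = d * measure (\<mu> j) UNIV + 2 * B * measure (\<mu> j) (A N)"
        by (subst Bochner_Integration.integral_add) (auto simp: integrable_real_indicator emeasure_eq_measure)
      also have "\<dots> < e"
      proof -
        have "d * measure (\<mu> j) UNIV < d * K" using elim d by (intro mult_strict_left_mono) auto
        also have "d * K = e / 2" using K by (simp add: d_def)
        finally have 1: "d * measure (\<mu> j) UNIV < e / 2" .
        have "2 * B * measure (\<mu> j) (A N) <= (2 * B + 1) * (e / (2 * (2 * B + 1)))"
          using N[of N j] B0 by (intro mult_mono) auto
        also have "\<dots> = e / 2" using B0 by (simp add: field_simps add_nonneg_eq_0_iff)
        finally show ?thesis using 1 by simp
      qed
      finally show ?case by (simp add: integral_nonneg_AE)
    qed
    then show "\<exists>no. \<forall>n\<ge>no. norm ((LINT x|\<mu> n. \<bar>h n x - f x\<bar>) - 0) < e"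
      by (simp add: eventually_sequentially)
  qed
  have "(\<lambda>j. (LINT x|\<mu> j. h j x) - (LINT x|\<mu> j. f x)) \<longlonglongrightarrow> 0"
  proof (rule tendsto_rabs_zero_cancel, rule tendsto_sandwich[OF _ _ tendsto_const 0])
    show "\<forall>\<^sub>F j in sequentially. \<bar>(LINT x|\<mu> j. h j x) - (LINT x|\<mu> j. f x)\<bar> <= (LINT x|\<mu> j. \<bar>h j x - f x\<bar>)"
    proof (intro always_eventually allI)
      fix j
      have "(LINT x|\<mu> j. h j x) - (LINT x|\<mu> j. f x) = (LINT x|\<mu> j. h j x - f x)" using hi by simp
      then show "\<bar>(LINT x|\<mu> j. h j x) - (LINT x|\<mu> j. f x)\<bar> <= (LINT x|\<mu> j. \<bar>h j x - f x\<bar>)"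
        using integral_abs_bound[of "\<mu> j" "\<lambda>x. h j x - f x"] by simp
    qed
  qed auto
  from tendsto_add[OF this setwise_integral_bounded[OF s fb h(2) fB]] show ?thesis by simp
qed

text \<open>The excess over a level is itself a nonnegative function, so
  \<open>setwise_integral_le\<close> carries its bound to the limit measure: one level
  \<open>K\<close> serves the limit and the late members of the sequence.\<close>

lemma ui_integrable_limit:
  assumes s: "setwise \<mu> \<nu>" and fb: "!!j. finb (\<mu> j)" "finb \<nu>"
    and g: "g \<in> borel_measurable borel" "!!x. 0 <= g x" and u: "ui \<mu> g" and e: "0 < e"
  shows "\<exists>K\<ge>0. (LINT x|\<nu>. max 0 (g x - K)) <= e \<and> integrable \<nu> g \<and>
     (\<forall>\<^sub>F j in sequentially. (LINT x|\<mu> j. max 0 (g x - K)) <= e)"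
proof -
  obtain K0 where K0: "\<forall>\<^sub>F j in sequentially. (LINT x|\<mu> j. max 0 (g x - K0)) <= e"
    using u e unfolding ui_def by blast
  define K where "K = max 0 K0"
  have ii: "integrable (\<mu> j) (\<lambda>x. max 0 (g x - c))" for j c
    using u fb unfolding ui_def
    by (intro integrable_max Bochner_Integration.integrable_diff) (auto simp: finb_def finite_measure.integrable_const)
  have K: "\<forall>\<^sub>F j in sequentially. (LINT x|\<mu> j. max 0 (g x - K)) <= e"
    using K0
  proof eventually_elim
    case (elim j)
    have "(LINT x|\<mu> j. max 0 (g x - K)) <= (LINT x|\<mu> j. max 0 (g x - K0))"
      by (rule integral_mono[OF ii ii]) (auto simp: K_def)
    then show ?case using elim by simp
  qed
  have 1: "integrable \<nu> (\<lambda>x. max 0 (g x - K))" "(LINT x|\<nu>. max 0 (g x - K)) <= e"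
    by (rule setwise_integral_le[OF s fb, where C = e]; use g K ii in auto)+
  have "integrable \<nu> (\<lambda>x. max 0 (g x - K) + K)"
    using 1 fb(2) by (auto simp: finb_def finite_measure.integrable_const)
  then have "integrable \<nu> g"
    by (rule Bochner_Integration.integrable_bound) (use g fb in \<open>auto simp: finbD K_def\<close>)
  then show ?thesis using 1 K by (intro exI[of _ K]) (auto simp: K_def)
qed

text \<open>Vitali's convergence theorem for varying measures. Clamping at \<plusminus>K reduces to
  bounded integrands and costs at most the integral of the excess of \<open>g\<close> over
  \<open>K\<close>, for every function dominated by \<open>g\<close>.\<close>

lemma setwise_integral_pointwise:
  fixes f :: "'b::topological_space => real"
  assumes s: "setwise \<mu> \<nu>" and uc: "ucadd \<mu>" and fb: "!!j. finb (\<mu> j)" "finb \<nu>"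
    and h: "!!j. h j \<in> borel_measurable borel" "f \<in> borel_measurable borel"
    and p: "!!x. (\<lambda>j. h j x) \<longlonglongrightarrow> f x" and hg: "!!j x. \<bar>h j x\<bar> <= g x"
    and g: "g \<in> borel_measurable borel" and u: "ui \<mu> g"
  shows "(\<lambda>j. LINT x|\<mu> j. h j x) \<longlonglongrightarrow> (LINT x|\<nu>. f x)" and "integrable \<nu> f" "integrable (\<mu> j) (h k)"
proof -
  have g0: "0 <= g x" for x using hg[of 0 x] by simp
  have fg: "\<bar>f x\<bar> <= g x" for x
    by (rule tendsto_upperbound[OF tendsto_rabs[OF p[of x]]]) (use hg in auto)
  have gi: "integrable (\<mu> j) g" for j using u by (simp add: ui_def)
  note U = ui_integrable_limit[OF s fb g g0 u]
  have gn: "integrable \<nu> g" using U[of 1] by auto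
  note [simp] = finbD(2,3,4)[OF fb(1)] finbD(2,3,4)[OF fb(2)]
  have hi: "integrable (\<mu> j) (h k)" for j k
    by (rule Bochner_Integration.integrable_bound[OF gi]) (use h hg g0 in auto)
  then show "integrable (\<mu> j) (h k)" .
  show fi: "integrable \<nu> f"
    by (rule Bochner_Integration.integrable_bound[OF gn]) (use h fg g0 in auto)
  define c where "c K t = max (- K) (min K t)" for K t :: real
  have ct: "\<bar>t - c K t\<bar> <= max 0 (b - K)" if "\<bar>t\<bar> <= b" for K t b
    using that by (auto simp: c_def max_def min_def)
  show "(\<lambda>j. LINT x|\<mu> j. h j x) \<longlonglongrightarrow> (LINT x|\<nu>. f x)"
  proof (rule LIMSEQ_I)
    fix e :: real assume e: "0 < e"
    obtain K where K: "K >= 0" "(LINT x|\<nu>. max 0 (g x - K)) <= e / 4"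
      "\<forall>\<^sub>F j in sequentially. (LINT x|\<mu> j. max 0 (g x - K)) <= e / 4"
      using U[of "e / 4"] e by auto
    have cb: "\<bar>c K t\<bar> <= K" for t using K(1) by (auto simp: c_def)
    have cm: "(\<lambda>x. c K (k x)) \<in> borel_measurable borel" if "k \<in> borel_measurable borel" for k :: "'b => real"
      unfolding c_def using that by measurable
    have cd: "\<bar>integral\<^sup>L m k - (LINT x|m. c K (k x))\<bar> <= (LINT x|m. max 0 (g x - K))"
      if "finb m" "integrable m g" "integrable m k" "k \<in> borel_measurable borel" "!!x. \<bar>k x\<bar> <= g x" for m k
    proof -
      have i: "integrable m (\<lambda>x. c K (k x))" by (rule finb_integrable_bounded[OF that(1) cm[OF that(4)], of K]) (use cb in auto)
      have ig: "integrable m (\<lambda>x. max 0 (g x - K))"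
        using that by (auto simp: finb_def finite_measure.integrable_const)
      have "\<bar>integral\<^sup>L m k - (LINT x|m. c K (k x))\<bar> = \<bar>(LINT x|m. k x - c K (k x))\<bar>" using i that(3) by simp
      also have "\<dots> <= (LINT x|m. \<bar>k x - c K (k x)\<bar>)" by (rule integral_abs_bound)
      also have "\<dots> <= (LINT x|m. max 0 (g x - K))"
        by (rule integral_mono) (use i ig that(3) ct that(5) in auto)
      finally show ?thesis .
    qed
    have "(\<lambda>j. LINT x|\<mu> j. c K (h j x)) \<longlonglongrightarrow> (LINT x|\<nu>. c K (f x))"
      by (rule setwise_integral_pointwise_bounded[OF s uc fb cm cm _ cb])
        (use h p in \<open>auto simp: c_def intro!: tendsto_max tendsto_min\<close>)
    then have "\<forall>\<^sub>F j in sequentially. \<bar>(LINT x|\<mu> j. c K (h j x)) - (LINT x|\<nu>. c K (f x))\<bar> < e / 4"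
      using e by (auto dest!: tendstoD[where e = "e/4"] simp: dist_real_def)
    with K(3) have "\<forall>\<^sub>F j in sequentially. norm ((LINT x|\<mu> j. h j x) - (LINT x|\<nu>. f x)) < e"
    proof eventually_elim
      case (elim j)
      then show ?case
        using cd[OF fb(1) gi hi h(1) hg, of j j] cd[OF fb(2) gn fi h(2) fg] K(2) e
        unfolding real_norm_def by linarith
    qed
    then show "\<exists>no. \<forall>n\<ge>no. norm ((LINT x|\<mu> n. h n x) - (LINT x|\<nu>. f x)) < e"
      by (simp add: eventually_sequentially)
  qed
qed

lemma subset_Pow_UNIV: "E \<subseteq> Pow UNIV" by simp

text \<open>Countability serves the diagonal extraction, stability under intersection the induction
  over disjoint unions. Finite intersections of a countable basis have both properties; the
  intersection of the empty family contributes \<open>UNIV\<close>.\<close>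

lemma borel_countable_pi_system:
  "\<exists>E::'b::second_countable_topology set set. countable E \<and> Int_stable E \<and> E \<subseteq> Collect open \<and> UNIV \<in> E \<and> borel = sigma UNIV E"
proof -
  obtain B :: "'b set set" where B: "topological_basis B" "countable B"
    using ex_countable_basis by blast
  define E where "E = Inter ` {F. finite F \<and> F \<subseteq> B}"
  have o: "E \<subseteq> Collect open"
    unfolding E_def using topological_basis_open[OF B(1)] by (auto intro!: open_Inter)
  have "countable E"
    unfolding E_def by (intro countable_image countable_Collect_finite_subset B)
  moreover have "Int_stable E"
  proof (unfold Int_stable_def, intro ballI)
    fix a b assume "a \<in> E" "b \<in> E"
    then obtain F G where "a = \<Inter>F" "b = \<Inter>G" "finite F" "finite G" "F \<subseteq> B" "G \<subseteq> B" unfolding E_def by auto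
    then have "a \<inter> b = \<Inter>(F \<union> G)" "finite (F \<union> G)" "F \<union> G \<subseteq> B" by auto
    then show "a \<inter> b \<in> E" unfolding E_def by blast
  qed
  moreover have "UNIV \<in> E" unfolding E_def by (rule image_eqI[of _ _ "{}"]) auto
  moreover have "borel = sigma UNIV E"
  proof (subst borel_eq_countable_basis[OF B(2,1)], rule sigma_eqI)
    have BE: "B \<subseteq> E"
    proof
      fix b assume "b \<in> B" then show "b \<in> E" unfolding E_def by (intro image_eqI[of _ _ "{b}"]) auto
    qed
    have "E \<subseteq> sigma_sets UNIV B"
    proof
      fix x assume "x \<in> E"
      then have "x \<in> sets borel" using o by auto
      then show "x \<in> sigma_sets UNIV B" by (simp add: borel_eq_countable_basis[OF B(2,1)])
    qed
    then show "sigma_sets UNIV B = sigma_sets UNIV E"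
      using BE by (intro sigma_sets_eqI) auto
  qed auto
  ultimately show ?thesis using o by blast
qed

text \<open>Diagonal extraction gives convergence on a countable intersection-stable generator. The
  sets on which the masses converge are closed under complements and, since tails are uniformly
  small, under countable disjoint unions; hence convergence on every Borel set. Uniformity is used a
  second time to make the limit countably additive.\<close>

lemma setwise_compact:
  fixes \<mu> :: "nat => 'b::second_countable_topology measure"
  assumes fb: "!!j. finb (\<mu> j)" and C: "!!j. measure (\<mu> j) UNIV <= C" and uc: "ucadd \<mu>"
  shows "\<exists>r \<nu>. strict_mono (r::nat=>nat) \<and> finb \<nu> \<and> setwise (\<lambda>j. \<mu> (r j)) \<nu>"
proof -
  note [simp] = finbD(2,3)[OF fb]
  have fin: "finite_measure (\<mu> j)" for j using fb by (rule finbD)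
  have le: "measure (\<mu> j) A <= C" for j A
    using finite_measure.bounded_measure[OF fin, of j A] C[of j] by simp
  obtain E :: "'b set set" where E: "countable E" "Int_stable E" "E \<subseteq> Collect open" "UNIV \<in> E" "borel = sigma UNIV E"
    using borel_countable_pi_system by blast
  have sB: "sets borel = sigma_sets UNIV E"
    using sets_measure_of[OF subset_Pow_UNIV, of E "\<lambda>_. 0"] E(5) by metis
  define P where "P n s \<longleftrightarrow> convergent (\<lambda>j. measure (\<mu> (s j)) (from_nat_into E n))" for n and s :: "nat => nat"
  interpret S: subseqs P
  proof
    fix n and s :: "nat => nat"
    have "compact {0..C}" by simp
    then have "seq_compact {0..C}" by (simp add: compact_eq_seq_compact_metric)
    then obtain l r where "strict_mono r" "((\<lambda>j. measure (\<mu> (s j)) (from_nat_into E n)) \<circ> r) \<longlonglongrightarrow> l"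
      by (rule seq_compactE[where f = "\<lambda>j. measure (\<mu> (s j)) (from_nat_into E n)"]) (use le in auto)
    then show "\<exists>r'. strict_mono r' \<and> P n (s \<circ> r')"
      unfolding P_def by (auto simp: convergent_def comp_def)
  qed
  define r where "r = S.diagseq"
  have r: "strict_mono r" unfolding r_def by (rule S.subseq_diagseq)
  have convE: "convergent (\<lambda>j. measure (\<mu> (r j)) e)" if "e \<in> E" for e
  proof -
    obtain n where n: "from_nat_into E n = e" using from_nat_into_surj[OF E(1) \<open>e \<in> E\<close>] by blast
    have "P n (S.diagseq \<circ> ((+) (Suc n)))"
    proof (rule S.diagseq_holds)
      fix q s :: "nat => nat" and n assume "strict_mono q" "P n s"
      then show "P n (s \<circ> q)"
        unfolding P_def using convergent_subseq_convergent[of "\<lambda>j. measure (\<mu> (s j)) (from_nat_into E n)" q] by (simp add: comp_def)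
    qed
    then have "convergent (\<lambda>j. measure (\<mu> (r (j + Suc n))) e)"
      unfolding P_def r_def n by (simp add: comp_def add.commute)
    then show ?thesis
      by (subst (asm) convergent_ignore_initial_segment)
  qed
  define L where "L A = lim (\<lambda>j. measure (\<mu> (r j)) A)" for A
  have cU: "convergent (\<lambda>j. measure (\<mu> (r j)) UNIV)" using convE E(4) by auto
  have "convergent (\<lambda>j. measure (\<mu> (r j)) A)" if "A \<in> sigma_sets UNIV E" for A
    using E(2) subset_Pow_UNIV[of E] that
  proof (induction A rule: sigma_sets_induct_disjoint)
    case (basic A)
    then show ?case by (rule convE)
  next
    case empty
    show ?case by (simp add: convergent_const)
  next
    case (compl A)
    have "A \<in> sets borel" using compl sB by simp
    then have "measure (\<mu> (r j)) (UNIV - A) = measure (\<mu> (r j)) UNIV - measure (\<mu> (r j)) A" for j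
      using finite_measure.finite_measure_compl[OF fin, of A "r j"] by simp
    then show ?case using convergent_diff[OF cU compl(2)] by simp
  next
    case (union A)
    have A: "A i \<in> sets borel" for i using union(2) sB by auto
    \<comment> \<open>The tails of the disjoint union decrease to the empty set, so their mass is
      small uniformly in \<open>j\<close>; the union inherits the Cauchy property from finitely many
      pieces.\<close>
    define T where "T N = (\<Union>i\<in>{N..}. A i)" for N :: nat
    have T: "T N \<in> sets borel" for N unfolding T_def by (rule sets.countable_UN') (auto intro: A)
    have "decseq T" unfolding T_def decseq_def by (auto intro: order_trans)
    moreover have "(\<Inter>i. T i) = {}"
    proof -
      have "x \<notin> (\<Inter>i. T i)" for x
      proof
        assume x: "x \<in> (\<Inter>i. T i)"
        then obtain i where "x \<in> A i" unfolding T_def by blast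
        moreover obtain k where "k >= Suc i" "x \<in> A k" using x unfolding T_def by blast
        ultimately show False using union(1) unfolding disjoint_family_on_def by (metis IntI UNIV_I empty_iff not_less_eq_eq order_refl)
      qed
      then show ?thesis by blast
    qed
    moreover have "range T \<subseteq> sets borel" using T by auto
    ultimately have tail: "\<exists>N. \<forall>n\<ge>N. \<forall>j. measure (\<mu> j) (T n) < e" if "0 < e" for e
      using uc that unfolding ucadd_def by blast
    have split: "measure (\<mu> j) (\<Union>i. A i) = (\<Sum>i<N. measure (\<mu> j) (A i)) + measure (\<mu> j) (T N)" for j N
    proof -
      interpret finite_measure "\<mu> j" by (rule fin)
      have "(\<Union>i. A i) = (\<Union>i\<in>{..<N}. A i) \<union> T N" unfolding T_def UN_Un[symmetric] by (rule arg_cong[where f = "\<lambda>I. \<Union> (A ` I)"]) auto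
      moreover have "(\<Union>i\<in>{..<N}. A i) \<inter> T N = {}"
      proof -
        have False if "i < N" "k >= N" "x \<in> A i" "x \<in> A k" for x i k
          using disjoint_family_onD[OF union(1), of i k] that by auto
        then show ?thesis unfolding T_def by blast
      qed
      moreover have "measure (\<mu> j) (\<Union>i\<in>{..<N}. A i) = (\<Sum>i<N. measure (\<mu> j) (A i))"
        using A union(1) by (intro finite_measure_finite_Union) (auto simp: disjoint_family_on_def)
      ultimately show ?thesis using A T finite_measure_Union[of "\<Union>i\<in>{..<N}. A i" "T N"] by simp
    qed
    show ?case
    proof (rule Cauchy_convergent, rule CauchyI)
      fix e :: real assume e: "0 < e"
      obtain N where N: "!!j. measure (\<mu> j) (T N) < e / 3" using tail[of "e/3"] e by auto
      have "convergent (\<lambda>j. \<Sum>i<N. measure (\<mu> (r j)) (A i))"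
        by (rule convergent_sum) (rule union)
      then have cau: "Cauchy (\<lambda>j. \<Sum>i<N. measure (\<mu> (r j)) (A i))" by (rule convergent_Cauchy)
      have "0 < e / 3" using e by simp
      from CauchyD[OF cau this] obtain M where M: "!!m n. m >= M ==> n >= M ==>
          norm ((\<Sum>i<N. measure (\<mu> (r m)) (A i)) - (\<Sum>i<N. measure (\<mu> (r n)) (A i))) < e / 3"
        by blast
      show "\<exists>M. \<forall>m\<ge>M. \<forall>n\<ge>M. norm (measure (\<mu> (r m)) (\<Union> (range A)) - measure (\<mu> (r n)) (\<Union> (range A))) < e"
      proof (intro exI allI impI)
        fix m n assume "M <= m" "M <= n"
        then show "norm (measure (\<mu> (r m)) (\<Union> (range A)) - measure (\<mu> (r n)) (\<Union> (range A))) < e"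
          using M[of m n] N[of "r m"] N[of "r n"] split[of "r m" N] split[of "r n" N]
            measure_nonneg[of "\<mu> (r m)" "T N"] measure_nonneg[of "\<mu> (r n)" "T N"]
          unfolding real_norm_def by linarith
      qed
    qed
  qed
  then have conv: "(\<lambda>j. measure (\<mu> (r j)) A) \<longlonglongrightarrow> L A" if "A \<in> sets borel" for A
    using that sB unfolding L_def by (simp add: convergent_LIMSEQ_iff)
  have L0: "0 <= L A" if "A \<in> sets borel" for A
    by (rule tendsto_lowerbound[OF conv[OF that]]) auto
  have Ladd: "L (A \<union> B) = L A + L B" if AB: "A \<in> sets borel" "B \<in> sets borel" "A \<inter> B = {}" for A B
  proof (rule LIMSEQ_unique[OF conv])
    show "(\<lambda>j. measure (\<mu> (r j)) (A \<union> B)) \<longlonglongrightarrow> L A + L B"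
      using tendsto_add[OF conv[OF AB(1)] conv[OF AB(2)]] finite_measure.finite_measure_Union[OF fin _ _ AB(3)] AB by simp
  qed (use AB in auto)
  define \<nu> where "\<nu> = measure_of UNIV (sets borel) (\<lambda>A. ennreal (L A))"
  have sn: "sets \<nu> = sets (borel :: 'b measure)"
    using sets.sigma_sets_eq[of "borel :: 'b measure"] unfolding \<nu>_def by simp
  have en: "emeasure \<nu> A = ennreal (L A)" if "A \<in> sets borel" for A
  proof (rule emeasure_measure_of[OF \<nu>_def])
    have LE: "L {} = 0" unfolding L_def by simp
    show "positive (sets \<nu>) (\<lambda>A. ennreal (L A))" unfolding positive_def using LE by simp
    show "countably_additive (sets \<nu>) (\<lambda>A. ennreal (L A))"
      unfolding sn
    \<comment> \<open>For a finite additive set function continuity at the empty set suffices; the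
      bound of \<open>ucadd\<close> is uniform in \<open>j\<close> and survives the limit.\<close>
    proof (rule ring_of_sets.empty_continuous_imp_countably_additive)
      show "ring_of_sets UNIV (sets (borel :: 'b measure))"
        using sets.ring_of_sets_axioms[of "borel :: 'b measure"] by simp
      show "positive (sets borel) (\<lambda>A. ennreal (L A))" unfolding positive_def using LE by simp
      show "additive (sets borel) (\<lambda>A. ennreal (L A))"
        unfolding additive_def using Ladd L0 by simp
      fix A :: "nat => 'b set" assume A: "range A \<subseteq> sets borel" "decseq A" "(\<Inter>i. A i) = {}"
      have "(\<lambda>i. L (A i)) \<longlonglongrightarrow> 0"
      proof (rule LIMSEQ_I)
        fix e :: real assume e: "0 < e"
        then have "0 < e / 2" by simp
        then obtain N where N: "!!n j. n >= N ==> measure (\<mu> j) (A n) < e / 2"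
          using uc[unfolded ucadd_def, rule_format, of A "e / 2"] A by blast
        have "L (A n) <= e / 2" if "n >= N" for n
          by (rule tendsto_upperbound[OF conv]) (use A N[OF that] in \<open>auto intro!: always_eventually less_imp_le\<close>)
        then show "\<exists>no. \<forall>n\<ge>no. norm (L (A n) - 0) < e"
          using L0 A(1) e by (intro exI[of _ N]) (fastforce simp: image_subset_iff)
      qed
      then show "(\<lambda>i. ennreal (L (A i))) \<longlonglongrightarrow> 0" using tendsto_ennrealI by fastforce
    qed auto
  qed (use that sn in auto)
  have "finb \<nu>"
    unfolding finb_def using sn en[of UNIV] sets_eq_imp_space_eq[OF sn] by (auto intro!: finite_measureI)
  moreover have "setwise (\<lambda>j. \<mu> (r j)) \<nu>"
    unfolding setwise_def using conv en L0 by (simp add: measure_def)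
  ultimately show ?thesis using r by blast
qed

text \<open>Successive extraction over a finite index set, so that one subsequence serves all signed
  coordinates of a vector field.\<close>

lemma setwise_compact_family:
  fixes \<mu> :: "nat => 'i => 'b::second_countable_topology measure"
  assumes "finite I" and fb: "!!j i. i \<in> I ==> finb (\<mu> j i)" and C: "!!j i. i \<in> I ==> measure (\<mu> j i) UNIV <= C"
    and uc: "!!i. i \<in> I ==> ucadd (\<lambda>j. \<mu> j i)"
  shows "\<exists>r \<nu>. strict_mono (r::nat=>nat) \<and> (\<forall>i\<in>I. finb (\<nu> i) \<and> setwise (\<lambda>j. \<mu> (r j) i) (\<nu> i))"
  using assms
proof (induction I)
  case empty
  show ?case by (intro exI[of _ id]) (auto simp: strict_mono_def)
next
  case (insert x I)
  from insert.IH insert.prems obtain r \<nu> where r: "strict_mono (r::nat=>nat)"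
    "!!i. i \<in> I ==> finb (\<nu> i) \<and> setwise (\<lambda>j. \<mu> (r j) i) (\<nu> i)" by (metis insertCI)
  obtain q \<nu>' where q: "strict_mono (q::nat=>nat)" "finb \<nu>'" "setwise (\<lambda>j. \<mu> (r (q j)) x) \<nu>'"
    using setwise_compact[of "\<lambda>j. \<mu> (r j) x" C] insert.prems ucadd_reindex[of "\<lambda>j. \<mu> j x" r] by auto
  show ?case
  proof (intro exI conjI ballI)
    show "strict_mono (r \<circ> q)" using r(1) q(1) by (rule strict_mono_o)
    fix i assume "i \<in> insert x I"
    then show "finb ((\<nu>(x := \<nu>')) i)" "setwise (\<lambda>j. \<mu> ((r \<circ> q) j) i) ((\<nu>(x := \<nu>')) i)"
      using r(2)[of i] q insert.hyps(2) setwise_subseq[of "\<lambda>j. \<mu> (r j) i" "\<nu> i" q] by auto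
  qed
qed

section \<open>Locally uniform limits along convergent sequences\<close>

text \<open>A convergent sequence together with its limit is compact, so uniform convergence on
  compact sets can be used although \<open>P2\<close> is not locally compact. The first claim yields
  continuity of the limit function; the second lets function and argument move together.\<close>

lemma locally_uniform_limit_seq:
  fixes f :: "nat => 'a::metric_space => 'b::metric_space"
  assumes f: "locally_uniform_limit S f g" "!!n. continuous_on S (f n)"
    and z: "z \<longlonglongrightarrow> l" "!!j. z j \<in> S" "l \<in> S"
  shows "(\<lambda>j. g (z j)) \<longlonglongrightarrow> g l"
    and "filterlim n at_top sequentially ==> (\<lambda>j. f (n j) (z j)) \<longlonglongrightarrow> g l"
proof -
  define K where "K = insert l (range z)"
  have "compact K"
  proof -
    have "seq_compact K"
    proof (rule seq_compactI)
      fix u :: "nat => 'a" assume u: "\<forall>k. u k \<in> K"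
      show "\<exists>m\<in>K. \<exists>r. strict_mono (r::nat=>nat) \<and> (u \<circ> r) \<longlonglongrightarrow> m"
      \<comment> \<open>Either the terms of \<open>u\<close> eventually keep a distance from
        \<open>l\<close>, hence range over finitely many \<open>z j\<close> and some value recurs
        infinitely often, or \<open>u\<close> returns arbitrarily close to \<open>l\<close> and a
        subsequence tends to \<open>l\<close>.\<close>
      proof (cases "\<exists>e>0. \<exists>N. \<forall>k\<ge>N. dist (u k) l >= e")
        case True
        then obtain e N where e: "e > 0" "!!k. k >= N ==> dist (u k) l >= e" by blast
        obtain M where M: "!!j. j >= M ==> dist (z j) l < e" using z(1) e(1) unfolding lim_sequentially by blast
        have "u k \<in> z ` {..<M}" if "k >= N" for k
          using u e that M by (auto simp: K_def) (metis dist_self image_eqI insert_iff lessThan_iff not_less rangeE)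
        then have "u ` {N..} \<subseteq> z ` {..<M}" by auto
        then have fin: "finite (u ` {N..})" by (rule finite_subset) simp
        have "infinite {N..}" by (rule infinite_Ici)
        then obtain k0 where k0: "k0 >= N" "infinite {k\<in>{N..}. u k = u k0}"
          using pigeonhole_infinite[OF _ fin] by auto
        obtain r where r: "strict_mono (r::nat=>nat)" "!!n. r n \<in> {k\<in>{N..}. u k = u k0}"
          using infinite_enumerate[OF k0(2)] by blast
        then have "(u \<circ> r) = (\<lambda>_. u k0)" by auto
        then show ?thesis using r(1) u by (intro bexI[of _ "u k0"] exI[of _ r]) auto
      next
        case False
        then have F: "!!e N. e > 0 ==> \<exists>k\<ge>N. dist (u k) l < e" by force
        have "\<exists>f. \<forall>n. dist (u (f n)) l < inverse (Suc n) \<and> f n < f (Suc n)"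
        proof (rule dependent_nat_choice)
          show "\<exists>x. dist (u x) l < inverse (Suc 0)" using F[of "inverse (Suc 0)" 0] by auto
          fix x n assume "dist (u x) l < inverse (Suc n)"
          show "\<exists>y. dist (u y) l < inverse (Suc (Suc n)) \<and> x < y"
            using F[of "inverse (Suc (Suc n))" "Suc x"] by auto
        qed
        then obtain f where f: "!!n. dist (u (f n)) l < inverse (Suc n)" "!!n. f n < f (Suc n)" by blast
        have "strict_mono f" using f(2) by (simp add: strict_mono_Suc_iff)
        moreover have "(u \<circ> f) \<longlonglongrightarrow> l"
        proof (rule metric_tendsto_imp_tendsto[OF LIMSEQ_inverse_real_of_nat])
          show "\<forall>\<^sub>F x in sequentially. dist ((u \<circ> f) x) l <= dist (inverse (real (Suc x))) 0"
            using f(1) by (auto intro!: always_eventually less_imp_le simp del: of_nat_Suc)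
        qed
        ultimately show ?thesis by (auto simp: K_def)
      qed
    qed
    then show ?thesis by (simp add: compact_eq_seq_compact_metric)
  qed
  moreover have KS: "K \<subseteq> S" using z by (auto simp: K_def)
  ultimately have ul: "uniform_limit K f g sequentially"
    using f(1) unfolding locally_uniform_limit_def by blast
  have "continuous_on K g"
    by (rule uniform_limit_theorem[OF _ ul]) (auto intro!: always_eventually continuous_on_subset[OF f(2) KS])
  then show 1: "(\<lambda>j. g (z j)) \<longlonglongrightarrow> g l"
    by (rule continuous_on_tendsto_compose[OF _ z(1)]) (auto simp: K_def)
  assume n: "filterlim n at_top sequentially"
  show "(\<lambda>j. f (n j) (z j)) \<longlonglongrightarrow> g l"
  proof (rule tendstoI)
    fix e :: real assume e: "0 < e"
    have "\<forall>\<^sub>F k in sequentially. \<forall>x\<in>K. dist (f k x) (g x) < e / 2"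
      using uniform_limitD[OF ul, of "e / 2"] e by simp
    then have "\<forall>\<^sub>F j in sequentially. \<forall>x\<in>K. dist (f (n j) x) (g x) < e / 2"
      using n unfolding filterlim_iff by blast
    moreover have "\<forall>\<^sub>F j in sequentially. dist (g (z j)) (g l) < e / 2"
      using tendstoD[OF 1, of "e / 2"] e by simp
    ultimately show "\<forall>\<^sub>F j in sequentially. dist (f (n j) (z j)) (g l) < e"
    proof eventually_elim
      case (elim j)
      have "z j \<in> K" by (simp add: K_def)
      then have "dist (f (n j) (z j)) (g (z j)) < e / 2" using elim(1) by blast
      then show ?case using elim(2) dist_triangle[of "f (n j) (z j)" "g l" "g (z j)"] by linarith
    qed
  qed
qed

section \<open>Setwise convergence and the Wasserstein distance\<close>

text \<open>Transport between two measures with weights \<open>a\<close>, \<open>b\<close> on the cells of a countable partition: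
  the common mass stays in its cell, the excess \<open>(a - b)\<^sup>+\<close> is spread over \<open>(b - a)\<^sup>+\<close>; \<open>M\<close> is
  the total excess.\<close>

definition excess :: "(nat => real) => (nat => real) => nat => real" where
  "excess a b i = max 0 (a i - b i) / a i"

definition stay :: "(nat => real) => (nat => real) => nat => nat => real" where
  "stay a b i l = (if i = l then min (a i) (b i) / (a i * b i) else 0)"

lemma nn_integral_cells:
  assumes n: "sets N = sets borel" and idx: "idx \<in> measurable borel (count_space UNIV)"
  shows "(\<integral>\<^sup>+ y. f (idx y) \<partial>N) = (\<Sum>l::nat. f l * emeasure N (idx -` {l}))"
proof -
  have S: "idx -` {l} \<in> sets borel" for l
    using measurable_sets[OF idx, of "{l}"] by simp
  have "(\<integral>\<^sup>+ y. f (idx y) \<partial>N) = (\<integral>\<^sup>+ y. (\<Sum>l. f l * indicator (idx -` {l}) y) \<partial>N)"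
  proof (rule nn_integral_cong)
    fix y
    have "(\<Sum>l. f l * indicator (idx -` {l}) y) = (\<Sum>l\<in>{idx y}. f l * indicator (idx -` {l}) y)"
      by (rule suminf_finite) auto
    then show "f (idx y) = (\<Sum>l. f l * indicator (idx -` {l}) y)" by simp
  qed
  also have "\<dots> = (\<Sum>l. \<integral>\<^sup>+ y. f l * indicator (idx -` {l}) y \<partial>N)"
    by (rule nn_integral_suminf) (use S n in measurable)
  also have "\<dots> = (\<Sum>l. f l * emeasure N (idx -` {l}))"
    using S n by (subst nn_integral_cmult_indicator) auto
  finally show ?thesis .
qed

lemma measurable_cells:
  assumes "idx \<in> measurable borel (count_space UNIV)"
  shows "(\<lambda>y. f (idx y) :: real) \<in> borel_measurable borel"
  by (rule measurable_compose[OF assms]) simp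

lemma measurable_cells_pair:
  fixes idx :: "'a::euclidean_space => nat"
  assumes idx: "idx \<in> measurable borel (count_space UNIV)"
  shows "(\<lambda>z::'a \<times> 'a. f (idx (fst z)) (idx (snd z)) :: real) \<in> borel_measurable borel"
proof -
  have 1: "(\<lambda>z::'a \<times> 'a. idx (fst z)) \<in> measurable borel (count_space UNIV)"
    "(\<lambda>z::'a \<times> 'a. idx (snd z)) \<in> measurable borel (count_space UNIV)"
    by (rule measurable_compose[OF _ idx], simp)+
  have "(\<lambda>z::'a \<times> 'a. (idx (fst z), idx (snd z))) \<in> measurable borel (count_space UNIV)"
    using measurable_Pair[OF 1] by (simp add: pair_measure_countable)
  from measurable_compose[OF this, of "\<lambda>p. f (fst p) (snd p)"] show ?thesis by simp
qed

text \<open>Cellwise \<open>a + (b - a)\<^sup>+ = b + (a - b)\<^sup>+\<close>, and both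
  \<open>a\<close> and \<open>b\<close> sum to one; cancelling these finite totals leaves the
  equality of the excess masses.\<close>

lemma excess_mass:
  fixes m n :: "'a::euclidean_space P2"
  assumes idx: "idx \<in> measurable borel (count_space UNIV)"
    and ab: "!!i. a i = measure (meas m) (idx -` {i})" "!!i. b i = measure (meas n) (idx -` {i})"
  shows "(\<integral>\<^sup>+ y. ennreal (excess b a (idx y)) \<partial>meas n) = (\<integral>\<^sup>+ x. ennreal (excess a b (idx x)) \<partial>meas m)"
proof -
  interpret m: prob_space "meas m" by simp
  interpret n: prob_space "meas n" by simp
  have em: "emeasure (meas m) (idx -` {i}) = ennreal (a i)" "emeasure (meas n) (idx -` {i}) = ennreal (b i)" for i
    by (simp_all add: ab m.emeasure_eq_measure n.emeasure_eq_measure)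
  have ab0: "0 <= a i" "0 <= b i" for i by (simp_all add: ab)
  have ex: "ennreal (excess a b i) * ennreal (a i) = ennreal (max 0 (a i - b i))"
    "ennreal (excess b a i) * ennreal (b i) = ennreal (max 0 (b i - a i))" for i
    using ab0[of i] by (auto simp: excess_def ennreal_neg simp flip: ennreal_mult)
  have L: "(\<integral>\<^sup>+ y. ennreal (excess b a (idx y)) \<partial>meas n) = (\<Sum>l. ennreal (max 0 (b l - a l)))"
    using nn_integral_cells[of "meas n" idx "\<lambda>l. ennreal (excess b a l)"] idx by (simp add: em ex)
  have R: "(\<integral>\<^sup>+ x. ennreal (excess a b (idx x)) \<partial>meas m) = (\<Sum>l. ennreal (max 0 (a l - b l)))"
    using nn_integral_cells[of "meas m" idx "\<lambda>l. ennreal (excess a b l)"] idx by (simp add: em ex)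
  have 1: "(\<Sum>l. ennreal (a l)) = 1"
    using nn_integral_cells[of "meas m" idx "\<lambda>_. 1"] idx by (simp add: em m.emeasure_space_1[simplified])
  have 2: "(\<Sum>l. ennreal (b l)) = 1"
    using nn_integral_cells[of "meas n" idx "\<lambda>_. 1"] idx by (simp add: em n.emeasure_space_1[simplified])
  have "(\<Sum>l. ennreal (a l)) + (\<Sum>l. ennreal (max 0 (b l - a l))) = (\<Sum>l. ennreal (a l) + ennreal (max 0 (b l - a l)))"
    by (rule suminf_add) auto
  also have "\<dots> = (\<Sum>l. ennreal (b l) + ennreal (max 0 (a l - b l)))"
  proof (rule suminf_cong)
    fix l
    have "a l + max 0 (b l - a l) = b l + max 0 (a l - b l)" by (simp add: max_def)
    then show "ennreal (a l) + ennreal (max 0 (b l - a l)) = ennreal (b l) + ennreal (max 0 (a l - b l))"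
      using ab0[of l] ennreal_plus[of "a l" "max 0 (b l - a l)"] ennreal_plus[of "b l" "max 0 (a l - b l)"] by simp
  qed
  also have "\<dots> = (\<Sum>l. ennreal (b l)) + (\<Sum>l. ennreal (max 0 (a l - b l)))"
    by (rule suminf_add[symmetric]) auto
  finally show ?thesis using L R by (simp add: 1 2)
qed

text \<open>The density of the coupling, integrated over the second variable from a cell of positive
  mass: the part that stays gives \<open>min a b / a\<close>, the part that moves gives
  \<open>(a - b)\<^sup>+ / a\<close>, and together they make one.\<close>

lemma transport_marginal:
  fixes m n :: "'a::euclidean_space P2"
  assumes idx: "idx \<in> measurable borel (count_space UNIV)"
    and ab: "!!i. a i = measure (meas m) (idx -` {i})" "!!i. b i = measure (meas n) (idx -` {i})"
    and M: "(\<integral>\<^sup>+ y. ennreal (excess b a (idx y)) \<partial>meas n) = ennreal M" "0 <= M"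
    and i: "a i ~= 0"
  shows "(\<integral>\<^sup>+ y. ennreal (stay a b i (idx y)) \<partial>meas n) <= 1"
    "(\<integral>\<^sup>+ y. ennreal (excess a b i * excess b a (idx y) / M) \<partial>meas n) = ennreal (excess a b i)"
    "(\<integral>\<^sup>+ y. ennreal (stay a b i (idx y) + excess a b i * excess b a (idx y) / M) \<partial>meas n) = 1"
proof -
  interpret m: prob_space "meas m" by simp
  interpret n: prob_space "meas n" by simp
  have em: "emeasure (meas m) (idx -` {i}) = ennreal (a i)" "emeasure (meas n) (idx -` {i}) = ennreal (b i)" for i
    by (simp_all add: ab m.emeasure_eq_measure n.emeasure_eq_measure)
  have ab0: "0 <= a i" "0 <= b i" for i by (simp_all add: ab)
  have e0: "0 <= excess a b i" "0 <= excess b a i" "0 <= stay a b i l" for i l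
    using ab0 by (auto simp: excess_def stay_def)
  have "(\<integral>\<^sup>+ y. ennreal (stay a b i (idx y)) \<partial>meas n) = (\<Sum>l. ennreal (stay a b i l) * ennreal (b l))"
    using nn_integral_cells[of "meas n" idx "\<lambda>l. ennreal (stay a b i l)"] idx by (simp add: em)
  also have "\<dots> = (\<Sum>l\<in>{i}. ennreal (stay a b i l) * ennreal (b l))"
    by (rule suminf_finite) (auto simp: stay_def)
  also have "\<dots> = ennreal (min (a i) (b i) / a i)"
    using ab0[of i] i by (auto simp: stay_def simp flip: ennreal_mult)
  finally have st: "(\<integral>\<^sup>+ y. ennreal (stay a b i (idx y)) \<partial>meas n) = ennreal (min (a i) (b i) / a i)" .
  then show "(\<integral>\<^sup>+ y. ennreal (stay a b i (idx y)) \<partial>meas n) <= 1"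
    using ab0[of i] i by (simp add: divide_le_eq)
  have "(\<integral>\<^sup>+ y. ennreal (excess a b i * excess b a (idx y) / M) \<partial>meas n)
      = (\<integral>\<^sup>+ y. ennreal (excess a b i / M) * ennreal (excess b a (idx y)) \<partial>meas n)"
    using e0 M(2) by (intro nn_integral_cong) (simp add: flip: ennreal_mult)
  also have "\<dots> = ennreal (excess a b i / M) * ennreal M"
    using measurable_cells[OF idx, of "excess b a"] by (subst nn_integral_cmult) (simp_all add: M(1))
  also have "\<dots> = ennreal (excess a b i)"
  \<comment> \<open>For \<open>M = 0\<close> the quotient is zero by convention, while the excess of
    every cell charged by \<open>m\<close> is zero as well, so the formula persists.\<close>
  proof (cases "M = 0")
    case True
    have "ennreal (excess a b i) * ennreal (a i) <= (\<Sum>l. ennreal (excess a b l) * ennreal (a l))"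
      using sum_le_suminf[of "\<lambda>l. ennreal (excess a b l) * ennreal (a l)" "{i}"] by simp
    also have "\<dots> = (\<integral>\<^sup>+ x. ennreal (excess a b (idx x)) \<partial>meas m)"
      using nn_integral_cells[of "meas m" idx "\<lambda>l. ennreal (excess a b l)"] idx by (simp add: em)
    also have "\<dots> = 0" using excess_mass[OF idx ab] M True by simp
    finally have "excess a b i * a i <= 0" using e0 ab0[of i] by (auto simp flip: ennreal_mult)
    then have "excess a b i = 0" using e0(1)[of i] ab0[of i] i by (metis antisym mult_eq_0_iff mult_nonneg_nonneg)
    then show ?thesis by simp
  qed (use e0 M in \<open>simp flip: ennreal_mult\<close>)
  finally show ex: "(\<integral>\<^sup>+ y. ennreal (excess a b i * excess b a (idx y) / M) \<partial>meas n) = ennreal (excess a b i)" .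
  have "(\<integral>\<^sup>+ y. ennreal (stay a b i (idx y) + excess a b i * excess b a (idx y) / M) \<partial>meas n)
     = (\<integral>\<^sup>+ y. ennreal (stay a b i (idx y)) + ennreal (excess a b i * excess b a (idx y) / M) \<partial>meas n)"
    using e0 M(2) by (intro nn_integral_cong ennreal_plus) auto
  also have "\<dots> = ennreal (min (a i) (b i) / a i) + ennreal (excess a b i)"
    using measurable_cells[OF idx, of "stay a b i"] measurable_cells[OF idx, of "\<lambda>j. excess a b i * excess b a j / M"]
    by (subst nn_integral_add) (simp_all add: st ex)
  also have "\<dots> = ennreal (min (a i) (b i) / a i + excess a b i)"
    using ab0[of i] e0(1) by (intro ennreal_plus[symmetric]) auto
  also have "min (a i) (b i) / a i + excess a b i = 1"
    using i by (auto simp: excess_def min_def max_def field_simps)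
  finally show "(\<integral>\<^sup>+ y. ennreal (stay a b i (idx y) + excess a b i * excess b a (idx y) / M) \<partial>meas n) = 1"
    by simp
qed

text \<open>There are countably many cells, so those of mass zero form a null set; outside it the
  quotients by cell masses are genuine.\<close>

lemma AE_cell_positive:
  fixes m :: "'a::euclidean_space P2"
  assumes idx: "idx \<in> measurable borel (count_space UNIV)"
  shows "AE x in meas m. measure (meas m) (idx -` {idx x :: nat}) ~= 0"
proof -
  interpret m: prob_space "meas m" by simp
  have S: "idx -` {l} \<in> sets borel" for l
    using measurable_sets[OF idx, of "{l}"] by simp
  have "AE x in meas m. \<forall>i. measure (meas m) (idx -` {i}) = 0 --> idx x ~= i"
  proof (subst AE_all_countable, intro allI)
    fix i
    show "AE x in meas m. measure (meas m) (idx -` {i}) = 0 --> idx x ~= i"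
    proof (cases "measure (meas m) (idx -` {i}) = 0")
      case True
      show ?thesis
        by (rule AE_I[where N = "idx -` {i}"]) (use True S in \<open>auto simp: m.emeasure_eq_measure\<close>)
    qed simp
  qed
  then show ?thesis by (rule AE_mp) auto
qed

text \<open>Inside the ball of radius \<open>r\<close> the square is at most
  \<open>r\<^sup>2\<close>, outside it is at most \<open>|x|\<^sup>3 / r\<close>. With
  \<open>r\<close> large and then \<open>M\<close> small, little mass carries little second
  moment.\<close>

lemma third_moment_tail:
  assumes "(\<integral>\<^sup>+ x. ennreal (norm x ^ 3) \<partial>meas m) <= ennreal R" "0 < r" "0 <= R"
    and f: "f \<in> borel_measurable borel" "!!x. 0 <= f x" "!!x. f x <= 1" "(\<integral>\<^sup>+ x. ennreal (f x) \<partial>meas m) <= ennreal M" "0 <= M"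
  shows "(\<integral>\<^sup>+ x. ennreal (f x) * ennreal ((norm x)\<^sup>2) \<partial>meas m) <= ennreal (r\<^sup>2 * M + R / r)"
proof -
  have "(\<integral>\<^sup>+ x. ennreal (f x) * ennreal ((norm x)\<^sup>2) \<partial>meas m)
     <= (\<integral>\<^sup>+ x. ennreal (r\<^sup>2) * ennreal (f x) + ennreal (1 / r) * ennreal (norm x ^ 3) \<partial>meas m)"
  proof (rule nn_integral_mono)
    fix x
    have "f x * (norm x)\<^sup>2 <= r\<^sup>2 * f x + 1 / r * norm x ^ 3"
    proof (cases "norm x <= r")
      case True
      then have "f x * (norm x)\<^sup>2 <= f x * r\<^sup>2" using f(2) by (intro mult_left_mono power_mono) auto
      then show ?thesis using assms(2) by (simp add: mult.commute add_increasing2)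
    next
      case False
      have "f x * (norm x)\<^sup>2 <= 1 * (norm x)\<^sup>2" using f(3) by (intro mult_right_mono) auto
      also have "\<dots> <= 1 / r * norm x ^ 3"
      proof -
        have "r * (norm x)\<^sup>2 <= norm x * (norm x)\<^sup>2" using False by (intro mult_right_mono) auto
        then show ?thesis using assms(2) by (simp add: field_simps power2_eq_square power3_eq_cube)
      qed
      finally show ?thesis using f(2)[of x] by (simp add: add_increasing)
    qed
    then show "ennreal (f x) * ennreal ((norm x)\<^sup>2) <= ennreal (r\<^sup>2) * ennreal (f x) + ennreal (1 / r) * ennreal (norm x ^ 3)"
      using f(2)[of x] assms(2) by (simp flip: ennreal_mult ennreal_plus)
  qed
  also have "\<dots> = ennreal (r\<^sup>2) * (\<integral>\<^sup>+ x. ennreal (f x) \<partial>meas m) + ennreal (1 / r) * (\<integral>\<^sup>+ x. ennreal (norm x ^ 3) \<partial>meas m)"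
    using f(1) by (subst nn_integral_add; (subst nn_integral_cmult)?; (subst nn_integral_cmult)?; simp)
  also have "\<dots> <= ennreal (r\<^sup>2) * ennreal M + ennreal (1 / r) * ennreal R"
    by (intro add_mono mult_left_mono assms) auto
  also have "\<dots> = ennreal (r\<^sup>2 * M + R / r)"
    using assms by (simp flip: ennreal_mult ennreal_plus)
  finally show ?thesis .
qed


text \<open>The density \<open>H\<close> with respect to the product measure splits into mass that
  stays in its cell, displaced by at most \<open>c\<close>, and mass that leaves it. For the latter
  \<open>|x - y|\<^sup>2 <= 2|x|\<^sup>2 + 2|y|\<^sup>2\<close>, and
  \<open>third_moment_tail\<close> bounds both second moments by the same quantity, whence the
  factor 4.\<close>

lemma W2_squared_cells:
  fixes m n :: "'a::euclidean_space P2"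
  assumes idx: "idx \<in> measurable borel (count_space UNIV)"
    and c: "!!x y. idx x = idx y ==> dist x y <= c" "0 <= c"
    and ab: "!!i. a i = measure (meas m) (idx -` {i})" "!!i. b i = measure (meas n) (idx -` {i})"
    and M: "(\<integral>\<^sup>+ y. ennreal (excess b a (idx y)) \<partial>meas n) = ennreal M" "0 <= M"
    and R: "(\<integral>\<^sup>+ x. ennreal (norm x ^ 3) \<partial>meas m) <= ennreal R" "(\<integral>\<^sup>+ x. ennreal (norm x ^ 3) \<partial>meas n) <= ennreal R"
    and r: "0 < r" "0 <= R"
  shows "W2_squared (meas m) (meas n) <= ennreal (c\<^sup>2 + 4 * (r\<^sup>2 * M + R / r))"
proof -
  interpret m: prob_space "meas m" by simp
  interpret n: prob_space "meas n" by simp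
  interpret P: pair_prob_space "meas m" "meas n" ..
  have sP: "sets (meas m \<Otimes>\<^sub>M meas n) = sets borel"
    by (simp add: borel_prod[symmetric] cong: sets_pair_measure_cong)
  have mP [simp]: "measurable (meas m \<Otimes>\<^sub>M meas n) N = measurable borel N" for N :: "ennreal measure"
    by (rule measurable_cong_sets[OF sP refl])
  have ab0: "0 <= a i" "0 <= b i" for i by (simp_all add: ab)
  have e0: "0 <= excess a b i" "0 <= excess b a i" "0 <= stay a b i l" for i l
    using ab0 by (auto simp: excess_def stay_def)
  have e1: "excess a b i <= 1" "excess b a i <= 1" for i
    using ab0[of i] by (auto simp: excess_def divide_le_eq)
  define S where "S z = ennreal (stay a b (idx (fst z)) (idx (snd z)))" for z
  define Q where "Q z = ennreal (excess a b (idx (fst z)) * excess b a (idx (snd z)) / M)" for z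
  have Sm [measurable]: "S \<in> borel_measurable borel"
    unfolding S_def using measurable_cells_pair[OF idx, of "stay a b"] by simp
  have Qm [measurable]: "Q \<in> borel_measurable borel"
    unfolding Q_def using measurable_cells_pair[OF idx, of "\<lambda>i l. excess a b i * excess b a l / M"] by simp
  define H where "H z = S z + Q z" for z
  have Hm [measurable]: "H \<in> borel_measurable borel" unfolding H_def by measurable
  have Heq: "H z = ennreal (stay a b (idx (fst z)) (idx (snd z)) + excess a b (idx (fst z)) * excess b a (idx (snd z)) / M)" for z
    unfolding H_def S_def Q_def using e0 M(2) by (intro ennreal_plus[symmetric]) auto
  have stay_sym: "stay a b i l = stay b a l i" for i l by (auto simp: stay_def min.commute mult.commute)
  have M': "(\<integral>\<^sup>+ x. ennreal (excess a b (idx x)) \<partial>meas m) = ennreal M"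
    using excess_mass[OF idx ab] M by simp
  note tm = transport_marginal[OF idx ab M] transport_marginal[OF idx ab(2,1) M' M(2)]
  have AEm: "AE x in meas m. a (idx x) ~= 0" using AE_cell_positive[OF idx, of m] by (simp add: ab)
  have AEn: "AE y in meas n. b (idx y) ~= 0" using AE_cell_positive[OF idx, of n] by (simp add: ab)
  have int1: "(\<integral>\<^sup>+ z. f (fst z) * h z \<partial>(meas m \<Otimes>\<^sub>M meas n)) = (\<integral>\<^sup>+ x. f x * (\<integral>\<^sup>+ y. h (x, y) \<partial>meas n) \<partial>meas m)"
    if "f \<in> borel_measurable borel" "h \<in> borel_measurable borel" for f :: "'a => ennreal" and h
  proof -
    have fm: "(\<lambda>z. f (fst z) * h z) \<in> borel_measurable borel"
      by (rule borel_measurable_times_ennreal[OF measurable_compose[OF borel_measurable_fst_snd(1) that(1)] that(2)])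
    have "(\<integral>\<^sup>+ z. f (fst z) * h z \<partial>(meas m \<Otimes>\<^sub>M meas n)) = (\<integral>\<^sup>+ x. (\<integral>\<^sup>+ y. f x * h (x, y) \<partial>meas n) \<partial>meas m)"
      using n.nn_integral_fst[of "\<lambda>z. f (fst z) * h z" "meas m"] fm by simp
    also have "\<dots> = (\<integral>\<^sup>+ x. f x * (\<integral>\<^sup>+ y. h (x, y) \<partial>meas n) \<partial>meas m)"
    proof (intro nn_integral_cong nn_integral_cmult)
      fix x
      have "(\<lambda>y. h (x, y)) \<in> borel_measurable borel"
        by (rule measurable_compose[OF _ that(2)]) (intro borel_measurable_continuous_onI continuous_intros)
      then show "(\<lambda>y. h (x, y)) \<in> borel_measurable (meas n)" by simp
    qed
    finally show ?thesis .
  qed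
  have int2: "(\<integral>\<^sup>+ z. f (snd z) * h z \<partial>(meas m \<Otimes>\<^sub>M meas n)) = (\<integral>\<^sup>+ y. f y * (\<integral>\<^sup>+ x. h (x, y) \<partial>meas m) \<partial>meas n)"
    if "f \<in> borel_measurable borel" "h \<in> borel_measurable borel" for f :: "'a => ennreal" and h
  proof -
    have fm: "(\<lambda>z. f (snd z) * h z) \<in> borel_measurable borel"
      by (rule borel_measurable_times_ennreal[OF measurable_compose[OF borel_measurable_fst_snd(2) that(1)] that(2)])
    have "(\<integral>\<^sup>+ z. f (snd z) * h z \<partial>(meas m \<Otimes>\<^sub>M meas n)) = (\<integral>\<^sup>+ y. (\<integral>\<^sup>+ x. f y * h (x, y) \<partial>meas m) \<partial>meas n)"
      using P.nn_integral_snd[of "\<lambda>z. f (snd z) * h z"] fm by simp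
    also have "\<dots> = (\<integral>\<^sup>+ y. f y * (\<integral>\<^sup>+ x. h (x, y) \<partial>meas m) \<partial>meas n)"
    proof (intro nn_integral_cong nn_integral_cmult)
      fix y
      have "(\<lambda>x. h (x, y)) \<in> borel_measurable borel"
        by (rule measurable_compose[OF _ that(2)]) (intro borel_measurable_continuous_onI continuous_intros)
      then show "(\<lambda>x. h (x, y)) \<in> borel_measurable (meas m)" by simp
    qed
    finally show ?thesis .
  qed
  define g where "g = density (meas m \<Otimes>\<^sub>M meas n) H"
  have sg: "sets g = sets borel" using sP by (simp add: g_def)
  have mg [simp]: "measurable g N = measurable borel N" for N :: "ennreal measure"
    by (rule measurable_cong_sets[OF sg refl])
  have mg' [simp]: "measurable g N = measurable borel N" for N :: "'a measure"
    by (rule measurable_cong_sets[OF sg refl])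
  have intg: "(\<integral>\<^sup>+ z. f z \<partial>g) = (\<integral>\<^sup>+ z. f z * H z \<partial>(meas m \<Otimes>\<^sub>M meas n))" if "f \<in> borel_measurable borel" for f
    unfolding g_def using that by (subst nn_integral_density) (auto simp: mult.commute)
  have "distr g borel fst = meas m"
  proof (rule measure_eqI)
    fix A :: "'a set" assume "A \<in> sets (distr g borel fst)"
    then have A [measurable]: "A \<in> sets borel" by simp
    have mA: "(\<lambda>p. indicator A (fst p) :: ennreal) \<in> borel_measurable (borel :: ('a \<times> 'a) measure)"
      by (rule measurable_compose[OF borel_measurable_fst_snd(1)]) simp
    have "emeasure (distr g borel fst) A = (\<integral>\<^sup>+ x. indicator A x \<partial>distr g borel fst)" by simp
    also have "\<dots> = (\<integral>\<^sup>+ z. indicator A (fst z) \<partial>g)" by (rule nn_integral_distr) simp_all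
    also have "\<dots> = (\<integral>\<^sup>+ x. indicator A x * (\<integral>\<^sup>+ y. H (x, y) \<partial>meas n) \<partial>meas m)"
      by (subst intg[OF mA], rule int1) simp_all
    also have "\<dots> = (\<integral>\<^sup>+ x. indicator A x \<partial>meas m)"
      by (rule nn_integral_cong_AE, rule AE_mp[OF AEm]) (use tm(3) in \<open>auto simp: Heq\<close>)
    finally show "emeasure (distr g borel fst) A = emeasure (meas m) A" by simp
  qed simp
  moreover have "distr g borel snd = meas n"
  proof (rule measure_eqI)
    fix A :: "'a set" assume "A \<in> sets (distr g borel snd)"
    then have A [measurable]: "A \<in> sets borel" by simp
    have mA: "(\<lambda>p. indicator A (snd p) :: ennreal) \<in> borel_measurable (borel :: ('a \<times> 'a) measure)"
      by (rule measurable_compose[OF borel_measurable_fst_snd(2)]) simp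
    have "emeasure (distr g borel snd) A = (\<integral>\<^sup>+ x. indicator A x \<partial>distr g borel snd)" by simp
    also have "\<dots> = (\<integral>\<^sup>+ z. indicator A (snd z) \<partial>g)" by (rule nn_integral_distr) simp_all
    also have "\<dots> = (\<integral>\<^sup>+ y. indicator A y * (\<integral>\<^sup>+ x. H (x, y) \<partial>meas m) \<partial>meas n)"
      by (subst intg[OF mA], rule int2) simp_all
    also have "\<dots> = (\<integral>\<^sup>+ x. indicator A x \<partial>meas n)"
      by (rule nn_integral_cong_AE, rule AE_mp[OF AEn])
        (use tm(6) in \<open>auto simp: Heq stay_sym mult.commute[of "excess a b _"]\<close>)
    finally show "emeasure (distr g borel snd) A = emeasure (meas n) A" by simp
  qed simp
  ultimately have gc: "g \<in> couplings (meas m) (meas n)" by (simp add: couplings_def sg)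
  have cm: "(\<lambda>p. ennreal ((dist (fst p) (snd p))\<^sup>2)) \<in> borel_measurable (borel :: ('a \<times> 'a) measure)"
    by (intro measurable_compose[OF _ measurable_ennreal] borel_measurable_continuous_onI continuous_intros)
  have fm1: "(\<lambda>z. ennreal ((norm (fst z))\<^sup>2) * Q z) \<in> borel_measurable (borel :: ('a \<times> 'a) measure)"
    by (intro borel_measurable_times_ennreal Qm measurable_compose[OF _ measurable_ennreal] borel_measurable_continuous_onI continuous_intros)
  have fm2: "(\<lambda>z. ennreal ((norm (snd z))\<^sup>2) * Q z) \<in> borel_measurable (borel :: ('a \<times> 'a) measure)"
    by (intro borel_measurable_times_ennreal Qm measurable_compose[OF _ measurable_ennreal] borel_measurable_continuous_onI continuous_intros)
  have "transport_cost g = (\<integral>\<^sup>+ z. ennreal ((dist (fst z) (snd z))\<^sup>2) * H z \<partial>(meas m \<Otimes>\<^sub>M meas n))"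
    unfolding transport_cost_def by (rule intg[OF cm])
  also have "\<dots> <= (\<integral>\<^sup>+ z. ennreal (c\<^sup>2) * S z + (2 * (ennreal ((norm (fst z))\<^sup>2) * Q z) + 2 * (ennreal ((norm (snd z))\<^sup>2) * Q z)) \<partial>(meas m \<Otimes>\<^sub>M meas n))"
  proof (rule nn_integral_mono)
    fix z :: "'a \<times> 'a"
    have "ennreal ((dist (fst z) (snd z))\<^sup>2) * S z <= ennreal (c\<^sup>2) * S z"
    proof (cases "idx (fst z) = idx (snd z)")
      case True
      then show ?thesis using c by (intro mult_right_mono ennreal_leI power_mono) auto
    qed (simp add: S_def stay_def)
    moreover have "ennreal ((dist (fst z) (snd z))\<^sup>2) * Q z <= (2 * ennreal ((norm (fst z))\<^sup>2) + 2 * ennreal ((norm (snd z))\<^sup>2)) * Q z"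
    proof (rule mult_right_mono)
      have "(dist (fst z) (snd z))\<^sup>2 <= (norm (fst z) + norm (snd z))\<^sup>2"
        by (intro power_mono) (auto simp: dist_norm norm_triangle_ineq4)
      also have "\<dots> <= 2 * (norm (fst z))\<^sup>2 + 2 * (norm (snd z))\<^sup>2"
        using sum_squares_bound[of "norm (fst z)" "norm (snd z)"] by (simp add: power2_sum)
      finally have "ennreal ((dist (fst z) (snd z))\<^sup>2) <= ennreal (2 * (norm (fst z))\<^sup>2 + 2 * (norm (snd z))\<^sup>2)"
        by (rule ennreal_leI)
      then show "ennreal ((dist (fst z) (snd z))\<^sup>2) <= 2 * ennreal ((norm (fst z))\<^sup>2) + 2 * ennreal ((norm (snd z))\<^sup>2)"
        by (simp add: ennreal_mult)
    qed simp
    ultimately show "ennreal ((dist (fst z) (snd z))\<^sup>2) * H z \<le>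
        ennreal (c\<^sup>2) * S z + (2 * (ennreal ((norm (fst z))\<^sup>2) * Q z) + 2 * (ennreal ((norm (snd z))\<^sup>2) * Q z))"
      unfolding H_def by (simp add: distrib_left distrib_right add_mono mult.assoc)
  qed
  also have "\<dots> = ennreal (c\<^sup>2) * (\<integral>\<^sup>+ z. S z \<partial>(meas m \<Otimes>\<^sub>M meas n)) +
      (2 * (\<integral>\<^sup>+ z. ennreal ((norm (fst z))\<^sup>2) * Q z \<partial>(meas m \<Otimes>\<^sub>M meas n)) +
       2 * (\<integral>\<^sup>+ z. ennreal ((norm (snd z))\<^sup>2) * Q z \<partial>(meas m \<Otimes>\<^sub>M meas n)))"
  proof -
    have i1: "(\<lambda>z. ennreal (c\<^sup>2) * S z) \<in> borel_measurable borel" by measurable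
    have i2: "(\<lambda>z. 2 * (ennreal ((norm (fst z))\<^sup>2) * Q z)) \<in> borel_measurable borel"
      "(\<lambda>z. 2 * (ennreal ((norm (snd z))\<^sup>2) * Q z)) \<in> borel_measurable borel"
      using fm1 fm2 by measurable
    show ?thesis
      by (subst nn_integral_add; (subst nn_integral_add)?; (subst nn_integral_cmult)?; (subst nn_integral_cmult)?;
          (subst nn_integral_cmult)?; (simp only: mP)?; (intro borel_measurable_add)?; (rule i1 i2 fm1 fm2 Sm refl)?)
  qed
  also have "\<dots> <= ennreal (c\<^sup>2) * 1 + (2 * ennreal (r\<^sup>2 * M + R / r) + 2 * ennreal (r\<^sup>2 * M + R / r))"
  proof (intro add_mono mult_left_mono)
    have "(\<integral>\<^sup>+ z. S z \<partial>(meas m \<Otimes>\<^sub>M meas n)) = (\<integral>\<^sup>+ x. 1 * (\<integral>\<^sup>+ y. S (x, y) \<partial>meas n) \<partial>meas m)"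
      using int1[OF _ Sm, of "\<lambda>_. 1"] by simp
    also have "\<dots> <= (\<integral>\<^sup>+ x. 1 \<partial>meas m)"
      by (rule nn_integral_mono_AE, rule AE_mp[OF AEm]) (use tm(1) in \<open>auto simp: S_def\<close>)
    finally show "(\<integral>\<^sup>+ z. S z \<partial>(meas m \<Otimes>\<^sub>M meas n)) <= 1" by (simp add: m.emeasure_space_1[simplified])
    have em: "(\<lambda>x. excess a b (idx x)) \<in> borel_measurable borel" "(\<lambda>x. excess b a (idx x)) \<in> borel_measurable borel"
      by (rule measurable_cells[OF idx])+
    have "(\<integral>\<^sup>+ z. ennreal ((norm (fst z))\<^sup>2) * Q z \<partial>(meas m \<Otimes>\<^sub>M meas n))
        = (\<integral>\<^sup>+ x. ennreal ((norm x)\<^sup>2) * (\<integral>\<^sup>+ y. Q (x, y) \<partial>meas n) \<partial>meas m)"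
      by (rule int1) simp_all
    also have "\<dots> = (\<integral>\<^sup>+ x. ennreal (excess a b (idx x)) * ennreal ((norm x)\<^sup>2) \<partial>meas m)"
      by (rule nn_integral_cong_AE, rule AE_mp[OF AEm]) (use tm(2) in \<open>auto simp: Q_def mult.commute\<close>)
    also have "\<dots> <= ennreal (r\<^sup>2 * M + R / r)"
      by (rule third_moment_tail) (use R r M' M e0 e1 em in auto)
    finally show "(\<integral>\<^sup>+ z. ennreal ((norm (fst z))\<^sup>2) * Q z \<partial>(meas m \<Otimes>\<^sub>M meas n)) <= ennreal (r\<^sup>2 * M + R / r)" .
    have "(\<integral>\<^sup>+ z. ennreal ((norm (snd z))\<^sup>2) * Q z \<partial>(meas m \<Otimes>\<^sub>M meas n))
        = (\<integral>\<^sup>+ y. ennreal ((norm y)\<^sup>2) * (\<integral>\<^sup>+ x. Q (x, y) \<partial>meas m) \<partial>meas n)"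
      by (rule int2) simp_all
    also have "\<dots> = (\<integral>\<^sup>+ y. ennreal (excess b a (idx y)) * ennreal ((norm y)\<^sup>2) \<partial>meas n)"
      by (rule nn_integral_cong_AE, rule AE_mp[OF AEn]) (use tm(5) in \<open>auto simp: Q_def mult.commute[of "excess a b _"] mult.commute[of "ennreal ((norm _)\<^sup>2)"]\<close>)
    also have "\<dots> <= ennreal (r\<^sup>2 * M + R / r)"
      by (rule third_moment_tail) (use R r M' M e0 e1 em in auto)
    finally show "(\<integral>\<^sup>+ z. ennreal ((norm (snd z))\<^sup>2) * Q z \<partial>(meas m \<Otimes>\<^sub>M meas n)) <= ennreal (r\<^sup>2 * M + R / r)" .
  qed auto
  also have "\<dots> = ennreal (c\<^sup>2 + 4 * (r\<^sup>2 * M + R / r))"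
  proof -
    have *: "2 * ennreal q + 2 * ennreal q = ennreal (4 * q)" if "0 <= q" for q
      using that by (simp add: ennreal_mult flip: distrib_right)
    have q: "0 <= r\<^sup>2 * M + R / r" using r M by simp
    show ?thesis unfolding *[OF q] using ennreal_plus[of "c\<^sup>2" "4 * (r\<^sup>2 * M + R / r)"] q by simp
  qed
  finally show ?thesis
    unfolding W2_squared_def using INF_lower[OF gc, of transport_cost] by (rule order_trans[rotated])
qed

lemma small_cells:
  assumes "0 < c"
  shows "\<exists>idx :: 'a::euclidean_space => nat. idx \<in> measurable borel (count_space UNIV) \<and> (\<forall>x y. idx x = idx y --> dist x y <= c)"
proof -
  obtain D :: "'a set" where D: "countable D" "!!X. open X ==> X ~= {} ==> \<exists>d\<in>D. d \<in> X"
    by (erule countable_dense_setE)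
  define d where "d = from_nat_into D"
  define idx where "idx y = (LEAST i. dist y (d i) < c / 2)" for y
  have idx: "dist y (d (idx y)) < c / 2" for y
  proof -
    obtain x where "x \<in> D" "x \<in> ball y (c / 2)" using D(2)[of "ball y (c/2)"] assms by auto
    moreover obtain i where "d i = x" using from_nat_into_surj[OF D(1) \<open>x \<in> D\<close>] unfolding d_def by blast
    ultimately have "dist y (d i) < c / 2" by simp
    then show ?thesis unfolding idx_def by (rule LeastI)
  qed
  have "idx \<in> measurable borel (count_space UNIV)"
    unfolding idx_def by measurable
  moreover have "dist x y <= c" if "idx x = idx y" for x y
    using dist_triangle2[of x y "d (idx x)"] idx[of x] idx[of y] that by simp
  ultimately show ?thesis by blast
qed

text \<open>Setwise convergence controls the cell masses, hence the mass to be moved; the uniform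
  third moment turns a small moved mass into a small quadratic cost.\<close>

lemma P2_tendsto_setwise:
  fixes \<mu> :: "nat => 'a::euclidean_space P2"
  assumes s: "setwise (\<lambda>j. meas (\<mu> j)) (meas \<nu>)"
    and R: "!!j. (\<integral>\<^sup>+ x. ennreal (norm x ^ 3) \<partial>meas (\<mu> j)) <= ennreal R" "(\<integral>\<^sup>+ x. ennreal (norm x ^ 3) \<partial>meas \<nu>) <= ennreal R"
  shows "\<mu> \<longlonglongrightarrow> \<nu>"
proof (rule metric_LIMSEQ_I)
  fix e :: real assume e: "0 < e"
  define c where "c = e / 2"
  have c: "0 < c" using e by (simp add: c_def)
  obtain idx :: "'a => nat" where idx: "idx \<in> measurable borel (count_space UNIV)" "!!x y. idx x = idx y ==> dist x y <= c"
    using small_cells[OF c] by blast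
  define R' where "R' = max R 1"
  have R': "0 < R'" "R <= R'" by (auto simp: R'_def)
  \<comment> \<open>Then \<open>4R'/r = e\<^sup>2/8\<close> and
    \<open>c\<^sup>2 = e\<^sup>2/4\<close>, so the cost is below \<open>e\<^sup>2\<close> as soon as
    the term with \<open>M j\<close> is small.\<close>
  define r where "r = 8 * R' * 4 / e\<^sup>2"
  have r: "0 < r" using R' e by (simp add: r_def)
  have S: "idx -` {l} \<in> sets borel" for l
    using measurable_sets[OF idx(1), of "{l}"] by simp
  define a where "a j i = measure (meas (\<mu> j)) (idx -` {i})" for j i
  define b where "b i = measure (meas \<nu>) (idx -` {i})" for i
  have ab0: "0 <= a j i" "0 <= b i" for i j by (simp_all add: a_def b_def)
  have e01: "0 <= excess b (a j) i" "excess b (a j) i <= 1" for i j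
    using ab0(1)[of j i] ab0(2)[of i] by (auto simp: excess_def divide_le_eq)
  interpret \<nu>: prob_space "meas \<nu>" by simp
  \<comment> \<open>The moved mass is written as an integral against the fixed \<open>\<nu>\<close>,
    so that dominated convergence applies; \<open>excess_mass\<close> identifies it with the excess
    integrated against \<open>\<mu> j\<close>.\<close>
  define M where "M j = (LINT y|meas \<nu>. excess b (a j) (idx y))" for j
  have em: "(\<lambda>y. excess b (a j) (idx y)) \<in> borel_measurable borel" for j
    by (rule measurable_cells[OF idx(1)])
  have Mn: "(\<integral>\<^sup>+ y. ennreal (excess b (a j) (idx y)) \<partial>meas \<nu>) = ennreal (M j)" for j
    unfolding M_def by (rule nn_integral_eq_integral) (use em e01 in \<open>auto intro!: \<nu>.integrable_const_bound[where B = 1]\<close>)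
  have M0: "0 <= M j" for j unfolding M_def using e01 by simp
  have "M \<longlonglongrightarrow> (LINT y|meas \<nu>. 0)"
    unfolding M_def
  proof (rule integral_dominated_convergence[where w = "\<lambda>_. 1"])
    have "(\<lambda>j. excess b (a j) i) \<longlonglongrightarrow> 0" for i
    proof -
      have "(\<lambda>j. a j i) \<longlonglongrightarrow> b i" using s S unfolding setwise_def a_def b_def by blast
      then have "(\<lambda>j. max 0 (b i - a j i) / b i) \<longlonglongrightarrow> max 0 (b i - b i) / b i"
        unfolding divide_inverse by (intro tendsto_intros)
      then show ?thesis by (simp add: excess_def)
    qed
    then show "AE y in meas \<nu>. (\<lambda>j. excess b (a j) (idx y)) \<longlonglongrightarrow> 0" by simp
  qed (use em e01 in auto)
  then have "M \<longlonglongrightarrow> 0" by simp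
  then have "(\<lambda>j. c\<^sup>2 + 4 * (r\<^sup>2 * M j + R' / r)) \<longlonglongrightarrow> c\<^sup>2 + 4 * (r\<^sup>2 * 0 + R' / r)"
    by (intro tendsto_intros)
  moreover have "c\<^sup>2 + 4 * (r\<^sup>2 * 0 + R' / r) < e\<^sup>2"
  proof -
    have "4 * (R' / r) = e\<^sup>2 / 8" using R' e by (simp add: r_def)
    moreover have "c\<^sup>2 = e\<^sup>2 / 4" by (simp add: c_def power_divide)
    moreover have "0 < e\<^sup>2" using e by simp
    ultimately show ?thesis unfolding mult_zero_right add_0 by linarith
  qed
  ultimately have "\<forall>\<^sub>F j in sequentially. c\<^sup>2 + 4 * (r\<^sup>2 * M j + R' / r) < e\<^sup>2"
    by (rule order_tendstoD)
  then have "\<forall>\<^sub>F j in sequentially. dist (\<mu> j) \<nu> < e"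
  proof eventually_elim
    case (elim j)
    have RR: "(\<integral>\<^sup>+ x. ennreal (norm x ^ 3) \<partial>meas (\<mu> j)) <= ennreal R'" "(\<integral>\<^sup>+ x. ennreal (norm x ^ 3) \<partial>meas \<nu>) <= ennreal R'"
      using R[THEN order_trans, OF ennreal_leI[OF R'(2)]] by auto
    have "W2_squared (meas \<nu>) (meas (\<mu> j)) <= ennreal (c\<^sup>2 + 4 * (r\<^sup>2 * M j + R' / r))"
    proof (rule W2_squared_cells[OF idx(1) idx(2), where a = b and b = "a j"])
      show "(\<integral>\<^sup>+ y. ennreal (excess (a j) b (idx y)) \<partial>meas (\<mu> j)) = ennreal (M j)"
        using excess_mass[OF idx(1), where a = b and m = \<nu> and b = "a j" and n = "\<mu> j"] Mn[of j] by (simp add: a_def b_def)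
    qed (use c RR r R' M0 in \<open>auto simp: a_def b_def\<close>)
    then have "enn2real (W2_squared (meas \<nu>) (meas (\<mu> j))) <= c\<^sup>2 + 4 * (r\<^sup>2 * M j + R' / r)"
      using M0 r R' by (intro enn2real_leI) auto
    also have "\<dots> < e\<^sup>2" by (rule elim)
    finally have "sqrt (enn2real (W2_squared (meas \<nu>) (meas (\<mu> j)))) < e"
      using e by (simp add: real_less_lsqrt)
    then show ?case by (simp add: dist_P2_def W2_def W2_squared_commute)
  qed
  then show "\<exists>no. \<forall>n\<ge>no. dist (\<mu> n) \<nu> < e" by (simp add: eventually_sequentially)
qed

section \<open>Entropy\<close>

definition wt :: "'a::euclidean_space \<times> 'a => real" where
  "wt z = norm (fst z) ^ 3 + norm (snd z) ^ 3"

definition w3 :: "('a::euclidean_space \<times> 'a) P2 => real" where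
  "w3 m = (LINT z|meas m. wt z)"

definition ent :: "'b::euclidean_space P2 => real" where
  "ent m = (LINT z|meas m. ln (leb_density (meas m) z))"

text \<open>Precisely the measures on which the functional is finite, for positive
  \<open>alpha\<close> and \<kappa>; see \<open>objective_good\<close> and
  \<open>objective_not_good\<close>.\<close>

definition good :: "('a::euclidean_space \<times> 'a) P2 => bool" where
  "good m \<longleftrightarrow> integrable (meas m) wt \<and> has_leb_density (meas m) \<and>
     integrable (meas m) (\<lambda>z. ln (leb_density (meas m) z))"

text \<open>The relative entropy with respect to the finite measure of density \<open>exp (f - \<beta> wt)\<close>.\<close>

definition kl :: "real => ('a::euclidean_space \<times> 'a => real) => ('a \<times> 'a) P2 => real" where
  "kl \<beta> f m = ent m - (LINT z|meas m. f z) + \<beta> * w3 m - 1 + (LINT z|lborel. exp (f z - \<beta> * wt z))"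

lemma wt_nonneg [simp]: "0 <= wt z" by (simp add: wt_def)

lemma continuous_wt [continuous_intros]: "continuous_on S wt"
  unfolding wt_def by (intro continuous_intros)

lemma wt_measurable [measurable]: "wt \<in> borel_measurable borel"
  by (intro borel_measurable_continuous_onI continuous_intros)

lemma norm_cubed_le_wt: "norm z ^ 3 <= 4 * wt z"
proof -
  define a b where "a = norm (fst z)" and "b = norm (snd z)"
  have ab: "0 <= a" "0 <= b" by (simp_all add: a_def b_def)
  have "norm z ^ 3 <= (a + b) ^ 3"
    using norm_Pair_le[of "fst z" "snd z"] by (intro power_mono) (simp_all add: a_def b_def)
  also have "\<dots> <= 4 * (a ^ 3 + b ^ 3)"
  proof -
    have "4 * (a ^ 3 + b ^ 3) - (a + b) ^ 3 = 3 * (a + b) * (a - b)\<^sup>2"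
      by (simp add: power2_eq_square power3_eq_cube algebra_simps)
    also have "\<dots> >= 0" using ab by simp
    finally show ?thesis by simp
  qed
  finally show ?thesis by (simp add: wt_def a_def b_def)
qed

text \<open>The weight is at least \<open>|z|\<^sup>3 / 4\<close>, hence at least \<open>n/4\<close>
  where \<open>n <= |z| < n + 1\<close>. Covering by balls of radius \<open>n + 1\<close> compares
  the integral with a series of decaying exponentials times volumes of polynomial growth.\<close>

lemma integrable_exp_wt:
  assumes "0 < \<beta>"
  shows "integrable lborel (\<lambda>z::'a::euclidean_space \<times> 'a. exp (- \<beta> * wt z))"
proof (rule integrableI_bounded)
  define c where "c = \<beta> / 4"
  have c: "0 < c" using assms by (simp add: c_def)
  define D where "D = DIM('a \<times> 'a)"
  define V where "V = unit_ball_vol (real D)"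
  have V: "0 <= V" by (simp add: V_def)
  define a where "a n = exp (- c * real n) * (V * real (Suc n) ^ D)" for n
  have "(\<integral>\<^sup>+ z. ennreal (norm (exp (- \<beta> * wt z))) \<partial>(lborel :: ('a \<times> 'a) measure)) \<le>
      (\<integral>\<^sup>+ z. (\<Sum>n. ennreal (exp (- c * real n)) * indicator (ball (0::'a \<times> 'a) (real (Suc n))) z) \<partial>lborel)"
  proof (rule nn_integral_mono)
    fix z :: "'a \<times> 'a"
    define n where "n = nat \<lfloor>norm z\<rfloor>"
    have n: "real n <= norm z" "norm z < real (Suc n)"
      using floor_correct[of "norm z"] unfolding n_def by (simp_all add: add.commute)
    have "c * real n <= \<beta> * wt z"
    proof -
      have "real n <= norm z ^ 3"
      proof (cases "n = 0")
        case False
        then have "1 <= norm z" using n(1) by linarith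
        then have "norm z ^ 1 <= norm z ^ 3" by (intro power_increasing) auto
        then show ?thesis using n(1) by simp
      qed simp
      then have "real n <= 4 * wt z" using norm_cubed_le_wt[of z] by linarith
      then have "c * real n <= c * (4 * wt z)" using c by (intro mult_left_mono) auto
      then show ?thesis by (simp add: c_def)
    qed
    then have "ennreal (norm (exp (- \<beta> * wt z))) <= ennreal (exp (- c * real n)) * indicator (ball (0::'a \<times> 'a) (real (Suc n))) z"
      using n(2) by (simp add: indicator_def ennreal_leI del: of_nat_Suc)
    also have "\<dots> <= (\<Sum>n. ennreal (exp (- c * real n)) * indicator (ball (0::'a \<times> 'a) (real (Suc n))) z)"
    proof -
      define F where "F n = ennreal (exp (- c * real n)) * indicator (ball (0::'a \<times> 'a) (real (Suc n))) z" for n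
      have "F n <= (\<Sum>n. F n)" using sum_le_suminf[of F "{n}"] by simp
      then show ?thesis by (simp only: F_def)
    qed
    finally show "ennreal (norm (exp (- \<beta> * wt z))) <= (\<Sum>n. ennreal (exp (- c * real n)) * indicator (ball (0::'a \<times> 'a) (real (Suc n))) z)" .
  qed
  also have "\<dots> = (\<Sum>n. \<integral>\<^sup>+ z. ennreal (exp (- c * real n)) * indicator (ball (0::'a \<times> 'a) (real (Suc n))) z \<partial>lborel)"
    by (rule nn_integral_suminf)
      (intro borel_measurable_times_ennreal borel_measurable_const borel_measurable_indicator, simp)
  also have "\<dots> = (\<Sum>n. ennreal (a n))"
  proof (rule suminf_cong)
    fix n
    have "(\<integral>\<^sup>+ z. ennreal (exp (- c * real n)) * indicator (ball (0::'a \<times> 'a) (real (Suc n))) z \<partial>lborel)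
        = ennreal (exp (- c * real n)) * emeasure lborel (ball (0::'a \<times> 'a) (real (Suc n)))"
      by (rule nn_integral_cmult_indicator) simp
    also have "emeasure lborel (ball (0::'a \<times> 'a) (real (Suc n))) = ennreal (V * real (Suc n) ^ D)"
      unfolding V_def D_def by (rule emeasure_ball) simp
    finally show "(\<integral>\<^sup>+ z. ennreal (exp (- c * real n)) * indicator (ball (0::'a \<times> 'a) (real (Suc n))) z \<partial>lborel) = ennreal (a n)"
      using V by (simp add: a_def ennreal_mult)
  qed
  also have "\<dots> < \<infinity>"
  proof -
    have "summable a"
    proof -
      have lim: "filterlim (\<lambda>n. c * real (Suc n)) at_top sequentially"
        by (rule filterlim_tendsto_pos_mult_at_top[OF tendsto_const c])
          (rule filterlim_compose[OF filterlim_real_sequentially filterlim_Suc])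
      \<comment> \<open>The exponent \<open>D + 2\<close> leaves the summable
        \<open>1/s\<^sup>2\<close> after the volume factor \<open>s ^ D\<close> is absorbed.\<close>
      have "(\<lambda>n. (c * real (Suc n)) ^ (D + 2) / exp (c * real (Suc n))) \<longlonglongrightarrow> 0"
        by (rule filterlim_compose[OF tendsto_power_div_exp_0 lim])
      then have "Bseq (\<lambda>n. (c * real (Suc n)) ^ (D + 2) / exp (c * real (Suc n)))"
        by (intro convergent_imp_Bseq convergentI)
      then obtain K where K: "!!n. norm ((c * real (Suc n)) ^ (D + 2) / exp (c * real (Suc n))) <= K"
        by (auto simp: Bseq_def)
      define K' where "K' = V * exp c * K / c ^ (D + 2)"
      have le: "norm (a n) <= K' * inverse (real (Suc n) ^ 2)" for n
      proof -
        define s where "s = real (Suc n)"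
        have s: "0 < s" by (simp add: s_def)
        have "(c * s) ^ (D + 2) / exp (c * s) <= K" using K[of n] unfolding s_def[symmetric] using c s by simp
        then have "(c * s) ^ (D + 2) * exp (- (c * s)) <= K" by (simp add: exp_minus divide_inverse)
        then have "s ^ D * s ^ 2 * exp (- (c * s)) <= K / c ^ (D + 2)"
        proof -
          have "(c * s) ^ (D + 2) * exp (- (c * s)) = (s ^ D * s ^ 2 * exp (- (c * s))) * c ^ (D + 2)"
            by (simp add: power_mult_distrib power_add power2_eq_square algebra_simps)
          moreover have "0 < c ^ (D + 2)" using c by simp
          ultimately show ?thesis
            using \<open>(c * s) ^ (D + 2) * exp (- (c * s)) <= K\<close> by (simp only: pos_le_divide_eq)
        qed
        then have "(s ^ D * s ^ 2 * exp (- (c * s))) * inverse (s ^ 2) <= K / c ^ (D + 2) * inverse (s ^ 2)"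
          by (rule mult_right_mono) simp
        moreover have "(s ^ D * s ^ 2 * exp (- (c * s))) * inverse (s ^ 2) = s ^ D * exp (- (c * s))"
          using s by simp
        ultimately have "V * exp c * (s ^ D * exp (- (c * s))) <= V * exp c * (K / c ^ (D + 2) * inverse (s ^ 2))"
          using V by (intro mult_left_mono) auto
        moreover have "exp (- c * real n) = exp c * exp (- (c * s))"
          by (simp add: s_def algebra_simps flip: exp_add)
        then have "a n = V * exp c * (s ^ D * exp (- (c * s)))"
          unfolding a_def s_def[symmetric] by (simp only: ac_simps)
        ultimately have "a n <= V * exp c * (K / c ^ (D + 2) * inverse (s ^ 2))" by simp
        moreover have "V * exp c * (K / c ^ (D + 2) * inverse (s ^ 2)) = K' * inverse (real (Suc n) ^ 2)"
          by (simp add: K'_def s_def)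
        moreover have "0 <= a n" using V by (simp add: a_def)
        ultimately show ?thesis unfolding real_norm_def by linarith
      qed
      have "summable (\<lambda>n. K' * inverse (real (Suc n) ^ 2))"
        using inverse_power_summable[of 2, where 'a = real] summable_Suc_iff[of "\<lambda>n. inverse (real n ^ 2)"]
        by (intro summable_mult) simp
      then show ?thesis by (rule summable_comparison_test'[where N = 0]) (rule le)
    qed
    then have "a sums suminf a" by (rule summable_sums)
    moreover have "0 <= a n" for n using V by (simp add: a_def)
    ultimately have "(\<Sum>n. ennreal (a n)) = ennreal (suminf a)" by (intro suminf_ennreal_eq)
    then show ?thesis by simp
  qed
  finally show "(\<integral>\<^sup>+ z. ennreal (norm (exp (- \<beta> * wt z))) \<partial>(lborel :: ('a \<times> 'a) measure)) < \<infinity>" .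
qed (use wt_measurable in measurable)

lemma integrable_exp_bounded_wt:
  assumes "0 < \<beta>" "f \<in> borel_measurable borel" "!!z. f z <= B"
  shows "integrable lborel (\<lambda>z::'a::euclidean_space \<times> 'a. exp (f z - \<beta> * wt z))"
proof (rule Bochner_Integration.integrable_bound)
  show "integrable lborel (\<lambda>z::'a \<times> 'a. exp B * exp (- \<beta> * wt z))"
    using integrable_exp_wt[OF assms(1)] by simp
  show "AE z in lborel. norm (exp (f z - \<beta> * wt z)) <= norm (exp B * exp (- \<beta> * wt z))"
    using assms(3) by (simp add: exp_diff exp_minus divide_inverse mult_right_mono)
qed (use assms(2) in measurable)

text \<open>The Radon-Nikodym derivative is infinite only on a Lebesgue-null set because the mass is
  finite, so its real-valued version represents the same measure.\<close>

lemma leb_density_props: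
  assumes "has_leb_density m" "finb m"
  shows "leb_density m \<in> borel_measurable borel" "0 <= leb_density m z"
    "density lborel (\<lambda>z. ennreal (leb_density m z)) = m"
    "integrable lborel (leb_density m)"
proof -
  obtain f where f: "f \<in> borel_measurable lborel" "density lborel f = m"
    using assms(1) unfolding has_leb_density_def by blast
  have d: "density lborel (RN_deriv lborel m) = m" by (rule RN_derivI[OF f])
  have rm: "RN_deriv lborel m \<in> borel_measurable borel"
    using borel_measurable_RN_deriv[of lborel m] by simp
  show m: "leb_density m \<in> borel_measurable borel"
    unfolding leb_density_def using rm by measurable
  show "0 <= leb_density m z" by (simp add: leb_density_def)
  have "emeasure m UNIV = (\<integral>\<^sup>+ z. RN_deriv lborel m z \<partial>lborel)"
    using rm by (subst d[symmetric]) (simp add: emeasure_density)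
  then have fin: "(\<integral>\<^sup>+ z. RN_deriv lborel m z \<partial>lborel) ~= \<infinity>"
    using finite_measure.emeasure_finite[OF finbD(1)[OF assms(2)], of UNIV] by simp
  then have "AE z in lborel. RN_deriv lborel m z ~= \<infinity>"
    using rm by (intro nn_integral_noteq_infinite) auto
  then have ae: "AE z in lborel. ennreal (leb_density m z) = RN_deriv lborel m z"
    by (rule AE_mp) (auto simp: leb_density_def less_top)
  then have "density lborel (\<lambda>z. ennreal (leb_density m z)) = density lborel (RN_deriv lborel m)"
    using m rm by (intro density_cong) auto
  then show "density lborel (\<lambda>z. ennreal (leb_density m z)) = m" using d by simp
  have "(\<integral>\<^sup>+ z. ennreal (leb_density m z) \<partial>lborel) = (\<integral>\<^sup>+ z. RN_deriv lborel m z \<partial>lborel)"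
    by (rule nn_integral_cong_AE[OF ae])
  then show "integrable lborel (leb_density m)"
    using fin m by (intro integrableI_nonneg) (auto simp: leb_density_def less_top)
qed

lemma leb_density_integral:
  fixes f :: "'b::euclidean_space => 'c::{banach, second_countable_topology}"
  assumes "has_leb_density m" "finb m" "f \<in> borel_measurable borel"
  shows "integrable m f \<longleftrightarrow> integrable lborel (\<lambda>z. leb_density m z *\<^sub>R f z)"
    "(LINT z|m. f z) = (LINT z|lborel. leb_density m z *\<^sub>R f z)"
proof -
  note P = leb_density_props[OF assms(1,2)]
  have d: "m = density lborel (\<lambda>z. ennreal (leb_density m z))" by (rule P(3)[symmetric])
  show "integrable m f \<longleftrightarrow> integrable lborel (\<lambda>z. leb_density m z *\<^sub>R f z)"
    by (subst d, rule integrable_density) (use P assms(3) in auto)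
  show "(LINT z|m. f z) = (LINT z|lborel. leb_density m z *\<^sub>R f z)"
    by (subst d, rule integral_density) (use P assms(3) in auto)
qed

lemma leb_density_prob:
  fixes m :: "'b::euclidean_space P2"
  assumes "has_leb_density (meas m)"
  shows "(LINT z|lborel. leb_density (meas m) z) = 1"
proof -
  interpret prob_space "meas m" by simp
  show ?thesis
    using leb_density_integral(2)[OF assms finb_meas, of "\<lambda>_. 1 :: real"] prob_space by simp
qed

lemma AE_leb_density_pos:
  assumes "has_leb_density m" "finb m"
  shows "AE z in m. 0 < leb_density m z"
proof -
  note P = leb_density_props[OF assms]
  have "AE z in density lborel (\<lambda>z. ennreal (leb_density m z)). 0 < leb_density m z"
    using P(1) by (subst AE_density) auto
  then show ?thesis by (simp only: P(3))
qed

text \<open>Gibbs' inequality for a reference measure of arbitrary mass: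
  \<open>ln x <= x - 1\<close> at \<open>x = exp (f - \<beta> wt) / p\<close>, multiplied by
  \<open>p\<close> and integrated. The summand \<open>- 1\<close> and the reference mass in
  \<open>kl\<close> come from this form.\<close>

lemma kl_nonneg:
  fixes m :: "('a::euclidean_space \<times> 'a) P2"
  assumes g: "good m" and b: "0 < \<beta>" and f: "f \<in> borel_measurable borel" "!!z. \<bar>f z\<bar> <= B"
  shows "0 <= kl \<beta> f m"
proof -
  define p where "p = leb_density (meas m)"
  have gd: "has_leb_density (meas m)" "integrable (meas m) wt" "integrable (meas m) (\<lambda>z. ln (p z))"
    using g by (auto simp: good_def p_def)
  note P = leb_density_props[OF gd(1) finb_meas, folded p_def]
  note I = leb_density_integral[OF gd(1) finb_meas, folded p_def, where 'c = real, simplified]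
  have fi: "integrable (meas m) f" by (rule finb_integrable_bounded[OF finb_meas f(1)]) (use f in auto)
  note [measurable] = P(1) f(1)
  have im: "integrable lborel (\<lambda>z. p z * f z)" "integrable lborel (\<lambda>z. p z * wt z)" "integrable lborel (\<lambda>z. p z * ln (p z))"
    using I(1)[of f] I(1)[of wt] I(1)[of "\<lambda>z. ln (p z)"] fi gd f by auto
  have ei: "integrable lborel (\<lambda>z. exp (f z - \<beta> * wt z))"
    by (rule integrable_exp_bounded_wt[OF b f(1), where B = B]) (use f(2) in \<open>auto simp: abs_le_iff\<close>)
  have "(LINT z|lborel. p z * f z - \<beta> * (p z * wt z) - p z * ln (p z)) <= (LINT z|lborel. exp (f z - \<beta> * wt z) - p z)"
  proof (rule integral_mono)
    fix z
    show "p z * f z - \<beta> * (p z * wt z) - p z * ln (p z) <= exp (f z - \<beta> * wt z) - p z"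
    proof (cases "p z = 0")
      case False
      then have p: "0 < p z" using P(2)[of z] by simp
      define u where "u = f z - \<beta> * wt z"
      have "ln (exp u / p z) <= exp u / p z - 1" using p by (intro ln_le_minus_one) auto
      then have "p z * (u - ln (p z)) <= p z * (exp u / p z - 1)" using p by (intro mult_left_mono) (auto simp: ln_div)
      then show ?thesis using p by (simp add: u_def algebra_simps)
    qed simp
  qed (use im ei P in auto)
  then show ?thesis
    using im ei P(4) I(2)[of f] I(2)[of wt] I(2)[of "\<lambda>z. ln (p z)"] f leb_density_prob[OF gd(1), folded p_def]
    by (simp add: kl_def ent_def w3_def p_def[symmetric])
qed

text \<open>Nonnegativity of the relative entropy for the exponent
  \<open>f + s * indicator A\<close>, expanded around \<open>f\<close>: the duality between relative
  entropy and exponential moments, specialised to an indicator.\<close>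

lemma kl_perturb:
  fixes m :: "('a::euclidean_space \<times> 'a) P2"
  assumes g: "good m" and b: "0 < \<beta>" and f: "f \<in> borel_measurable borel" "!!z. \<bar>f z\<bar> <= B" and A: "A \<in> sets borel"
  shows "s * measure (meas m) A <= kl \<beta> f m + (exp s - 1) * (LINT z|lborel. indicator A z * exp (f z - \<beta> * wt z))"
proof -
  define h where "h z = f z + s * indicat_real A z" for z
  have "h \<in> borel_measurable borel" unfolding h_def using f(1) A by measurable
  moreover have "\<bar>h z\<bar> <= B + \<bar>s\<bar>" for z
    using f(2)[of z] by (auto simp: h_def indicator_def)
  ultimately have h: "h \<in> borel_measurable borel" "!!z. \<bar>h z\<bar> <= B + \<bar>s\<bar>" by auto
  have ei: "integrable lborel (\<lambda>z. exp (f z - \<beta> * wt z))"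
    by (rule integrable_exp_bounded_wt[OF b f(1), where B = B]) (use f(2) in \<open>auto simp: abs_le_iff\<close>)
  have "(\<lambda>z. exp (h z - \<beta> * wt z)) = (\<lambda>z. exp (f z - \<beta> * wt z) + (exp s - 1) * (indicator A z * exp (f z - \<beta> * wt z)))"
    by (auto simp: h_def indicator_def exp_add exp_diff field_simps)
  moreover have ii: "integrable lborel (\<lambda>z. indicator A z * exp (f z - \<beta> * wt z))"
    using integrable_real_mult_indicator[of A lborel, OF _ ei] A by (simp add: mult.commute)
  ultimately have e: "(LINT z|lborel. exp (h z - \<beta> * wt z)) =
      (LINT z|lborel. exp (f z - \<beta> * wt z)) + (exp s - 1) * (LINT z|lborel. indicator A z * exp (f z - \<beta> * wt z))"
    using ei by simp
  interpret prob_space "meas m" by simp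
  have fi: "integrable (meas m) f" by (rule finb_integrable_bounded[OF finb_meas f(1)]) (use f in auto)
  have "(LINT z|meas m. h z) = (LINT z|meas m. f z) + s * measure (meas m) A"
    unfolding h_def using fi A by (simp add: emeasure_eq_measure)
  then show ?thesis
    using kl_nonneg[OF g b h] e unfolding kl_def by linarith
qed

text \<open>The two bounds of \<open>kl_perturb\<close>, with \<open>s\<close> and \<open>-s\<close>, eliminate the reference measure.\<close>

lemma kl_compare:
  fixes m n :: "('a::euclidean_space \<times> 'a) P2"
  assumes g: "good m" "good n" and b: "0 < \<beta>" and f: "f \<in> borel_measurable borel" "!!z. \<bar>f z\<bar> <= B"
    and A: "A \<in> sets borel" and s: "0 < s"
  shows "measure (meas m) A <= measure (meas n) A + (exp s - 1) + (kl \<beta> f m + exp s * kl \<beta> f n) / s"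
proof -
  interpret n: prob_space "meas n" by simp
  define \<rho> where "\<rho> = (LINT z|lborel. indicator A z * exp (f z - \<beta> * wt z))"
  have 1: "s * measure (meas m) A <= kl \<beta> f m + (exp s - 1) * \<rho>"
    using kl_perturb[OF g(1) b f A, of s] by (simp add: \<rho>_def)
  have 2: "(1 - exp (- s)) * \<rho> <= kl \<beta> f n + s * measure (meas n) A"
    using kl_perturb[OF g(2) b f A, of "- s"] by (simp add: \<rho>_def algebra_simps)
  have "(exp s - 1) * \<rho> = exp s * ((1 - exp (- s)) * \<rho>)" by (simp add: exp_minus field_simps)
  also have "\<dots> <= exp s * (kl \<beta> f n + s * measure (meas n) A)" using 2 by (intro mult_left_mono) auto
  finally have "s * measure (meas m) A <= kl \<beta> f m + exp s * (kl \<beta> f n + s * measure (meas n) A)" using 1 by simp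
  then have "measure (meas m) A <= (kl \<beta> f m + exp s * (kl \<beta> f n + s * measure (meas n) A)) / s"
    using s by (simp add: pos_le_divide_eq mult.commute)
  also have "\<dots> = exp s * measure (meas n) A + (kl \<beta> f m + exp s * kl \<beta> f n) / s"
    using s by (simp add: field_simps)
  also have "exp s * measure (meas n) A <= measure (meas n) A + (exp s - 1)"
  proof -
    have "(exp s - 1) * measure (meas n) A <= (exp s - 1) * 1" using s by (intro mult_left_mono) auto
    then show ?thesis by (simp add: algebra_simps)
  qed
  finally show ?thesis by simp
qed

text \<open>Both measures have vanishing relative entropy with respect to the same moving reference,
  and the bound of \<open>kl_compare\<close> no longer contains that reference, so the bounds
  \<open>B k\<close> may diverge. The complement of \<open>A\<close> supplies the opposite
  inequality.\<close>

lemma kl_setwise: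
  fixes m :: "nat => ('a::euclidean_space \<times> 'a) P2"
  assumes g: "!!k. good (m k)" "good n" and b: "0 < \<beta>"
    and f: "!!k. f k \<in> borel_measurable borel" "!!k z. \<bar>f k z\<bar> <= B k"
    and k1: "(\<lambda>k. kl \<beta> (f k) (m k)) \<longlonglongrightarrow> 0" and k2: "(\<lambda>k. kl \<beta> (f k) n) \<longlonglongrightarrow> 0"
  shows "setwise (\<lambda>k. meas (m k)) (meas n)"
  unfolding setwise_def
proof (intro ballI LIMSEQ_I)
  fix A :: "('a \<times> 'a) set" and e :: real assume A: "A \<in> sets borel" and e: "0 < e"
  interpret n: prob_space "meas n" by simp
  \<comment> \<open>For this \<open>s\<close> the error \<open>exp s - 1\<close> of the comparison
    is \<open>e/2\<close>; it is fixed before \<open>k\<close> tends to infinity.\<close>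
  define s where "s = ln (1 + e / 2)"
  have s: "0 < s" "exp s - 1 = e / 2" using e by (simp_all add: s_def)
  define q where "q k = (kl \<beta> (f k) (m k) + exp s * kl \<beta> (f k) n) / s" for k
  have "q \<longlonglongrightarrow> (0 + exp s * 0) / s" unfolding q_def using s by (intro tendsto_intros k1 k2) auto
  then have "\<forall>\<^sub>F k in sequentially. q k < e / 2" using e by (intro order_tendstoD(2)[of q]) auto
  then have "\<forall>\<^sub>F k in sequentially. norm (measure (meas (m k)) A - measure (meas n) A) < e"
  proof eventually_elim
    case (elim k)
    interpret m: prob_space "meas (m k)" by simp
    have 1: "measure (meas (m k)) A <= measure (meas n) A + e / 2 + q k"
      using kl_compare[OF g b f A s(1), of k k] s(2) by (simp add: q_def)
    have "measure (meas (m k)) (UNIV - A) <= measure (meas n) (UNIV - A) + e / 2 + q k"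
      using kl_compare[OF g b f _ s(1), of "UNIV - A" k k] A s(2) by (simp add: q_def)
    then have "1 - measure (meas (m k)) A <= 1 - measure (meas n) A + e / 2 + q k"
      using m.prob_compl[of A] n.prob_compl[of A] A by simp
    then show ?case using 1 elim unfolding real_norm_def by linarith
  qed
  then show "\<exists>no. \<forall>k\<ge>no. norm (measure (meas (m k)) A - measure (meas n) A) < e"
    by (simp add: eventually_sequentially)
qed

text \<open>By \<open>kl_perturb\<close> with the fixed finite reference \<open>exp (- wt)\<close>,
  the mass of a set is at most a constant plus \<open>exp s\<close> times its reference mass, all
  divided by \<open>s\<close>. After \<open>s\<close> is taken large, the reference mass tends to
  zero by dominated convergence, independently of \<open>j\<close>.\<close>

lemma ucadd_good:
  fixes m :: "nat => ('a::euclidean_space \<times> 'a) P2"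
  assumes g: "!!j. good (m j)" and R: "!!j. w3 (m j) <= R" "!!j. ent (m j) <= R"
  shows "ucadd (\<lambda>j. meas (m j))"
  unfolding ucadd_def
proof (intro allI impI)
  fix A :: "nat => ('a \<times> 'a) set" and e :: real
  assume A: "range A \<subseteq> sets borel \<and> decseq A \<and> (\<Inter>i. A i) = {}" and e: "0 < e"
  have As [measurable]: "A n \<in> sets borel" for n using A by auto
  define r :: "'a \<times> 'a => real" where "r z = exp (- wt z)" for z
  have ri: "integrable lborel r" unfolding r_def using integrable_exp_wt[of 1] by simp
  define K where "K = \<bar>R\<bar> + \<bar>R\<bar> + (LINT z|lborel. r z) + 1"
  have K: "0 < K" by (simp add: K_def r_def add_nonneg_pos)
  define s where "s = 2 * K / e"
  have s: "0 < s" using K e by (simp add: s_def)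
  have "(\<lambda>n. LINT z|lborel. indicator (A n) z * r z) \<longlonglongrightarrow> (LINT z|(lborel :: ('a \<times> 'a) measure). 0)"
  proof (rule integral_dominated_convergence[where w = r])
    have "(\<lambda>n. indicator (A n) z * r z) \<longlonglongrightarrow> 0" for z
    proof -
      obtain N where "z \<notin> A N" using A by blast
      then have "z \<notin> A n" if "n >= N" for n using A that unfolding decseq_def by blast
      then have "\<forall>\<^sub>F n in sequentially. indicator (A n) z * r z = 0"
        by (auto simp: eventually_sequentially intro!: exI[of _ N])
      then show ?thesis by (rule tendsto_eventually)
    qed
    then show "AE z in lborel. (\<lambda>n. indicator (A n) z * r z) \<longlonglongrightarrow> 0" by simp
  qed (use ri in \<open>auto simp: indicator_def r_def\<close>)
  then have "\<forall>\<^sub>F n in sequentially. (LINT z|lborel. indicator (A n) z * r z) < 1 / exp s"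
    by (intro order_tendstoD(2)[where y = 0]) simp_all
  then obtain N where N: "!!n. n >= N ==> (LINT z|lborel. indicator (A n) z * r z) < 1 / exp s"
    by (auto simp: eventually_sequentially)
  show "\<exists>N. \<forall>n\<ge>N. \<forall>j. measure (meas (m j)) (A n) < e"
  proof (intro exI allI impI)
    fix n j assume n: "n >= N"
    define q where "q = (LINT z|lborel. indicator (A n) z * r z)"
    have q: "0 <= q" unfolding q_def r_def by (intro integral_nonneg_AE) auto
    have "s * measure (meas (m j)) (A n) <= kl 1 (\<lambda>_. 0) (m j) + (exp s - 1) * q"
      using kl_perturb[OF g, of 1 "\<lambda>_. 0" 0 "A n" s j] by (simp add: q_def r_def)
    also have "kl 1 (\<lambda>_. 0) (m j) <= K - 2"
      using R[of j] abs_ge_self[of R] by (simp add: kl_def K_def r_def)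
    also have "(exp s - 1) * q <= 1"
    proof -
      have "(exp s - 1) * q <= exp s * q" using q by (intro mult_right_mono) auto
      also have "\<dots> <= exp s * (1 / exp s)" using N[OF n] by (intro mult_left_mono) (auto simp: q_def)
      finally show ?thesis by simp
    qed
    finally have "s * measure (meas (m j)) (A n) <= K" by simp
    then have "measure (meas (m j)) (A n) <= e / 2"
      using K e by (simp add: s_def field_simps)
    then show "measure (meas (m j)) (A n) < e" using e by simp
  qed
qed

section \<open>Truncated logarithms and lower semicontinuity of the entropy\<close>

definition clamp1 :: "real => real => real" where
  "clamp1 M t = max (- M) (min M t)"

lemma clamp1_bound: "0 <= M ==> \<bar>clamp1 M t\<bar> <= M" by (auto simp: clamp1_def)

lemma clamp1_eq: "\<bar>t\<bar> <= M ==> clamp1 M t = t" by (auto simp: clamp1_def)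

lemma clamp1_abs_le: "0 <= M ==> \<bar>clamp1 M t\<bar> <= \<bar>t\<bar>" by (auto simp: clamp1_def)

lemma clamp1_measurable: "f \<in> borel_measurable M' ==> (\<lambda>z. clamp1 M (f z)) \<in> borel_measurable M'"
  unfolding clamp1_def by (intro borel_measurable_max borel_measurable_min borel_measurable_const)

lemma clamp1_tendsto: "(\<lambda>n. clamp1 (real n) t) \<longlonglongrightarrow> t"
proof (rule tendsto_eventually)
  obtain N where N: "\<bar>t\<bar> <= real N" using real_arch_simple by blast
  show "\<forall>\<^sub>F n in sequentially. clamp1 (real n) t = t"
    using eventually_ge_at_top[of N]
  proof eventually_elim
    case (elim n)
    then have "\<bar>t\<bar> <= real n" using N by linarith
    then show ?case by (rule clamp1_eq)
  qed
qed

text \<open>\<open>cut M p w\<close> is \<open>ln p + w\<close> cut off at \<open>\<plusminus>M\<close>; where \<open>p = 0\<close> it is \<open>-M\<close>, the limiting value.\<close>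

definition cut :: "real => real => real => real" where
  "cut M p w = (if 0 < p then clamp1 M (ln p + w) else - M)"

lemma cut_bound: "0 <= M ==> \<bar>cut M p w\<bar> <= M"
  using clamp1_bound[of M] by (auto simp: cut_def)

text \<open>With \<open>p = exp u * exp (- w)\<close> and \<open>s\<close> the clamped
  \<open>u\<close>, the claim reduces to \<open>s * exp s - exp s + 1 >= 0\<close> and
  \<open>s * exp s <= s * exp u\<close>; the latter holds because \<open>s\<close> lies between 0
  and \<open>u\<close>.\<close>

lemma cut_integrand_nonneg:
  assumes "0 <= p" "0 <= M"
  shows "0 <= cut M p w * p - exp (cut M p w) * exp (- w) + exp (- w)"
proof (cases "0 < p")
  case True
  define u where "u = ln p + w"
  define s where "s = clamp1 M u"
  have p: "p = exp u * exp (- w)" using True by (simp add: u_def exp_add exp_minus)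
  have "exp s - 1 <= s * exp s"
  proof -
    have "1 - s <= exp (- s)" using exp_ge_add_one_self[of "- s"] by simp
    then have "exp s * (1 - s) <= exp s * exp (- s)" by (intro mult_left_mono) auto
    then show ?thesis by (simp add: algebra_simps exp_minus)
  qed
  also have "s * exp s <= s * exp u"
  proof (cases "0 <= u")
    case True
    then have "0 <= s" "s <= u" using assms(2) by (auto simp: s_def clamp1_def)
    then show ?thesis by (intro mult_left_mono) auto
  next
    case False
    then have "s <= 0" "u <= s" using assms(2) by (auto simp: s_def clamp1_def)
    then show ?thesis by (intro mult_left_mono_neg) auto
  qed
  finally have "0 <= (s * exp u - exp s + 1) * exp (- w)" by (intro mult_nonneg_nonneg) auto
  moreover have "s * p - exp s * exp (- w) + exp (- w) = (s * exp u - exp s + 1) * exp (- w)"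
    by (subst p) (simp add: algebra_simps)
  moreover have "cut M p w = s" using True by (simp add: cut_def s_def u_def)
  ultimately show ?thesis by simp
next
  case False
  then have "p = 0" using assms by simp
  then show ?thesis using assms(2) by (simp add: cut_def mult_le_cancel_right1 flip: exp_add)
qed

lemma cut_integrand_tendsto:
  assumes "0 <= p"
  shows "(\<lambda>n. cut (real n) p w * p - exp (cut (real n) p w) * exp (- w) + exp (- w))
     \<longlonglongrightarrow> p * (ln p + w) - p + exp (- w)"
proof (cases "0 < p")
  case True
  have "(\<lambda>n. clamp1 (real n) (ln p + w) * p - exp (clamp1 (real n) (ln p + w)) * exp (- w) + exp (- w))
     \<longlonglongrightarrow> (ln p + w) * p - exp (ln p + w) * exp (- w) + exp (- w)"
    by (intro tendsto_intros clamp1_tendsto)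
  moreover have "exp (ln p + w) * exp (- w) = p" using True by (simp add: exp_add exp_minus)
  ultimately show ?thesis using True by (simp add: cut_def mult.commute)
next
  case False
  then have p: "p = 0" using assms by simp
  have "(\<lambda>n. exp (- real n)) \<longlonglongrightarrow> 0"
    by (rule filterlim_compose[OF exp_at_bot]) (simp add: filterlim_uminus_at_bot filterlim_real_sequentially)
  then have "(\<lambda>n. - exp (- real n) * exp (- w) + exp (- w)) \<longlonglongrightarrow> - 0 * exp (- w) + exp (- w)"
    by (intro tendsto_intros)
  then show ?thesis by (simp add: p cut_def)
qed

text \<open>For a fixed bounded measurable \<open>c\<close>, nonnegativity of the relative entropy
  bounds the integral of \<open>c\<close> against \<open>m j\<close> by \<open>L - 1\<close> plus an
  exponential integral, and this linear inequality passes to the setwise limit. Taking for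
  \<open>c\<close> the truncated logarithm of the limit density relative to
  \<open>exp (- \<beta> wt)\<close> and removing the truncation by Fatou recovers the entropy of
  \<open>n\<close>.\<close>

lemma entropy_lsc:
  fixes m :: "nat => ('a::euclidean_space \<times> 'a) P2"
  assumes s: "setwise (\<lambda>j. meas (m j)) (meas n)" and g: "!!j. good (m j)" and b: "0 < \<beta>"
    and R: "!!j. w3 (m j) <= R" and L: "\<forall>\<^sub>F j in sequentially. ent (m j) + \<beta> * w3 (m j) <= L"
  shows "good n" "w3 n <= R" "ent n + \<beta> * w3 n <= L"
proof -
  have fb: "finb (meas (m j))" "finb (meas n)" for j by simp_all
  have gw: "integrable (meas (m j)) wt" for j using g by (simp add: good_def)
  have wi: "integrable (meas n) wt" "(LINT z|meas n. wt z) <= R"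
    by (rule setwise_integral_le[OF s fb, where C = R]; use gw R in \<open>auto simp: w3_def\<close>)+
  then show "w3 n <= R" by (simp add: w3_def)
  have "absolutely_continuous lborel (meas n)"
  proof (unfold absolutely_continuous_def, intro subsetI)
    fix A :: "('a \<times> 'a) set" assume A: "A \<in> null_sets lborel"
    then have Ab: "A \<in> sets borel" by auto
    have "measure (meas (m j)) A = 0" for j
    proof -
      have gd: "has_leb_density (meas (m j))" using g by (simp add: good_def)
      have "emeasure (density lborel (\<lambda>z. ennreal (leb_density (meas (m j)) z))) A = 0"
        using A leb_density_props(1)[OF gd finb_meas] by (subst emeasure_density) (auto intro!: nn_integral_null_set)
      then show ?thesis by (simp add: leb_density_props(3)[OF gd finb_meas] measure_def)
    qed
    moreover have "(\<lambda>j. measure (meas (m j)) A) \<longlonglongrightarrow> measure (meas n) A"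
      using s Ab unfolding setwise_def by blast
    ultimately have "measure (meas n) A = 0" by (simp add: LIMSEQ_const_iff)
    then show "A \<in> null_sets (meas n)"
      using Ab finite_measure.emeasure_eq_measure[OF finbD(1)[OF fb(2)]] by auto
  qed
  then obtain q where "q \<in> borel_measurable lborel" "density lborel q = meas n"
    using sigma_finite_measure.Radon_Nikodym[OF sigma_finite_lborel, of "meas n"] by auto
  then have hd: "has_leb_density (meas n)" unfolding has_leb_density_def by blast
  define p where "p = leb_density (meas n)"
  note P = leb_density_props[OF hd finb_meas, folded p_def]
  note I = leb_density_integral[OF hd finb_meas, folded p_def, where 'c = real, simplified]
  define r :: "'a \<times> 'a => real" where "r z = exp (- (\<beta> * wt z))" for z
  have ri: "integrable lborel r" unfolding r_def using integrable_exp_wt[OF b] by simp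
  note [measurable] = P(1)
  have rm [measurable]: "r \<in> borel_measurable borel" unfolding r_def by measurable
  define c where "c k z = cut (real k) (p z) (\<beta> * wt z)" for k z
  have cm [measurable]: "c k \<in> borel_measurable borel" for k
    unfolding c_def cut_def using clamp1_measurable[of "\<lambda>z. ln (p z) + \<beta> * wt z" borel] by measurable
  have cb: "\<bar>c k z\<bar> <= real k" for k z unfolding c_def by (rule cut_bound) simp
  \<comment> \<open>Completing the integrand by \<open>r\<close> makes it nonnegative, by
    \<open>cut_integrand_nonneg\<close>, as Fatou's lemma requires.\<close>
  define K where "K k z = c k z * p z - exp (c k z) * r z + r z" for k z
  define K' where "K' z = p z * (ln (p z) + \<beta> * wt z) - p z + r z" for z
  have K0: "0 <= K k z" for k z
    unfolding K_def c_def r_def using cut_integrand_nonneg[OF P(2), of "real k" z "\<beta> * wt z"] by simp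
  have Klim: "(\<lambda>k. K k z) \<longlonglongrightarrow> K' z" for z
    unfolding K_def c_def r_def K'_def using cut_integrand_tendsto[OF P(2), of z "\<beta> * wt z"] by simp
  have Ki: "integrable lborel (K k)" "(LINT z|lborel. K k z) <= L - 1 + (LINT z|lborel. r z)" for k
  proof -
    have ci: "integrable (meas n) (c k)" by (rule finb_integrable_bounded[OF fb(2) cm]) (use cb in auto)
    then have i1: "integrable lborel (\<lambda>z. c k z * p z)" using I(1)[OF cm] by (simp add: mult.commute)
    have "integrable lborel (\<lambda>z. exp (c k z - \<beta> * wt z))"
      by (rule integrable_exp_bounded_wt[OF b cm, where B = "real k"]) (use cb in \<open>auto simp: abs_le_iff\<close>)
    then have i2: "integrable lborel (\<lambda>z. exp (c k z) * r z)" by (simp add: r_def exp_diff exp_minus divide_inverse)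
    show "integrable lborel (K k)" unfolding K_def using i1 i2 ri by auto
    have "(LINT z|meas n. c k z) <= L - 1 + (LINT z|lborel. exp (c k z) * r z)"
    proof (rule tendsto_upperbound)
      show "(\<lambda>j. LINT z|meas (m j). c k z) \<longlonglongrightarrow> (LINT z|meas n. c k z)"
        by (rule setwise_integral_bounded[OF s fb cm cb])
      show "\<forall>\<^sub>F j in sequentially. (LINT z|meas (m j). c k z) <= L - 1 + (LINT z|lborel. exp (c k z) * r z)"
        using L
      proof eventually_elim
        case (elim j)
        have "(LINT z|lborel. exp (c k z - \<beta> * wt z)) = (LINT z|lborel. exp (c k z) * r z)"
          by (simp add: r_def exp_diff exp_minus divide_inverse)
        then show ?case using kl_nonneg[OF g[of j] b cm[of k] cb] elim by (simp add: kl_def)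
      qed
    qed simp
    moreover have "(LINT z|lborel. K k z) = (LINT z|lborel. c k z * p z) - (LINT z|lborel. exp (c k z) * r z) + (LINT z|lborel. r z)"
      unfolding K_def using i1 i2 ri by simp
    moreover have "(LINT z|meas n. c k z) = (LINT z|lborel. c k z * p z)" using I(2)[OF cm] by (simp add: mult.commute)
    ultimately show "(LINT z|lborel. K k z) <= L - 1 + (LINT z|lborel. r z)" by simp
  qed
  define Q where "Q = L - 1 + (LINT z|lborel. r z)"
  have Km: "K k \<in> borel_measurable borel" "K' \<in> borel_measurable borel" for k
    unfolding K_def K'_def by measurable
  have Q0: "0 <= Q"
    using order_trans[OF integral_nonneg_AE Ki(2)[of 0]] K0 unfolding Q_def by auto
  have "(\<integral>\<^sup>+ z. ennreal (K' z) \<partial>lborel) = (\<integral>\<^sup>+ z. liminf (\<lambda>k. ennreal (K k z)) \<partial>lborel)"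
    by (intro nn_integral_cong lim_imp_Liminf[symmetric] tendsto_ennrealI Klim) simp
  also have "\<dots> <= liminf (\<lambda>k. \<integral>\<^sup>+ z. ennreal (K k z) \<partial>lborel)"
    by (rule nn_integral_liminf) (use Km in measurable)
  also have "\<dots> <= ennreal Q"
  proof (rule Liminf_le)
    have "(\<integral>\<^sup>+ z. ennreal (K k z) \<partial>lborel) <= ennreal Q" for k
      using nn_integral_eq_integral[OF Ki(1), of k] K0 Ki(2)[of k] by (simp add: Q_def ennreal_leI)
    then show "\<forall>\<^sub>F k in sequentially. (\<integral>\<^sup>+ z. ennreal (K k z) \<partial>lborel) <= ennreal Q" by simp
  qed simp
  finally have nn: "(\<integral>\<^sup>+ z. ennreal (K' z) \<partial>lborel) <= ennreal Q" .
  have K'0: "0 <= K' z" for z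
    by (rule tendsto_lowerbound[OF Klim]) (use K0 in auto)
  have K'i: "integrable lborel K'"
    using Km(2) K'0 nn by (intro integrableI_nonneg) (auto simp: le_less_trans[OF nn])
  have K'le: "(LINT z|lborel. K' z) <= Q"
    using nn_integral_eq_integral[OF K'i] K'0 nn Q0 by simp
  have wp: "integrable lborel (\<lambda>z. p z * wt z)" using wi(1) I(1)[of wt] by simp
  have "integrable lborel (\<lambda>z. K' z - \<beta> * (p z * wt z) + p z - r z)"
    using K'i wp P(4) ri by auto
  also have "(\<lambda>z. K' z - \<beta> * (p z * wt z) + p z - r z) = (\<lambda>z. p z * ln (p z))"
    by (auto simp: K'_def algebra_simps)
  finally have lp: "integrable lborel (\<lambda>z. p z * ln (p z))" .
  have lm: "(\<lambda>z. ln (p z)) \<in> borel_measurable borel" by measurable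
  have li: "integrable (meas n) (\<lambda>z. ln (p z))" using lp I(1)[OF lm] by simp
  then show "good n" unfolding good_def using wi hd by (simp add: p_def)
  have "(LINT z|lborel. K' z) = (LINT z|lborel. p z * ln (p z) + \<beta> * (p z * wt z) - p z + r z)"
    by (simp add: K'_def algebra_simps)
  also have "\<dots> = (LINT z|lborel. p z * ln (p z)) + \<beta> * (LINT z|lborel. p z * wt z) - (LINT z|lborel. p z) + (LINT z|lborel. r z)"
    using lp wp P(4) ri by simp
  also have "\<dots> = ent n + \<beta> * w3 n - 1 + (LINT z|lborel. r z)"
    using I(2)[OF lm] I(2)[of wt] leb_density_prob[OF hd] by (simp add: ent_def w3_def p_def)
  finally show "ent n + \<beta> * w3 n <= L" using K'le by (simp add: Q_def)
qed

lemma norm_sq_le_wt: "(norm z)\<^sup>2 <= 2 + wt z"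
proof -
  have "t\<^sup>2 <= 1 + t ^ 3" if "0 <= t" for t :: real
  proof (cases "t <= 1")
    case True
    then have "t\<^sup>2 <= 1\<^sup>2" using that by (intro power_mono) auto
    then show ?thesis using that by (simp add: add_increasing2)
  next
    case False
    then have "t ^ 2 <= t ^ 3" by (intro power_increasing) auto
    then show ?thesis by simp
  qed
  from this[of "norm (fst z)"] this[of "norm (snd z)"] show ?thesis
    by (simp add: wt_def norm_prod_def)
qed

text \<open>\<open>setwise_compact\<close> yields a finite measure; its mass is one because
  \<open>UNIV\<close> is Borel, and the bound on third moments, which survives by Fatou, puts it
  into \<open>P2\<close>.\<close>

lemma good_compact:
  fixes m :: "nat => ('a::euclidean_space \<times> 'a) P2"
  assumes g: "!!j. good (m j)" and R: "!!j. w3 (m j) <= R" "!!j. ent (m j) <= R"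
  shows "\<exists>r n. strict_mono (r::nat=>nat) \<and> setwise (\<lambda>j. meas (m (r j))) (meas n) \<and> good n \<and> w3 n <= R"
proof -
  have pU: "measure (meas (m j)) UNIV = 1" for j
    using prob_space.prob_space[OF meas_props(1)[of "m j"]] by simp
  obtain r \<nu> where r: "strict_mono (r::nat=>nat)" "finb \<nu>" "setwise (\<lambda>j. meas (m (r j))) \<nu>"
    using setwise_compact[of "\<lambda>j. meas (m j)" 1, OF finb_meas _ ucadd_good[OF g R]] pU by auto
  have "(\<lambda>j. measure (meas (m (r j))) UNIV) \<longlonglongrightarrow> measure \<nu> UNIV"
    using r(3) by (simp add: setwise_def)
  then have \<nu>U: "measure \<nu> UNIV = 1" using pU by (simp add: LIMSEQ_const_iff)
  have ps: "prob_space \<nu>"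
    by (rule prob_spaceI) (use \<nu>U r(2) in \<open>simp add: finbD finite_measure.emeasure_eq_measure\<close>)
  have gw: "integrable (meas (m j)) wt" for j using g by (simp add: good_def)
  have "integrable \<nu> wt"
    by (rule setwise_integral_le[OF r(3) finb_meas r(2), where C = R]; use gw R in \<open>auto simp: w3_def\<close>)
  then have "integrable \<nu> (\<lambda>z. 2 + wt z)"
    by (intro Bochner_Integration.integrable_add finite_measure.integrable_const[OF finbD(1)[OF r(2)]])
  then have "(\<integral>\<^sup>+ z. ennreal (2 + wt z) \<partial>\<nu>) < \<infinity>"
    by (subst nn_integral_eq_integral) auto
  moreover have "abs_moment 2 \<nu> <= (\<integral>\<^sup>+ z. ennreal (2 + wt z) \<partial>\<nu>)"
    unfolding abs_moment_def by (intro nn_integral_mono ennreal_leI norm_sq_le_wt)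
  ultimately have "\<nu> \<in> {\<mu>. prob_space \<mu> \<and> sets \<mu> = sets borel \<and> abs_moment 2 \<mu> < \<infinity>}"
    using ps r(2) by (auto simp: finbD)
  then have eq: "meas (P2_of \<nu>) = \<nu>" by (rule P2_of_inverse)
  have "setwise (\<lambda>j. meas (m (r j))) (meas (P2_of \<nu>))" using r(3) eq by simp
  moreover have "good (P2_of \<nu>)" "w3 (P2_of \<nu>) <= R"
    using entropy_lsc[of "\<lambda>j. m (r j)" "P2_of \<nu>" 1 R "R + R"] calculation g R add_mono[OF R(2) R(1)]
    by auto
  ultimately show ?thesis using r(1) by blast
qed

section \<open>The functional in terms of entropy and third moments\<close>

lemma marg_moment:
  fixes m :: "('a::euclidean_space \<times> 'a) P2"
  shows "abs_moment q (meas (marg1 m)) = (\<integral>\<^sup>+ z. ennreal (norm (fst z) ^ q) \<partial>meas m)"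
    "abs_moment q (meas (marg2 m)) = (\<integral>\<^sup>+ z. ennreal (norm (snd z) ^ q) \<partial>meas m)"
  unfolding abs_moment_def meas_marg1 meas_marg2 by (subst nn_integral_distr; simp)+

lemma moment3_sum:
  fixes m :: "('a::euclidean_space \<times> 'a) P2"
  shows "abs_moment 3 (meas (marg1 m)) + abs_moment 3 (meas (marg2 m)) = (\<integral>\<^sup>+ z. ennreal (wt z) \<partial>meas m)"
  unfolding marg_moment wt_def by (subst nn_integral_add[symmetric]) (simp_all add: ennreal_plus)

text \<open>\<open>ln x <= x - 1\<close> at \<open>x = exp (- wt) / p\<close> bounds
  \<open>- p * ln p\<close> by \<open>p * wt + exp (- wt)\<close>, so a finite third moment excludes
  the indeterminate form \<open>\<infinity> - \<infinity>\<close> in the entropy.\<close>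

lemma entropy_negative_part:
  fixes m :: "('a::euclidean_space \<times> 'a) P2"
  assumes hd: "has_leb_density (meas m)" and wi: "integrable (meas m) wt"
  shows "(\<integral>\<^sup>+ z. ennreal (- ln (leb_density (meas m) z)) \<partial>meas m) < \<infinity>"
proof -
  define p where "p = leb_density (meas m)"
  note P = leb_density_props[OF hd finb_meas, folded p_def]
  note I = leb_density_integral[OF hd finb_meas, folded p_def, where 'c = real, simplified]
  note [measurable] = P(1)
  have wp: "integrable lborel (\<lambda>z. p z * wt z)" using wi I(1)[of wt] by simp
  have ri: "integrable lborel (\<lambda>z::'a \<times> 'a. exp (- wt z))" using integrable_exp_wt[of 1] by simp
  have "(\<integral>\<^sup>+ z. ennreal (- ln (p z)) \<partial>meas m) = (\<integral>\<^sup>+ z. ennreal (p z) * ennreal (- ln (p z)) \<partial>lborel)"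
    by (subst P(3)[symmetric], subst nn_integral_density) auto
  also have "\<dots> <= (\<integral>\<^sup>+ z. ennreal (p z * wt z + exp (- wt z)) \<partial>lborel)"
  proof (rule nn_integral_mono)
    fix z
    have "p z * (- ln (p z)) <= p z * wt z + exp (- wt z)"
    proof (cases "p z = 0")
      case False
      then have p: "0 < p z" using P(2)[of z] by simp
      have "ln (exp (- wt z) / p z) <= exp (- wt z) / p z - 1" using p by (intro ln_le_minus_one) auto
      then have "p z * (- wt z - ln (p z)) <= p z * (exp (- wt z) / p z - 1)" using p by (intro mult_left_mono) (auto simp: ln_div)
      then show ?thesis using p by (simp add: algebra_simps)
    qed simp
    then have "ennreal (p z * (- ln (p z))) <= ennreal (p z * wt z + exp (- wt z))" by (rule ennreal_leI)
    then show "ennreal (p z) * ennreal (- ln (p z)) <= ennreal (p z * wt z + exp (- wt z))"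
      by (simp only: ennreal_mult'[OF P(2)])
  qed
  also have "\<dots> < \<infinity>" using wp ri P(2) by (subst nn_integral_eq_integral) auto
  finally show ?thesis by (simp add: p_def)
qed

lemma boltzmann_entropy_good:
  assumes g: "good m"
  shows "boltzmann_entropy (meas m) = ereal (ent m)"
proof -
  define l where "l z = ln (leb_density (meas m) z)" for z
  have li: "integrable (meas m) l" and hd: "has_leb_density (meas m)"
    using g unfolding good_def l_def by auto
  have f: "(\<integral>\<^sup>+ z. ennreal (l z) \<partial>meas m) < \<infinity>" "(\<integral>\<^sup>+ z. ennreal (- l z) \<partial>meas m) < \<infinity>"
    using li by (auto simp: real_integrable_def less_top)
  obtain a b where ab: "(\<integral>\<^sup>+ z. ennreal (l z) \<partial>meas m) = ennreal a" "(\<integral>\<^sup>+ z. ennreal (- l z) \<partial>meas m) = ennreal b" "0 <= a" "0 <= b"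
    using f by (metis ennreal_cases less_irrefl infinity_ennreal_def)
  have "ent m = a - b"
    unfolding ent_def l_def[symmetric] real_lebesgue_integral_def[OF li] ab using ab(3,4) by simp
  then show ?thesis
    unfolding boltzmann_entropy_def l_def[symmetric] ab using hd ab(3,4) by (simp add: enn2ereal_ennreal)
qed

lemma objective_good:
  fixes m :: "('a::euclidean_space \<times> 'a) P2"
  assumes g: "good m"
  shows "objective W V \<phi> \<kappa> t m = ereal (Zfun W V t m - psi \<phi> t - (LINT z|meas m. fpart \<phi> z)
     + alpha \<phi> * exp (lam \<phi> * t) * w3 m + \<kappa> * ent m)"
    and "test_val \<phi> t m = ereal (psi \<phi> t + (LINT z|meas m. fpart \<phi> z) - alpha \<phi> * exp (lam \<phi> * t) * w3 m)"
proof -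
  have "integrable (meas m) wt" using g by (simp add: good_def)
  then have "(\<integral>\<^sup>+ z. ennreal (wt z) \<partial>meas m) = ennreal (w3 m)"
    unfolding w3_def by (simp add: nn_integral_eq_integral)
  then have "enn2ereal (abs_moment 3 (meas (marg1 m))) + enn2ereal (abs_moment 3 (meas (marg2 m))) = ereal (w3 m)"
    using moment3_sum[of m] by (simp add: enn2ereal_ennreal w3_def flip: plus_ennreal.rep_eq)
  then show tv: "test_val \<phi> t m = ereal (psi \<phi> t + (LINT z|meas m. fpart \<phi> z) - alpha \<phi> * exp (lam \<phi> * t) * w3 m)"
    unfolding test_val_def by simp
  show "objective W V \<phi> \<kappa> t m = ereal (Zfun W V t m - psi \<phi> t - (LINT z|meas m. fpart \<phi> z)
     + alpha \<phi> * exp (lam \<phi> * t) * w3 m + \<kappa> * ent m)"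
    unfolding objective_def tv boltzmann_entropy_good[OF g] by (simp add: algebra_simps)
qed

text \<open>Either the third moment is infinite, so the test function is \<open>-\<infinity>\<close>
  and the resulting \<open>\<infinity>\<close> absorbs the entropy term in \<open>ereal\<close>; or
  it is finite and the entropy is infinite, by definition if there is no density and otherwise
  because its negative part is finite.\<close>

lemma objective_not_good:
  fixes m :: "('a::euclidean_space \<times> 'a) P2"
  assumes g: "\<not> good m" and "0 < \<kappa>" "0 < alpha \<phi>"
  shows "objective W V \<phi> \<kappa> t m = \<infinity>"
proof (cases "integrable (meas m) wt")
  case False
  have "(\<integral>\<^sup>+ z. ennreal (wt z) \<partial>meas m) = \<infinity>"
  proof (rule ccontr)
    assume "(\<integral>\<^sup>+ z. ennreal (wt z) \<partial>meas m) ~= \<infinity>"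
    then have "integrable (meas m) wt" by (intro integrableI_nonneg) (auto simp: less_top)
    then show False using False by simp
  qed
  then have sum: "enn2ereal (abs_moment 3 (meas (marg1 m))) + enn2ereal (abs_moment 3 (meas (marg2 m))) = \<infinity>"
    unfolding plus_ennreal.rep_eq[symmetric] moment3_sum by simp
  show ?thesis
    unfolding objective_def test_val_def sum using assms by simp
next
  case True
  have "boltzmann_entropy (meas m) = \<infinity>"
  proof (cases "has_leb_density (meas m)")
    case hd: True
    define l where "l z = ln (leb_density (meas m) z)" for z
    have lm: "l \<in> borel_measurable borel" unfolding l_def using leb_density_props(1)[OF hd finb_meas] by measurable
    have neg: "(\<integral>\<^sup>+ z. ennreal (- l z) \<partial>meas m) < \<infinity>"
      unfolding l_def by (rule entropy_negative_part[OF hd True])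
    have "\<not> integrable (meas m) l" using g hd True by (simp add: good_def l_def[abs_def])
    then have "(\<integral>\<^sup>+ z. ennreal (l z) \<partial>meas m) = \<infinity>"
      using neg lm by (auto simp: real_integrable_def)
    moreover obtain b where "(\<integral>\<^sup>+ z. ennreal (- l z) \<partial>meas m) = ennreal b" "0 <= b"
      using neg by (metis ennreal_cases less_irrefl infinity_ennreal_def)
    ultimately show ?thesis
      unfolding boltzmann_entropy_def l_def[symmetric] using hd by (simp add: enn2ereal_ennreal)
  qed (simp add: boltzmann_entropy_def)
  moreover have "(\<integral>\<^sup>+ z. ennreal (wt z) \<partial>meas m) = ennreal (w3 m)"
    unfolding w3_def using True by (simp add: nn_integral_eq_integral)
  then have "enn2ereal (abs_moment 3 (meas (marg1 m))) + enn2ereal (abs_moment 3 (meas (marg2 m))) = ereal (w3 m)"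
    using moment3_sum[of m] by (simp add: enn2ereal_ennreal w3_def flip: plus_ennreal.rep_eq)
  ultimately show ?thesis
    unfolding objective_def test_val_def using assms by simp
qed

section \<open>Approximation by smooth functions\<close>

text \<open>A sigmoid whose derivatives are polynomials in itself, which makes them bounded at every
  order; steep sigmoids approximate indicators of half-spaces.\<close>

definition logistic :: "real => real" where
  "logistic s = 1 / (1 + exp (- s))"

lemma logistic_bounds: "0 <= logistic s" "logistic s <= 1"
  by (auto simp: logistic_def add_pos_pos divide_le_eq)

lemma logistic_has_derivative: "(logistic has_real_derivative logistic s * (1 - logistic s)) (at s)"
proof -
  have p: "0 < 1 + exp (- s)" by (simp add: add_pos_pos)
  have "(logistic has_real_derivative exp (- s) / (1 + exp (- s))\<^sup>2) (at s)"
    unfolding logistic_def[abs_def] using p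
    by (auto intro!: derivative_eq_intros simp: power2_eq_square)
  moreover have "exp (- s) / (1 + exp (- s))\<^sup>2 = logistic s * (1 - logistic s)"
    using p unfolding logistic_def by (simp add: field_simps power2_eq_square)
  ultimately show ?thesis by simp
qed

lemma continuous_logistic: "continuous_on S logistic"
  using logistic_has_derivative by (meson DERIV_isCont continuous_at_imp_continuous_on)

lemma logistic_at_top: "(logistic \<longlongrightarrow> 1) at_top"
proof -
  have "((\<lambda>s. 1 / (1 + exp (- s))) \<longlongrightarrow> 1 / (1 + 0 :: real)) at_top"
    by (intro tendsto_intros filterlim_compose[OF exp_at_bot] filterlim_uminus_at_bot_at_top) simp
  then show ?thesis by (simp add: logistic_def[abs_def])
qed

lemma logistic_at_bot: "(logistic \<longlongrightarrow> 0) at_bot"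
proof -
  have e: "logistic (- s) = 1 - logistic s" for s
  proof -
    have "1 + exp s ~= 0" "1 + exp (- s) ~= 0"
      using exp_gt_zero[of s] exp_gt_zero[of "- s"] by linarith+
    then show ?thesis unfolding logistic_def by (simp add: field_simps flip: exp_add)
  qed
  have "((\<lambda>s. 1 - logistic s) \<longlongrightarrow> 1 - 1) at_top" by (intro tendsto_intros logistic_at_top)
  then have "((\<lambda>s. logistic (- s)) \<longlongrightarrow> 0) at_top" by (simp add: e)
  then show ?thesis by (simp add: filterlim_at_bot_mirror)
qed

text \<open>The shift by \<open>sqrt n\<close> is of lower order than \<open>n (y - a)\<close> for
  \<open>y > a\<close> but decides the boundary point \<open>y = a\<close>, so the limit is the
  indicator of the open half-line everywhere.\<close>

lemma logistic_affine_step: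
  "(\<lambda>n. logistic (real n * (y - a) - sqrt (real n))) \<longlonglongrightarrow> indicat_real {z. a < z} y"
proof (cases "a < y")
  case True
  have "filterlim (\<lambda>n. sqrt (real n) * (- 1 + (y - a) * sqrt (real n))) at_top sequentially"
  proof (rule filterlim_at_top_mult_at_top)
    show s: "filterlim (\<lambda>n. sqrt (real n)) at_top sequentially"
      by (rule filterlim_compose[OF sqrt_at_top filterlim_real_sequentially])
    have "filterlim (\<lambda>n. (y - a) * sqrt (real n)) at_top sequentially"
      using True by (intro filterlim_tendsto_pos_mult_at_top[OF tendsto_const _ s]) simp
    then show "filterlim (\<lambda>n. - 1 + (y - a) * sqrt (real n)) at_top sequentially"
      by (rule filterlim_tendsto_add_at_top[OF tendsto_const])
  qed
  moreover have "sqrt (real n) * (- 1 + (y - a) * sqrt (real n)) = real n * (y - a) - sqrt (real n)" for n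
    by (simp add: algebra_simps)
  ultimately have "filterlim (\<lambda>n. real n * (y - a) - sqrt (real n)) at_top sequentially" by simp
  then show ?thesis using True filterlim_compose[OF logistic_at_top] by simp
next
  case False
  have "filterlim (\<lambda>n. real n * (y - a) - sqrt (real n)) at_bot sequentially"
  proof (rule filterlim_at_bot_mono)
    show "filterlim (\<lambda>n. - sqrt (real n)) at_bot sequentially"
      unfolding filterlim_uminus_at_bot minus_minus
      by (rule filterlim_compose[OF sqrt_at_top filterlim_real_sequentially])
    show "\<forall>\<^sub>F n in sequentially. real n * (y - a) - sqrt (real n) <= - sqrt (real n)"
      using False by (simp add: mult_nonneg_nonpos)
  qed
  then show ?thesis using False filterlim_compose[OF logistic_at_bot] by simp
qed

text \<open>Common abstraction of two families: bounded C^2 functions, for the perturbations, and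
  smooth functions, for weak gradients. Products and complements of functions with values in [0, 1]
  imitate Boolean operations, and sigmoids along one direction supply half-spaces.\<close>

definition step_class :: "('b::euclidean_space => real) set => bool" where
  "step_class F \<longleftrightarrow> (\<forall>f\<in>F. f \<in> borel_measurable borel \<and> (\<forall>x. 0 <= f x \<and> f x <= 1)) \<and>
     (\<forall>f\<in>F. \<forall>g\<in>F. (\<lambda>x. f x * g x) \<in> F) \<and> (\<forall>f\<in>F. (\<lambda>x. 1 - f x) \<in> F) \<and>
     (\<forall>c d i. (\<lambda>x. logistic (c * (x \<bullet> i) + d)) \<in> F)"

text \<open>The sets whose indicators can be approximated in L^1(\<mu>) are closed under complements
  and countable unions and contain the half-spaces, which generate the Borel sets.\<close>

lemma step_class_approx:
  fixes F :: "('b::euclidean_space => real) set"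
  assumes F: "step_class F" and fb: "finb \<mu>" and A: "A \<in> sets borel" and e: "0 < e"
  shows "\<exists>f\<in>F. (LINT x|\<mu>. \<bar>f x - indicator A x\<bar>) < e"
proof -
  note [simp] = finbD(2,3,4)[OF fb]
  interpret finite_measure \<mu> using fb by (rule finbD)
  have Fm: "f \<in> borel_measurable borel" "0 <= f x" "f x <= 1" if "f \<in> F" for f x
    using F that unfolding step_class_def by auto
  have Fmult: "(\<lambda>x. f x * g x) \<in> F" if "f \<in> F" "g \<in> F" for f g using F that unfolding step_class_def by auto
  have Fc: "(\<lambda>x. 1 - f x) \<in> F" if "f \<in> F" for f using F that unfolding step_class_def by auto
  have Fl: "(\<lambda>x. logistic (c * (x \<bullet> i) + d)) \<in> F" for c d i using F unfolding step_class_def by auto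
  have bi: "integrable \<mu> h" if "h \<in> borel_measurable borel" "!!x. \<bar>h x\<bar> <= 2" for h :: "'b => real"
    using finb_integrable_bounded[OF fb that(1), of 2] that(2) by auto
  have ai: "integrable \<mu> (\<lambda>x. \<bar>f x - indicator A x\<bar>)" if "f \<in> F" "A \<in> sets borel" for f A
  proof (rule bi)
    show "\<bar>\<bar>f x - indicator A x\<bar>\<bar> <= 2" for x
      using Fm(2,3)[OF that(1), of x] by (auto simp: indicator_def)
  qed (use Fm(1)[OF that(1)] that(2) in auto)
  define P where "P A \<longleftrightarrow> (\<forall>e>0. \<exists>f\<in>F. (LINT x|\<mu>. \<bar>f x - indicator A x\<bar>) < e)" for A :: "'b set"
  have Plim: "P A" if A: "A \<in> sets borel" "!!n. f n \<in> F" "!!x. (\<lambda>n. f n x) \<longlonglongrightarrow> indicator A x" for A f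
    unfolding P_def
  proof (intro allI impI)
    fix e :: real assume e: "0 < e"
    have "(\<lambda>n. LINT x|\<mu>. \<bar>f n x - indicator A x\<bar>) \<longlonglongrightarrow> (LINT x|\<mu>. 0)"
    proof (rule integral_dominated_convergence[where w = "\<lambda>_. 2"])
      show "AE x in \<mu>. (\<lambda>n. \<bar>f n x - indicator A x\<bar>) \<longlonglongrightarrow> 0"
        using A(3) by (auto intro!: tendsto_rabs_zero simp: LIM_zero_iff)
      show "AE x in \<mu>. norm \<bar>f n x - indicator A x\<bar> <= 2" for n
      proof (rule AE_I2)
        fix x
        show "norm \<bar>f n x - indicator A x\<bar> <= 2"
          using Fm(2,3)[OF A(2), of n x] by (auto simp: indicator_def)
      qed
    qed (use A(1) Fm(1)[OF A(2)] in auto)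
    then have "\<forall>\<^sub>F n in sequentially. (LINT x|\<mu>. \<bar>f n x - indicator A x\<bar>) < e"
      using e by (intro order_tendstoD(2)[where y = 0]) auto
    then obtain n where "(LINT x|\<mu>. \<bar>f n x - indicator A x\<bar>) < e" by (auto simp: eventually_sequentially)
    then show "\<exists>f\<in>F. (LINT x|\<mu>. \<bar>f x - indicator A x\<bar>) < e" using A(2) by blast
  qed
  have Pun: "P (A \<union> B)" if AB: "A \<in> sets borel" "B \<in> sets borel" "P A" "P B" for A B
    unfolding P_def
  proof (intro allI impI)
    fix e :: real assume e: "0 < e"
    then have e2: "0 < e / 2" by simp
    obtain f where f: "f \<in> F" "(LINT x|\<mu>. \<bar>f x - indicator A x\<bar>) < e / 2" using AB(3) e2 unfolding P_def by blast
    obtain g where g: "g \<in> F" "(LINT x|\<mu>. \<bar>g x - indicator B x\<bar>) < e / 2" using AB(4) e2 unfolding P_def by blast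
    \<comment> \<open>A soft union, the complement of the product of complements; its distance to
      the indicator of the union is at most the sum of the two distances.\<close>
    define h where "h x = 1 - (1 - f x) * (1 - g x)" for x
    have hF: "h \<in> F" unfolding h_def by (intro Fc Fmult f(1) g(1))
    have "(LINT x|\<mu>. \<bar>h x - indicator (A \<union> B) x\<bar>) <= (LINT x|\<mu>. \<bar>f x - indicator A x\<bar> + \<bar>g x - indicator B x\<bar>)"
    proof (rule integral_mono)
      fix x
      have fg: "0 <= f x" "f x <= 1" "0 <= g x" "g x <= 1" using Fm f(1) g(1) by auto
      have p: "0 <= f x * g x" "f x * g x <= g x" "f x * g x <= f x"
        using fg by (auto simp: mult_left_le_one_le mult_right_le_one_le)
      have "0 <= (1 - f x) * (1 - g x)" using fg by (intro mult_nonneg_nonneg) auto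
      then have p2: "0 <= 1 - f x - g x + f x * g x" by (simp add: algebra_simps)
      show "\<bar>h x - indicator (A \<union> B) x\<bar> <= \<bar>f x - indicator A x\<bar> + \<bar>g x - indicator B x\<bar>"
        using fg p p2 unfolding h_def indicator_def by (auto simp: algebra_simps abs_if)
    qed (use ai hF f(1) g(1) AB in auto)
    also have "\<dots> = (LINT x|\<mu>. \<bar>f x - indicator A x\<bar>) + (LINT x|\<mu>. \<bar>g x - indicator B x\<bar>)"
      using ai f(1) g(1) AB by (intro Bochner_Integration.integral_add) auto
    also have "\<dots> < e" using f(2) g(2) by simp
    finally show "\<exists>f\<in>F. (LINT x|\<mu>. \<bar>f x - indicator (A \<union> B) x\<bar>) < e" using hF by blast
  qed
  have Pempty: "P {}"
  proof (rule Plim[of _ "\<lambda>n x. logistic (0 * (x \<bullet> 0) + - real n)"])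
    show "(\<lambda>n. logistic (0 * (x \<bullet> 0) + - real n)) \<longlonglongrightarrow> indicator {} x" for x :: 'b
      by (auto intro!: filterlim_compose[OF logistic_at_bot] simp: filterlim_uminus_at_bot filterlim_real_sequentially)
    show "(\<lambda>x. logistic (0 * (x \<bullet> 0) + - real n)) \<in> F" for n by (rule Fl)
  qed simp
  have "P A" if "A \<in> sigma_sets UNIV ((\<lambda>(a, i). {x::'b. a < x \<bullet> i}) ` (UNIV \<times> Basis))" for A
    using that
  proof (induction rule: sigma_sets.induct)
    case (Basic A)
    then obtain a i where A: "A = {x. a < x \<bullet> i}" by auto
    show ?case
    proof (rule Plim[of _ "\<lambda>n x. logistic (real n * (x \<bullet> i) + (- (real n * a) - sqrt (real n)))"])
      fix x
      have eq: "real n * (x \<bullet> i) + (- (real n * a) - sqrt (real n)) = real n * (x \<bullet> i - a) - sqrt (real n)" for n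
        by (simp add: algebra_simps)
      show "(\<lambda>n. logistic (real n * (x \<bullet> i) + (- (real n * a) - sqrt (real n)))) \<longlonglongrightarrow> indicator A x"
        unfolding eq using logistic_affine_step[of "x \<bullet> i" a] by (simp add: A indicator_def)
    qed (auto simp: A intro: Fl)
  next
    case Empty
    show ?case by (rule Pempty)
  next
    case (Compl A)
    show ?case
      unfolding P_def
    proof (intro allI impI)
      fix e :: real assume "0 < e"
      then obtain f where f: "f \<in> F" "(LINT x|\<mu>. \<bar>f x - indicator A x\<bar>) < e" using Compl(2) unfolding P_def by blast
      moreover have "\<bar>1 - f x - indicator (UNIV - A) x\<bar> = \<bar>f x - indicator A x\<bar>" for x
        by (auto simp: indicator_def)
      ultimately show "\<exists>f\<in>F. (LINT x|\<mu>. \<bar>f x - indicator (UNIV - A) x\<bar>) < e"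
        by (intro bexI[OF _ Fc[OF f(1)]]) simp
    qed
  next
    case (Union A)
    have Ab: "A i \<in> sets borel" for i
      using Union(1)[of i] by (simp add: borel_eq_halfspace_greater)
    \<comment> \<open>Finite unions are covered by \<open>Pun\<close>, and the mass still missing
      tends to zero by continuity from below.\<close>
    define U where "U N = (\<Union>i<N. A i)" for N
    have Ub: "U N \<in> sets borel" for N unfolding U_def using Ab by auto
    have PU: "P (U N)" for N
    proof (induction N)
      case 0
      show ?case using Pempty by (simp add: U_def)
    next
      case (Suc N)
      have "U (Suc N) = U N \<union> A N" by (auto simp: U_def less_Suc_eq)
      then show ?case using Pun[OF Ub Ab Suc Union(2)] by simp
    qed
    have UU: "(\<Union>N. U N) = (\<Union>i. A i)" unfolding U_def by blast
    have inc: "incseq U" unfolding U_def incseq_def by force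
    have lim: "(\<lambda>N. measure \<mu> (U N)) \<longlonglongrightarrow> measure \<mu> (\<Union>i. A i)"
      using finite_Lim_measure_incseq[of U] Ub inc UU by auto
    show ?case
      unfolding P_def
    proof (intro allI impI)
      fix e :: real assume e: "0 < e"
      have "\<forall>\<^sub>F N in sequentially. measure \<mu> (\<Union>i. A i) - e / 2 < measure \<mu> (U N)"
        using lim e by (intro order_tendstoD(1)) auto
      then obtain N where N: "measure \<mu> (\<Union>i. A i) - e / 2 < measure \<mu> (U N)" by (auto simp: eventually_sequentially)
      have "0 < e / 2" using e by simp
      then obtain f where f: "f \<in> F" "(LINT x|\<mu>. \<bar>f x - indicator (U N) x\<bar>) < e / 2"
        using PU[of N] unfolding P_def by blast
      have sub: "U N \<subseteq> (\<Union>i. A i)" by (auto simp: U_def)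
      have Am: "(\<Union>i. A i) \<in> sets borel" using Ab by auto
      have di: "integrable \<mu> (indicat_real ((\<Union>i. A i) - U N))"
        using Am Ub by (intro integrable_real_indicator) (auto simp: emeasure_eq_measure)
      have "(LINT x|\<mu>. \<bar>f x - indicator (\<Union>i. A i) x\<bar>) <= (LINT x|\<mu>. \<bar>f x - indicator (U N) x\<bar> + indicator ((\<Union>i. A i) - U N) x)"
      proof (rule integral_mono)
        show "integrable \<mu> (\<lambda>x. \<bar>f x - indicator (U N) x\<bar> + indicator ((\<Union>i. A i) - U N) x)"
          by (rule Bochner_Integration.integrable_add[OF ai[OF f(1) Ub] di])
        show "\<bar>f x - indicator (\<Union>i. A i) x\<bar> <= \<bar>f x - indicator (U N) x\<bar> + indicator ((\<Union>i. A i) - U N) x" for x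
          using sub by (auto simp: indicator_def abs_if)
      qed (rule ai[OF f(1) Am])
      also have "\<dots> = (LINT x|\<mu>. \<bar>f x - indicator (U N) x\<bar>) + measure \<mu> ((\<Union>i. A i) - U N)"
        using Am Ub by (subst Bochner_Integration.integral_add[OF ai[OF f(1) Ub] di]) simp
      also have "measure \<mu> ((\<Union>i. A i) - U N) = measure \<mu> (\<Union>i. A i) - measure \<mu> (U N)"
        using finite_measure_Diff[of "\<Union>i. A i" "U N"] Am Ub sub by simp
      finally show "\<exists>f\<in>F. (LINT x|\<mu>. \<bar>f x - indicator (\<Union>i. A i) x\<bar>) < e" using f N by (intro bexI[OF _ f(1)]) linarith
    qed
  qed
  moreover have "A \<in> sigma_sets UNIV ((\<lambda>(a, i). {x::'b. a < x \<bullet> i}) ` (UNIV \<times> Basis))"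
    using A by (simp add: borel_eq_halfspace_greater)
  ultimately show ?thesis using e unfolding P_def by blast
qed

section \<open>Bounded functions of class C^2\<close>

lemma C2_bounded_const: "C2_bounded (\<lambda>_. c)"
  unfolding C2_bounded_def
proof (intro exI[of _ "\<lambda>_. 0"] conjI allI)
  show "((\<lambda>_. c) has_derivative blinfun_apply 0) (at z)" for z :: 'a
    by (simp add: zero_blinfun.rep_eq)
  show "((\<lambda>_. 0 :: 'a \<Rightarrow>\<^sub>L real) has_derivative blinfun_apply 0) (at z)" for z :: 'a
    by (simp add: zero_blinfun.rep_eq)
qed auto

lemma C2_bounded_mult:
  assumes "C2_bounded f" "C2_bounded g"
  shows "C2_bounded (\<lambda>z. f z * g z)"
proof -
  obtain Df D2f where f: "!!z. (f has_derivative blinfun_apply (Df z)) (at z)"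
    "!!z. (Df has_derivative blinfun_apply (D2f z)) (at z)" "continuous_on UNIV D2f"
    "bounded (range f)" "bounded (range Df)" "bounded (range D2f)"
    using assms(1) unfolding C2_bounded_def by blast
  obtain Dg D2g where g: "!!z. (g has_derivative blinfun_apply (Dg z)) (at z)"
    "!!z. (Dg has_derivative blinfun_apply (D2g z)) (at z)" "continuous_on UNIV D2g"
    "bounded (range g)" "bounded (range Dg)" "bounded (range D2g)"
    using assms(2) unfolding C2_bounded_def by blast
  obtain B where B: "!!z. norm (f z) <= B" "!!z. norm (Df z) <= B" "!!z. norm (D2f z) <= B"
    "!!z. norm (g z) <= B" "!!z. norm (Dg z) <= B" "!!z. norm (D2g z) <= B"
  proof -
    obtain b1 where b1: "!!z. norm (f z) <= b1" using f(4) unfolding bounded_iff by blast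
    obtain b2 where b2: "!!z. norm (Df z) <= b2" using f(5) unfolding bounded_iff by blast
    obtain b3 where b3: "!!z. norm (D2f z) <= b3" using f(6) unfolding bounded_iff by blast
    obtain b4 where b4: "!!z. norm (g z) <= b4" using g(4) unfolding bounded_iff by blast
    obtain b5 where b5: "!!z. norm (Dg z) <= b5" using g(5) unfolding bounded_iff by blast
    obtain b6 where b6: "!!z. norm (D2g z) <= b6" using g(6) unfolding bounded_iff by blast
    show thesis using b1 b2 b3 b4 b5 b6 by (intro that[of "max (max b1 b2) (max (max b3 b4) (max b5 b6))"]) (auto simp: le_max_iff_disj)
  qed
  have B0: "0 <= B" using order_trans[OF norm_ge_zero B(1)] .
  define D where "D z = f z *\<^sub>R Dg z + g z *\<^sub>R Df z" for z
  define D2 where "D2 z = (f z *\<^sub>R D2g z + (blinfun_scaleR_left (Dg z) o\<^sub>L Df z)) +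
     (g z *\<^sub>R D2f z + (blinfun_scaleR_left (Df z) o\<^sub>L Dg z))" for z
  have 1: "((\<lambda>z. f z * g z) has_derivative blinfun_apply (D z)) (at z)" for z
    using has_derivative_mult[OF f(1) g(1), of z]
    by (rule has_derivative_eq_rhs) (auto simp: D_def blinfun.bilinear_simps)
  have 2: "(D has_derivative blinfun_apply (D2 z)) (at z)" for z
  proof -
    have "(D has_derivative (\<lambda>h. (f z *\<^sub>R D2g z h + Df z h *\<^sub>R Dg z) + (g z *\<^sub>R D2f z h + Dg z h *\<^sub>R Df z))) (at z)"
      unfolding D_def[abs_def] by (intro has_derivative_add has_derivative_scaleR f g)
    then show ?thesis by (rule has_derivative_eq_rhs) (auto simp: D2_def blinfun.bilinear_simps)
  qed
  have c: "continuous_on UNIV f" "continuous_on UNIV Df" "continuous_on UNIV g" "continuous_on UNIV Dg"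
    using f(1,2) g(1,2) by (meson has_derivative_continuous continuous_at_imp_continuous_on)+
  have 3: "continuous_on UNIV D2"
    unfolding D2_def[abs_def] by (intro continuous_intros c f g)
  have 4: "norm (f z * g z) <= B * B" for z
    unfolding norm_mult by (intro mult_mono B B0) auto
  have sc: "norm (h *\<^sub>R v) <= B * B" if "norm h <= B" "norm v <= B" for h :: real and v :: "'c::real_normed_vector"
    unfolding norm_scaleR using that B0 by (intro mult_mono) auto
  have 5: "norm (D z) <= B * B + B * B" for z
    unfolding D_def by (intro norm_triangle_mono sc B)
  have nl: "norm (blinfun_scaleR_left v :: real \<Rightarrow>\<^sub>L 'c) <= norm v" for v :: "'c::real_normed_vector"
    by (rule norm_blinfun_bound) (auto simp: mult.commute)
  have cp: "norm (blinfun_scaleR_left v o\<^sub>L u) <= B * B" if "norm v <= B" "norm u <= B"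
    for v :: "'a \<Rightarrow>\<^sub>L real" and u :: "'a \<Rightarrow>\<^sub>L real"
    by (rule order_trans[OF norm_blinfun_compose], rule mult_mono) (use that nl[of v] B0 in auto)
  have 6: "norm (D2 z) <= (B * B + B * B) + (B * B + B * B)" for z
    unfolding D2_def by (intro norm_triangle_mono sc cp B)
  show ?thesis
    unfolding C2_bounded_def
    by (rule exI[of _ D], rule exI[of _ D2]) (use 1 2 3 4 5 6 in \<open>auto simp: bounded_iff\<close>)
qed

lemma C2_bounded_add:
  assumes "C2_bounded f" "C2_bounded g"
  shows "C2_bounded (\<lambda>z. f z + g z)"
proof -
  obtain Df D2f where f: "!!z. (f has_derivative blinfun_apply (Df z)) (at z)"
    "!!z. (Df has_derivative blinfun_apply (D2f z)) (at z)" "continuous_on UNIV D2f"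
    "bounded (range f)" "bounded (range Df)" "bounded (range D2f)"
    using assms(1) unfolding C2_bounded_def by blast
  obtain Dg D2g where g: "!!z. (g has_derivative blinfun_apply (Dg z)) (at z)"
    "!!z. (Dg has_derivative blinfun_apply (D2g z)) (at z)" "continuous_on UNIV D2g"
    "bounded (range g)" "bounded (range Dg)" "bounded (range D2g)"
    using assms(2) unfolding C2_bounded_def by blast
  show ?thesis
    unfolding C2_bounded_def
  proof (intro exI[of _ "\<lambda>z. Df z + Dg z"] exI[of _ "\<lambda>z. D2f z + D2g z"] conjI allI)
    show "((\<lambda>z. f z + g z) has_derivative blinfun_apply (Df z + Dg z)) (at z)" for z
      using has_derivative_add[OF f(1) g(1), of z] by (rule has_derivative_eq_rhs) (auto simp: blinfun.bilinear_simps)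
    show "((\<lambda>z. Df z + Dg z) has_derivative blinfun_apply (D2f z + D2g z)) (at z)" for z
      using has_derivative_add[OF f(2) g(2), of z] by (rule has_derivative_eq_rhs) (auto simp: blinfun.bilinear_simps)
  qed (intro continuous_intros f g bounded_plus_comp)+
qed

lemma C2_bounded_cmult: "C2_bounded f ==> C2_bounded (\<lambda>z. c * f z)"
  by (rule C2_bounded_mult[OF C2_bounded_const])

lemma C2_bounded_sum: "(!!i. i \<in> I ==> C2_bounded (f i)) ==> C2_bounded (\<lambda>z. \<Sum>i\<in>I. f i z)"
  by (induction I rule: infinite_finite_induct) (auto intro: C2_bounded_const C2_bounded_add)

text \<open>The first two derivatives of the sigmoid are \<open>q = l (1 - l)\<close> and
  \<open>q (1 - 2 l)\<close>, both of modulus at most one.\<close>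

lemma C2_bounded_logistic: "C2_bounded (\<lambda>x::'b::euclidean_space. logistic (c * (x \<bullet> i) + d))"
proof -
  define l where "l x = logistic (c * (x \<bullet> i) + d)" for x :: 'b
  define q where "q x = l x * (1 - l x)" for x
  define I where "I = c *\<^sub>R (blinfun_inner_left i :: 'b \<Rightarrow>\<^sub>L real)"
  define D where "D x = q x *\<^sub>R I" for x
  define D2 where "D2 x = blinfun_scaleR_left I o\<^sub>L ((q x * (1 - 2 * l x)) *\<^sub>R I)" for x
  have lb: "0 <= l x" "l x <= 1" for x by (simp_all add: l_def logistic_bounds)
  have l: "(l has_derivative (\<lambda>h. q x * (c * (h \<bullet> i)))) (at x)" for x
  proof -
    have "(logistic has_derivative (\<lambda>h. h * (l x * (1 - l x)))) (at (c * (x \<bullet> i) + d))"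
      unfolding l_def using logistic_has_derivative by (simp add: has_field_derivative_def mult_commute_abs)
    moreover have "((\<lambda>x. c * (x \<bullet> i) + d) has_derivative (\<lambda>h. c * (h \<bullet> i))) (at x)"
      by (auto intro!: derivative_eq_intros)
    ultimately have "((\<lambda>x. logistic (c * (x \<bullet> i) + d)) has_derivative (\<lambda>h. (c * (h \<bullet> i)) * (l x * (1 - l x)))) (at x)"
      by (rule has_derivative_compose[rotated])
    then show ?thesis by (simp add: l_def[abs_def] q_def mult.commute)
  qed
  have qd: "(q has_derivative (\<lambda>h. q x * (1 - 2 * l x) * (c * (h \<bullet> i)))) (at x)" for x
  proof -
    have "(q has_derivative (\<lambda>h. l x * (- (q x * (c * (h \<bullet> i)))) + q x * (c * (h \<bullet> i)) * (1 - l x))) (at x)"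
      unfolding q_def[abs_def]
      by (rule has_derivative_mult[OF l[unfolded q_def]]) (auto intro!: derivative_eq_intros l[unfolded q_def])
    then show ?thesis by (rule has_derivative_eq_rhs) (auto simp: algebra_simps)
  qed
  have cl: "continuous_on UNIV l"
    unfolding l_def by (rule continuous_on_compose2[OF continuous_logistic[of UNIV]]) (auto intro!: continuous_intros)
  have q1: "\<bar>q x\<bar> <= 1" for x using lb[of x] by (simp add: q_def mult_le_one abs_le_iff)
  have q2: "\<bar>q x * (1 - 2 * l x)\<bar> <= 1" for x
    unfolding abs_mult using q1[of x] lb[of x] by (intro mult_le_one) auto
  have "C2_bounded l"
    unfolding C2_bounded_def
  proof (intro exI[of _ D] exI[of _ D2] conjI allI)
    show "(l has_derivative blinfun_apply (D x)) (at x)" for x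
      using l by (rule has_derivative_eq_rhs) (auto simp: D_def I_def blinfun.bilinear_simps)
    show "(D has_derivative blinfun_apply (D2 x)) (at x)" for x
    proof -
      have "(D has_derivative (\<lambda>h. (q x * (1 - 2 * l x) * (c * (h \<bullet> i))) *\<^sub>R I)) (at x)"
        unfolding D_def[abs_def] by (rule has_derivative_scaleR_left[OF qd])
      then show ?thesis by (rule has_derivative_eq_rhs) (auto simp: D2_def I_def blinfun.bilinear_simps)
    qed
    show "continuous_on UNIV D2"
      unfolding D2_def q_def by (intro continuous_intros cl)
    show "bounded (range l)" using lb by (auto simp: bounded_iff intro!: exI[of _ 1])
    show "bounded (range D)"
      unfolding bounded_iff D_def by (auto intro!: exI[of _ "norm I"] mult_left_le_one_le q1)
    have "norm (D2 x) <= norm (blinfun_scaleR_left I) * norm I" for x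
      unfolding D2_def by (rule order_trans[OF norm_blinfun_compose], rule mult_left_mono)
        (auto intro!: mult_left_le_one_le q2[unfolded abs_mult] simp: abs_mult)
    then show "bounded (range D2)" by (auto simp: bounded_iff)
  qed
  then show ?thesis by (simp add: l_def[abs_def])
qed

lemma C2_bounded_continuous: "C2_bounded f ==> continuous_on UNIV f"
  unfolding C2_bounded_def continuous_on_eq_continuous_at[OF open_UNIV] by (meson has_derivative_continuous)

lemma C2_bounded_measurable: "C2_bounded f ==> f \<in> borel_measurable borel"
  by (intro borel_measurable_continuous_onI C2_bounded_continuous)

lemma C2_step_class: "step_class {f. C2_bounded f \<and> (\<forall>x. 0 <= f x \<and> f x <= 1)}"
  unfolding step_class_def
proof (intro conjI ballI allI; clarify)
  fix f :: "'a => real" assume f: "C2_bounded f" "\<forall>x. 0 <= f x \<and> f x <= 1"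
  show "f \<in> borel_measurable borel" using f(1) by (rule C2_bounded_measurable)
  have "C2_bounded (\<lambda>x. 1 + (-1) * f x)" by (intro C2_bounded_add C2_bounded_const C2_bounded_cmult f)
  then show "C2_bounded (\<lambda>x. 1 - f x) \<and> (\<forall>x. 0 <= 1 - f x \<and> 1 - f x <= 1)" using f(2) by simp
  fix g :: "'a => real" assume g: "C2_bounded g" "\<forall>x. 0 <= g x \<and> g x <= 1"
  show "C2_bounded (\<lambda>x. f x * g x) \<and> (\<forall>x. 0 <= f x * g x \<and> f x * g x <= 1)"
    using f g by (auto intro: C2_bounded_mult mult_le_one)
qed (auto intro: C2_bounded_logistic logistic_bounds)

text \<open>Each layer indicator of \<open>layer_approx\<close> is replaced by an approximant with
  values in [0, 1]; with the weights of the layers the bound \<open>M\<close> is preserved exactly,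
  which later keeps the exponential of the approximant under control.\<close>

lemma C2_bounded_approx:
  fixes s :: "'b::euclidean_space => real"
  assumes fb: "finb \<mu>" and s: "s \<in> borel_measurable borel" "!!x. \<bar>s x\<bar> <= M" and M: "0 < M" and e: "0 < e"
  shows "\<exists>f. C2_bounded f \<and> (\<forall>x. \<bar>f x\<bar> <= M) \<and> (LINT x|\<mu>. \<bar>f x - s x\<bar>) < e"
proof -
  note [simp] = finbD(2,3,4)[OF fb]
  interpret finite_measure \<mu> using fb by (rule finbD)
  define K where "K = measure \<mu> UNIV + 1"
  have K: "0 < K" unfolding K_def by (simp add: add_nonneg_pos)
  obtain N :: nat where "max 1 (4 * M * K / e) < real N" using reals_Archimedean2 by blast
  then have N: "0 < N" "4 * M * K / e < real N" by auto
  define A where "A i = {z. s z > - M + 2 * M * real i / real N}" for i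
  have A[measurable]: "A i \<in> sets borel" for i unfolding A_def using s(1) by simp
  \<comment> \<open>\<open>N\<close> layers of weight \<open>2M/N\<close> with error
    \<open>e/(4M)\<close> each give \<open>e/2\<close>; the other half is the layer error, by the
    choice of \<open>N\<close>.\<close>
  have "0 < e / (4 * M)" using e M by simp
  then have "\<forall>i. \<exists>f. (C2_bounded f \<and> (\<forall>x. 0 <= f x \<and> f x <= 1)) \<and> (LINT x|\<mu>. \<bar>f x - indicator (A i) x\<bar>) < e / (4 * M)"
    using step_class_approx[OF C2_step_class fb A] by blast
  then obtain f where f: "!!i. C2_bounded (f i)" "!!i x. 0 <= f i x" "!!i x. f i x <= 1"
    "!!i. (LINT x|\<mu>. \<bar>f i x - indicator (A i) x\<bar>) < e / (4 * M)" by metis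
  define g where "g x = - M + 2 * M / real N * (\<Sum>i=1..N. f i x)" for x
  define t where "t x = - M + 2 * M / real N * (\<Sum>i=1..N. indicat_real (A i) x)" for x
  have gC: "C2_bounded g"
    unfolding g_def by (intro C2_bounded_add C2_bounded_const C2_bounded_cmult C2_bounded_sum f)
  have gM: "\<bar>g x\<bar> <= M" for x
  proof -
    have "0 <= (\<Sum>i=1..N. f i x)" by (intro sum_nonneg f)
    moreover have "(\<Sum>i=1..N. f i x) <= (\<Sum>i=1..N. 1)" by (intro sum_mono f)
    moreover have "0 <= 2 * M / real N" using M by simp
    ultimately have "0 <= 2 * M / real N * (\<Sum>i=1..N. f i x)" "2 * M / real N * (\<Sum>i=1..N. f i x) <= 2 * M / real N * (\<Sum>i=1..N. 1)"
      by (metis mult_nonneg_nonneg, metis mult_left_mono)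
    moreover have "2 * M / real N * (\<Sum>i=1..N. 1) = 2 * M" using N by simp
    ultimately show ?thesis unfolding g_def abs_le_iff by linarith
  qed
  have st: "\<bar>s x - t x\<bar> <= 2 * M / real N" for x
    unfolding t_def A_def using layer_approx[of s x M N] M N s by auto
  have fm: "f i \<in> borel_measurable borel" for i by (rule C2_bounded_measurable[OF f(1)])
  have fi: "integrable \<mu> (\<lambda>x. \<bar>f i x - indicator (A i) x\<bar>)" for i
    by (rule finb_integrable_bounded[OF fb, where B = 1]) (use fm f in \<open>auto simp: indicator_def\<close>)
  have "(LINT x|\<mu>. \<bar>g x - s x\<bar>) <= (LINT x|\<mu>. 2 * M / real N * (\<Sum>i=1..N. \<bar>f i x - indicator (A i) x\<bar>) + 2 * M / real N)"
  proof (rule integral_mono)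
    show "integrable \<mu> (\<lambda>x. \<bar>g x - s x\<bar>)"
    proof (rule finb_integrable_bounded[OF fb, where B = "M + M"])
      show "norm \<bar>g x - s x\<bar> <= M + M" for x using gM[of x] s(2)[of x] by simp
    qed (use C2_bounded_measurable[OF gC] s in auto)
    show "integrable \<mu> (\<lambda>x. 2 * M / real N * (\<Sum>i=1..N. \<bar>f i x - indicator (A i) x\<bar>) + 2 * M / real N)"
      using fi by auto
    fix x
    have "g x - t x = 2 * M / real N * (\<Sum>i=1..N. f i x - indicator (A i) x)"
      by (simp add: g_def t_def sum_subtractf algebra_simps)
    then have "\<bar>g x - t x\<bar> = 2 * M / real N * \<bar>\<Sum>i=1..N. f i x - indicator (A i) x\<bar>" using M by (simp add: abs_mult)
    also have "\<dots> <= 2 * M / real N * (\<Sum>i=1..N. \<bar>f i x - indicator (A i) x\<bar>)"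
      using M by (intro mult_left_mono sum_abs) auto
    finally show "\<bar>g x - s x\<bar> <= 2 * M / real N * (\<Sum>i=1..N. \<bar>f i x - indicator (A i) x\<bar>) + 2 * M / real N"
      using st[of x] by linarith
  qed
  also have "\<dots> = 2 * M / real N * (\<Sum>i=1..N. LINT x|\<mu>. \<bar>f i x - indicator (A i) x\<bar>) + 2 * M / real N * measure \<mu> UNIV"
    using fi by (simp add: Bochner_Integration.integral_sum)
  also have "\<dots> <= 2 * M / real N * (\<Sum>i=1..N. e / (4 * M)) + 2 * M / real N * K"
    using M f(4) by (intro add_mono mult_left_mono sum_mono) (auto simp: K_def intro: less_imp_le)
  also have "2 * M / real N * (\<Sum>i=1..N. e / (4 * M)) = e / 2" using M N by simp
  also have "2 * M / real N * K < e / 2" using N M K e by (simp add: field_simps)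
  finally have "(LINT x|\<mu>. \<bar>g x - s x\<bar>) < e" by simp
  then show ?thesis using gC gM by blast
qed

text \<open>With \<open>f = ln p + \<beta> wt\<close> the relative entropy would vanish, but this
  \<open>f\<close> is in general neither bounded nor smooth. Truncation makes it bounded, with
  convergence of both integrals in \<open>kl\<close>; approximation by C^2 functions with the same
  bound \<open>M\<close> makes it smooth, \<open>exp\<close> being Lipschitz on [-M, M] with
  constant \<open>exp M\<close>.\<close>

lemma kl_small_exists:
  fixes m :: "('a::euclidean_space \<times> 'a) P2"
  assumes g: "good m" and b: "0 < \<beta>" and d: "0 < \<delta>"
  shows "\<exists>f. C2_bounded f \<and> kl \<beta> f m <= \<delta>"
proof -
  define p where "p = leb_density (meas m)"
  have hd: "has_leb_density (meas m)" and wi: "integrable (meas m) wt" and li: "integrable (meas m) (\<lambda>z. ln (p z))"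
    using g by (auto simp: good_def p_def)
  note P = leb_density_props[OF hd finb_meas, folded p_def]
  note I = leb_density_integral[OF hd finb_meas, folded p_def, where 'c = real, simplified]
  have ppos: "AE z in meas m. 0 < p z" using AE_leb_density_pos[OF hd finb_meas] by (simp add: p_def)
  note [measurable] = P(1)
  define r :: "'a \<times> 'a => real" where "r z = exp (- (\<beta> * wt z))" for z
  have ri: "integrable lborel r" unfolding r_def using integrable_exp_wt[OF b] by simp
  have rm [measurable]: "r \<in> borel_measurable borel" unfolding r_def by measurable
  have er: "exp (f z - \<beta> * wt z) = exp (f z) * r z" for f z by (simp add: r_def exp_diff exp_minus divide_inverse)
  define c where "c k z = cut (real k) (p z) (\<beta> * wt z)" for k z
  have cm [measurable]: "c k \<in> borel_measurable borel" for k
    unfolding c_def cut_def using clamp1_measurable[of "\<lambda>z. ln (p z) + \<beta> * wt z" borel] by measurable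
  have cb: "\<bar>c k z\<bar> <= real k" for k z unfolding c_def by (rule cut_bound) simp
  have 1: "(\<lambda>k. LINT z|meas m. c k z) \<longlonglongrightarrow> (LINT z|meas m. ln (p z) + \<beta> * wt z)"
  proof (rule integral_dominated_convergence[where w = "\<lambda>z. \<bar>ln (p z) + \<beta> * wt z\<bar>"])
    show "AE z in meas m. (\<lambda>k. c k z) \<longlonglongrightarrow> ln (p z) + \<beta> * wt z"
      using ppos by (rule AE_mp) (auto simp: c_def cut_def clamp1_tendsto)
    show "AE z in meas m. norm (c k z) <= \<bar>ln (p z) + \<beta> * wt z\<bar>" for k
      using ppos by (rule AE_mp) (auto simp: c_def cut_def clamp1_abs_le)
  qed (use li wi in auto)
  have 2: "(\<lambda>k. LINT z|lborel. exp (c k z) * r z) \<longlonglongrightarrow> (LINT z|lborel. p z)"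
  proof (rule integral_dominated_convergence[where w = "\<lambda>z. p z + r z"])
    show "AE z in lborel. (\<lambda>k. exp (c k z) * r z) \<longlonglongrightarrow> p z"
    proof (rule AE_I2)
      fix z
      show "(\<lambda>k. exp (c k z) * r z) \<longlonglongrightarrow> p z"
      proof (cases "0 < p z")
        case True
        have "(\<lambda>k. exp (clamp1 (real k) (ln (p z) + \<beta> * wt z)) * r z) \<longlonglongrightarrow> exp (ln (p z) + \<beta> * wt z) * r z"
          by (intro tendsto_intros clamp1_tendsto)
        moreover have "exp (ln (p z) + \<beta> * wt z) * r z = p z" using True by (simp add: r_def exp_add exp_minus)
        ultimately show ?thesis using True by (simp add: c_def cut_def)
      next
        case False
        then have p0: "p z = 0" using P(2)[of z] by simp
        have "(\<lambda>n. exp (- real n)) \<longlonglongrightarrow> 0"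
          by (rule filterlim_compose[OF exp_at_bot]) (simp add: filterlim_uminus_at_bot filterlim_real_sequentially)
        then have "(\<lambda>n. exp (- real n) * r z) \<longlonglongrightarrow> 0 * r z" by (intro tendsto_intros)
        then show ?thesis by (simp add: p0 c_def cut_def)
      qed
    qed
    show "AE z in lborel. norm (exp (c k z) * r z) <= p z + r z" for k
    proof (rule AE_I2)
      fix z
      have r0: "0 <= r z" by (simp add: r_def)
      show "norm (exp (c k z) * r z) <= p z + r z"
      proof (cases "0 < p z")
        case True
        define u where "u = ln (p z) + \<beta> * wt z"
        have "exp (clamp1 (real k) u) <= exp u + 1"
        proof (cases "0 <= u")
          case True
          then have "clamp1 (real k) u <= u" by (auto simp: clamp1_def)
          then show ?thesis by (simp add: add_increasing2)
        next
          case False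
          then have "clamp1 (real k) u <= 0" by (auto simp: clamp1_def)
          then show ?thesis by (simp add: add_increasing)
        qed
        then have "exp (clamp1 (real k) u) * r z <= (exp u + 1) * r z" using r0 by (rule mult_right_mono)
        also have "(exp u + 1) * r z = p z + r z" using True by (simp add: u_def r_def exp_add exp_minus distrib_right)
        finally show ?thesis using True r0 by (simp add: c_def cut_def u_def)
      next
        case False
        have "exp (- real k) * r z <= 1 * r z" using r0 by (intro mult_right_mono) auto
        then show ?thesis using False r0 P(2)[of z] by (simp add: c_def cut_def)
      qed
    qed
  qed (use P ri in auto)
  have lw: "(LINT z|meas m. ln (p z) + \<beta> * wt z) = ent m + \<beta> * w3 m"
    using li wi by (simp add: ent_def w3_def p_def)
  have "(\<lambda>k. kl \<beta> (c k) m) \<longlonglongrightarrow> ent m - (ent m + \<beta> * w3 m) + \<beta> * w3 m - 1 + 1"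
    unfolding kl_def er using 1 2 lw leb_density_prob[OF hd, folded p_def] by (intro tendsto_intros) auto
  then have "(\<lambda>k. kl \<beta> (c k) m) \<longlonglongrightarrow> 0" by simp
  then have "\<forall>\<^sub>F k in sequentially. kl \<beta> (c k) m < \<delta> / 2"
    using d by (intro order_tendstoD(2)[where y = 0]) auto
  then obtain k where "\<forall>i\<ge>k. kl \<beta> (c i) m < \<delta> / 2" unfolding eventually_sequentially by blast
  \<comment> \<open>The index \<open>Suc k\<close> makes the bound \<open>M\<close> positive, as
    \<open>C2_bounded_approx\<close> requires.\<close>
  then have k: "kl \<beta> (c (Suc k)) m < \<delta> / 2" using le_Suc_eq by blast
  define M where "M = real (Suc k)"
  have M: "0 < M" by (simp add: M_def)
  define s where "s = c (Suc k)"
  have sm [measurable]: "s \<in> borel_measurable borel" and sM: "\<bar>s z\<bar> <= M" for z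
    using cb[of "Suc k" z] by (auto simp: s_def M_def)
  \<comment> \<open>\<open>p\<close> controls the integral against \<open>m\<close> and
    \<open>r\<close> the exponential integral; one approximation in this measure serves
    both.\<close>
  define \<mu> where "\<mu> = density lborel (\<lambda>z. ennreal (p z + r z))"
  have pr0: "0 <= p z + r z" for z using P(2)[of z] by (simp add: r_def)
  have pri: "integrable lborel (\<lambda>z. p z + r z)" using P(4) ri by auto
  have fb: "finb \<mu>"
    unfolding finb_def
  proof
    have "emeasure \<mu> UNIV = (\<integral>\<^sup>+ z. ennreal (p z + r z) \<partial>lborel)"
      unfolding \<mu>_def by (subst emeasure_density) auto
    also have "\<dots> < \<infinity>" using pri pr0 by (subst nn_integral_eq_integral) auto
    finally show "finite_measure \<mu>" by (intro finite_measureI) (auto simp: \<mu>_def)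
  qed (simp add: \<mu>_def)
  define e where "e = \<delta> / (2 * exp M)"
  have e: "0 < e" using d by (simp add: e_def)
  obtain f where f: "C2_bounded f" "!!x. \<bar>f x\<bar> <= M" "(LINT x|\<mu>. \<bar>f x - s x\<bar>) < e"
    using C2_bounded_approx[OF fb sm sM M e] by blast
  have fm [measurable]: "f \<in> borel_measurable borel" by (rule C2_bounded_measurable[OF f(1)])
  have ab: "integrable \<mu> (\<lambda>x. \<bar>f x - s x\<bar>)"
  proof (rule finb_integrable_bounded[OF fb, where B = "M + M"])
    show "norm \<bar>f x - s x\<bar> <= M + M" for x using f(2)[of x] sM[of x] by simp
  qed auto
  then have ab': "integrable lborel (\<lambda>x. (p x + r x) * \<bar>f x - s x\<bar>)"
    unfolding \<mu>_def using pr0 by (subst (asm) integrable_density) auto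
  have abe: "(LINT x|lborel. (p x + r x) * \<bar>f x - s x\<bar>) < e"
    using f(3) unfolding \<mu>_def using pr0 by (subst (asm) integral_density) auto
  have mi: "integrable (meas m) f" "integrable (meas m) s"
    by (rule finb_integrable_bounded[OF finb_meas, where B = M]; use f(2) sM in auto)+
  have ei: "integrable lborel (\<lambda>z. exp (f z) * r z)" "integrable lborel (\<lambda>z. exp (s z) * r z)"
    using integrable_exp_bounded_wt[OF b fm, of M] integrable_exp_bounded_wt[OF b sm, of M] f(2) sM
    by (auto simp: er abs_le_iff)
  have pf: "integrable lborel (\<lambda>z. p z * f z)" "integrable lborel (\<lambda>z. p z * s z)"
    using I(1)[OF fm] I(1)[OF sm] mi by auto
  have "kl \<beta> f m - kl \<beta> s m = (LINT z|lborel. p z * s z - p z * f z + (exp (f z) * r z - exp (s z) * r z))"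
    unfolding kl_def er using I(2)[OF fm] I(2)[OF sm] pf ei by simp
  also have "\<dots> <= (LINT z|lborel. exp M * ((p z + r z) * \<bar>f z - s z\<bar>))"
  proof (rule integral_mono)
    fix z
    have r0: "0 <= r z" by (simp add: r_def)
    have "exp (f z) - exp (s z) <= exp M * \<bar>f z - s z\<bar>"
    proof -
      have "1 + (s z - f z) <= exp (s z - f z)" by (rule exp_ge_add_one_self)
      then have "exp (f z) * (1 + (s z - f z)) <= exp (f z) * exp (s z - f z)" by (intro mult_left_mono) auto
      then have "exp (f z) - exp (s z) <= exp (f z) * (f z - s z)" by (simp add: algebra_simps flip: exp_add)
      also have "\<dots> <= exp (f z) * \<bar>f z - s z\<bar>" by (intro mult_left_mono) auto
      also have "\<dots> <= exp M * \<bar>f z - s z\<bar>" using f(2)[of z] by (intro mult_right_mono) (auto simp: abs_le_iff)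
      finally show ?thesis .
    qed
    then have "(exp (f z) - exp (s z)) * r z <= (exp M * \<bar>f z - s z\<bar>) * r z" using r0 by (rule mult_right_mono)
    moreover have "p z * s z - p z * f z <= exp M * (p z * \<bar>f z - s z\<bar>)"
    proof -
      have "p z * (s z - f z) <= p z * \<bar>f z - s z\<bar>" using P(2) by (intro mult_left_mono) auto
      also have "1 * (p z * \<bar>f z - s z\<bar>) <= exp M * (p z * \<bar>f z - s z\<bar>)"
        using M P(2) by (intro mult_right_mono) auto
      finally show ?thesis by (simp add: algebra_simps)
    qed
    ultimately show "p z * s z - p z * f z + (exp (f z) * r z - exp (s z) * r z) <= exp M * ((p z + r z) * \<bar>f z - s z\<bar>)"
      by (simp add: algebra_simps)
  qed (use pf ei ab' in auto)
  also have "\<dots> < exp M * e" using abe by simp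
  also have "exp M * e = \<delta> / 2" by (simp add: e_def)
  finally have "kl \<beta> f m <= \<delta>" using k by (simp add: s_def)
  then show ?thesis using f(1) by blast
qed

section \<open>Convergence along sequences and existence of minimisers\<close>

text \<open>Growth of a product of two linearly growing fields: the scale on which bounded third
  moments already give uniform integrability.\<close>

definition quad :: "'b::real_normed_vector => real" where
  "quad z = 1 + (norm z)\<^sup>2"

lemma quad_pos [simp]: "0 <= quad z" "1 <= quad z" by (auto simp: quad_def)

lemma quad_measurable [measurable]: "quad \<in> borel_measurable (borel :: 'b::euclidean_space measure)"
  unfolding quad_def by measurable

text \<open>Splitting at \<open>t = 1/\<delta>\<close>: below, the square is at most
  \<open>1/\<delta>\<^sup>2\<close>; above, it is at most \<delta> times the cube. Quadratic
  quantities thus cost an arbitrarily small part of the third moment, up to a constant.\<close>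

lemma quad_le_wt:
  fixes z :: "'a::euclidean_space \<times> 'a"
  assumes "0 < \<delta>"
  shows "quad z <= \<delta> * wt z + (1 + 2 / \<delta>\<^sup>2)"
proof -
  have "t\<^sup>2 <= \<delta> * t ^ 3 + 1 / \<delta>\<^sup>2" if "0 <= t" for t
  proof (cases "t <= 1 / \<delta>")
    case True
    then have "t\<^sup>2 <= (1 / \<delta>)\<^sup>2" using that by (intro power_mono) auto
    then show ?thesis using that assms by (simp add: power_divide add_increasing)
  next
    case False
    then have "1 <= \<delta> * t" using assms by (simp add: field_simps)
    then have "1 * t\<^sup>2 <= (\<delta> * t) * t\<^sup>2" by (intro mult_right_mono) auto
    moreover have "(\<delta> * t) * t\<^sup>2 = \<delta> * t ^ 3" by (simp add: power2_eq_square power3_eq_cube)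
    moreover have "0 <= 1 / \<delta>\<^sup>2" by simp
    ultimately show ?thesis by linarith
  qed
  from this[of "norm (fst z)"] this[of "norm (snd z)"] show ?thesis
    by (simp add: quad_def wt_def norm_prod_def algebra_simps)
qed

text \<open>The two forms serve two regimes. In the first the moment \<open>S\<close> enters only as
  \<open>S\<^sup>2\<close>, with coefficients independent of the measure, as coercivity demands; in
  the second \<open>S\<close> is a uniform bound and the majorant is a multiple of
  \<open>quad\<close>.\<close>

lemma linear_growth_product:
  fixes z :: "'a::euclidean_space \<times> 'a" and u v :: 'a
  assumes "norm u <= C * (1 + norm (fst z) + S)" "norm v <= D * (1 + norm (snd z) + S)" "0 <= S" "0 <= C" "0 <= D"
  shows "\<bar>(u - v) \<bullet> (fst z - snd z)\<bar> <= (C + D) * (4 * quad z + S\<^sup>2)"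
    "\<bar>(u - v) \<bullet> (fst z - snd z)\<bar> <= (C + D) * (3 + S) * quad z"
proof -
  define t where "t = norm z"
  have xy: "norm (fst z) <= t" "norm (snd z) <= t" "0 <= t"
    using norm_fst_le[of "fst z" "snd z"] norm_snd_le[of "snd z" "fst z"] by (auto simp: t_def)
  have "\<bar>(u - v) \<bullet> (fst z - snd z)\<bar> <= norm (u - v) * norm (fst z - snd z)" by (rule Cauchy_Schwarz_ineq2)
  also have "\<dots> <= (C * (1 + t + S) + D * (1 + t + S)) * (t + t)"
  proof (rule mult_mono)
    have "norm (u - v) <= norm u + norm v" by (rule norm_triangle_ineq4)
    also have "\<dots> <= C * (1 + norm (fst z) + S) + D * (1 + norm (snd z) + S)" using assms by simp
    also have "\<dots> <= C * (1 + t + S) + D * (1 + t + S)" using xy assms by (intro add_mono mult_left_mono) auto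
    finally show "norm (u - v) <= C * (1 + t + S) + D * (1 + t + S)" .
    show "norm (fst z - snd z) <= t + t" using norm_triangle_ineq4[of "fst z" "snd z"] xy by linarith
  qed (use assms xy in auto)
  finally have *: "\<bar>(u - v) \<bullet> (fst z - snd z)\<bar> <= (C + D) * ((1 + t + S) * (t + t))" by (simp add: algebra_simps)
  have 1: "2 * t <= 1 + t\<^sup>2" using sum_squares_bound[of 1 t] by simp
  have 2: "2 * (S * t) <= S\<^sup>2 + t\<^sup>2" using sum_squares_bound[of S t] by simp
  have 3: "S * (2 * t) <= S * (1 + t\<^sup>2)" using 1 assms by (intro mult_left_mono) auto
  have "(1 + t + S) * (t + t) <= 4 * quad z + S\<^sup>2"
    using 1 2 by (simp add: quad_def t_def[symmetric] algebra_simps power2_eq_square)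
  then show "\<bar>(u - v) \<bullet> (fst z - snd z)\<bar> <= (C + D) * (4 * quad z + S\<^sup>2)"
    by (intro order_trans[OF * mult_left_mono]) (use assms in auto)
  have "(1 + t + S) * (t + t) <= (3 + S) * quad z"
    using 1 3 by (simp add: quad_def t_def[symmetric] algebra_simps power2_eq_square)
  then show "\<bar>(u - v) \<bullet> (fst z - snd z)\<bar> <= (C + D) * (3 + S) * quad z"
    unfolding mult.assoc by (intro order_trans[OF * mult_left_mono]) (use assms in auto)
qed

lemma meas_UNIV [simp]: "measure (meas m) UNIV = 1"
  using prob_space.prob_space[OF meas_props(1)[of m]] by simp

lemma good_quad:
  fixes m :: "('a::euclidean_space \<times> 'a) P2"
  assumes g: "good m"
  shows "integrable (meas m) quad"
    "0 < \<delta> ==> (LINT z|meas m. quad z) <= \<delta> * w3 m + (1 + 2 / \<delta>\<^sup>2)"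
    "E2 (marg1 m) <= (LINT z|meas m. quad z)" "E2 (marg2 m) <= (LINT z|meas m. quad z)"
proof -
  interpret prob_space "meas m" by simp
  have wi: "integrable (meas m) wt" using g by (simp add: good_def)
  have i: "integrable (meas m) (\<lambda>z. \<delta> * wt z + (1 + 2 / \<delta>\<^sup>2))" for \<delta> using wi by auto
  show qi: "integrable (meas m) quad"
  proof (rule Bochner_Integration.integrable_bound[OF i[of 1]])
    show "AE z in meas m. norm (quad z) <= norm (1 * wt z + (1 + 2 / 1\<^sup>2))"
      using quad_le_wt[of 1] by (auto intro!: AE_I2)
  qed simp
  show "(LINT z|meas m. quad z) <= \<delta> * w3 m + (1 + 2 / \<delta>\<^sup>2)" if "0 < \<delta>"
  proof -
    have "(LINT z|meas m. quad z) <= (LINT z|meas m. \<delta> * wt z + (1 + 2 / \<delta>\<^sup>2))"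
      by (rule integral_mono[OF qi i]) (rule quad_le_wt[OF that])
    also have "\<dots> = \<delta> * w3 m + (1 + 2 / \<delta>\<^sup>2)"
      using wi by (simp add: w3_def prob_space)
    finally show ?thesis .
  qed
  have nq: "(\<integral>\<^sup>+ z. ennreal (quad z) \<partial>meas m) = ennreal (LINT z|meas m. quad z)"
    by (rule nn_integral_eq_integral[OF qi]) simp
  have q0: "0 <= (LINT z|meas m. quad z)" by (rule integral_nonneg_AE) simp
  have "norm (fst z) ^ 2 <= quad z" "norm (snd z) ^ 2 <= quad z" for z :: "'a \<times> 'a"
    by (auto simp: quad_def norm_prod_def)
  then have "(\<integral>\<^sup>+ z. ennreal (norm (fst z) ^ 2) \<partial>meas m) <= ennreal (LINT z|meas m. quad z)"
    "(\<integral>\<^sup>+ z. ennreal (norm (snd z) ^ 2) \<partial>meas m) <= ennreal (LINT z|meas m. quad z)"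
    unfolding nq[symmetric] by (auto intro!: nn_integral_mono ennreal_leI)
  then show "E2 (marg1 m) <= (LINT z|meas m. quad z)" "E2 (marg2 m) <= (LINT z|meas m. quad z)"
    unfolding E2_def marg_moment using q0 by (auto intro!: enn2real_leI)
qed

text \<open>With \<open>S\<^sup>2\<close> equal to the integral \<open>e\<close> of
  \<open>quad\<close>, the pointwise bound integrates to \<open>5 (C + D) e\<close>, which
  \<open>good_quad\<close> trades for a small multiple of the third moment. The constant
  \<open>c\<close> is independent of \<open>U\<close>, \<open>t\<close> and
  \<open>m\<close>.\<close>

lemma Zfun_coercive:
  fixes V :: "'a::euclidean_space \<times> 'a P2 => 'a"
  assumes V: "!!y \<mu>. norm (V (y, \<mu>)) <= D * (1 + norm y + sqrt (E2 \<mu>))" "0 <= D" and C: "0 <= C" and d: "0 < \<delta>"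
  shows "\<exists>c\<ge>0. \<forall>U t m. good m --> (\<forall>x \<mu>. norm (U (t, x, \<mu>)) <= C * (1 + norm x + sqrt (E2 \<mu>))) \<longrightarrow>
     \<bar>Zfun U V t m\<bar> <= \<delta> * w3 m + c"
proof -
  define q where "q = \<delta> / (5 * (C + D) + 1)"
  have q: "0 < q" using d C V(2) by (simp add: q_def add_nonneg_pos)
  define c where "c = 5 * (C + D) * (1 + 2 / q\<^sup>2)"
  show ?thesis
  proof (intro exI[of _ c] conjI allI impI)
    show "0 <= c" using C V(2) by (simp add: c_def add_nonneg_nonneg)
    fix U :: "real \<times> 'a \<times> 'a P2 => 'a" and t and m :: "('a \<times> 'a) P2"
    assume g: "good m" and U: "\<forall>x \<mu>. norm (U (t, x, \<mu>)) <= C * (1 + norm x + sqrt (E2 \<mu>))"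
    interpret prob_space "meas m" by simp
    note gq = good_quad[OF g]
    define e where "e = (LINT z|meas m. quad z)"
    have e0: "0 <= e" unfolding e_def by (rule integral_nonneg_AE) simp
    define S where "S = sqrt e"
    have S: "0 <= S" "S\<^sup>2 = e" "sqrt (E2 (marg1 m)) <= S" "sqrt (E2 (marg2 m)) <= S"
      using e0 gq(3,4) by (auto simp: S_def e_def)
    have b: "\<bar>(U (t, fst z, marg1 m) - V (snd z, marg2 m)) \<bullet> (fst z - snd z)\<bar> <= (C + D) * (4 * quad z + S\<^sup>2)" for z
    proof (rule linear_growth_product(1)[OF _ _ S(1) C V(2)])
      have "C * (1 + norm (fst z) + sqrt (E2 (marg1 m))) <= C * (1 + norm (fst z) + S)"
        using S(3) C by (intro mult_left_mono) auto
      then show "norm (U (t, fst z, marg1 m)) <= C * (1 + norm (fst z) + S)" using U order_trans by blast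
      have "D * (1 + norm (snd z) + sqrt (E2 (marg2 m))) <= D * (1 + norm (snd z) + S)"
        using S(4) V(2) by (intro mult_left_mono) auto
      then show "norm (V (snd z, marg2 m)) <= D * (1 + norm (snd z) + S)" using V(1) order_trans by blast
    qed
    have "\<bar>Zfun U V t m\<bar> <= (LINT z|meas m. (C + D) * (4 * quad z + S\<^sup>2))"
      unfolding Zfun_def
      by (rule order_trans[OF integral_abs_bound], rule integral_mono')
        (use gq(1) b in \<open>auto intro!: mult_nonneg_nonneg add_nonneg_nonneg C V(2)\<close>)
    also have "\<dots> = (C + D) * (5 * e)"
      using gq(1) by (simp add: S(2) prob_space flip: e_def)
    also have "\<dots> <= (C + D) * (5 * (q * w3 m + (1 + 2 / q\<^sup>2)))"
      using gq(2)[OF q] C V(2) by (intro mult_left_mono) (auto simp: e_def)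
    also have "\<dots> = (5 * (C + D) * q) * w3 m + c" unfolding c_def by (simp only: ring_distribs mult.assoc add.assoc) (simp add: algebra_simps)
    also have "(5 * (C + D) * q) * w3 m <= \<delta> * w3 m"
    proof (rule mult_right_mono)
      have "5 * (C + D) * q <= (5 * (C + D) + 1) * q" using q by (intro mult_right_mono) auto
      also have "\<dots> = \<delta>" using C V(2) by (simp add: q_def add_nonneg_eq_0_iff)
      finally show "5 * (C + D) * q <= \<delta>" .
      show "0 <= w3 m" unfolding w3_def by (rule integral_nonneg_AE) simp
    qed
    finally show "\<bar>Zfun U V t m\<bar> <= \<delta> * w3 m + c" by simp
  qed
qed

lemma w3_nonneg: "0 <= w3 m"
  unfolding w3_def by (rule integral_nonneg_AE) simp

section \<open>Setwise convergent sequences with bounded entropy and third moment\<close>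

text \<open>Third moments are assumed bounded, not convergent; their convergence is a separate
  hypothesis of \<open>ui_wt\<close>, where integrands of cubic growth are treated.\<close>

locale good_seq =
  fixes m :: "nat => ('a::euclidean_space \<times> 'a) P2" and n :: "('a \<times> 'a) P2" and R :: real
  assumes sw: "setwise (\<lambda>j. meas (m j)) (meas n)" and gm: "!!j. good (m j)" and gn: "good n"
    and w3R: "!!j. w3 (m j) <= R" and entR: "!!j. ent (m j) <= R"
begin

lemma uc: "ucadd (\<lambda>j. meas (m j))"
  by (rule ucadd_good[OF gm w3R entR])

lemma w3nR: "w3 n <= R"
  by (rule entropy_lsc(2)[OF sw gm zero_less_one w3R, of "R + R"])
    (simp add: add_mono[OF entR w3R, simplified] always_eventually)

lemma R0: "0 <= R" using w3_nonneg[of "m 0"] w3R[of 0] by linarith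

lemma nn_wt_le: "good k ==> w3 k <= R ==> (\<integral>\<^sup>+ z. ennreal (wt z) \<partial>meas k) <= ennreal R"
  by (subst nn_integral_eq_integral) (auto simp: good_def w3_def ennreal_leI)

text \<open>Setwise convergence passes to marginals through preimages, and third moments of
  marginals are at most the integral of \<open>wt\<close>, so \<open>P2_tendsto_setwise\<close>
  applies.\<close>

lemma marg_conv: "(\<lambda>j. marg1 (m j)) \<longlonglongrightarrow> marg1 n" "(\<lambda>j. marg2 (m j)) \<longlonglongrightarrow> marg2 n"
proof -
  have w: "(\<integral>\<^sup>+ z. ennreal (wt z) \<partial>meas (m j)) <= ennreal R" "(\<integral>\<^sup>+ z. ennreal (wt z) \<partial>meas n) <= ennreal R" for j
    using nn_wt_le gm gn w3R w3nR by auto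
  have pre: "fst -` A \<in> sets (borel :: ('a \<times> 'a) measure)" "snd -` A \<in> sets (borel :: ('a \<times> 'a) measure)"
    if "A \<in> sets borel" for A :: "'a set"
    using measurable_sets[OF borel_measurable_fst_snd(1) that] measurable_sets[OF borel_measurable_fst_snd(2) that] by simp_all
  have m1: "(\<integral>\<^sup>+ x. ennreal (norm x ^ 3) \<partial>meas (marg1 k)) <= (\<integral>\<^sup>+ z. ennreal (wt z) \<partial>meas k)"
    "(\<integral>\<^sup>+ x. ennreal (norm x ^ 3) \<partial>meas (marg2 k)) <= (\<integral>\<^sup>+ z. ennreal (wt z) \<partial>meas k)" for k :: "('a \<times> 'a) P2"
    unfolding abs_moment_def[symmetric] marg_moment by (auto intro!: nn_integral_mono ennreal_leI simp: wt_def)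
  show "(\<lambda>j. marg1 (m j)) \<longlonglongrightarrow> marg1 n"
  proof (rule P2_tendsto_setwise)
    show "setwise (\<lambda>j. meas (marg1 (m j))) (meas (marg1 n))"
      using sw pre unfolding setwise_def meas_marg1 by (simp add: measure_distr)
  qed (rule order_trans[OF m1(1) w(1)], rule order_trans[OF m1(1) w(2)])
  show "(\<lambda>j. marg2 (m j)) \<longlonglongrightarrow> marg2 n"
  proof (rule P2_tendsto_setwise)
    show "setwise (\<lambda>j. meas (marg2 (m j))) (meas (marg2 n))"
      using sw pre unfolding setwise_def meas_marg2 by (simp add: measure_distr)
  qed (rule order_trans[OF m1(2) w(1)], rule order_trans[OF m1(2) w(2)])
qed

definition SR :: real where "SR = sqrt (R + 3)"

lemma sqrt_E2_le: "sqrt (E2 (marg1 (m j))) <= SR" "sqrt (E2 (marg2 (m j))) <= SR"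
  "sqrt (E2 (marg1 n)) <= SR" "sqrt (E2 (marg2 n)) <= SR" "0 <= SR"
proof -
  have "(LINT z|meas k. quad z) <= R + 3" if "good k" "w3 k <= R" for k :: "('a \<times> 'a) P2"
    using good_quad(2)[OF that(1), of 1] that(2) by simp
  then have "E2 (marg1 k) <= R + 3" "E2 (marg2 k) <= R + 3" if "good k" "w3 k <= R" for k :: "('a \<times> 'a) P2"
    using good_quad(3,4)[OF that(1)] that by (meson order_trans)+
  then show "sqrt (E2 (marg1 (m j))) <= SR" "sqrt (E2 (marg2 (m j))) <= SR"
    "sqrt (E2 (marg1 n)) <= SR" "sqrt (E2 (marg2 n)) <= SR"
    using gm gn w3R w3nR by (auto simp: SR_def)
  show "0 <= SR" using R0 by (simp add: SR_def)
qed

text \<open>By \<open>quad_le_wt\<close> the excess of \<open>K * quad\<close> over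
  \<open>K (1 + 2/\<delta>\<^sup>2)\<close> is at most \<open>K \<delta> wt\<close>, whose integral
  is at most \<open>K \<delta> R\<close>.\<close>

lemma ui_quad:
  assumes K: "0 <= K"
  shows "ui (\<lambda>j. meas (m j)) (\<lambda>z. K * quad z)"
  unfolding ui_def
proof (intro conjI allI impI)
  show "integrable (meas (m j)) (\<lambda>z. K * quad z)" for j using good_quad(1)[OF gm] by simp
  fix e :: real assume e: "0 < e"
  define \<delta> where "\<delta> = e / (K * R + 1)"
  have d: "0 < \<delta>" using e K R0 by (simp add: \<delta>_def add_nonneg_pos)
  show "\<exists>K'. \<forall>\<^sub>F j in sequentially. (LINT z|meas (m j). max 0 (K * quad z - K')) <= e"
  proof (intro exI[of _ "K * (1 + 2 / \<delta>\<^sup>2)"] always_eventually allI)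
    fix j
    have wi: "integrable (meas (m j)) wt" using gm by (simp add: good_def)
    have "(LINT z|meas (m j). max 0 (K * quad z - K * (1 + 2 / \<delta>\<^sup>2))) <= (LINT z|meas (m j). K * \<delta> * wt z)"
    proof (rule integral_mono')
      fix z
      have "K * quad z <= K * (\<delta> * wt z + (1 + 2 / \<delta>\<^sup>2))" by (rule mult_left_mono[OF quad_le_wt[OF d] K])
      then show "max 0 (K * quad z - K * (1 + 2 / \<delta>\<^sup>2)) <= K * \<delta> * wt z"
        using K d by (simp add: algebra_simps)
    qed (use wi K d in auto)
    also have "\<dots> = K * \<delta> * w3 (m j)" by (simp add: w3_def)
    also have "\<dots> <= K * \<delta> * R" using w3R K d by (intro mult_left_mono) auto
    also have "\<dots> <= (K * R + 1) * \<delta>" using d by (simp add: algebra_simps)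
    also have "\<dots> = e" using K R0 by (simp add: \<delta>_def add_nonneg_eq_0_iff)
    finally show "(LINT z|meas (m j). max 0 (K * quad z - K * (1 + 2 / \<delta>\<^sup>2))) <= e" .
  qed
qed

lemma integral_conv_quad:
  assumes h: "!!j. h j \<in> borel_measurable borel" and p: "!!z. (\<lambda>j. h j z) \<longlonglongrightarrow> (f z :: real)"
    and b: "!!j z. \<bar>h j z\<bar> <= K * quad z"
  shows "(\<lambda>j. LINT z|meas (m j). h j z) \<longlonglongrightarrow> (LINT z|meas n. f z)" and "integrable (meas n) f"
    and "integrable (meas (m j)) (h i)" and "f \<in> borel_measurable borel"
proof -
  have "0 <= K" using order_trans[OF abs_ge_zero b[of 0 0]] by (simp add: quad_def)
  note u = ui_quad[OF this]
  show fm: "f \<in> borel_measurable borel" using borel_measurable_LIMSEQ_metric[OF h p] .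
  show "(\<lambda>j. LINT z|meas (m j). h j z) \<longlonglongrightarrow> (LINT z|meas n. f z)" "integrable (meas n) f" "integrable (meas (m j)) (h i)"
    using setwise_integral_pointwise[OF sw uc finb_meas finb_meas h fm p b _ u] by simp_all
qed

text \<open>\<open>U\<close> may change with \<open>j\<close>: this covers the approximating
  solutions and, with constant \<open>U\<close>, their limit.\<close>

lemma Zfun_conv:
  fixes U :: "nat => real \<times> 'a \<times> 'a P2 => 'a"
  assumes Up: "!!x. (\<lambda>j. U j (t j, x, marg1 (m j))) \<longlonglongrightarrow> u (s, x, marg1 n)"
    and Uc: "!!j. continuous_on UNIV (\<lambda>x. U j (t j, x, marg1 (m j)))"
    and Ub: "!!j x. norm (U j (t j, x, marg1 (m j))) <= C * (1 + norm x + sqrt (E2 (marg1 (m j))))"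
    and C: "0 <= C" and Vc: "continuous_on UNIV V"
    and V: "!!y \<mu>. norm (V (y, \<mu>)) <= D * (1 + norm y + sqrt (E2 \<mu>))" "0 <= D"
  shows "(\<lambda>j. Zfun (U j) V (t j) (m j)) \<longlonglongrightarrow> Zfun u V s n"
  unfolding Zfun_def
proof (rule integral_conv_quad(1)[where K = "(C + D) * (3 + SR)"])
  have [measurable]: "(\<lambda>x. U j (t j, x, marg1 (m j))) \<in> borel_measurable borel" for j
    using Uc by (rule borel_measurable_continuous_onI)
  have "continuous_on UNIV (\<lambda>y. V (y, marg2 (m j)))" for j
    by (rule continuous_on_compose2[OF Vc]) (auto intro!: continuous_intros)
  then have [measurable]: "(\<lambda>y. V (y, marg2 (m j))) \<in> borel_measurable borel" for j
    by (rule borel_measurable_continuous_onI)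
  show "(\<lambda>z. (U j (t j, fst z, marg1 (m j)) - V (snd z, marg2 (m j))) \<bullet> (fst z - snd z)) \<in> borel_measurable borel" for j
    by (intro borel_measurable_inner borel_measurable_diff measurable_compose[of fst borel borel "\<lambda>x. U j (t j, x, marg1 (m j))"]
      measurable_compose[of snd borel borel "\<lambda>y. V (y, marg2 (m j))"]) measurable
  show "(\<lambda>j. (U j (t j, fst z, marg1 (m j)) - V (snd z, marg2 (m j))) \<bullet> (fst z - snd z))
     \<longlonglongrightarrow> (u (s, fst z, marg1 n) - V (snd z, marg2 n)) \<bullet> (fst z - snd z)" for z
  proof -
    have "(\<lambda>j. V (snd z, marg2 (m j))) \<longlonglongrightarrow> V (snd z, marg2 n)"
      by (rule continuous_on_tendsto_compose[OF Vc]) (auto intro!: tendsto_Pair marg_conv)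
    then show ?thesis using Up by (intro tendsto_intros) auto
  qed
  show "\<bar>(U j (t j, fst z, marg1 (m j)) - V (snd z, marg2 (m j))) \<bullet> (fst z - snd z)\<bar> <= (C + D) * (3 + SR) * quad z" for j z
  proof (rule linear_growth_product(2)[OF _ _ sqrt_E2_le(5) C V(2)])
    have "C * (1 + norm (fst z) + sqrt (E2 (marg1 (m j)))) <= C * (1 + norm (fst z) + SR)"
      using sqrt_E2_le C by (intro mult_left_mono) auto
    then show "norm (U j (t j, fst z, marg1 (m j))) <= C * (1 + norm (fst z) + SR)" using Ub order_trans by blast
    have "D * (1 + norm (snd z) + sqrt (E2 (marg2 (m j)))) <= D * (1 + norm (snd z) + SR)"
      using sqrt_E2_le V(2) by (intro mult_left_mono) auto
    then show "norm (V (snd z, marg2 (m j))) <= D * (1 + norm (snd z) + SR)" using V(1) order_trans by blast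
  qed
qed

end

section \<open>Coercivity and the direct method\<close>

lemma entropy_lower_bound:
  fixes m :: "('a::euclidean_space \<times> 'a) P2"
  assumes "good m" "0 < \<beta>"
  shows "1 - (LINT z|(lborel :: ('a \<times> 'a) measure). exp (- (\<beta> * wt z))) <= ent m + \<beta> * w3 m"
  using kl_nonneg[OF assms, of "\<lambda>_. 0" 0] by (simp add: kl_def)

definition Jr :: "(real \<times> 'a \<times> 'a P2 => 'a) => ('a \<times> 'a P2 => 'a) => 'a test_fun => real =>
   real => ('a::euclidean_space \<times> 'a) P2 => real" where
  "Jr W V \<phi> \<kappa> t m = Zfun W V t m - psi \<phi> t - (LINT z|meas m. fpart \<phi> z)
     + alpha \<phi> * exp (lam \<phi> * t) * w3 m + \<kappa> * ent m"

lemma objective_Jr: "good m ==> objective W V \<phi> \<kappa> t m = ereal (Jr W V \<phi> \<kappa> t m)"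
  by (simp add: objective_good Jr_def)

lemma linear_growth_nonneg:
  assumes "linear_growth (V :: 'a::euclidean_space \<times> 'a P2 => 'a)"
  shows "\<exists>D\<ge>0. \<forall>y \<mu>. norm (V (y, \<mu>)) <= D * (1 + norm y + sqrt (E2 \<mu>))"
proof -
  obtain D where D: "!!y \<mu>. norm (V (y, \<mu>)) <= D * (1 + norm y + sqrt (E2 \<mu>))"
    using assms unfolding linear_growth_def by blast
  show ?thesis
  proof (intro exI[of _ "max D 0"] conjI allI)
    fix y :: 'a and \<mu> :: "'a P2"
    have "0 <= 1 + norm y + sqrt (E2 \<mu>)" by (simp add: E2_def)
    then have "D * (1 + norm y + sqrt (E2 \<mu>)) <= max D 0 * (1 + norm y + sqrt (E2 \<mu>))"
      by (intro mult_right_mono) auto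
    then show "norm (V (y, \<mu>)) <= max D 0 * (1 + norm y + sqrt (E2 \<mu>))" using D order_trans by blast
  qed simp
qed

text \<open>Uniformity over \<open>U\<close> is the point: a single \<open>c\<close> has to serve
  all \<open>Wn n\<close>, so that bounds on minimisers do not depend on \<open>n\<close>.\<close>

definition coercive_const ::
  "('a \<times> 'a P2 => 'a) => real => real => real => real => ('a::euclidean_space \<times> 'a) P2 => bool" where
  "coercive_const V C a \<kappa> c m \<longleftrightarrow> (\<forall>U \<phi> t B. 0 <= t \<longrightarrow>
     (\<forall>x \<mu>. norm (U (t, x, \<mu>)) <= C * (1 + norm x + sqrt (E2 \<mu>))) --> alpha \<phi> >= a --> lam \<phi> > 0 \<longrightarrow>
     fpart \<phi> \<in> borel_measurable borel --> (\<forall>z. \<bar>fpart \<phi> z\<bar> <= B) \<longrightarrow>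
     (a / 4) * w3 m <= Jr U V \<phi> \<kappa> t m + psi \<phi> t + B + c \<and>
     \<kappa> * ent m <= Jr U V \<phi> \<kappa> t m + psi \<phi> t + B + c + (a / 4) * w3 m)"

lemma coercive_constD:
  assumes "coercive_const V C a \<kappa> c m" "0 <= t" "!!x \<mu>. norm (U (t, x, \<mu>)) <= C * (1 + norm x + sqrt (E2 \<mu>))"
    "alpha \<phi> >= a" "lam \<phi> > 0" "fpart \<phi> \<in> borel_measurable borel" "!!z. \<bar>fpart \<phi> z\<bar> <= B"
  shows "(a / 4) * w3 m <= Jr U V \<phi> \<kappa> t m + psi \<phi> t + B + c"
    "\<kappa> * ent m <= Jr U V \<phi> \<kappa> t m + psi \<phi> t + B + c + (a / 4) * w3 m"
  using assms unfolding coercive_const_def by blast+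

text \<open>Of the coefficient \<open>a\<close> of the third moment one quarter absorbs
  \<open>Zfun\<close> and one half the negative part of the entropy, by the choice
  \<open>\<kappa> * b = a / 2\<close>; the last quarter remains as coercivity.\<close>

lemma coercive_const_exists:
  fixes V :: "'a::euclidean_space \<times> 'a P2 => 'a"
  assumes D: "!!y \<mu>. norm (V (y, \<mu>)) <= D * (1 + norm y + sqrt (E2 \<mu>))" "0 <= D"
    and C: "0 <= C" and a: "0 < a" and k: "0 < \<kappa>"
  shows "\<exists>c. \<forall>m. good m --> coercive_const V C a \<kappa> c m"
proof -
  obtain c where c: "c >= 0" "!!U t m. good m ==> (!!x \<mu>. norm (U (t, x, \<mu>)) <= C * (1 + norm x + sqrt (E2 \<mu>))) ==>
     \<bar>Zfun U V t m\<bar> <= (a / 4) * w3 m + c"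
    using Zfun_coercive[of V D C "a / 4"] D C a by force
  define b where "b = a / (2 * \<kappa>)"
  have b: "0 < b" "\<kappa> * b = a / 2" using a k by (auto simp: b_def)
  define r0 where "r0 = 1 - (LINT z|(lborel :: ('a \<times> 'a) measure). exp (- (b * wt z)))"
  show ?thesis
  proof (rule exI[of _ "c + \<bar>\<kappa> * r0\<bar>"], unfold coercive_const_def, intro allI impI)
    fix m :: "('a \<times> 'a) P2" and U :: "real \<times> 'a \<times> 'a P2 => 'a" and \<phi> :: "'a test_fun" and t B
    assume g: "good m" and t: "0 <= t" and U: "\<forall>x \<mu>. norm (U (t, x, \<mu>)) <= C * (1 + norm x + sqrt (E2 \<mu>))"
      and al: "a <= alpha \<phi>" and la: "0 < lam \<phi>"
      and f: "fpart \<phi> \<in> borel_measurable borel" "\<forall>z. \<bar>fpart \<phi> z\<bar> <= B"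
    interpret prob_space "meas m" by simp
    have w: "0 <= w3 m" by (rule w3_nonneg)
    have Z: "\<bar>Zfun U V t m\<bar> <= (a / 4) * w3 m + c" using c(2)[OF g, of U t] U by blast
    have fi: "integrable (meas m) (fpart \<phi>)" by (rule finb_integrable_bounded[OF finb_meas f(1)]) (use f in auto)
    have "\<bar>(LINT z|meas m. fpart \<phi> z)\<bar> <= (LINT z|meas m. \<bar>fpart \<phi> z\<bar>)" by (rule integral_abs_bound)
    also have "\<dots> <= (LINT z|meas m. B)" by (rule integral_mono) (use fi f in auto)
    finally have F: "\<bar>(LINT z|meas m. fpart \<phi> z)\<bar> <= B" by simp
    have "r0 <= ent m + b * w3 m" unfolding r0_def by (rule entropy_lower_bound[OF g b(1)])
    then have "\<kappa> * r0 <= \<kappa> * (ent m + b * w3 m)" using k by (intro mult_left_mono) auto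
    then have E: "- \<bar>\<kappa> * r0\<bar> <= \<kappa> * ent m + (a / 2) * w3 m" 
      using abs_ge_minus_self[of "\<kappa> * r0"] unfolding distrib_left mult.assoc[symmetric] b(2) by linarith
    have "a * 1 <= alpha \<phi> * exp (lam \<phi> * t)" using al la t a by (intro mult_mono) auto
    then have A: "a * w3 m <= alpha \<phi> * exp (lam \<phi> * t) * w3 m" using w by (intro mult_right_mono) auto
    have A0: "0 <= a * w3 m" using a w by simp
    have q: "a * w3 m = (a / 4) * w3 m + (a / 2) * w3 m + (a / 4) * w3 m" by simp
    show "(a / 4) * w3 m <= Jr U V \<phi> \<kappa> t m + psi \<phi> t + B + (c + \<bar>\<kappa> * r0\<bar>) \<and>
        \<kappa> * ent m <= Jr U V \<phi> \<kappa> t m + psi \<phi> t + B + (c + \<bar>\<kappa> * r0\<bar>) + (a / 4) * w3 m"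
      using Z F E A A0 q unfolding Jr_def abs_le_iff by linarith
  qed
qed

lemma exp_diff_w3_tendsto:
  assumes t: "t \<longlonglongrightarrow> s" and w: "!!j. w3 (m j) <= R"
  shows "(\<lambda>j. (exp (l * t j) - exp (l * s)) * w3 (m j)) \<longlonglongrightarrow> 0"
proof (rule Lim_null_comparison)
  have "(\<lambda>j. exp (l * t j) - exp (l * s)) \<longlonglongrightarrow> exp (l * s) - exp (l * s)" by (intro tendsto_intros t)
  then have "(\<lambda>j. \<bar>exp (l * t j) - exp (l * s)\<bar> * R) \<longlonglongrightarrow> \<bar>exp (l * s) - exp (l * s)\<bar> * R"
    by (rule tendsto_mult[OF tendsto_rabs tendsto_const])
  then show "(\<lambda>j. \<bar>exp (l * t j) - exp (l * s)\<bar> * R) \<longlonglongrightarrow> 0"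
    by (simp only: diff_self abs_zero mult_zero_left)
  show "\<forall>\<^sub>F j in sequentially. norm ((exp (l * t j) - exp (l * s)) * w3 (m j)) <= \<bar>exp (l * t j) - exp (l * s)\<bar> * R"
    using w by (auto simp: abs_mult abs_of_nonneg[OF w3_nonneg] intro!: always_eventually mult_left_mono)
qed

text \<open>The direct method. Along a minimising sequence third moments and entropies are bounded
  by coercivity and the times stay away from \<open>T\<close> by \<open>barrier\<close>;
  \<open>Zfun\<close>, \<open>psi\<close> and the bounded part converge, while entropy and cubic
  term are lower semicontinuous together.\<close>

lemma minimiser_exists:
  fixes W :: "real \<times> 'a::euclidean_space \<times> 'a P2 => 'a"
  assumes Wc: "continuous_on ({0..T} \<times> UNIV \<times> UNIV) W"
    and W: "!!t x \<mu>. t \<in> {0..T} ==> norm (W (t, x, \<mu>)) <= C * (1 + norm x + sqrt (E2 \<mu>))" "0 <= C"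
    and Vc: "continuous_on UNIV V"
    and V: "!!y \<mu>. norm (V (y, \<mu>)) <= D * (1 + norm y + sqrt (E2 \<mu>))" "0 <= D"
    and al: "0 < alpha \<phi>" "0 < lam \<phi>" and k: "0 < \<kappa>"
    and f: "fpart \<phi> \<in> borel_measurable borel" "!!z. \<bar>fpart \<phi> z\<bar> <= B"
    and psic: "continuous_on {0..<T} (psi \<phi>)" and psib: "!!t. t \<in> {0..<T} ==> psi \<phi> t <= P"
    and barrier: "!!b. \<exists>\<tau><T. \<forall>t\<in>{0..<T}. b <= psi \<phi> t --> t <= \<tau>"
    and m0: "good (m0 :: ('a \<times> 'a) P2)" and T: "0 < T"
  shows "\<exists>t m. t \<in> {0..<T} \<and> good m \<and> (\<forall>s\<in>{0..<T}. \<forall>\<mu>. objective W V \<phi> \<kappa> t m <= objective W V \<phi> \<kappa> s \<mu>)"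
proof -
  define J where "J = Jr W V \<phi> \<kappa>"
  obtain c where c: "!!m :: ('a \<times> 'a) P2. good m ==> coercive_const V C (alpha \<phi>) \<kappa> c m"
    using coercive_const_exists[OF V W(2) al(1) k] by blast
  have cc: "(alpha \<phi> / 4) * w3 m <= J t m + psi \<phi> t + B + c \<and> \<kappa> * ent m <= J t m + psi \<phi> t + B + c + (alpha \<phi> / 4) * w3 m"
    if "good m" "t \<in> {0..<T}" for t m
    unfolding J_def
    by (intro conjI; rule coercive_constD[OF c[OF that(1)]]) (use that(2) W(1) al f in auto)
  define S where "S = {J t m |t m. t \<in> {0..<T} \<and> good m}"
  have Sne: "S ~= {}" using m0 T unfolding S_def by fastforce
  have low: "- (P + B + c) <= x" if xS: "x \<in> S" for x
  proof -
    obtain t m where x: "x = J t m" "t \<in> {0..<T}" "good m" using xS unfolding S_def by blast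
    have "0 <= (alpha \<phi> / 4) * w3 m" using al w3_nonneg by (intro mult_nonneg_nonneg) auto
    then show ?thesis using cc[OF x(3,2)] psib[OF x(2)] x(1) by linarith
  qed
  then have bd: "bdd_below S" by (rule bdd_belowI)
  define I where "I = Inf S"
  have Ile: "I <= J t m" if "t \<in> {0..<T}" "good m" for t m
    unfolding I_def by (rule cInf_lower[OF _ bd]) (use that in \<open>auto simp: S_def\<close>)
  have "\<exists>t m. t \<in> {0..<T} \<and> good m \<and> J t m < I + inverse (real (Suc j))" for j
  proof -
    have "Inf S < I + inverse (real (Suc j))" by (simp add: I_def)
    then obtain x where "x \<in> S" "x < I + inverse (real (Suc j))" using cInf_lessD[OF Sne] by blast
    then show ?thesis unfolding S_def by blast
  qed
  then obtain t m where tm: "!!j. t j \<in> {0..<T}" "!!j. good (m j)" "!!j. J (t j) (m j) < I + inverse (real (Suc j))"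
    by metis
  have J1: "J (t j) (m j) <= I + 1" for j
  proof -
    have "inverse (real (Suc j)) <= 1" by (simp add: inverse_le_1_iff)
    then show ?thesis using tm(3)[of j] by linarith
  qed
  define R1 where "R1 = (I + 1 + P + B + c) * 4 / alpha \<phi>"
  have w1: "w3 (m j) <= R1" for j
    using cc[OF tm(2)[of j] tm(1)[of j]] J1[of j] psib[OF tm(1), of j] al by (simp add: R1_def field_simps)
  define R2 where "R2 = (I + 1 + P + B + c + (alpha \<phi> / 4) * R1) / \<kappa>"
  have e2: "ent (m j) <= R2" for j
  proof -
    have "(alpha \<phi> / 4) * w3 (m j) <= (alpha \<phi> / 4) * R1" using al w1 by (intro mult_left_mono) auto
    then have "\<kappa> * ent (m j) <= I + 1 + P + B + c + (alpha \<phi> / 4) * R1"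
      using cc[OF tm(2)[of j] tm(1)[of j]] J1[of j] psib[OF tm(1), of j] by linarith
    then show ?thesis using k by (simp add: R2_def pos_le_divide_eq mult.commute)
  qed
  define R where "R = max R1 R2"
  have wR: "w3 (m j) <= R" and eR: "ent (m j) <= R" for j using w1[of j] e2[of j] by (auto simp: R_def)
  have pl: "- (I + 1 + B + c) <= psi \<phi> (t j)" for j
  proof -
    have "0 <= (alpha \<phi> / 4) * w3 (m j)" using al w3_nonneg by (intro mult_nonneg_nonneg) auto
    then show ?thesis using cc[OF tm(2)[of j] tm(1)[of j]] J1[of j] by linarith
  qed
  \<comment> \<open>Bounded values of the functional bound \<open>psi \<phi>\<close> from below
    along the sequence, which by \<open>barrier\<close> keeps the times below some
    \<open>\<tau> < T\<close>.\<close>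
  obtain \<tau> where \<tau>: "\<tau> < T" "!!j. t j <= \<tau>" using barrier[of "- (I + 1 + B + c)"] pl tm(1) by blast
  obtain r n where r: "strict_mono (r::nat=>nat)" "setwise (\<lambda>j. meas (m (r j))) (meas n)" "good n" "w3 n <= R"
    using good_compact[of m R, OF tm(2) wR eR] by blast
  have "seq_compact {0..\<tau>}" using compact_Icc by (simp add: compact_eq_seq_compact_metric)
  moreover have "\<forall>j. t (r j) \<in> {0..\<tau>}" using tm(1) \<tau>(2) by auto
  ultimately obtain s q where q: "s \<in> {0..\<tau>}" "strict_mono (q::nat=>nat)" "((\<lambda>j. t (r j)) \<circ> q) \<longlonglongrightarrow> s"
    by (rule seq_compactE)
  define t' where "t' j = t (r (q j))" for j
  define m' where "m' j = m (r (q j))" for j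
  have t's: "t' \<longlonglongrightarrow> s" using q(3) by (simp add: t'_def[abs_def] comp_def)
  have t'T: "t' j \<in> {0..<T}" and sT: "s \<in> {0..<T}" for j using tm(1) q(1) \<tau>(1) by (auto simp: t'_def)
  interpret good_seq m' n R
    by unfold_locales (use setwise_subseq[OF r(2) q(2)] tm(2) r(3) wR eR in \<open>auto simp: m'_def\<close>)
  have Wt: "continuous_on UNIV (\<lambda>x. W (t, x, \<mu>))" if "t \<in> {0..<T}" for t \<mu>
    by (rule continuous_on_compose2[OF Wc]) (use that in \<open>auto intro!: continuous_intros\<close>)
  have Zl: "(\<lambda>j. Zfun W V (t' j) (m' j)) \<longlonglongrightarrow> Zfun W V s n"
  proof (rule Zfun_conv[OF _ Wt[OF t'T] W(1) W(2) Vc V])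
    show "(\<lambda>j. W (t' j, x, marg1 (m' j))) \<longlonglongrightarrow> W (s, x, marg1 n)" for x
      by (rule continuous_on_tendsto_compose[OF Wc]) (use t'T sT in \<open>auto intro!: tendsto_Pair t's marg_conv always_eventually simp: less_imp_le\<close>)
  qed (use t'T in \<open>auto simp: less_imp_le\<close>)
  have pl': "(\<lambda>j. psi \<phi> (t' j)) \<longlonglongrightarrow> psi \<phi> s"
    by (rule continuous_on_tendsto_compose[OF psic t's sT]) (use t'T in auto)
  have fl: "(\<lambda>j. LINT z|meas (m' j). fpart \<phi> z) \<longlonglongrightarrow> (LINT z|meas n. fpart \<phi> z)"
    by (rule setwise_integral_bounded[OF sw finb_meas finb_meas f])
  have Jl: "(\<lambda>j. J (t' j) (m' j)) \<longlonglongrightarrow> I"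
  proof (rule tendsto_sandwich[where f = "\<lambda>_. I" and h = "\<lambda>j. I + inverse (real (Suc (r (q j))))"])
    have rq: "strict_mono (r \<circ> q)" using r(1) q(2) by (rule strict_mono_o)
    have "(\<lambda>j. I + inverse (real (Suc j))) \<longlonglongrightarrow> I + 0"
      by (intro tendsto_intros LIMSEQ_inverse_real_of_nat)
    from LIMSEQ_subseq_LIMSEQ[OF this rq] show "(\<lambda>j. I + inverse (real (Suc (r (q j))))) \<longlonglongrightarrow> I"
      by (simp add: comp_def)
    show "\<forall>\<^sub>F j in sequentially. I <= J (t' j) (m' j)"
      using Ile t'T gm by auto
    show "\<forall>\<^sub>F j in sequentially. J (t' j) (m' j) <= I + inverse (real (Suc (r (q j))))"
      using tm(3) by (auto simp: t'_def m'_def intro!: always_eventually less_imp_le simp del: of_nat_Suc)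
  qed simp
  \<comment> \<open>Dividing by \<kappa> and freezing the time in the exponential puts entropy and
    cubic term into the combination treated by \<open>entropy_lsc\<close>; the error of freezing
    vanishes by \<open>exp_diff_w3_tendsto\<close>, whence the term
    \<open>alpha \<phi> * 0\<close>.\<close>
  define \<xi> where "\<xi> = alpha \<phi> * exp (lam \<phi> * s) / \<kappa>"
  have \<xi>: "0 < \<xi>" using al k by (simp add: \<xi>_def)
  define L0 where "L0 = (I - Zfun W V s n + psi \<phi> s + (LINT z|meas n. fpart \<phi> z) - alpha \<phi> * 0) / \<kappa>"
  have eq: "ent (m' j) + \<xi> * w3 (m' j) = (J (t' j) (m' j) - Zfun W V (t' j) (m' j) + psi \<phi> (t' j) + (LINT z|meas (m' j). fpart \<phi> z)
      - alpha \<phi> * ((exp (lam \<phi> * t' j) - exp (lam \<phi> * s)) * w3 (m' j))) / \<kappa>" for j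
    using k by (simp add: J_def Jr_def \<xi>_def field_simps)
  have El: "(\<lambda>j. ent (m' j) + \<xi> * w3 (m' j)) \<longlonglongrightarrow> L0"
    unfolding eq L0_def using k by (intro tendsto_intros Jl Zl pl' fl exp_diff_w3_tendsto[OF t's w3R]) auto
  have "ent n + \<xi> * w3 n <= L0"
  proof (rule field_le_epsilon)
    fix e :: real assume "0 < e"
    then have "\<forall>\<^sub>F j in sequentially. ent (m' j) + \<xi> * w3 (m' j) < L0 + e"
      using El by (intro order_tendstoD(2)) auto
    then have "\<forall>\<^sub>F j in sequentially. ent (m' j) + \<xi> * w3 (m' j) <= L0 + e"
      by (rule eventually_mono) simp
    then show "ent n + \<xi> * w3 n <= L0 + e" by (rule entropy_lsc(3)[OF sw gm \<xi> w3R])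
  qed
  then have "\<kappa> * (ent n + \<xi> * w3 n) <= \<kappa> * L0" using k by (intro mult_left_mono) auto
  moreover have "\<kappa> * L0 = I - Zfun W V s n + psi \<phi> s + (LINT z|meas n. fpart \<phi> z)" using k by (simp add: L0_def)
  moreover have "\<kappa> * (ent n + \<xi> * w3 n) = \<kappa> * ent n + alpha \<phi> * exp (lam \<phi> * s) * w3 n"
    using k by (simp add: \<xi>_def distrib_left)
  ultimately have JI: "J s n <= I" unfolding J_def Jr_def by linarith
  show ?thesis
  proof (intro exI[of _ s] exI[of _ n] conjI ballI allI)
    fix u \<mu> assume u: "u \<in> {0..<T}"
    show "objective W V \<phi> \<kappa> s n <= objective W V \<phi> \<kappa> u \<mu>"
    proof (cases "good \<mu>")
      case True
      then show ?thesis using JI Ile[OF u True] objective_Jr[OF gn, of W V \<phi> \<kappa> s] objective_Jr[OF True, of W V \<phi> \<kappa> u]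
        by (simp add: J_def)
    next
      case False
      then show ?thesis using objective_not_good[OF False k al(1)] by simp
    qed
  qed (use sT gn in auto)
qed

section \<open>The weak gradient vanishes where a nonnegative function does\<close>

lemma lborel_integral_translation:
  fixes f :: "'b::euclidean_space => 'c::{banach, second_countable_topology}"
  assumes "f \<in> borel_measurable borel"
  shows "(LINT z|lborel. f (z + a)) = (LINT z|lborel. f z)"
    "integrable lborel (\<lambda>z. f (z + a)) \<longleftrightarrow> integrable lborel f"
proof -
  have d: "lborel = distr lborel borel ((+) a)" by (rule lborel_distr_plus[symmetric])
  show "(LINT z|lborel. f (z + a)) = (LINT z|lborel. f z)"
    by (subst (2) d, subst integral_distr) (use assms in \<open>auto simp: add.commute\<close>)
  show "integrable lborel (\<lambda>z. f (z + a)) \<longleftrightarrow> integrable lborel f"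
    by (subst (2) d, subst integrable_distr_eq) (use assms in \<open>auto simp: add.commute\<close>)
qed

text \<open>By regularity \<open>A\<close> lies between a compact \<open>K n\<close> and an open
  \<open>U\<close> whose difference \<open>D\<close> has measure at most \<open>2 * e'\<close>. A
  short enough shift keeps \<open>K n\<close> inside \<open>U\<close>, so the two indicators can
  differ only on \<open>D\<close> and its translate.\<close>

lemma indicator_translation_small:
  fixes A :: "'b::euclidean_space set"
  assumes A: "A \<in> sets borel" "emeasure lborel A < \<infinity>" and e: "0 < e"
  shows "\<exists>d>0. \<forall>v. norm v < d --> (LINT z|lborel. \<bar>indicat_real A (z + v) - indicat_real A z\<bar>) <= e"
proof -
  define e' where "e' = e / 8"
  have e': "0 < e'" using e by (simp add: e'_def)
  obtain U where U: "open U" "A \<subseteq> U" "emeasure lborel (U - A) < ennreal e'"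
    using outer_regular_lborel[OF A(1) e'] by auto
  obtain U' where U': "open U'" "- A \<subseteq> U'" "emeasure lborel (U' - (- A)) < ennreal e'"
    using outer_regular_lborel[of "- A" e'] A(1) e' by auto
  define C where "C = - U'"
  have C: "closed C" "C \<subseteq> A" "A - C = U' - (- A)" using U' by (auto simp: C_def)
  define K where "K n = C \<inter> cball 0 (real n)" for n
  have Kc: "compact (K n)" and KA: "K n \<subseteq> A" for n
    using C by (auto simp: K_def compact_cball closed_Int_compact)
  have Kb: "K n \<in> sets borel" for n using Kc by (simp add: borel_compact)
  have Cb: "C \<in> sets borel" using C by simp
  have "(\<lambda>n. emeasure lborel (A - K n)) \<longlonglongrightarrow> emeasure lborel (\<Inter>n. A - K n)"
  proof (rule Lim_emeasure_decseq)
    show "range (\<lambda>n. A - K n) \<subseteq> sets lborel" using A Kb by auto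
    show "decseq (\<lambda>n. A - K n)" by (rule decseq_SucI) (auto simp: K_def)
    have "emeasure lborel (A - K n) <= emeasure lborel A" for n by (rule emeasure_mono) (use A in auto)
    then show "emeasure lborel (A - K n) ~= \<infinity>" for n using A(2) by (metis infinity_ennreal_def leD top_greatest antisym)
  qed
  moreover have "(\<Inter>n. A - K n) = A - C"
  proof -
    have "\<exists>n. x \<in> K n" if "x \<in> C" for x using that real_arch_simple[of "norm x"] by (auto simp: K_def)
    then show ?thesis by (auto simp: K_def)
  qed
  ultimately have "(\<lambda>n. emeasure lborel (A - K n)) \<longlonglongrightarrow> emeasure lborel (A - C)" by simp
  moreover have "emeasure lborel (A - C) < ennreal e'" using U'(3) C(3) by simp
  ultimately have "\<forall>\<^sub>F n in sequentially. emeasure lborel (A - K n) < ennreal e'" by (rule order_tendstoD)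
  then obtain n where n: "emeasure lborel (A - K n) < ennreal e'" by (auto simp: eventually_sequentially)
  define D where "D = U - K n"
  have Db: "D \<in> sets borel" unfolding D_def using U Kb by auto
  have "emeasure lborel D <= emeasure lborel (U - A) + emeasure lborel (A - K n)"
    by (rule order_trans[OF emeasure_mono emeasure_subadditive]) (use U A Kb in \<open>auto simp: D_def\<close>)
  also have "\<dots> <= ennreal e' + ennreal e'" using U(3) n by (intro add_mono) auto
  also have "\<dots> = ennreal (2 * e')" using e' by (simp flip: ennreal_plus)
  finally have D: "emeasure lborel D <= ennreal (2 * e')" .
  then have Df: "emeasure lborel D < \<infinity>" by (rule le_less_trans) simp
  have Dm: "measure lborel D <= 2 * e'" using D e' by (auto simp: measure_def intro: enn2real_leI)
  obtain d where d: "d > 0" "(\<Union>x\<in>K n. ball x d) \<subseteq> U"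
    using compact_subset_open_imp_ball_epsilon_subset[OF Kc U(1), of n] KA U(2) by blast
  have iD: "integrable lborel (indicat_real D)" using Df Db by (intro integrable_real_indicator) auto
  have mD: "indicat_real D \<in> borel_measurable borel" using Db by simp
  have iD': "integrable lborel (\<lambda>z. indicat_real D (z + v))" for v
    using lborel_integral_translation(2)[OF mD, of v] iD by simp
  show ?thesis
  proof (intro exI[of _ d] conjI allI impI d)
    fix v :: 'b assume v: "norm v < d"
    have iA: "integrable lborel (indicat_real A)" using A by (intro integrable_real_indicator) auto
    have mA: "indicat_real A \<in> borel_measurable borel" using A by simp
    have iA': "integrable lborel (\<lambda>z. indicat_real A (z + v))"
      using lborel_integral_translation(2)[OF mA, of v] iA by simp
    have "(LINT z|lborel. \<bar>indicat_real A (z + v) - indicat_real A z\<bar>) <= (LINT z|lborel. indicat_real D z + indicat_real D (z + v))"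
    proof (rule integral_mono)
      fix z
      have "z \<in> D \<or> z + v \<in> D" if "z + v \<in> A" "z \<notin> A"
      proof (cases "z + v \<in> K n")
        case True
        have "z \<in> ball (z + v) d" using v by (simp add: dist_norm)
        then have "z \<in> U" using d(2) True by blast
        then show ?thesis using that KA[of n] by (auto simp: D_def)
      qed (use that U(2) in \<open>auto simp: D_def\<close>)
      moreover have "z \<in> D \<or> z + v \<in> D" if "z + v \<notin> A" "z \<in> A"
      proof (cases "z \<in> K n")
        case True
        have "z + v \<in> ball z d" using v by (simp add: dist_norm)
        then have "z + v \<in> U" using d(2) True by blast
        then show ?thesis using that KA[of n] by (auto simp: D_def)
      qed (use that U(2) in \<open>auto simp: D_def\<close>)
      ultimately show "\<bar>indicat_real A (z + v) - indicat_real A z\<bar> <= indicat_real D z + indicat_real D (z + v)"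
        by (auto simp: indicator_def)
    qed (use iA iA' iD iD' in auto)
    also have "\<dots> = 2 * measure lborel D"
      using iD iD' lborel_integral_translation(1)[OF mD, of v] by simp
    also have "\<dots> <= e" using Dm e by (simp add: e'_def)
    finally show "(LINT z|lborel. \<bar>indicat_real A (z + v) - indicat_real A z\<bar>) <= e" .
  qed
qed

text \<open>Indicators are handled by \<open>indicator_translation_small\<close>; the property
  passes to sums and to dominated limits because translation is an isometry of L^1.\<close>

lemma L1_translation_continuous:
  fixes f :: "'b::euclidean_space => real"
  assumes "integrable lborel f"
  shows "\<forall>e>0. \<exists>d>0. \<forall>v. norm v < d --> (LINT z|lborel. \<bar>f (z + v) - f z\<bar>) <= e"
  using assms
proof (induction rule: integrable_induct)
  case (base A c)
  show ?case
  proof (intro allI impI)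
    fix e :: real assume e: "0 < e"
    define e' where "e' = e / (\<bar>c\<bar> + 1)"
    have e': "0 < e'" "\<bar>c\<bar> * e' <= e" using e by (auto simp: e'_def field_simps)
    obtain d where d: "d > 0" "!!v. norm v < d ==> (LINT z|lborel. \<bar>indicat_real A (z + v) - indicat_real A z\<bar>) <= e'"
      using indicator_translation_small[of A e'] base e' by auto
    have "(LINT z|lborel. \<bar>indicat_real A (z + v) *\<^sub>R c - indicat_real A z *\<^sub>R c\<bar>) = \<bar>c\<bar> * (LINT z|lborel. \<bar>indicat_real A (z + v) - indicat_real A z\<bar>)" for v
      by (subst integral_mult_right_zero[symmetric]) (auto intro!: Bochner_Integration.integral_cong simp: abs_mult[symmetric] algebra_simps)
    moreover have "\<bar>c\<bar> * (LINT z|lborel. \<bar>indicat_real A (z + v) - indicat_real A z\<bar>) <= e" if "norm v < d" for v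
      using mult_left_mono[OF d(2)[OF that], of "\<bar>c\<bar>"] e'(2) by simp
    ultimately show "\<exists>d>0. \<forall>v. norm v < d --> (LINT z|lborel. \<bar>indicat_real A (z + v) *\<^sub>R c - indicat_real A z *\<^sub>R c\<bar>) <= e"
      using d(1) by (intro exI[of _ d]) simp
  qed
next
  case (add f g)
  note [measurable] = borel_measurable_integrable[OF add.hyps(1)] borel_measurable_integrable[OF add.hyps(2)]
  show ?case
  proof (intro allI impI)
    fix e :: real assume "0 < e"
    then have e: "0 < e / 2" by simp
    obtain d1 where d1: "d1 > 0" "!!v. norm v < d1 ==> (LINT z|lborel. \<bar>f (z + v) - f z\<bar>) <= e / 2" using add.IH(1) e by blast
    obtain d2 where d2: "d2 > 0" "!!v. norm v < d2 ==> (LINT z|lborel. \<bar>g (z + v) - g z\<bar>) <= e / 2" using add.IH(2) e by blast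
    have i: "integrable lborel (\<lambda>z. f (z + v))" "integrable lborel (\<lambda>z. g (z + v))" for v
      using lborel_integral_translation(2)[of f v] lborel_integral_translation(2)[of g v] add.hyps by auto
    show "\<exists>d>0. \<forall>v. norm v < d --> (LINT z|lborel. \<bar>f (z + v) + g (z + v) - (f z + g z)\<bar>) <= e"
    proof (intro exI[of _ "min d1 d2"] conjI allI impI)
      fix v :: 'b assume v: "norm v < min d1 d2"
      have "(LINT z|lborel. \<bar>f (z + v) + g (z + v) - (f z + g z)\<bar>) <= (LINT z|lborel. \<bar>f (z + v) - f z\<bar> + \<bar>g (z + v) - g z\<bar>)"
        by (rule integral_mono) (use i add.hyps in auto)
      also have "\<dots> = (LINT z|lborel. \<bar>f (z + v) - f z\<bar>) + (LINT z|lborel. \<bar>g (z + v) - g z\<bar>)"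
        using i add.hyps by (intro Bochner_Integration.integral_add) auto
      also have "\<dots> <= e" using d1(2)[of v] d2(2)[of v] v by simp
      finally show "(LINT z|lborel. \<bar>f (z + v) + g (z + v) - (f z + g z)\<bar>) <= e" .
    qed (use d1 d2 in auto)
  qed
next
  case (lim f s)
  note [measurable] = borel_measurable_integrable[OF lim.hyps(4)] borel_measurable_integrable[OF lim.hyps(1)]
  show ?case
  proof (intro allI impI)
    fix e :: real assume e: "0 < e"
    have "(\<lambda>i. LINT z|lborel. \<bar>s i z - f z\<bar>) \<longlonglongrightarrow> (LINT z|(lborel :: 'b measure). 0)"
    proof (rule integral_dominated_convergence[where w = "\<lambda>z. 3 * \<bar>f z\<bar>"])
      show "AE z in lborel. (\<lambda>i. \<bar>s i z - f z\<bar>) \<longlonglongrightarrow> 0"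
        using lim.hyps(2) by (auto intro!: tendsto_rabs_zero simp: LIM_zero_iff)
      show "AE z in lborel. norm \<bar>s i z - f z\<bar> <= 3 * \<bar>f z\<bar>" for i
      proof (rule AE_I2)
        fix z
        have "\<bar>s i z\<bar> <= 2 * \<bar>f z\<bar>" using lim.hyps(3)[of z i] by simp
        then show "norm \<bar>s i z - f z\<bar> <= 3 * \<bar>f z\<bar>" unfolding real_norm_def by linarith
      qed
    qed (use lim.hyps in auto)
    then have "\<forall>\<^sub>F i in sequentially. (LINT z|lborel. \<bar>s i z - f z\<bar>) < e / 3"
      using e by (intro order_tendstoD(2)[where y = 0]) auto
    then obtain i where "\<forall>j\<ge>i. (LINT z|lborel. \<bar>s j z - f z\<bar>) < e / 3" unfolding eventually_sequentially by blast
    then have i: "(LINT z|lborel. \<bar>s i z - f z\<bar>) < e / 3" by blast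
    have "0 < e / 3" using e by simp
    then obtain d where d: "d > 0" "!!v. norm v < d ==> (LINT z|lborel. \<bar>s i (z + v) - s i z\<bar>) <= e / 3" using lim.IH by blast
    show "\<exists>d>0. \<forall>v. norm v < d --> (LINT z|lborel. \<bar>f (z + v) - f z\<bar>) <= e"
    proof (intro exI[of _ d] conjI allI impI d)
      fix v :: 'b assume v: "norm v < d"
      have tr: "integrable lborel (\<lambda>z. f (z + v))" "integrable lborel (\<lambda>z. s i (z + v))"
        using lborel_integral_translation(2)[of f v] lborel_integral_translation(2)[of "s i" v] lim.hyps(1,4) by auto
      have t2: "(LINT z|lborel. \<bar>s i (z + v) - f (z + v)\<bar>) = (LINT z|lborel. \<bar>s i z - f z\<bar>)"
        using lborel_integral_translation(1)[of "\<lambda>z. \<bar>s i z - f z\<bar>" v] by simp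
      have "(LINT z|lborel. \<bar>f (z + v) - f z\<bar>) <= (LINT z|lborel. \<bar>s i (z + v) - f (z + v)\<bar> + \<bar>s i (z + v) - s i z\<bar> + \<bar>s i z - f z\<bar>)"
        by (rule integral_mono) (use tr lim.hyps(1,4) in auto)
      also have "\<dots> = (LINT z|lborel. \<bar>s i (z + v) - f (z + v)\<bar>) + (LINT z|lborel. \<bar>s i (z + v) - s i z\<bar>) + (LINT z|lborel. \<bar>s i z - f z\<bar>)"
        using tr lim.hyps(1,4) by simp
      also have "\<dots> <= e" using i t2 d(2)[OF v] by linarith
      finally show "(LINT z|lborel. \<bar>f (z + v) - f z\<bar>) <= e" .
    qed
  qed
qed

section \<open>Smooth functions with compact support\<close>

lemma Ck_Suc_imp: "Ck (Suc k) f ==> Ck k f"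
proof (induction k arbitrary: f)
  case 0
  then obtain f' where "!!x. (f has_derivative f' x) (at x)" by auto
  then have "!!x. isCont f x" using has_derivative_continuous by blast
  then show ?case by (simp add: continuous_at_imp_continuous_on)
next
  case (Suc k)
  then obtain f' where f': "!!x. (f has_derivative f' x) (at x)" "!!v. Ck (Suc k) (\<lambda>x. f' x v)" by fastforce
  then show ?case using Suc.IH by (auto intro!: exI[of _ f'])
qed

lemma Ck_const: "Ck k (\<lambda>_. c)"
proof (induction k arbitrary: c)
  case (Suc k)
  show ?case by (auto intro!: exI[of _ "\<lambda>_ _. 0"] Suc)
qed simp

lemma Ck_add: "Ck k f ==> Ck k g ==> Ck k (\<lambda>x. f x + g x)"
proof (induction k arbitrary: f g)
  case (Suc k)
  obtain f' where f': "!!x. (f has_derivative f' x) (at x)" "!!v. Ck k (\<lambda>x. f' x v)" using Suc.prems by auto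
  obtain g' where g': "!!x. (g has_derivative g' x) (at x)" "!!v. Ck k (\<lambda>x. g' x v)" using Suc.prems by auto
  show ?case unfolding Ck.simps
    by (intro exI[of _ "\<lambda>x v. f' x v + g' x v"] conjI allI has_derivative_add f' g' Suc.IH)
qed (simp add: continuous_on_add)

lemma Ck_mult: "Ck k f ==> Ck k g ==> Ck k (\<lambda>x. f x * g x)"
proof (induction k arbitrary: f g)
  case (Suc k)
  obtain f' where f': "!!x. (f has_derivative f' x) (at x)" "!!v. Ck k (\<lambda>x. f' x v)" using Suc.prems by auto
  obtain g' where g': "!!x. (g has_derivative g' x) (at x)" "!!v. Ck k (\<lambda>x. g' x v)" using Suc.prems by auto
  have c: "Ck k f" "Ck k g" using Suc.prems by (auto intro: Ck_Suc_imp simp del: Ck.simps)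
  show ?case unfolding Ck.simps
    by (intro exI[of _ "\<lambda>x v. f x * g' x v + f' x v * g x"] conjI allI has_derivative_mult f' g' Ck_add Suc.IH c)
qed (simp add: continuous_on_mult)

lemma Ck_inner: "Ck k (\<lambda>x. x \<bullet> i)"
proof (cases k)
  case (Suc j)
  show ?thesis unfolding Suc Ck.simps
    by (intro exI[of _ "\<lambda>_ v. v \<bullet> i"] conjI allI Ck_const has_derivative_inner_left has_derivative_ident)
qed (auto intro!: continuous_intros)

lemma Ck_translate: "Ck k f ==> Ck k (\<lambda>x. f (x - a))"
proof (induction k arbitrary: f)
  case 0
  have c: "continuous_on UNIV f" using 0 by simp
  have "continuous_on UNIV (\<lambda>x. f (x - a))"
    by (rule continuous_on_compose2[OF c]) (auto intro!: continuous_intros)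
  then show ?case by simp
next
  case (Suc k)
  obtain f' where f': "!!x. (f has_derivative f' x) (at x)" "!!v. Ck k (\<lambda>x. f' x v)" using Suc.prems by auto
  have "((\<lambda>x. f (x - a)) has_derivative f' (x - a)) (at x)" for x
  proof -
    have "((\<lambda>x. x - a) has_derivative (\<lambda>h. h)) (at x)" by (auto intro!: derivative_eq_intros)
    from has_derivative_compose[OF this f'(1)] show ?thesis by simp
  qed
  then show ?case using Suc.IH[OF f'(2)] unfolding Ck.simps by (intro exI[of _ "\<lambda>x. f' (x - a)"]) auto
qed

lemma Ck_logistic: "Ck k (\<lambda>x::'b::euclidean_space. logistic (c * (x \<bullet> i) + d))"
proof (induction k)
  case 0
  have "continuous_on UNIV (\<lambda>x::'b. logistic (c * (x \<bullet> i) + d))"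
    by (rule continuous_on_compose2[OF continuous_logistic[of UNIV]]) (auto intro!: continuous_intros)
  then show ?case by simp
next
  case (Suc k)
  define l where "l x = logistic (c * (x \<bullet> i) + d)" for x :: 'b
  have "(l has_derivative (\<lambda>h. (l x * (1 + (-1) * l x)) * (c * (h \<bullet> i)))) (at x)" for x
  proof -
    have "(logistic has_derivative (\<lambda>h. h * (l x * (1 - l x)))) (at (c * (x \<bullet> i) + d))"
      unfolding l_def using logistic_has_derivative by (simp add: has_field_derivative_def mult_commute_abs)
    moreover have "((\<lambda>x. c * (x \<bullet> i) + d) has_derivative (\<lambda>h. c * (h \<bullet> i))) (at x)"
      by (auto intro!: derivative_eq_intros)
    ultimately have "((\<lambda>x. logistic (c * (x \<bullet> i) + d)) has_derivative (\<lambda>h. (c * (h \<bullet> i)) * (l x * (1 - l x)))) (at x)"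
      by (rule has_derivative_compose[rotated])
    then show ?thesis by (simp add: l_def[abs_def] mult.commute)
  qed
  moreover have "Ck k (\<lambda>x. (l x * (1 + (-1) * l x)) * (c * (v \<bullet> i)))" for v
    using Suc unfolding l_def by (intro Ck_mult Ck_add Ck_const)
  ultimately show ?case unfolding Ck.simps l_def[abs_def] by (intro exI[of _ "\<lambda>x h. (l x * (1 + (-1) * l x)) * (c * (h \<bullet> i))"]) (auto simp: l_def)
qed

text \<open>A family of flat functions closed under differentiation; \<open>bump 1\<close> is \<open>exp (-1/s)\<close>.\<close>

definition bump :: "real poly => real => real" where
  "bump P s = (if 0 < s then poly P (1 / s) * exp (- (1 / s)) else 0)"

lemma poly_exp_tendsto: "((\<lambda>t::real. t ^ n * poly P t * exp (- t)) \<longlongrightarrow> 0) at_top"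
proof (induction P arbitrary: n)
  case (pCons a P)
  have "((\<lambda>t. a * (t ^ n / exp t) + t ^ Suc n * poly P t * exp (- t)) \<longlongrightarrow> a * 0 + 0) at_top"
    by (intro tendsto_intros tendsto_power_div_exp_0 pCons)
  then show ?case by (simp add: algebra_simps exp_minus divide_inverse)
qed simp

text \<open>In the variable \<open>t = 1/s\<close> differentiation in \<open>s\<close> is
  \<open>- t\<^sup>2\<close> times differentiation in \<open>t\<close>, which sends
  \<open>P(t) exp (- t)\<close> to \<open>t\<^sup>2 (P - P')(t) exp (- t)\<close>; this is the
  polynomial \<open>[:0, 0, 1:] * (P - pderiv P)\<close>.\<close>

lemma bump_has_derivative:
  "(bump P has_real_derivative bump ([:0, 0, 1:] * (P - pderiv P)) s) (at s)"
proof (cases "s = 0")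
  case s: False
  show ?thesis
  proof (cases "0 < s")
    case True
    have "((\<lambda>s. poly P (1 / s) * exp (- (1 / s))) has_real_derivative
        poly (pderiv P) (1 / s) * (- 1 / s\<^sup>2) * exp (- (1 / s)) + poly P (1 / s) * (exp (- (1 / s)) * (1 / s\<^sup>2))) (at s)"
      using True by (auto intro!: derivative_eq_intros DERIV_chain2[OF poly_DERIV] simp: power2_eq_square field_simps)
    moreover have "poly (pderiv P) (1 / s) * (- 1 / s\<^sup>2) * exp (- (1 / s)) + poly P (1 / s) * (exp (- (1 / s)) * (1 / s\<^sup>2))
        = bump ([:0, 0, 1:] * (P - pderiv P)) s"
      using True by (simp add: bump_def power2_eq_square field_simps)
    ultimately have "((\<lambda>s. poly P (1 / s) * exp (- (1 / s))) has_real_derivative bump ([:0, 0, 1:] * (P - pderiv P)) s) (at s)" by simp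
    then show ?thesis
      by (rule has_field_derivative_transform_within_open[of _ _ _ "{0<..}"]) (use True in \<open>auto simp: bump_def\<close>)
  next
    case False
    have "((\<lambda>_. 0) has_real_derivative 0) (at s)" by simp
    then have "(bump P has_real_derivative 0) (at s)"
      by (rule has_field_derivative_transform_within_open[of _ _ _ "{..<0}"]) (use False s in \<open>auto simp: bump_def\<close>)
    then show ?thesis using False by (simp add: bump_def)
  qed
next
  case True
  \<comment> \<open>At the junction the quotient is zero from the left; from the right it becomes,
    for \<open>t = 1/h\<close>, \<open>t\<close> times a polynomial times
    \<open>exp (- t)\<close>.\<close>
  have "((\<lambda>h. bump P h / h) \<longlongrightarrow> 0) (at 0)"
  proof (rule filterlim_split_at)
    show "((\<lambda>h. bump P h / h) \<longlongrightarrow> 0) (at_left 0)"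
    proof (rule tendsto_eventually)
      show "\<forall>\<^sub>F h in at_left 0. bump P h / h = 0"
        by (auto simp: eventually_at_filter bump_def)
    qed
    have "((\<lambda>t. bump P (inverse t) / inverse t) \<longlongrightarrow> 0) at_top"
    proof (rule Lim_transform_eventually)
      show "((\<lambda>t. t ^ 1 * poly P t * exp (- t)) \<longlongrightarrow> 0) at_top" by (rule poly_exp_tendsto)
      show "\<forall>\<^sub>F t in at_top. t ^ 1 * poly P t * exp (- t) = bump P (inverse t) / inverse t"
        using eventually_gt_at_top[of 0] by eventually_elim (simp add: bump_def field_simps)
    qed
    then show "((\<lambda>h. bump P h / h) \<longlongrightarrow> 0) (at_right 0)"
      by (simp add: filterlim_at_right_to_top)
  qed
  then have "(bump P has_real_derivative 0) (at 0)"
    unfolding DERIV_def using bump_def[of P 0] by simp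
  then show ?thesis using True by (simp add: bump_def)
qed

text \<open>The induction varies \<open>P\<close>, because differentiation stays in the family while
  changing the polynomial.\<close>

lemma Ck_bump:
  assumes g: "!!k. Ck k g"
  shows "Ck k (\<lambda>x. bump P (g x))"
proof (induction k arbitrary: P)
  case 0
  have "continuous_on UNIV (bump P)"
    using bump_has_derivative by (meson DERIV_isCont continuous_at_imp_continuous_on)
  moreover have "continuous_on UNIV g" using g[of 0] by simp
  ultimately have "continuous_on UNIV (\<lambda>x. bump P (g x))" by (rule continuous_on_compose2) auto
  then show ?case by simp
next
  case (Suc k)
  obtain g' where g': "!!x. (g has_derivative g' x) (at x)" "!!v. Ck k (\<lambda>x. g' x v)" using g[of "Suc k"] by auto
  have "((\<lambda>x. bump P (g x)) has_derivative (\<lambda>h. bump ([:0, 0, 1:] * (P - pderiv P)) (g x) * g' x h)) (at x)" for x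
    using has_derivative_compose[OF g'(1)[of x], of "bump P"] bump_has_derivative[of P "g x"]
    by (simp add: has_field_derivative_def)
  then show ?case unfolding Ck.simps
    by (intro exI[of _ "\<lambda>x h. bump ([:0, 0, 1:] * (P - pderiv P)) (g x) * g' x h"] conjI allI Ck_mult Suc.IH g') auto
qed

definition cutoff :: "real => 'b::euclidean_space => real" where
  "cutoff R z = bump 1 (R\<^sup>2 - z \<bullet> z)"

lemma cutoff_Ck: "Ck k (cutoff R :: 'b::euclidean_space => real)"
proof -
  have "Ck k (\<lambda>z::'b. R\<^sup>2 - z \<bullet> z)" for k
  proof (cases k)
    case (Suc j)
    have "((\<lambda>z::'b. R\<^sup>2 - z \<bullet> z) has_derivative (\<lambda>h. (-2) * (z \<bullet> h))) (at z)" for z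
      by (auto intro!: derivative_eq_intros simp: inner_commute)
    then show ?thesis unfolding Suc Ck.simps
      by (intro exI[of _ "\<lambda>z h. (-2) * (z \<bullet> h)"] conjI allI Ck_mult Ck_const Ck_inner)
  qed (auto intro!: continuous_intros)
  then show ?thesis unfolding cutoff_def[abs_def] by (rule Ck_bump)
qed

lemma cutoff_bounds: "0 <= cutoff R z" "cutoff R z <= 1"
  by (auto simp: cutoff_def bump_def)

lemma cutoff_pos: "norm z < R ==> 0 < cutoff R z"
proof -
  assume "norm z < R"
  then have "(norm z)\<^sup>2 < R\<^sup>2" by (intro power_strict_mono) auto
  then show ?thesis by (simp add: cutoff_def bump_def power2_norm_eq_inner)
qed

lemma cutoff_zero: "0 <= R ==> R <= norm z ==> cutoff R z = 0"
  using power_mono[of R "norm z" 2] by (simp add: cutoff_def bump_def power2_norm_eq_inner)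

lemma C_c_infinityI: "(!!k. Ck k \<eta>) ==> (!!z. R <= norm z ==> \<eta> z = 0) ==> C_c_infinity \<eta>"
  unfolding C_c_infinity_def compact_closure bounded_iff by (metis (mono_tags) linear mem_Collect_eq)

lemma C_c_infinity_translate:
  fixes \<eta> :: "'a::euclidean_space => real"
  assumes "C_c_infinity \<eta>"
  shows "C_c_infinity (\<lambda>z. \<eta> (z - a))"
proof -
  have "bounded {z. \<eta> z ~= 0}" using assms by (simp add: C_c_infinity_def compact_closure)
  then obtain R where R: "!!z. \<eta> z ~= 0 ==> norm z <= R" unfolding bounded_iff by blast
  show ?thesis
  proof (rule C_c_infinityI[where R = "R + norm a + 1"])
    show "Ck k (\<lambda>z. \<eta> (z - a))" for k using assms by (intro Ck_translate) (simp add: C_c_infinity_def)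
    fix z :: 'a assume "R + norm a + 1 <= norm z"
    moreover have "norm z <= norm (z - a) + norm a" using norm_triangle_ineq[of "z - a" a] by simp
    ultimately have "R < norm (z - a)" by linarith
    then show "\<eta> (z - a) = 0" using R[of "z - a"] by force
  qed
qed

lemma C_c_infinity_derivative:
  assumes "C_c_infinity \<eta>"
  obtains \<eta>' where "!!z. (\<eta> has_derivative \<eta>' z) (at z)" "!!v. continuous_on UNIV (\<lambda>z. \<eta>' z v)"
    "!!v. \<exists>B. \<forall>z. \<bar>\<eta>' z v\<bar> <= B"
proof -
  have "Ck (Suc 0) \<eta>" and K: "compact (closure {z. \<eta> z ~= 0})" using assms unfolding C_c_infinity_def by blast+
  then obtain \<eta>' where d: "!!z. (\<eta> has_derivative \<eta>' z) (at z)" "!!v. continuous_on UNIV (\<lambda>z. \<eta>' z v)" by auto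
  define K where "K = closure {z. \<eta> z ~= 0}"
  have z: "\<eta>' z = (\<lambda>_. 0)" if "z \<notin> K" for z
  proof -
    have "(\<eta> has_derivative (\<lambda>_. 0)) (at z)"
    proof (rule has_derivative_transform_within_open[where f = "\<lambda>_. 0" and s = "- K"])
      show "0 = \<eta> x" if "x \<in> - K" for x using that closure_subset[of "{z. \<eta> z ~= 0}"] unfolding K_def by force
    qed (use that in \<open>auto simp: K_def\<close>)
    then show ?thesis using has_derivative_unique d(1) by blast
  qed
  have "\<exists>B. \<forall>z. \<bar>\<eta>' z v\<bar> <= B" for v
  proof -
    have "compact ((\<lambda>z. \<eta>' z v) ` K)"
      using K unfolding K_def by (intro compact_continuous_image continuous_on_subset[OF d(2)]) auto
    from compact_imp_bounded[OF this] obtain B where B: "!!z. z \<in> K ==> \<bar>\<eta>' z v\<bar> <= B"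
      unfolding bounded_iff by auto
    have "\<bar>\<eta>' z v\<bar> <= max B 0" for z using B[of z] z[of z] by (cases "z \<in> K") auto
    then show ?thesis by blast
  qed
  then show thesis using that d by blast
qed

section \<open>Weak gradients along one coordinate\<close>

lemma weak_grad_measurable:
  assumes "weak_grad_x p q"
  shows "q \<in> borel_measurable borel"
proof (rule borel_measurable_LIMSEQ_metric)
  show "(\<lambda>z. indicator (cball 0 (real n)) z *\<^sub>R q z) \<in> borel_measurable borel" for n
    using assms unfolding weak_grad_x_def set_integrable_def by (auto dest!: spec[of _ "cball 0 (real n)"] borel_measurable_integrable)
  show "(\<lambda>n. indicator (cball 0 (real n)) z *\<^sub>R q z) \<longlonglongrightarrow> q z" for z
  proof (rule tendsto_eventually)
    obtain N where N: "norm z <= real N" using real_arch_simple by blast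
    show "\<forall>\<^sub>F n in sequentially. indicator (cball 0 (real n)) z *\<^sub>R q z = q z"
      using eventually_ge_at_top[of N] by eventually_elim (use N in \<open>auto simp: indicator_def\<close>)
  qed
qed

lemma integral_grad_fst:
  fixes p :: "'a::euclidean_space \<times> 'a => real"
  assumes p: "integrable lborel p" and b: "b \<in> Basis"
    and d: "!!z. (\<eta> has_derivative \<eta>' z) (at z)" "!!v. continuous_on UNIV (\<lambda>z. \<eta>' z v)" "!!v. \<exists>B. \<forall>z. \<bar>\<eta>' z v\<bar> <= B"
  shows "(LINT z|lborel. p z *\<^sub>R grad (\<lambda>x. \<eta> (x, snd z)) (fst z)) \<bullet> b = (LINT z|lborel. p z * \<eta>' z (b, 0))"
proof -
  have dx: "frechet_derivative (\<lambda>x. \<eta> (x, y)) (at x) c = \<eta>' (x, y) (c, 0)" for x y c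
  proof -
    have "((\<lambda>x. (x, y)) has_derivative (\<lambda>h. (h, 0))) (at x)" by (auto intro!: derivative_eq_intros)
    from has_derivative_compose[OF this d(1)] show ?thesis by (simp add: frechet_derivative_at[symmetric])
  qed
  have gr: "grad (\<lambda>x. \<eta> (x, snd z)) (fst z) = (\<Sum>c\<in>Basis. \<eta>' z (c, 0) *\<^sub>R c)" for z
    unfolding grad_def dx by simp
  have pm [measurable]: "p \<in> borel_measurable borel" using borel_measurable_integrable[OF p] by simp
  have \<eta>'m [measurable]: "(\<lambda>z. \<eta>' z v) \<in> borel_measurable borel" for v using d(2) by (rule borel_measurable_continuous_onI)
  have pi: "integrable lborel (\<lambda>z. p z * \<eta>' z v)" for v
  proof -
    obtain B where B: "!!z. \<bar>\<eta>' z v\<bar> <= B" using d(3) by blast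
    show ?thesis
    proof (rule Bochner_Integration.integrable_bound)
      show "integrable lborel (\<lambda>z. B * p z)" using p by simp
      show "AE z in lborel. norm (p z * \<eta>' z v) <= norm (B * p z)"
      proof (rule AE_I2)
        fix z
        have "\<bar>p z\<bar> * \<bar>\<eta>' z v\<bar> <= \<bar>p z\<bar> * \<bar>B\<bar>" using B[of z] by (intro mult_left_mono) auto
        then show "norm (p z * \<eta>' z v) <= norm (B * p z)" by (simp add: abs_mult mult.commute)
      qed
    qed simp
  qed
  have L: "integrable lborel (\<lambda>z. p z *\<^sub>R (\<Sum>c\<in>Basis. \<eta>' z (c, 0) *\<^sub>R c))"
    unfolding scaleR_sum_right scaleR_scaleR by (intro Bochner_Integration.integrable_sum integrable_scaleR_left pi)
  have "(LINT z|lborel. p z * \<eta>' z (b, 0)) = (LINT z|lborel. (p z *\<^sub>R (\<Sum>c\<in>Basis. \<eta>' z (c, 0) *\<^sub>R c)) \<bullet> b)"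
    using b by (simp add: inner_sum_left_Basis)
  also have "\<dots> = (LINT z|lborel. p z *\<^sub>R (\<Sum>c\<in>Basis. \<eta>' z (c, 0) *\<^sub>R c)) \<bullet> b"
    using L by (intro integral_inner_left) auto
  finally show ?thesis by (simp add: gr)
qed

lemma weak_grad_component:
  fixes p :: "'a::euclidean_space \<times> 'a => real"
  assumes w: "weak_grad_x p q" and p: "integrable lborel p" and \<eta>: "C_c_infinity \<eta>" and b: "b \<in> Basis"
    and d: "!!z. (\<eta> has_derivative \<eta>' z) (at z)" "!!v. continuous_on UNIV (\<lambda>z. \<eta>' z v)" "!!v. \<exists>B. \<forall>z. \<bar>\<eta>' z v\<bar> <= B"
  shows "(LINT z|lborel. p z * \<eta>' z (b, 0)) = - (LINT z|lborel. \<eta> z * (q z \<bullet> b))"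
    and "integrable lborel (\<lambda>z. \<eta> z * (q z \<bullet> b))"
proof -
  define K where "K = closure {z. \<eta> z ~= 0}"
  have K: "compact K" using \<eta> by (simp add: K_def C_c_infinity_def)
  have \<eta>c: "continuous_on UNIV \<eta>" using d(1) by (meson has_derivative_continuous continuous_at_imp_continuous_on)
  have [measurable]: "\<eta> \<in> borel_measurable borel" using \<eta>c by (rule borel_measurable_continuous_onI)
  have [measurable]: "q \<in> borel_measurable borel" by (rule weak_grad_measurable[OF w])
  obtain B where B: "!!z. z \<in> K ==> \<bar>\<eta> z\<bar> <= B"
    using compact_imp_bounded[OF compact_continuous_image[OF continuous_on_subset[OF \<eta>c] K]] unfolding bounded_iff by auto
  have qK: "integrable lborel (\<lambda>z. indicator K z *\<^sub>R q z)"
    using w K unfolding weak_grad_x_def set_integrable_def by blast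
  have Rr: "integrable lborel (\<lambda>z. \<eta> z *\<^sub>R q z)"
  proof (rule Bochner_Integration.integrable_bound)
    show "integrable lborel (\<lambda>z. B *\<^sub>R (indicator K z *\<^sub>R q z))" using qK by (intro integrable_scaleR_right)
    show "AE z in lborel. norm (\<eta> z *\<^sub>R q z) <= norm (B *\<^sub>R (indicator K z *\<^sub>R q z))"
    proof (rule AE_I2)
      fix z
      show "norm (\<eta> z *\<^sub>R q z) <= norm (B *\<^sub>R (indicator K z *\<^sub>R q z))"
      proof (cases "z \<in> K")
        case True
        then show ?thesis using B[OF True] by (auto intro: mult_right_mono)
      next
        case False
        then have "\<eta> z = 0" using closure_subset[of "{z. \<eta> z ~= 0}"] unfolding K_def by force
        then show ?thesis by simp
      qed
    qed
  qed simp
  have "(LINT z|lborel. p z * \<eta>' z (b, 0)) = (LINT z|lborel. p z *\<^sub>R grad (\<lambda>x. \<eta> (x, snd z)) (fst z)) \<bullet> b"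
    by (rule integral_grad_fst[OF p b d, symmetric])
  also have "\<dots> = - ((LINT z|lborel. \<eta> z *\<^sub>R q z) \<bullet> b)"
    unfolding w[unfolded weak_grad_x_def, THEN conjunct2, rule_format, OF \<eta>] by simp
  also have "(LINT z|lborel. \<eta> z *\<^sub>R q z) \<bullet> b = (LINT z|lborel. (\<eta> z *\<^sub>R q z) \<bullet> b)"
    using Rr by (intro integral_inner_left[symmetric]) auto
  finally show "(LINT z|lborel. p z * \<eta>' z (b, 0)) = - (LINT z|lborel. \<eta> z * (q z \<bullet> b))" by simp
  show "integrable lborel (\<lambda>z. \<eta> z * (q z \<bullet> b))" 
    using integrable_inner_left[of b lborel "\<lambda>z. \<eta> z *\<^sub>R q z"] Rr by simp
qed

text \<open>The mean value theorem for \<open>\<Theta> s\<close>, the integral of \<open>p\<close>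
  against the translate of \<eta> by \<open>s\<close> along the coordinate; its derivative tests the
  weak gradient with the translated \<eta>. A change of variables moves the shifts from \<eta> to
  \<open>p\<close> and \<open>q\<close>. The point \<xi> depends on \<eta>, but its size is
  controlled by \<open>h\<close> alone.\<close>

lemma weak_grad_difference:
  fixes p :: "'a::euclidean_space \<times> 'a => real"
  assumes w: "weak_grad_x p q" and p: "integrable lborel p" and \<eta>: "C_c_infinity \<eta>" and b: "b \<in> Basis" and h: "h ~= 0"
  shows "\<exists>\<xi>. \<bar>\<xi>\<bar> <= \<bar>h\<bar> \<and> (LINT z|lborel. p (z + h *\<^sub>R (b, 0)) * \<eta> z) - (LINT z|lborel. p z * \<eta> z)
     = h * (LINT z|lborel. \<eta> z * (q (z + \<xi> *\<^sub>R (b, 0)) \<bullet> b))"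
proof -
  define e :: "'a \<times> 'a" where "e = (b, 0)"
  obtain \<eta>' where d: "!!z. (\<eta> has_derivative \<eta>' z) (at z)" "!!v. continuous_on UNIV (\<lambda>z. \<eta>' z v)"
    "!!v. \<exists>B. \<forall>z. \<bar>\<eta>' z v\<bar> <= B" using C_c_infinity_derivative[OF \<eta>] by blast
  have \<eta>c: "continuous_on UNIV \<eta>" using d(1) by (meson has_derivative_continuous continuous_at_imp_continuous_on)
  have \<eta>m [measurable]: "\<eta> \<in> borel_measurable borel" using \<eta>c by (rule borel_measurable_continuous_onI)
  have \<eta>'m [measurable]: "(\<lambda>z. \<eta>' z v) \<in> borel_measurable borel" for v using d(2) by (rule borel_measurable_continuous_onI)
  have pm [measurable]: "p \<in> borel_measurable borel" using borel_measurable_integrable[OF p] by simp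
  have [measurable]: "q \<in> borel_measurable borel" by (rule weak_grad_measurable[OF w])
  obtain B where B: "!!z. \<bar>\<eta>' z e\<bar> <= B" using d(3) by blast
  have B0: "0 <= B" using B[of 0] by linarith
  have lin: "linear (\<eta>' z)" for z using d(1) has_derivative_linear by blast
  have line: "((\<lambda>s. \<eta> (z - s *\<^sub>R e)) has_real_derivative - \<eta>' (z - s *\<^sub>R e) e) (at s)" for z s
  proof -
    have "((\<lambda>s. z - s *\<^sub>R e) has_derivative (\<lambda>h. - (h *\<^sub>R e))) (at s)" by (auto intro!: derivative_eq_intros)
    from has_derivative_compose[OF this d(1)] have "((\<lambda>s. \<eta> (z - s *\<^sub>R e)) has_derivative (\<lambda>h. \<eta>' (z - s *\<^sub>R e) (- (h *\<^sub>R e)))) (at s)" .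
    moreover have "(\<lambda>h. \<eta>' (z - s *\<^sub>R e) (- (h *\<^sub>R e))) = (*) (- \<eta>' (z - s *\<^sub>R e) e)"
      using lin by (auto simp: linear_neg linear_cmul fun_eq_iff)
    ultimately show ?thesis unfolding has_field_derivative_def by simp
  qed
  have \<eta>b: "\<exists>M. \<forall>z. \<bar>\<eta> z\<bar> <= M"
  proof -
    have K: "compact (closure {z. \<eta> z ~= 0})" using \<eta> by (simp add: C_c_infinity_def)
    obtain M where M: "!!z. z \<in> closure {z. \<eta> z ~= 0} ==> \<bar>\<eta> z\<bar> <= M"
      using compact_imp_bounded[OF compact_continuous_image[OF continuous_on_subset[OF \<eta>c] K]] unfolding bounded_iff by auto
    have "\<bar>\<eta> z\<bar> <= max M 0" for z
      using M[of z] closure_subset[of "{z. \<eta> z ~= 0}"] by (cases "\<eta> z = 0") (auto simp: le_max_iff_disj)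
    then show ?thesis by blast
  qed
  then obtain M where M: "!!z. \<bar>\<eta> z\<bar> <= M" by blast
  have pe: "integrable lborel (\<lambda>z. p z * \<eta> (z - s *\<^sub>R e))" for s
  proof (rule Bochner_Integration.integrable_bound)
    show "integrable lborel (\<lambda>z. M * p z)" using p by simp
    show "AE z in lborel. norm (p z * \<eta> (z - s *\<^sub>R e)) <= norm (M * p z)"
    proof (rule AE_I2)
      fix z
      have "\<bar>p z\<bar> * \<bar>\<eta> (z - s *\<^sub>R e)\<bar> <= \<bar>p z\<bar> * \<bar>M\<bar>" using M[of "z - s *\<^sub>R e"] by (intro mult_left_mono) auto
      then show "norm (p z * \<eta> (z - s *\<^sub>R e)) <= norm (M * p z)" by (simp add: abs_mult mult.commute)
    qed
  qed simp
  define \<Theta> where "\<Theta> s = (LINT z|lborel. p z * \<eta> (z - s *\<^sub>R e))" for s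
  define D where "D s = (LINT z|lborel. \<eta> (z - s *\<^sub>R e) * (q z \<bullet> b))" for s
  have D: "D s = (LINT z|lborel. p z * (- \<eta>' (z - s *\<^sub>R e) e))" for s
  proof -
    have "((\<lambda>z. \<eta> (z - s *\<^sub>R e)) has_derivative \<eta>' (z - s *\<^sub>R e)) (at z)" for z
    proof -
      have "((\<lambda>z. z - s *\<^sub>R e) has_derivative (\<lambda>h. h)) (at z)" by (auto intro!: derivative_eq_intros)
      from has_derivative_compose[OF this d(1)] show ?thesis by simp
    qed
    moreover have "continuous_on UNIV (\<lambda>z. \<eta>' (z - s *\<^sub>R e) v)" for v
      by (rule continuous_on_compose2[OF d(2)]) (auto intro!: continuous_intros)
    moreover have "\<exists>B. \<forall>z. \<bar>\<eta>' (z - s *\<^sub>R e) v\<bar> <= B" for v using d(3) by blast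
    ultimately have "(LINT z|lborel. p z * \<eta>' (z - s *\<^sub>R e) (b, 0)) = - (LINT z|lborel. \<eta> (z - s *\<^sub>R e) * (q z \<bullet> b))"
      by (rule weak_grad_component(1)[OF w p C_c_infinity_translate[OF \<eta>] b])
    then show ?thesis by (simp add: D_def e_def)
  qed
  have "(\<Theta> has_real_derivative D s) (at s)" for s
    unfolding DERIV_def tendsto_at_iff_sequentially
  proof (intro allI impI)
    fix X :: "nat => real" assume X: "\<forall>i. X i \<in> UNIV - {0}" "X \<longlonglongrightarrow> 0"
    have X0: "X i ~= 0" for i using X(1) by auto
    have eq: "(\<Theta> (s + X i) - \<Theta> s) / X i = (LINT z|lborel. p z * ((\<eta> (z - (s + X i) *\<^sub>R e) - \<eta> (z - s *\<^sub>R e)) / X i))" for i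
    proof -
      have "\<Theta> (s + X i) - \<Theta> s = (LINT z|lborel. p z * \<eta> (z - (s + X i) *\<^sub>R e) - p z * \<eta> (z - s *\<^sub>R e))"
        unfolding \<Theta>_def using pe by simp
      then show ?thesis by (simp add: right_diff_distrib flip: integral_divide_zero)
    qed
    have "(\<lambda>i. LINT z|lborel. p z * ((\<eta> (z - (s + X i) *\<^sub>R e) - \<eta> (z - s *\<^sub>R e)) / X i)) \<longlonglongrightarrow> D s"
      unfolding D
    proof (rule integral_dominated_convergence[where w = "\<lambda>z. B * \<bar>p z\<bar>"])
      show "AE z in lborel. (\<lambda>i. p z * ((\<eta> (z - (s + X i) *\<^sub>R e) - \<eta> (z - s *\<^sub>R e)) / X i)) \<longlonglongrightarrow> p z * (- \<eta>' (z - s *\<^sub>R e) e)"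
      proof (rule AE_I2, intro tendsto_intros)
        fix z
        have "\<forall>Y. (\<forall>i. Y i \<in> UNIV - {0}) --> Y \<longlonglongrightarrow> 0 \<longrightarrow>
          ((\<lambda>h. (\<eta> (z - (s + h) *\<^sub>R e) - \<eta> (z - s *\<^sub>R e)) / h) \<circ> Y) \<longlonglongrightarrow> - \<eta>' (z - s *\<^sub>R e) e"
          using line[of z s] unfolding DERIV_def tendsto_at_iff_sequentially .
        then show "(\<lambda>i. (\<eta> (z - (s + X i) *\<^sub>R e) - \<eta> (z - s *\<^sub>R e)) / X i) \<longlonglongrightarrow> - \<eta>' (z - s *\<^sub>R e) e"
          using X unfolding comp_def by blast
      qed
      show "AE z in lborel. norm (p z * ((\<eta> (z - (s + X i) *\<^sub>R e) - \<eta> (z - s *\<^sub>R e)) / X i)) <= B * \<bar>p z\<bar>" for i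
      proof (rule AE_I2)
        fix z
        have "norm (\<eta> (z - (s + X i) *\<^sub>R e) - \<eta> (z - s *\<^sub>R e)) <= B * norm (s + X i - s)"
        proof (rule field_differentiable_bound[where S = UNIV])
          show "((\<lambda>s. \<eta> (z - s *\<^sub>R e)) has_field_derivative - \<eta>' (z - t *\<^sub>R e) e) (at t within UNIV)" for t
            using line by simp
        qed (use B in auto)
        then have "\<bar>(\<eta> (z - (s + X i) *\<^sub>R e) - \<eta> (z - s *\<^sub>R e)) / X i\<bar> <= B"
          using X0[of i] by (simp add: divide_le_eq)
        then have "\<bar>p z\<bar> * \<bar>(\<eta> (z - (s + X i) *\<^sub>R e) - \<eta> (z - s *\<^sub>R e)) / X i\<bar> <= \<bar>p z\<bar> * B"
          by (intro mult_left_mono) auto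
        then show "norm (p z * ((\<eta> (z - (s + X i) *\<^sub>R e) - \<eta> (z - s *\<^sub>R e)) / X i)) <= B * \<bar>p z\<bar>"
          unfolding real_norm_def abs_mult by (simp add: mult.commute)
      qed
      have sm: "(\<lambda>z. \<eta>' (z - s *\<^sub>R e) e) \<in> borel_measurable borel"
        by (rule measurable_compose[OF _ \<eta>'m]) simp
      show "(\<lambda>z. p z * - \<eta>' (z - s *\<^sub>R e) e) \<in> borel_measurable lborel" using sm by simp
    qed (use p in auto)
    then show "((\<lambda>h. (\<Theta> (s + h) - \<Theta> s) / h) \<circ> X) \<longlonglongrightarrow> D s" by (simp add: comp_def eq)
  qed
  then have dT: "!!s. (\<Theta> has_real_derivative D s) (at s)" .
  obtain \<xi> where \<xi>: "\<bar>\<xi>\<bar> <= \<bar>h\<bar>" "\<Theta> h - \<Theta> 0 = h * D \<xi>"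
  proof (cases "0 < h")
    case True
    obtain x where "0 < x" "x < h" "\<Theta> h - \<Theta> 0 = (h - 0) * D x" using MVT2[OF True, of \<Theta> D] dT by blast
    then show thesis by (intro that[of x]) auto
  next
    case False
    then have h0: "h < 0" using h by simp
    obtain x where "h < x" "x < 0" "\<Theta> 0 - \<Theta> h = (0 - h) * D x" using MVT2[OF h0, of \<Theta> D] dT by blast
    then show thesis by (intro that[of x]) auto
  qed
  have t1: "\<Theta> h = (LINT z|lborel. p (z + h *\<^sub>R e) * \<eta> z)"
    unfolding \<Theta>_def using lborel_integral_translation(1)[of "\<lambda>z. p z * \<eta> (z - h *\<^sub>R e)" "h *\<^sub>R e"] by simp
  have t2: "D \<xi> = (LINT z|lborel. \<eta> z * (q (z + \<xi> *\<^sub>R e) \<bullet> b))"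
    unfolding D_def using lborel_integral_translation(1)[of "\<lambda>z. \<eta> (z - \<xi> *\<^sub>R e) * (q z \<bullet> b)" "\<xi> *\<^sub>R e"] by simp
  have t0: "\<Theta> 0 = (LINT z|lborel. p z * \<eta> z)" by (simp add: \<Theta>_def)
  show ?thesis using \<xi> unfolding t1 t2 t0 e_def by blast
qed

lemma smooth_step_class: "step_class {f :: 'b::euclidean_space => real. (\<forall>k. Ck k f) \<and> (\<forall>x. 0 <= f x \<and> f x <= 1)}"
  unfolding step_class_def
proof (intro conjI ballI allI; clarify)
  fix f :: "'b => real" assume f: "\<forall>k. Ck k f" "\<forall>x. 0 <= f x \<and> f x <= 1"
  have "continuous_on UNIV f" using f(1) Ck.simps(1) by blast
  then show "f \<in> borel_measurable borel" by (rule borel_measurable_continuous_onI)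
  have "Ck k (\<lambda>x. 1 + (-1) * f x)" for k using f(1) by (intro Ck_add Ck_mult Ck_const) auto
  then show "(\<forall>k. Ck k (\<lambda>x. 1 - f x)) \<and> (\<forall>x. 0 <= 1 - f x \<and> 1 - f x <= 1)" using f(2) by simp
  fix g :: "'b => real" assume g: "\<forall>k. Ck k g" "\<forall>x. 0 <= g x \<and> g x <= 1"
  show "(\<forall>k. Ck k (\<lambda>x. f x * g x)) \<and> (\<forall>x. 0 <= f x * g x \<and> f x * g x <= 1)"
    using f g by (auto intro: Ck_mult mult_le_one simp del: Ck.simps)
qed (auto intro: Ck_logistic logistic_bounds simp del: Ck.simps)

lemma integrable_mult_bounded:
  fixes f g :: "'b => real"
  assumes "integrable M f" "g \<in> borel_measurable M" "!!x. \<bar>g x\<bar> <= B"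
  shows "integrable M (\<lambda>x. g x * f x)"
proof (rule Bochner_Integration.integrable_bound)
  show "integrable M (\<lambda>x. B * f x)" using assms(1) by simp
  show "AE x in M. norm (g x * f x) <= norm (B * f x)"
  proof (rule AE_I2)
    fix x
    have "\<bar>g x\<bar> <= \<bar>B\<bar>" using assms(3)[of x] by linarith
    then show "norm (g x * f x) <= norm (B * f x)" by (simp add: abs_mult mult_right_mono)
  qed
qed (use assms borel_measurable_integrable[OF assms(1)] in measurable)

text \<open>The logarithmic gradient is \<open>q / p\<close>, read as zero where \<open>p\<close>
  vanishes, so integration by parts against the measure would lose any part of \<open>q\<close>
  living there. At a zero of a nonnegative function the difference quotient has the sign of
  \<open>h\<close>. Choosing for \<open>h\<close> the sign opposite to the component
  \<open>q \<bullet> b\<close> makes quotient and component differ by at least the modulus of the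
  component, whereas the two are close when tested by smooth functions.\<close>

lemma weak_grad_zero:
  fixes p :: "'a::euclidean_space \<times> 'a => real"
  assumes w: "weak_grad_x p q" and p: "integrable lborel p" "!!z. 0 <= p z"
  shows "AE z in lborel. p z = 0 --> q z = 0"
proof -
  have pm [measurable]: "p \<in> borel_measurable borel" using borel_measurable_integrable[OF p(1)] by simp
  have qm [measurable]: "q \<in> borel_measurable borel" by (rule weak_grad_measurable[OF w])
  have main: "AE z in lborel. p z = 0 --> 0 < s * (q z \<bullet> b) --> cutoff (real n) z = 0"
    if b: "b \<in> Basis" and s: "s = 1 \<or> s = - 1" for b n s
  proof -
    define R where "R = real n"
    define e :: "'a \<times> 'a" where "e = (b, 0)"
    have ne: "norm e = 1" using b by (simp add: e_def norm_Pair)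
    define c where "c z = cutoff R z" for z :: "'a \<times> 'a"
    have c0: "0 <= c z" "c z <= 1" for z by (auto simp: c_def cutoff_bounds)
    have cz: "c z = 0" if "R <= norm z" for z using that by (simp add: c_def cutoff_zero R_def)
    have "continuous_on UNIV c" using cutoff_Ck[of 0 R] by (simp add: c_def[abs_def])
    then have cm [measurable]: "c \<in> borel_measurable borel" by (rule borel_measurable_continuous_onI)
    define Q where "Q z = q z \<bullet> b" for z
    have Qm [measurable]: "Q \<in> borel_measurable borel" unfolding Q_def by measurable
    \<comment> \<open>The cutoff lives in the ball of radius \<open>R\<close>, and shifts have
      length at most one, so this truncation is globally integrable and agrees with \<open>Q\<close>
      wherever it is evaluated under the cutoff.\<close>
    define Q1 where "Q1 z = indicator (cball 0 (R + 1)) z * Q z" for z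
    have Q1: "integrable lborel Q1"
    proof -
      have "integrable lborel (\<lambda>z. indicator (cball 0 (R + 1)) z *\<^sub>R q z)"
        using w unfolding weak_grad_x_def set_integrable_def by auto
      then have "integrable lborel (\<lambda>z. (indicator (cball 0 (R + 1)) z *\<^sub>R q z) \<bullet> b)" by (intro integrable_inner_left) auto
      then show ?thesis by (simp add: Q1_def[abs_def] Q_def)
    qed
    have Q1m [measurable]: "Q1 \<in> borel_measurable borel" using borel_measurable_integrable[OF Q1] by simp
    define A where "A = {z. p z = 0 \<and> 0 < s * Q z}"
    have A [measurable]: "A \<in> sets borel" unfolding A_def by measurable
    have cQ: "c z * Q z = c z * Q1 z" for z using cz[of z] by (cases "R <= norm z") (auto simp: Q1_def)
    have icQ: "integrable lborel (\<lambda>z. c z * Q z)"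
      unfolding cQ by (rule integrable_mult_bounded[OF Q1, where B = 1]) (use c0 in auto)
    have small: "(LINT z|lborel. c z * indicator A z * \<bar>Q z\<bar>) <= \<epsilon> + \<epsilon>" if eps: "0 < \<epsilon>" for \<epsilon>
    proof -
      obtain d where d: "d > 0" "!!v. norm v < d ==> (LINT z|lborel. \<bar>Q1 (z + v) - Q1 z\<bar>) <= \<epsilon>"
        using L1_translation_continuous[OF Q1] eps by blast
      \<comment> \<open>The sign is opposite to that of the component on \<open>A\<close>; the size
        is below \<open>d\<close>, for the translation estimate, and at most one, so that shifted
        points stay in the ball of radius \<open>R + 1\<close>.\<close>
      define h where "h = - s * (min d 1 / 2)"
      have h: "h ~= 0" "\<bar>h\<bar> < d" "\<bar>h\<bar> <= 1" using s d(1) by (auto simp: h_def abs_mult)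
      define G where "G z = (p (z + h *\<^sub>R e) - p z) / h - Q z" for z
      have Gm [measurable]: "G \<in> borel_measurable borel" unfolding G_def by measurable
      have pt: "integrable lborel (\<lambda>z. p (z + h *\<^sub>R e))" using lborel_integral_translation(2)[OF pm] p by simp
      have cG: "integrable lborel (\<lambda>z. c z * G z)"
      proof -
        have "integrable lborel (\<lambda>z. c z * (p (z + h *\<^sub>R e) - p z))"
          by (rule integrable_mult_bounded[where B = 1]) (use p pt c0 in auto)
        then have "integrable lborel (\<lambda>z. c z * (p (z + h *\<^sub>R e) - p z) / h - c z * Q z)"
          using icQ by (intro Bochner_Integration.integrable_diff integrable_divide)
        then show ?thesis by (simp add: G_def right_diff_distrib)
      qed
      have fG: "\<bar>(LINT z|lborel. f z * (c z * G z))\<bar> <= \<epsilon>" if f: "!!k. Ck k f" "!!z. 0 <= f z \<and> f z <= 1" for f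
      proof -
        define \<eta> where "\<eta> z = c z * f z" for z
        have fc: "continuous_on UNIV f" using f(1)[of 0] by simp
        then have fm [measurable]: "f \<in> borel_measurable borel" by (rule borel_measurable_continuous_onI)
        have \<eta>m [measurable]: "\<eta> \<in> borel_measurable borel" unfolding \<eta>_def by measurable
        have \<eta>1: "\<bar>\<eta> z\<bar> <= 1" for z using c0[of z] f(2)[of z] by (auto simp: \<eta>_def abs_mult intro: mult_le_one)
        have \<eta>c: "C_c_infinity \<eta>"
        proof (rule C_c_infinityI)
          show "Ck k \<eta>" for k unfolding \<eta>_def[abs_def] c_def by (intro Ck_mult cutoff_Ck f(1))
          show "\<eta> z = 0" if "R <= norm z" for z using cz[OF that] by (simp add: \<eta>_def)
        qed
        obtain \<xi> where \<xi>: "\<bar>\<xi>\<bar> <= \<bar>h\<bar>" "(LINT z|lborel. p (z + h *\<^sub>R e) * \<eta> z) - (LINT z|lborel. p z * \<eta> z)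
            = h * (LINT z|lborel. \<eta> z * Q (z + \<xi> *\<^sub>R e))"
          using weak_grad_difference[OF w p(1) \<eta>c b h(1)] unfolding e_def Q_def by blast
        have nx: "norm (\<xi> *\<^sub>R e) < d" "norm (\<xi> *\<^sub>R e) <= 1" using \<xi>(1) h ne by auto
        have e1: "\<eta> z * Q (z + \<xi> *\<^sub>R e) = \<eta> z * Q1 (z + \<xi> *\<^sub>R e)" "\<eta> z * Q z = \<eta> z * Q1 z" for z
        proof -
          show "\<eta> z * Q (z + \<xi> *\<^sub>R e) = \<eta> z * Q1 (z + \<xi> *\<^sub>R e)"
          proof (cases "R <= norm z")
            case False
            have "norm (z + \<xi> *\<^sub>R e) <= norm z + norm (\<xi> *\<^sub>R e)" by (rule norm_triangle_ineq)
            then have "norm (z + \<xi> *\<^sub>R e) <= R + 1" using False nx(2) by linarith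
            then show ?thesis by (simp add: Q1_def)
          qed (simp add: \<eta>_def cz)
          show "\<eta> z * Q z = \<eta> z * Q1 z" using cQ[of z] by (auto simp: \<eta>_def)
        qed
        have tQ: "integrable lborel (\<lambda>z. Q1 (z + \<xi> *\<^sub>R e))" using lborel_integral_translation(2)[OF Q1m] Q1 by simp
        have i3: "integrable lborel (\<lambda>z. \<eta> z * Q1 (z + \<xi> *\<^sub>R e))" "integrable lborel (\<lambda>z. \<eta> z * Q1 z)"
          "integrable lborel (\<lambda>z. \<eta> z * p (z + h *\<^sub>R e))" "integrable lborel (\<lambda>z. \<eta> z * p z)"
          using tQ Q1 p pt \<eta>1 by (auto intro!: integrable_mult_bounded[where B = 1])
        have "(LINT z|lborel. f z * (c z * G z)) = (LINT z|lborel. (\<eta> z * p (z + h *\<^sub>R e) - \<eta> z * p z) / h - \<eta> z * Q1 z)"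
          unfolding e1(2)[symmetric] by (rule Bochner_Integration.integral_cong) (auto simp: G_def \<eta>_def algebra_simps diff_divide_distrib)
        also have "\<dots> = ((LINT z|lborel. \<eta> z * p (z + h *\<^sub>R e)) - (LINT z|lborel. \<eta> z * p z)) / h - (LINT z|lborel. \<eta> z * Q1 z)"
          using i3 by simp
        also have "((LINT z|lborel. \<eta> z * p (z + h *\<^sub>R e)) - (LINT z|lborel. \<eta> z * p z)) / h = (LINT z|lborel. \<eta> z * Q1 (z + \<xi> *\<^sub>R e))"
          using \<xi>(2) h(1) unfolding e1(1) by (simp add: mult.commute)
        also have "(LINT z|lborel. \<eta> z * Q1 (z + \<xi> *\<^sub>R e)) - (LINT z|lborel. \<eta> z * Q1 z) = (LINT z|lborel. \<eta> z * (Q1 (z + \<xi> *\<^sub>R e) - Q1 z))"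
          using i3 by (simp add: right_diff_distrib)
        finally have eq: "(LINT z|lborel. f z * (c z * G z)) = (LINT z|lborel. \<eta> z * (Q1 (z + \<xi> *\<^sub>R e) - Q1 z))" .
        have "\<bar>(LINT z|lborel. \<eta> z * (Q1 (z + \<xi> *\<^sub>R e) - Q1 z))\<bar> <= (LINT z|lborel. \<bar>\<eta> z * (Q1 (z + \<xi> *\<^sub>R e) - Q1 z)\<bar>)"
          by (rule integral_abs_bound)
        also have "\<dots> <= (LINT z|lborel. \<bar>Q1 (z + \<xi> *\<^sub>R e) - Q1 z\<bar>)"
        proof (rule integral_mono)
          show "integrable lborel (\<lambda>z. \<bar>\<eta> z * (Q1 (z + \<xi> *\<^sub>R e) - Q1 z)\<bar>)" using i3 by (simp add: right_diff_distrib)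
          show "integrable lborel (\<lambda>z. \<bar>Q1 (z + \<xi> *\<^sub>R e) - Q1 z\<bar>)" using tQ Q1 by simp
          fix z
          have "\<bar>\<eta> z\<bar> * \<bar>Q1 (z + \<xi> *\<^sub>R e) - Q1 z\<bar> <= 1 * \<bar>Q1 (z + \<xi> *\<^sub>R e) - Q1 z\<bar>" using \<eta>1 by (intro mult_right_mono) auto
          then show "\<bar>\<eta> z * (Q1 (z + \<xi> *\<^sub>R e) - Q1 z)\<bar> <= \<bar>Q1 (z + \<xi> *\<^sub>R e) - Q1 z\<bar>" by (simp add: abs_mult)
        qed
        also have "\<dots> <= \<epsilon>" by (rule d(2)[OF nx(1)])
        finally show ?thesis by (simp add: eq)
      qed
      \<comment> \<open>The indicator of \<open>A\<close> is approximated with respect to a measure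
        that depends on \<open>h\<close>; this is consistent because the bound \<open>fG\<close> is
        uniform over all admissible \<open>f\<close>.\<close>
      define \<mu> where "\<mu> = density lborel (\<lambda>z. ennreal \<bar>c z * G z\<bar>)"
      have fb: "finb \<mu>"
        unfolding finb_def
      proof
        have "emeasure \<mu> UNIV = (\<integral>\<^sup>+ z. ennreal \<bar>c z * G z\<bar> \<partial>lborel)"
          unfolding \<mu>_def by (subst emeasure_density) auto
        also have "\<dots> < \<infinity>" using cG by (subst nn_integral_eq_integral) auto
        finally show "finite_measure \<mu>" by (intro finite_measureI) (auto simp: \<mu>_def)
      qed (simp add: \<mu>_def)
      obtain f where f: "!!k. Ck k f" "!!x. 0 <= f x \<and> f x <= 1" "(LINT x|\<mu>. \<bar>f x - indicator A x\<bar>) < \<epsilon>"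
        using step_class_approx[OF smooth_step_class fb A eps] by auto
      have fc: "continuous_on UNIV f" using f(1)[of 0] by simp
      then have fm [measurable]: "f \<in> borel_measurable borel" by (rule borel_measurable_continuous_onI)
      have i4: "integrable lborel (\<lambda>z. f z * (c z * G z))" "integrable lborel (\<lambda>z. indicator A z * (c z * G z))"
        by (rule integrable_mult_bounded[OF cG, where B = 1]; use f(2) in \<open>auto simp: abs_le_iff indicator_def intro: order_trans\<close>)+
      have "\<bar>(LINT z|lborel. f z * (c z * G z)) - (LINT z|lborel. indicator A z * (c z * G z))\<bar> = \<bar>(LINT z|lborel. (f z - indicator A z) * (c z * G z))\<bar>"
        using i4 by (simp add: left_diff_distrib)
      also have "\<dots> <= (LINT z|lborel. \<bar>(f z - indicator A z) * (c z * G z)\<bar>)" by (rule integral_abs_bound)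
      also have "\<dots> = (LINT x|\<mu>. \<bar>f x - indicator A x\<bar>)"
        unfolding \<mu>_def by (subst integral_density) (auto simp: abs_mult mult.commute)
      also have "\<dots> < \<epsilon>" by (rule f(3))
      finally have "\<bar>(LINT z|lborel. indicator A z * (c z * G z))\<bar> <= \<epsilon> + \<epsilon>" using fG[OF f(1,2)] by linarith
      moreover have "(LINT z|lborel. c z * indicator A z * \<bar>Q z\<bar>) <= (LINT z|lborel. - s * (indicator A z * (c z * G z)))"
      proof (rule integral_mono)
        show "integrable lborel (\<lambda>z. c z * indicator A z * \<bar>Q z\<bar>)"
        proof -
          have "integrable lborel (\<lambda>z. indicator A z * \<bar>c z * Q z\<bar>)"
            by (rule integrable_mult_bounded[where B = 1]) (use icQ in \<open>auto simp: indicator_def\<close>)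
          then show ?thesis using c0 by (simp add: abs_mult mult.commute mult.left_commute)
        qed
        show "integrable lborel (\<lambda>z. - s * (indicator A z * (c z * G z)))" using i4(2) by simp
        fix z
        show "c z * indicator A z * \<bar>Q z\<bar> <= - s * (indicator A z * (c z * G z))"
        proof (cases "z \<in> A")
          case True
          then have z: "p z = 0" "0 < s * Q z" by (auto simp: A_def)
          have "0 <= p (z + h *\<^sub>R e) / (min d 1 / 2)" using p(2) d(1) by (intro divide_nonneg_nonneg) auto
          moreover have "- s * (p (z + h *\<^sub>R e) / h) = p (z + h *\<^sub>R e) / (min d 1 / 2)"
            using s by (auto simp: h_def)
          moreover have "\<bar>Q z\<bar> = s * Q z" using s z(2) by auto
          ultimately have "\<bar>Q z\<bar> <= - s * G z" using z(1) by (simp add: G_def right_diff_distrib)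
          then have "c z * \<bar>Q z\<bar> <= c z * (- s * G z)" using c0 by (intro mult_left_mono) auto
          then show ?thesis using True by (simp add: mult.left_commute)
        qed simp
      qed
      moreover have "(LINT z|lborel. - s * (indicator A z * (c z * G z))) <= \<bar>(LINT z|lborel. indicator A z * (c z * G z))\<bar>"
        using s by auto
      ultimately show ?thesis by linarith
    qed
    have iA: "integrable lborel (\<lambda>z. c z * indicator A z * \<bar>Q z\<bar>)"
    proof -
      have "integrable lborel (\<lambda>z. indicator A z * \<bar>c z * Q z\<bar>)"
        by (rule integrable_mult_bounded[where B = 1]) (use icQ in \<open>auto simp: indicator_def\<close>)
      then show ?thesis using c0 by (simp add: abs_mult mult.commute mult.left_commute)
    qed
    have nnA: "0 <= c z * indicator A z * \<bar>Q z\<bar>" for z using c0 by simp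
    have "(LINT z|lborel. c z * indicator A z * \<bar>Q z\<bar>) <= 0"
    proof (rule field_le_epsilon)
      fix \<epsilon> :: real assume "0 < \<epsilon>"
      then show "(LINT z|lborel. c z * indicator A z * \<bar>Q z\<bar>) <= 0 + \<epsilon>" using small[of "\<epsilon> / 2"] by simp
    qed
    then have "(LINT z|lborel. c z * indicator A z * \<bar>Q z\<bar>) = 0"
      by (rule antisym[OF _ integral_nonneg_AE[OF AE_I2[OF nnA]]])
    then have "AE z in lborel. c z * indicator A z * \<bar>Q z\<bar> = 0"
      using integral_nonneg_eq_0_iff_AE[OF iA AE_I2[OF nnA]] by simp
    then show ?thesis
      by (rule AE_mp) (auto simp: A_def Q_def c_def R_def indicator_def)
  qed
  have "AE z in lborel. \<forall>b\<in>Basis. \<forall>n. \<forall>s\<in>{1, - 1}. p z = 0 --> 0 < s * (q z \<bullet> b) --> cutoff (real n) z = 0"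
    by (intro AE_finite_allI AE_all_countable[THEN iffD2] allI) (auto intro: main)
  then show ?thesis
  proof (rule AE_mp, intro AE_I2 impI)
    fix z assume *: "\<forall>b\<in>Basis. \<forall>n. \<forall>s\<in>{1, - 1}. p z = 0 --> 0 < s * (q z \<bullet> b) --> cutoff (real n) z = 0" and z: "p z = 0"
    obtain n where "norm z < real n" using reals_Archimedean2 by blast
    then have n: "cutoff (real n) z ~= 0" using cutoff_pos[of z "real n"] by simp
    have "q z \<bullet> b = 0" if "b \<in> Basis" for b
    proof -
      have "\<not> 0 < 1 * (q z \<bullet> b)" "\<not> 0 < - 1 * (q z \<bullet> b)" using * that z n by blast+
      then show ?thesis by simp
    qed
    then show "q z = 0" using euclidean_all_zero_iff[of "q z"] by blast
  qed
qed

text \<open>Integration by parts is restated against \<open>m\<close> itself, the form that survives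
  setwise limits. \<open>weak_grad_zero\<close> accounts for the zeros of the density, where
  \<open>g\<close> is zero by division.\<close>

lemma is_grad_x_logD:
  fixes m :: "('a::euclidean_space \<times> 'a) measure"
  assumes g: "is_grad_x_log m g" and fb: "finb m"
  shows "has_leb_density m" "g \<in> borel_measurable borel"
    and "C_c_infinity \<eta> ==> b \<in> Basis ==> (!!z. (\<eta> has_derivative \<eta>' z) (at z)) ==>
       (!!v. continuous_on UNIV (\<lambda>z. \<eta>' z v)) ==> (!!v. \<exists>B. \<forall>z. \<bar>\<eta>' z v\<bar> <= B) ==>
       (LINT z|m. \<eta>' z (b, 0)) = - (LINT z|m. \<eta> z * (g z \<bullet> b))"
proof -
  show hd: "has_leb_density m" using g by (simp add: is_grad_x_log_def)
  define p where "p = leb_density m"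
  obtain q where q: "weak_grad_x p q" "g = (\<lambda>z. q z /\<^sub>R p z)" using g unfolding is_grad_x_log_def p_def by blast
  note P = leb_density_props[OF hd fb, folded p_def]
  have qm [measurable]: "q \<in> borel_measurable borel" by (rule weak_grad_measurable[OF q(1)])
  note [measurable] = P(1)
  show gm [measurable]: "g \<in> borel_measurable borel" unfolding q(2) by measurable
  assume \<eta>: "C_c_infinity \<eta>" "b \<in> Basis" "!!z. (\<eta> has_derivative \<eta>' z) (at z)"
    "!!v. continuous_on UNIV (\<lambda>z. \<eta>' z v)" "!!v. \<exists>B. \<forall>z. \<bar>\<eta>' z v\<bar> <= B"
  have \<eta>'m: "(\<lambda>z. \<eta>' z (b, 0)) \<in> borel_measurable borel" using \<eta>(4) by (rule borel_measurable_continuous_onI)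
  have "continuous_on UNIV \<eta>" using \<eta>(3) by (meson has_derivative_continuous continuous_at_imp_continuous_on)
  then have [measurable]: "\<eta> \<in> borel_measurable borel" by (rule borel_measurable_continuous_onI)
  have ae: "AE z in lborel. \<eta> z * (q z \<bullet> b) = p z *\<^sub>R (\<eta> z * (g z \<bullet> b))"
    using weak_grad_zero[OF q(1) P(4,2)] by (rule AE_mp) (auto simp: q(2))
  have "(LINT z|m. \<eta>' z (b, 0)) = (LINT z|lborel. p z *\<^sub>R \<eta>' z (b, 0))"
    unfolding p_def by (rule leb_density_integral(2)[OF hd fb \<eta>'m])
  also have "\<dots> = - (LINT z|lborel. \<eta> z * (q z \<bullet> b))"
    using weak_grad_component(1)[OF q(1) P(4) \<eta>] by simp
  also have "(LINT z|lborel. \<eta> z * (q z \<bullet> b)) = (LINT z|lborel. p z *\<^sub>R (\<eta> z * (g z \<bullet> b)))"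
    by (rule integral_cong_AE[OF _ _ ae]) measurable
  also have "\<dots> = (LINT z|m. \<eta> z * (g z \<bullet> b))"
    unfolding p_def by (rule leb_density_integral(2)[OF hd fb, symmetric]) measurable
  finally show "(LINT z|m. \<eta>' z (b, 0)) = - (LINT z|m. \<eta> z * (g z \<bullet> b))" .
qed

text \<open>The weak gradient is recovered as \<open>p g\<close>; dividing by \<open>p\<close> again
  changes \<open>g\<close> at most where the density vanishes, an \<open>m\<close>-null set, hence
  the version \<open>g'\<close>.\<close>

lemma is_grad_x_logI:
  fixes m :: "('a::euclidean_space \<times> 'a) measure"
  assumes hd: "has_leb_density m" and fb: "finb m" and gm: "g \<in> borel_measurable borel" and gi: "integrable m g"
    and w: "!!\<eta> \<eta>' b. C_c_infinity \<eta> ==> b \<in> Basis ==> (!!z. (\<eta> has_derivative \<eta>' z) (at z)) ==>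
       (!!v. continuous_on UNIV (\<lambda>z. \<eta>' z v)) ==> (!!v. \<exists>B. \<forall>z. \<bar>\<eta>' z v\<bar> <= B) ==>
       (LINT z|m. \<eta>' z (b, 0)) = - (LINT z|m. \<eta> z * (g z \<bullet> b))"
  shows "\<exists>g'. is_grad_x_log m g' \<and> (AE z in m. g' z = g z) \<and> g' \<in> borel_measurable borel"
proof -
  define p where "p = leb_density m"
  note P = leb_density_props[OF hd fb, folded p_def]
  note [measurable] = P(1) gm
  define q where "q z = p z *\<^sub>R g z" for z
  have qi: "integrable lborel q"
    using gi leb_density_integral(1)[OF hd fb gm] by (simp add: q_def[abs_def] p_def)
  have qm [measurable]: "q \<in> borel_measurable borel" unfolding q_def by measurable
  have "weak_grad_x p q"
    unfolding weak_grad_x_def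
  proof (intro conjI allI impI)
    fix K :: "('a \<times> 'a) set" assume K: "compact K"
    then have KS: "K \<in> sets lborel" by (simp add: borel_compact)
    show "set_integrable lborel K p" "set_integrable lborel K q"
      unfolding set_integrable_def by (rule integrable_mult_indicator[OF KS P(4)], rule integrable_mult_indicator[OF KS qi])
  next
    fix \<eta> :: "'a \<times> 'a => real" assume \<eta>: "C_c_infinity \<eta>"
    obtain \<eta>' where d: "!!z. (\<eta> has_derivative \<eta>' z) (at z)" "!!v. continuous_on UNIV (\<lambda>z. \<eta>' z v)"
      "!!v. \<exists>B. \<forall>z. \<bar>\<eta>' z v\<bar> <= B" using C_c_infinity_derivative[OF \<eta>] by blast
    have \<eta>c: "continuous_on UNIV \<eta>" using d(1) by (meson has_derivative_continuous continuous_at_imp_continuous_on)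
    then have [measurable]: "\<eta> \<in> borel_measurable borel" by (rule borel_measurable_continuous_onI)
    have \<eta>b: "\<exists>M. \<forall>z. \<bar>\<eta> z\<bar> <= M"
    proof -
      have K: "compact (closure {z. \<eta> z ~= 0})" using \<eta> by (simp add: C_c_infinity_def)
      obtain M where M: "!!z. z \<in> closure {z. \<eta> z ~= 0} ==> \<bar>\<eta> z\<bar> <= M"
        using compact_imp_bounded[OF compact_continuous_image[OF continuous_on_subset[OF \<eta>c] K]] unfolding bounded_iff by auto
      have "\<bar>\<eta> z\<bar> <= max M 0" for z
        using M[of z] closure_subset[of "{z. \<eta> z ~= 0}"] by (cases "\<eta> z = 0") (auto simp: le_max_iff_disj)
      then show ?thesis by blast
    qed
    then obtain M where M: "!!z. \<bar>\<eta> z\<bar> <= M" by blast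
    have \<eta>q: "integrable lborel (\<lambda>z. \<eta> z *\<^sub>R q z)"
    proof (rule Bochner_Integration.integrable_bound)
      show "integrable lborel (\<lambda>z. M *\<^sub>R q z)" using qi by simp
      show "AE z in lborel. norm (\<eta> z *\<^sub>R q z) <= norm (M *\<^sub>R q z)"
      proof (rule AE_I2)
        fix z
        have "\<bar>\<eta> z\<bar> <= \<bar>M\<bar>" using M[of z] by linarith
        then show "norm (\<eta> z *\<^sub>R q z) <= norm (M *\<^sub>R q z)" by (simp add: mult_right_mono)
      qed
    qed simp
    show "(LINT z|lborel. p z *\<^sub>R grad (\<lambda>x. \<eta> (x, snd z)) (fst z)) = - (LINT z|lborel. \<eta> z *\<^sub>R q z)"
    proof (rule euclidean_eqI)
      fix b :: 'a assume b: "b \<in> Basis"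
      have \<eta>'m: "(\<lambda>z. \<eta>' z (b, 0)) \<in> borel_measurable borel" using d(2) by (rule borel_measurable_continuous_onI)
      have "(LINT z|lborel. p z *\<^sub>R grad (\<lambda>x. \<eta> (x, snd z)) (fst z)) \<bullet> b = (LINT z|lborel. p z *\<^sub>R \<eta>' z (b, 0))"
        using integral_grad_fst[OF P(4) b d] by simp
      also have "\<dots> = (LINT z|m. \<eta>' z (b, 0))"
        unfolding p_def by (rule leb_density_integral(2)[OF hd fb \<eta>'m, symmetric])
      also have "\<dots> = - (LINT z|m. \<eta> z * (g z \<bullet> b))" by (rule w[OF \<eta> b d])
      also have "(LINT z|m. \<eta> z * (g z \<bullet> b)) = (LINT z|lborel. p z *\<^sub>R (\<eta> z * (g z \<bullet> b)))"
        unfolding p_def by (rule leb_density_integral(2)[OF hd fb]) measurable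
      also have "\<dots> = (LINT z|lborel. (\<eta> z *\<^sub>R q z) \<bullet> b)"
        by (rule Bochner_Integration.integral_cong) (auto simp: q_def)
      also have "\<dots> = (LINT z|lborel. \<eta> z *\<^sub>R q z) \<bullet> b" using \<eta>q by (intro integral_inner_left) auto
      finally show "(LINT z|lborel. p z *\<^sub>R grad (\<lambda>x. \<eta> (x, snd z)) (fst z)) \<bullet> b = - (LINT z|lborel. \<eta> z *\<^sub>R q z) \<bullet> b" by simp
    qed
  qed
  then have "is_grad_x_log m (\<lambda>z. q z /\<^sub>R p z)"
    unfolding is_grad_x_log_def using hd by (auto simp: p_def)
  moreover have "AE z in m. q z /\<^sub>R p z = g z"
    using AE_leb_density_pos[OF hd fb] by (rule AE_mp) (auto simp: q_def p_def)
  moreover have "(\<lambda>z. q z /\<^sub>R p z) \<in> borel_measurable borel" by measurable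
  ultimately show ?thesis by blast
qed

section \<open>Weak limits of logarithmic gradients\<close>

lemma radon_nikodym_real:
  assumes fb: "finb n" "finb \<nu>" and ac: "absolutely_continuous n \<nu>"
  shows "\<exists>f. f \<in> borel_measurable borel \<and> (\<forall>z. 0 <= f z) \<and> integrable n f \<and> \<nu> = density n (\<lambda>z. ennreal (f z))"
proof -
  note [simp] = finbD(2,3,4)[OF fb(1)] finbD(2,3,4)[OF fb(2)]
  interpret n: finite_measure n using fb(1) by (rule finbD)
  interpret \<nu>: finite_measure \<nu> using fb(2) by (rule finbD)
  obtain F where F: "F \<in> borel_measurable n" "density n F = \<nu>" using n.Radon_Nikodym[OF ac] by auto
  have Fm [measurable]: "F \<in> borel_measurable borel" using F(1) by simp
  define f where "f z = enn2real (F z)" for z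
  have fm: "f \<in> borel_measurable borel" unfolding f_def by measurable
  have "(\<integral>\<^sup>+ z. F z \<partial>n) = emeasure \<nu> UNIV"
    unfolding F(2)[symmetric] by (subst emeasure_density) (auto simp: F(1))
  then have fin: "(\<integral>\<^sup>+ z. F z \<partial>n) ~= \<infinity>" by simp
  have "AE z in n. F z ~= \<infinity>" using F(1) fin by (intro nn_integral_noteq_infinite) auto
  then have ae: "AE z in n. ennreal (f z) = F z" by (rule AE_mp) (auto simp: f_def less_top)
  have "density n (\<lambda>z. ennreal (f z)) = density n F"
    by (rule density_cong[OF _ _ ae]) (use fm in auto)
  moreover have "integrable n f"
  proof (rule integrableI_nonneg)
    show "(\<integral>\<^sup>+ z. ennreal (f z) \<partial>n) < \<infinity>" using fin nn_integral_cong_AE[OF ae] by (simp add: less_top)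
  qed (use fm in \<open>auto simp: f_def\<close>)
  ultimately show ?thesis using fm F(2) by (intro exI[of _ f]) (auto simp: f_def)
qed

lemma inner_weighted:
  fixes u g :: "'a::real_inner"
  assumes "0 < \<delta>"
  shows "\<bar>u \<bullet> g\<bar> <= \<delta> * (norm g)\<^sup>2 + (1 / \<delta>) * (norm u)\<^sup>2"
proof -
  have "\<bar>u \<bullet> g\<bar> <= norm u * norm g" by (rule Cauchy_Schwarz_ineq2)
  also have "\<dots> <= \<delta> * (norm g)\<^sup>2 + (1 / \<delta>) * (norm u)\<^sup>2"
  proof -
    define a b where "a = norm u" and "b = norm g"
    have "\<delta> * (\<delta> * b\<^sup>2 + (1 / \<delta>) * a\<^sup>2 - a * b) = (\<delta> * b)\<^sup>2 - (\<delta> * b) * a + a\<^sup>2"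
      using assms by (simp add: algebra_simps power2_eq_square)
    also have "\<dots> = (\<delta> * b - a / 2)\<^sup>2 + (3 / 4) * a\<^sup>2" by (simp add: power2_eq_square algebra_simps)
    also have "\<dots> >= 0" by simp
    finally have "0 <= \<delta> * b\<^sup>2 + (1 / \<delta>) * a\<^sup>2 - a * b" using assms by (simp add: zero_le_mult_iff)
    then show ?thesis by (simp add: a_def b_def)
  qed
  finally show ?thesis .
qed

lemma inner_integral_weighted:
  fixes u g :: "'b::euclidean_space => 'a::euclidean_space"
  assumes fb: "finb M" and m: "u \<in> borel_measurable borel" "g \<in> borel_measurable borel"
    and i: "integrable M (\<lambda>z. (norm (u z))\<^sup>2)" "integrable M (\<lambda>z. (norm (g z))\<^sup>2)"
  shows "integrable M (\<lambda>z. u z \<bullet> g z)"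
    and "0 < \<delta> ==> \<bar>(LINT z|M. u z \<bullet> g z)\<bar> <= \<delta> * (LINT z|M. (norm (g z))\<^sup>2) + (1 / \<delta>) * (LINT z|M. (norm (u z))\<^sup>2)"
proof -
  note [simp] = finbD(2,3,4)[OF fb]
  note [measurable] = m
  have I: "integrable M (\<lambda>z. \<delta> * (norm (g z))\<^sup>2 + (1 / \<delta>) * (norm (u z))\<^sup>2)" for \<delta> using i by simp
  have um: "(\<lambda>z. u z \<bullet> g z) \<in> borel_measurable borel" by measurable
  show ii: "integrable M (\<lambda>z. u z \<bullet> g z)"
    by (rule Bochner_Integration.integrable_bound[OF I[of 1]])
      (use um inner_weighted[of 1] in \<open>auto intro!: AE_I2 order_trans[OF inner_weighted[of 1]]\<close>)
  show "\<bar>(LINT z|M. u z \<bullet> g z)\<bar> <= \<delta> * (LINT z|M. (norm (g z))\<^sup>2) + (1 / \<delta>) * (LINT z|M. (norm (u z))\<^sup>2)" if d: "0 < \<delta>"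
  proof -
    have "\<bar>(LINT z|M. u z \<bullet> g z)\<bar> <= (LINT z|M. \<bar>u z \<bullet> g z\<bar>)" by (rule integral_abs_bound)
    also have "\<dots> <= (LINT z|M. \<delta> * (norm (g z))\<^sup>2 + (1 / \<delta>) * (norm (u z))\<^sup>2)"
      by (rule integral_mono) (use ii I inner_weighted[OF d] in auto)
    finally show ?thesis using i by simp
  qed
qed

text \<open>Tested on all bounded Borel fields, not only continuous ones, so that truncations of the
  limit \<open>g'\<close> and of limits of other fields are admissible.\<close>

definition weak_conv :: "(nat => 'b::euclidean_space measure) => (nat => 'b => 'a::euclidean_space) => 'b measure => ('b => 'a) => bool" where
  "weak_conv \<mu> g \<nu> g' \<longleftrightarrow> (\<forall>v::'b => 'a. v \<in> borel_measurable borel --> (\<exists>B. \<forall>z. norm (v z) <= B) \<longrightarrow>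
     (\<lambda>j. LINT z|\<mu> j. v z \<bullet> g j z) \<longlonglongrightarrow> (LINT z|\<nu>. v z \<bullet> g' z))"

context good_seq
begin

text \<open>The signed parts of each coordinate are densities of finite measures. The Fisher bound
  and \<open>|g| <= \<delta> |g|\<^sup>2 + 1/\<delta>\<close> make these measures uniformly
  countably additive along with \<open>m j\<close>, so setwise limits exist and have densities
  relative to \<open>n\<close>. Their differences form the limit field, and integration by parts, an
  identity between integrals of bounded test functions, passes to the limit.\<close>

lemma grad_limit:
  fixes g :: "nat => 'a \<times> 'a => 'a"
  assumes g: "!!j. is_grad_x_log (meas (m j)) (g j)" and gi: "!!j. integrable (meas (m j)) (\<lambda>z. (norm (g j z))\<^sup>2)"
    and G: "!!j. (LINT z|meas (m j). (norm (g j z))\<^sup>2) <= G"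
  shows "\<exists>r g'. strict_mono (r::nat=>nat) \<and> is_grad_x_log (meas n) g' \<and> g' \<in> borel_measurable borel \<and>
     weak_conv (\<lambda>j. meas (m (r j))) (\<lambda>j. g (r j)) (meas n) g'"
proof -
  have G0: "0 <= G" using order_trans[OF integral_nonneg_AE G[of 0]] by auto
  have gm [measurable]: "g j \<in> borel_measurable borel" for j using is_grad_x_logD(2)[OF g finb_meas] .
  \<comment> \<open>An index is a basis vector with a sign; the two signs select the positive and
    the negative part of that coordinate.\<close>
  define s where "s i j z = max 0 (snd i * (g j z \<bullet> fst i))" for i :: "'a \<times> real" and j z
  define I where "I = (Basis :: 'a set) \<times> {1, - 1 :: real}"
  have sm [measurable]: "s i j \<in> borel_measurable borel" for i j unfolding s_def by measurable
  have s0: "0 <= s i j z" for i j z by (simp add: s_def)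
  have sg: "s i j z <= norm (g j z)" if "i \<in> I" for i j z
  proof -
    have "\<bar>g j z \<bullet> fst i\<bar> <= norm (g j z)" using that Basis_le_norm[of "fst i" "g j z"] by (auto simp: I_def)
    then show ?thesis using that by (auto simp: s_def I_def abs_le_iff)
  qed
  have tq: "t <= \<delta> * t\<^sup>2 + 1 / \<delta>" if "0 < \<delta>" for t \<delta> :: real
    using inner_weighted[OF that, of "1::real" t] by simp
  have si: "integrable (meas (m j)) (s i j)" if "i \<in> I" for i j
  proof (rule Bochner_Integration.integrable_bound)
    show "integrable (meas (m j)) (\<lambda>z. 1 * (norm (g j z))\<^sup>2 + 1 / 1)"
      using gi by (auto simp: finite_measure.integrable_const[OF finbD(1)[OF finb_meas]])
    show "AE z in meas (m j). norm (s i j z) <= norm (1 * (norm (g j z))\<^sup>2 + 1 / 1)"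
    proof (rule AE_I2)
      fix z show "norm (s i j z) <= norm (1 * (norm (g j z))\<^sup>2 + 1 / 1)"
        using sg[OF that, of j z] tq[of 1 "norm (g j z)"] s0[of i j z] by simp
    qed
  qed simp
  define \<mu> where "\<mu> j i = density (meas (m j)) (\<lambda>z. ennreal (s i j z))" for j i
  have \<mu>f: "finb (\<mu> j i)" if "i \<in> I" for i j
    unfolding finb_def
  proof
    have "emeasure (\<mu> j i) UNIV = (\<integral>\<^sup>+ z. ennreal (s i j z) \<partial>meas (m j))"
      unfolding \<mu>_def by (subst emeasure_density) auto
    also have "\<dots> < \<infinity>" using si[OF that] s0 by (subst nn_integral_eq_integral) auto
    finally show "finite_measure (\<mu> j i)" by (intro finite_measureI) (auto simp: \<mu>_def)
  qed (simp add: \<mu>_def)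
  have \<mu>A: "measure (\<mu> j i) A <= \<delta> * G + (1 / \<delta>) * measure (meas (m j)) A"
    if i: "i \<in> I" and A: "A \<in> sets borel" and d: "0 < \<delta>" for i j A \<delta>
  proof -
    interpret prob_space "meas (m j)" by simp
    have iA: "integrable (meas (m j)) (\<lambda>z. indicator A z * s i j z)"
      by (rule integrable_mult_bounded[OF si[OF i], where B = 1]) (use A in \<open>auto simp: indicator_def\<close>)
    have "emeasure (\<mu> j i) A = (\<integral>\<^sup>+ z. ennreal (indicator A z * s i j z) \<partial>meas (m j))"
      unfolding \<mu>_def using A by (subst emeasure_density) (auto intro!: nn_integral_cong simp: indicator_def)
    also have "\<dots> = ennreal (LINT z|meas (m j). indicator A z * s i j z)"
      using iA s0 by (intro nn_integral_eq_integral) (auto simp: indicator_def)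
    finally have "measure (\<mu> j i) A = (LINT z|meas (m j). indicator A z * s i j z)"
      using s0 by (simp add: measure_def indicator_def integral_nonneg_AE)
    also have "\<dots> <= (LINT z|meas (m j). \<delta> * (norm (g j z))\<^sup>2 + (1 / \<delta>) * indicator A z)"
    proof (rule integral_mono[OF iA])
      show "integrable (meas (m j)) (\<lambda>z. \<delta> * (norm (g j z))\<^sup>2 + (1 / \<delta>) * indicator A z)"
        using gi A by (auto simp: emeasure_eq_measure)
      fix z
      show "indicator A z * s i j z <= \<delta> * (norm (g j z))\<^sup>2 + (1 / \<delta>) * indicator A z"
        using sg[OF i, of j z] tq[OF d, of "norm (g j z)"] d by (auto simp: indicator_def)
    qed
    also have "\<dots> = \<delta> * (LINT z|meas (m j). (norm (g j z))\<^sup>2) + (1 / \<delta>) * measure (meas (m j)) A"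
      using gi A by (subst Bochner_Integration.integral_add) (auto simp: emeasure_eq_measure)
    also have "\<dots> <= \<delta> * G + (1 / \<delta>) * measure (meas (m j)) A" using G[of j] d by simp
    finally show ?thesis .
  qed
  have \<mu>uc: "ucadd (\<lambda>j. \<mu> j i)" if i: "i \<in> I" for i
    unfolding ucadd_def
  proof (intro allI impI)
    fix A :: "nat => ('a \<times> 'a) set" and e :: real
    assume A: "range A \<subseteq> sets borel \<and> decseq A \<and> (\<Inter>i. A i) = {}" and e: "0 < e"
    \<comment> \<open>\<open>\<delta> * G\<close> is at most \<open>e/2\<close>, and the threshold
      \<open>\<delta> * e / 2\<close> for the mass of \<open>A k\<close> keeps the other summand
      below \<open>e/2\<close>.\<close>
    define \<delta> where "\<delta> = e / 2 / (G + 1)"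
    have G1: "G + 1 ~= 0" using G0 by linarith
    have d: "0 < \<delta>" using e G0 by (simp add: \<delta>_def)
    have "0 < \<delta> * e / 2" using d e by simp
    from uc[unfolded ucadd_def, rule_format, OF A this] obtain N where N: "!!k j. k >= N ==> measure (meas (m j)) (A k) < \<delta> * e / 2"
      by blast
    show "\<exists>N. \<forall>k\<ge>N. \<forall>j. measure (\<mu> j i) (A k) < e"
    proof (intro exI allI impI)
      fix k j assume k: "k >= N"
      have Ak: "A k \<in> sets borel" using A by auto
      have "(1 / \<delta>) * measure (meas (m j)) (A k) < (1 / \<delta>) * (\<delta> * e / 2)"
        using N[OF k, of j] d by (intro mult_strict_left_mono) auto
      moreover have "(1 / \<delta>) * (\<delta> * e / 2) = e / 2" using d by simp
      moreover have "\<delta> * G <= e / 2"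
      proof -
        have "\<delta> * G <= \<delta> * (G + 1)" using d by simp
        also have "\<dots> = e / 2" using G1 unfolding \<delta>_def by (rule nonzero_eq_divide_eq[THEN iffD1]) simp
        finally show ?thesis .
      qed
      ultimately show "measure (\<mu> j i) (A k) < e" using \<mu>A[OF i Ak d, of j] by linarith
    qed
  qed
  have If: "finite I" by (simp add: I_def)
  have \<mu>U: "measure (\<mu> j i) UNIV <= G + 1" if "i \<in> I" for i j
    using \<mu>A[OF that, of UNIV 1 j] by simp
  obtain r \<nu> where r: "strict_mono (r::nat=>nat)" "!!i. i \<in> I ==> finb (\<nu> i)" "!!i. i \<in> I ==> setwise (\<lambda>j. \<mu> (r j) i) (\<nu> i)"
    using setwise_compact_family[of I \<mu> "G + 1", OF If \<mu>f \<mu>U \<mu>uc] by blast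
  have "\<exists>f. f \<in> borel_measurable borel \<and> (\<forall>z. 0 <= f z) \<and> integrable (meas n) f \<and> \<nu> i = density (meas n) (\<lambda>z. ennreal (f z))" if i: "i \<in> I" for i
  proof (rule radon_nikodym_real[OF finb_meas r(2)[OF i]])
    show "absolutely_continuous (meas n) (\<nu> i)"
      unfolding absolutely_continuous_def
    proof
      fix A assume A: "A \<in> null_sets (meas n)"
      then have Ab: "A \<in> sets borel" and A0: "measure (meas n) A = 0" by (auto simp: measure_def)
      have "measure (\<nu> i) A <= 0 + \<epsilon>" if e: "0 < \<epsilon>" for \<epsilon>
      proof -
        define \<delta> where "\<delta> = \<epsilon> / (G + 1)"
        have d: "0 < \<delta>" using e G0 by (simp add: \<delta>_def)
        have "measure (\<nu> i) A <= \<delta> * G + (1 / \<delta>) * measure (meas n) A"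
        proof (rule LIMSEQ_le)
          show "(\<lambda>j. measure (\<mu> (r j) i) A) \<longlonglongrightarrow> measure (\<nu> i) A" using r(3)[OF i] Ab by (auto simp: setwise_def)
          have "(\<lambda>j. measure (meas (m (r j))) A) \<longlonglongrightarrow> measure (meas n) A"
            using setwise_subseq[OF sw r(1)] Ab by (auto simp: setwise_def)
          then show "(\<lambda>j. \<delta> * G + (1 / \<delta>) * measure (meas (m (r j))) A) \<longlonglongrightarrow> \<delta> * G + (1 / \<delta>) * measure (meas n) A"
            by (intro tendsto_intros)
        qed (use \<mu>A[OF i Ab d] in auto)
        also have "\<dots> <= \<delta> * (G + 1)" using A0 d by simp
        also have "\<dots> = \<epsilon>" using G0 by (simp add: \<delta>_def)
        finally show ?thesis by simp
      qed
      then have "measure (\<nu> i) A <= 0" by (rule field_le_epsilon)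
      then have "measure (\<nu> i) A = 0" by (simp add: measure_le_0_iff)
      then show "A \<in> null_sets (\<nu> i)"
        using Ab finbD(2)[OF r(2)[OF i]] finite_measure.emeasure_eq_measure[OF finbD(1)[OF r(2)[OF i]]] by auto
    qed
  qed
  then obtain f where f: "!!i. i \<in> I ==> f i \<in> borel_measurable borel" "!!i z. i \<in> I ==> 0 <= f i z"
    "!!i. i \<in> I ==> integrable (meas n) (f i)" "!!i. i \<in> I ==> \<nu> i = density (meas n) (\<lambda>z. ennreal (f i z))"
    by metis
  define h where "h z = (\<Sum>b\<in>Basis. (f (b, 1) z - f (b, - 1) z) *\<^sub>R b)" for z
  have bI: "(b, 1) \<in> I" "(b, - 1) \<in> I" if "b \<in> Basis" for b using that by (auto simp: I_def)
  have hm [measurable]: "h \<in> borel_measurable borel"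
    unfolding h_def using f(1) bI by (intro borel_measurable_sum borel_measurable_scaleR borel_measurable_diff borel_measurable_const) auto
  have hi: "integrable (meas n) h"
    unfolding h_def using f(3) bI by (intro Bochner_Integration.integrable_sum integrable_scaleR_left Bochner_Integration.integrable_diff) auto
  have hb: "h z \<bullet> b = f (b, 1) z - f (b, - 1) z" if "b \<in> Basis" for z b
    using that by (simp add: h_def inner_sum_left_Basis)
  have comp: "(\<lambda>j. LINT z|meas (m (r j)). v z * (g (r j) z \<bullet> b)) \<longlonglongrightarrow> (LINT z|meas n. v z * (h z \<bullet> b))"
    and compi: "integrable (meas (m j)) (\<lambda>z. v z * (g j z \<bullet> b))" "integrable (meas n) (\<lambda>z. v z * (h z \<bullet> b))"
    if b: "b \<in> Basis" and v: "v \<in> borel_measurable borel" "!!z. \<bar>v z\<bar> <= B" for v :: "'a \<times> 'a => real" and b B j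
  proof -
    have vi: "integrable (meas (m j)) (\<lambda>z. v z * s i j z)" if "i \<in> I" for i j
      by (rule integrable_mult_bounded[OF si[OF that], where B = B]) (use v in auto)
    have vf: "integrable (meas n) (\<lambda>z. v z * f i z)" if "i \<in> I" for i
      by (rule integrable_mult_bounded[OF f(3)[OF that], where B = B]) (use v in auto)
    have conv: "(\<lambda>j. LINT z|meas (m (r j)). v z * s i (r j) z) \<longlonglongrightarrow> (LINT z|meas n. v z * f i z)" if i: "i \<in> I" for i
    proof -
      have "(\<lambda>j. LINT z|\<mu> (r j) i. v z) \<longlonglongrightarrow> (LINT z|\<nu> i. v z)"
        by (rule setwise_integral_bounded[OF r(3)[OF i] \<mu>f[OF i] r(2)[OF i] v])
      moreover have "(LINT z|\<mu> j i. v z) = (LINT z|meas (m j). v z * s i j z)" for j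
        unfolding \<mu>_def using v s0 by (subst integral_density) (auto simp: mult.commute)
      moreover have "(LINT z|\<nu> i. v z) = (LINT z|meas n. v z * f i z)"
        unfolding f(4)[OF i] using v f(1)[OF i] f(2)[OF i] by (subst integral_density) (auto simp: mult.commute)
      ultimately show ?thesis by simp
    qed
    have dec: "g j z \<bullet> b = s (b, 1) j z - s (b, - 1) j z" for j z by (auto simp: s_def max_def)
    show "integrable (meas (m j)) (\<lambda>z. v z * (g j z \<bullet> b))" "integrable (meas n) (\<lambda>z. v z * (h z \<bullet> b))"
      unfolding dec hb[OF b] right_diff_distrib using vi vf bI[OF b] by auto
    show "(\<lambda>j. LINT z|meas (m (r j)). v z * (g (r j) z \<bullet> b)) \<longlonglongrightarrow> (LINT z|meas n. v z * (h z \<bullet> b))"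
      unfolding dec hb[OF b] right_diff_distrib using vi vf bI[OF b] conv by (auto intro!: tendsto_diff)
  qed
  have wc: "weak_conv (\<lambda>j. meas (m (r j))) (\<lambda>j. g (r j)) (meas n) h"
    unfolding weak_conv_def
  proof (intro allI impI)
    fix v :: "'a \<times> 'a => 'a" assume v: "v \<in> borel_measurable borel" "\<exists>B. \<forall>z. norm (v z) <= B"
    then obtain B where B: "!!z. norm (v z) <= B" by blast
    have vb: "(\<lambda>z. v z \<bullet> b) \<in> borel_measurable borel" "\<bar>v z \<bullet> b\<bar> <= B" if "b \<in> Basis" for z b
      using v(1) order_trans[OF Basis_le_norm[OF that] B] by auto
    have e1: "(LINT z|meas (m j). v z \<bullet> g j z) = (\<Sum>b\<in>Basis. LINT z|meas (m j). (v z \<bullet> b) * (g j z \<bullet> b))" for j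
      by (rule trans[OF Bochner_Integration.integral_cong[OF refl euclidean_inner] Bochner_Integration.integral_sum])
        (rule compi(1)[OF _ vb])
    have e2: "(LINT z|meas n. v z \<bullet> h z) = (\<Sum>b\<in>Basis. LINT z|meas n. (v z \<bullet> b) * (h z \<bullet> b))"
      by (rule trans[OF Bochner_Integration.integral_cong[OF refl euclidean_inner] Bochner_Integration.integral_sum])
        (rule compi(2)[OF _ vb])
    show "(\<lambda>j. LINT z|meas (m (r j)). v z \<bullet> g (r j) z) \<longlonglongrightarrow> (LINT z|meas n. v z \<bullet> h z)"
      unfolding e1 e2 by (rule tendsto_sum, rule comp[OF _ vb])
  qed
  have "\<exists>g'. is_grad_x_log (meas n) g' \<and> (AE z in meas n. g' z = h z) \<and> g' \<in> borel_measurable borel"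
  proof (rule is_grad_x_logI[OF _ finb_meas hm hi])
    show "has_leb_density (meas n)" using gn by (simp add: good_def)
    fix \<eta> :: "'a \<times> 'a => real" and \<eta>' :: "'a \<times> 'a => 'a \<times> 'a => real" and b :: 'a
    assume \<eta>: "C_c_infinity \<eta>" "b \<in> Basis" "!!z. (\<eta> has_derivative \<eta>' z) (at z)"
      "!!v. continuous_on UNIV (\<lambda>z. \<eta>' z v)" "!!v. \<exists>B. \<forall>z. \<bar>\<eta>' z v\<bar> <= B"
    have \<eta>c: "continuous_on UNIV \<eta>" using \<eta>(3) by (meson has_derivative_continuous continuous_at_imp_continuous_on)
    then have \<eta>m: "\<eta> \<in> borel_measurable borel" by (rule borel_measurable_continuous_onI)
    have K: "compact (closure {z. \<eta> z ~= 0})" using \<eta> by (simp add: C_c_infinity_def)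
    obtain M where M: "!!z. z \<in> closure {z. \<eta> z ~= 0} ==> \<bar>\<eta> z\<bar> <= M"
      using compact_imp_bounded[OF compact_continuous_image[OF continuous_on_subset[OF \<eta>c] K]] unfolding bounded_iff by auto
    have \<eta>b: "\<bar>\<eta> z\<bar> <= max M 0" for z
      using M[of z] closure_subset[of "{z. \<eta> z ~= 0}"] by (cases "\<eta> z = 0") (auto simp: le_max_iff_disj)
    have \<eta>'m: "(\<lambda>z. \<eta>' z (b, 0)) \<in> borel_measurable borel" using \<eta>(4) by (rule borel_measurable_continuous_onI)
    obtain B where B: "!!z. \<bar>\<eta>' z (b, 0)\<bar> <= B" using \<eta>(5) by blast
    have "(\<lambda>j. LINT z|meas (m (r j)). \<eta>' z (b, 0)) \<longlonglongrightarrow> (LINT z|meas n. \<eta>' z (b, 0))"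
      by (rule setwise_integral_bounded[OF setwise_subseq[OF sw r(1)] finb_meas finb_meas \<eta>'m B])
    moreover have "(LINT z|meas (m (r j)). \<eta>' z (b, 0)) = - (LINT z|meas (m (r j)). \<eta> z * (g (r j) z \<bullet> b))" for j
      by (rule is_grad_x_logD(3)[OF g finb_meas \<eta>])
    ultimately have "(\<lambda>j. - (LINT z|meas (m (r j)). \<eta> z * (g (r j) z \<bullet> b))) \<longlonglongrightarrow> (LINT z|meas n. \<eta>' z (b, 0))" by simp
    moreover have "(\<lambda>j. - (LINT z|meas (m (r j)). \<eta> z * (g (r j) z \<bullet> b))) \<longlonglongrightarrow> - (LINT z|meas n. \<eta> z * (h z \<bullet> b))"
      by (intro tendsto_minus comp[OF \<eta>(2) \<eta>m \<eta>b])
    ultimately show "(LINT z|meas n. \<eta>' z (b, 0)) = - (LINT z|meas n. \<eta> z * (h z \<bullet> b))" by (rule LIMSEQ_unique)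
  qed
  then obtain g' where g': "is_grad_x_log (meas n) g'" "AE z in meas n. g' z = h z" "g' \<in> borel_measurable borel" by blast
  have "weak_conv (\<lambda>j. meas (m (r j))) (\<lambda>j. g (r j)) (meas n) g'"
    unfolding weak_conv_def
  proof (intro allI impI)
    fix v :: "'a \<times> 'a => 'a" assume v: "v \<in> borel_measurable borel" "\<exists>B. \<forall>z. norm (v z) <= B"
    have "(LINT z|meas n. v z \<bullet> h z) = (LINT z|meas n. v z \<bullet> g' z)"
    proof (rule integral_cong_AE)
      show "AE z in meas n. v z \<bullet> h z = v z \<bullet> g' z" using g'(2) by (rule AE_mp) auto
    qed (use v(1) g'(3) in \<open>auto intro: borel_measurable_inner\<close>)
    moreover have "(\<lambda>j. LINT z|meas (m (r j)). v z \<bullet> g (r j) z) \<longlonglongrightarrow> (LINT z|meas n. v z \<bullet> h z)"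
      using wc[unfolded weak_conv_def, rule_format, OF v(1)] v(2) by blast
    ultimately show "(\<lambda>j. LINT z|meas (m (r j)). v z \<bullet> g (r j) z) \<longlonglongrightarrow> (LINT z|meas n. v z \<bullet> g' z)"
      by simp
  qed
  then show ?thesis using r(1) g' by blast
qed

text \<open>Pointwise \<open>2 v \<bullet> g - |v|\<^sup>2 <= |g|\<^sup>2\<close>. For
  \<open>v\<close> a truncation of \<open>g'\<close> the integral of the left side converges to that
  of \<open>|v|\<^sup>2\<close>, and the truncation is then removed. The factors \<open>s j\<close>
  and bounds \<open>x j\<close> vary because the Fisher term carries coefficients depending on
  \<open>j\<close> and is bounded by other converging terms.\<close>

lemma weak_conv_lsc:
  fixes g :: "nat => 'a \<times> 'a => 'a"
  assumes wc: "weak_conv (\<lambda>j. meas (m j)) g (meas n) g'" and gm: "!!j. g j \<in> borel_measurable borel" "g' \<in> borel_measurable borel"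
    and gi: "!!j. integrable (meas (m j)) (\<lambda>z. (norm (g j z))\<^sup>2)"
    and G: "!!j. (LINT z|meas (m j). (norm (g j z))\<^sup>2) <= G"
  shows "integrable (meas n) (\<lambda>z. (norm (g' z))\<^sup>2)"
    and "s \<longlonglongrightarrow> s' ==> x \<longlonglongrightarrow> x' ==> (!!j. 0 <= s j) ==> (!!j. s j * (LINT z|meas (m j). (norm (g j z))\<^sup>2) <= x j) ==>
      s' * (LINT z|meas n. (norm (g' z))\<^sup>2) <= x'"
proof -
  note [measurable] = gm
  define v where "v k z = (if norm (g' z) <= real k then g' z else 0)" for k z
  have vm [measurable]: "v k \<in> borel_measurable borel" for k unfolding v_def by measurable
  have vb: "norm (v k z) <= real k" for k z by (simp add: v_def)
  have v2: "(\<lambda>z. (norm (v k z))\<^sup>2) \<in> borel_measurable borel" for k by measurable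
  have v2b: "\<bar>(norm (v k z))\<^sup>2\<bar> <= (real k)\<^sup>2" for k z using vb[of k z] by (simp add: power_mono)
  have vg: "v k z \<bullet> g' z = (norm (v k z))\<^sup>2" for k z by (simp add: v_def power2_norm_eq_inner)
  have iv: "integrable (meas j) (\<lambda>z. (norm (v k z))\<^sup>2)" for j k
    by (rule finb_integrable_bounded[OF finb_meas v2, where B = "(real k)\<^sup>2"]) (use v2b in auto)
  have main: "s' * (LINT z|meas n. (norm (v k z))\<^sup>2) <= x'"
    if sx: "s \<longlonglongrightarrow> s'" "x \<longlonglongrightarrow> x'" "!!j. 0 <= s j" "!!j. s j * (LINT z|meas (m j). (norm (g j z))\<^sup>2) <= x j" for s s' x x' k
  proof (rule LIMSEQ_le[OF _ sx(2)])
    have "(\<lambda>j. LINT z|meas (m j). v k z \<bullet> g j z) \<longlonglongrightarrow> (LINT z|meas n. v k z \<bullet> g' z)"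
      using wc vm vb unfolding weak_conv_def by blast
    moreover have "(\<lambda>j. LINT z|meas (m j). (norm (v k z))\<^sup>2) \<longlonglongrightarrow> (LINT z|meas n. (norm (v k z))\<^sup>2)"
      by (rule setwise_integral_bounded[OF sw finb_meas finb_meas v2 v2b])
    ultimately have "(\<lambda>j. s j * (2 * (LINT z|meas (m j). v k z \<bullet> g j z) - (LINT z|meas (m j). (norm (v k z))\<^sup>2)))
        \<longlonglongrightarrow> s' * (2 * (LINT z|meas n. v k z \<bullet> g' z) - (LINT z|meas n. (norm (v k z))\<^sup>2))"
      by (intro tendsto_intros sx(1))
    then show "(\<lambda>j. s j * (2 * (LINT z|meas (m j). v k z \<bullet> g j z) - (LINT z|meas (m j). (norm (v k z))\<^sup>2)))
        \<longlonglongrightarrow> s' * (LINT z|meas n. (norm (v k z))\<^sup>2)" by (simp add: vg)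
    have "s j * (2 * (LINT z|meas (m j). v k z \<bullet> g j z) - (LINT z|meas (m j). (norm (v k z))\<^sup>2)) <= x j" for j
    proof -
      have vgi: "integrable (meas (m j)) (\<lambda>z. v k z \<bullet> g j z)"
        by (rule inner_integral_weighted(1)[OF finb_meas vm gm(1) iv gi])
      have "2 * (LINT z|meas (m j). v k z \<bullet> g j z) - (LINT z|meas (m j). (norm (v k z))\<^sup>2) = (LINT z|meas (m j). 2 * (v k z \<bullet> g j z) - (norm (v k z))\<^sup>2)"
        using vgi iv by simp
      also have "\<dots> <= (LINT z|meas (m j). (norm (g j z))\<^sup>2)"
      proof (rule integral_mono)
        fix z
        have "0 <= (norm (g j z - v k z))\<^sup>2" by simp
        then show "2 * (v k z \<bullet> g j z) - (norm (v k z))\<^sup>2 <= (norm (g j z))\<^sup>2"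
          by (simp add: power2_norm_eq_inner inner_diff_left inner_diff_right inner_commute)
      qed (use vgi iv gi in auto)
      finally show ?thesis using mult_left_mono[OF _ sx(3)[of j]] sx(4)[of j] order_trans by blast
    qed
    then show "\<exists>N. \<forall>j\<ge>N. s j * (2 * (LINT z|meas (m j). v k z \<bullet> g j z) - (LINT z|meas (m j). (norm (v k z))\<^sup>2)) <= x j" by blast
  qed
  have vlim: "(\<lambda>k. (norm (v k z))\<^sup>2) \<longlonglongrightarrow> (norm (g' z))\<^sup>2" for z
  proof (rule tendsto_eventually)
    obtain N where N: "norm (g' z) <= real N" using real_arch_simple by blast
    show "\<forall>\<^sub>F k in sequentially. (norm (v k z))\<^sup>2 = (norm (g' z))\<^sup>2"
      using eventually_ge_at_top[of N] by eventually_elim (use N in \<open>auto simp: v_def\<close>)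
  qed
  show gi': "integrable (meas n) (\<lambda>z. (norm (g' z))\<^sup>2)"
  proof (rule integrableI_nonneg)
    have "(\<integral>\<^sup>+ z. ennreal ((norm (g' z))\<^sup>2) \<partial>meas n) = (\<integral>\<^sup>+ z. liminf (\<lambda>k. ennreal ((norm (v k z))\<^sup>2)) \<partial>meas n)"
      by (intro nn_integral_cong lim_imp_Liminf[symmetric] tendsto_ennrealI vlim) simp
    also have "\<dots> <= liminf (\<lambda>k. \<integral>\<^sup>+ z. ennreal ((norm (v k z))\<^sup>2) \<partial>meas n)"
      by (rule nn_integral_liminf) simp
    also have "\<dots> <= ennreal G"
    proof (rule Liminf_le)
      have "(\<integral>\<^sup>+ z. ennreal ((norm (v k z))\<^sup>2) \<partial>meas n) <= ennreal G" for k
        using nn_integral_eq_integral[OF iv, of k n] main[of "\<lambda>_. 1" 1 "\<lambda>_. G" G k] G by (auto intro: ennreal_leI)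
      then show "\<forall>\<^sub>F k in sequentially. (\<integral>\<^sup>+ z. ennreal ((norm (v k z))\<^sup>2) \<partial>meas n) <= ennreal G" by simp
    qed simp
    finally show "(\<integral>\<^sup>+ z. ennreal ((norm (g' z))\<^sup>2) \<partial>meas n) < \<infinity>" by (rule le_less_trans) simp
  qed auto
  assume sx: "s \<longlonglongrightarrow> s'" "x \<longlonglongrightarrow> x'" "!!j. 0 <= s j" "!!j. s j * (LINT z|meas (m j). (norm (g j z))\<^sup>2) <= x j"
  show "s' * (LINT z|meas n. (norm (g' z))\<^sup>2) <= x'"
  proof (rule tendsto_upperbound)
    have "(\<lambda>k. LINT z|meas n. (norm (v k z))\<^sup>2) \<longlonglongrightarrow> (LINT z|meas n. (norm (g' z))\<^sup>2)"
      by (rule integral_dominated_convergence[OF _ _ gi']) (use vlim in \<open>auto simp: v_def\<close>)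
    then show "(\<lambda>k. s' * (LINT z|meas n. (norm (v k z))\<^sup>2)) \<longlonglongrightarrow> s' * (LINT z|meas n. (norm (g' z))\<^sup>2)" by (intro tendsto_intros)
    show "\<forall>\<^sub>F k in sequentially. s' * (LINT z|meas n. (norm (v k z))\<^sup>2) <= x'" using main[OF sx] by simp
  qed simp
qed

text \<open>A truncation \<open>T k\<close> of the limit \<open>u\<close> is an admissible test
  field for \<open>weak_conv\<close>. The remainder \<open>U j - T k\<close> is small in L^2, since
  the integral of its square converges under the varying measures, and the Fisher bound makes its
  pairing with \<open>g j\<close> small.\<close>

lemma weak_strong:
  fixes g :: "nat => 'a \<times> 'a => 'a" and U :: "nat => 'a \<times> 'a => 'a"
  assumes wc: "weak_conv (\<lambda>j. meas (m j)) g (meas n) g'" and gm: "!!j. g j \<in> borel_measurable borel" "g' \<in> borel_measurable borel"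
    and gi: "!!j. integrable (meas (m j)) (\<lambda>z. (norm (g j z))\<^sup>2)" "integrable (meas n) (\<lambda>z. (norm (g' z))\<^sup>2)"
    and G: "!!j. (LINT z|meas (m j). (norm (g j z))\<^sup>2) <= G"
    and Um: "!!j. U j \<in> borel_measurable borel" and Up: "!!z. (\<lambda>j. U j z) \<longlonglongrightarrow> u z"
    and Ub: "!!j z. (norm (U j z))\<^sup>2 <= K * quad z"
  shows "(\<lambda>j. LINT z|meas (m j). U j z \<bullet> g j z) \<longlonglongrightarrow> (LINT z|meas n. u z \<bullet> g' z)"
proof (rule LIMSEQ_I)
  fix e :: real assume e: "0 < e"
  have um: "u \<in> borel_measurable borel" using borel_measurable_LIMSEQ_metric[OF Um Up] .
  note [measurable] = gm Um um
  have ub: "(norm (u z))\<^sup>2 <= K * quad z" for z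
    by (rule tendsto_upperbound[of "\<lambda>j. (norm (U j z))\<^sup>2"]) (use Ub in \<open>auto intro!: tendsto_intros Up\<close>)
  define G' where "G' = max G (LINT z|meas n. (norm (g' z))\<^sup>2) + 1"
  have G': "0 < G'" "!!j. (LINT z|meas (m j). (norm (g j z))\<^sup>2) <= G'" "(LINT z|meas n. (norm (g' z))\<^sup>2) <= G'"
  proof -
    have "0 <= (LINT z|meas n. (norm (g' z))\<^sup>2)" by (rule integral_nonneg_AE) simp
    then show "0 < G'" unfolding G'_def by linarith
    show "(LINT z|meas (m j). (norm (g j z))\<^sup>2) <= G'" for j using G[of j] unfolding G'_def by linarith
    show "(LINT z|meas n. (norm (g' z))\<^sup>2) <= G'" unfolding G'_def by linarith
  qed
  \<comment> \<open>Young's inequality with this \<delta> gives \<open>e/8\<close> from each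
    gradient and \<open>e/16\<close> from each remainder; with \<open>e/4\<close> from the truncated
    fields the total stays below \<open>e\<close>.\<close>
  define \<delta> where "\<delta> = e / (8 * G')"
  have d: "0 < \<delta>" "\<delta> * G' = e / 8" using e G'(1) by (simp_all add: \<delta>_def)
  define T where "T k z = (if norm (u z) <= real k then u z else 0)" for k z
  have Tm [measurable]: "T k \<in> borel_measurable borel" for k unfolding T_def by measurable
  have Tb: "norm (T k z) <= real k" for k z by (simp add: T_def)
  have uT: "(norm (u z - T k z))\<^sup>2 <= K * quad z" for k z using ub[of z] by (auto simp: T_def intro: order_trans[OF zero_le_power2])
  have K0: "0 <= K * quad z" for z :: "'a \<times> 'a" using ub[of z] by (meson order_trans zero_le_power2)
  have Kq: "integrable (meas n) (\<lambda>z. K * quad z)" using good_quad(1)[OF gn] by simp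
  have "(\<lambda>k. LINT z|meas n. (norm (u z - T k z))\<^sup>2) \<longlonglongrightarrow> (LINT z|meas n. 0)"
  proof (rule integral_dominated_convergence[OF _ _ Kq])
    show "AE z in meas n. (\<lambda>k. (norm (u z - T k z))\<^sup>2) \<longlonglongrightarrow> 0"
    proof (rule AE_I2, rule tendsto_eventually)
      fix z
      obtain N where N: "norm (u z) <= real N" using real_arch_simple by blast
      show "\<forall>\<^sub>F k in sequentially. (norm (u z - T k z))\<^sup>2 = 0"
        using eventually_ge_at_top[of N] by eventually_elim (use N in \<open>auto simp: T_def\<close>)
    qed
  qed (use uT in auto)
  then have "\<forall>\<^sub>F k in sequentially. (LINT z|meas n. (norm (u z - T k z))\<^sup>2) < \<delta> * e / 16"
    using d e by (intro order_tendstoD(2)[where y = 0]) auto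
  then obtain k where "\<forall>i\<ge>k. (LINT z|meas n. (norm (u z - T i z))\<^sup>2) < \<delta> * e / 16" unfolding eventually_sequentially by blast
  then have k: "(LINT z|meas n. (norm (u z - T k z))\<^sup>2) < \<delta> * e / 16" by blast
  define D where "D j z = (norm (U j z - T k z))\<^sup>2" for j z
  have Db: "\<bar>D j z\<bar> <= (2 * K + 2 * (real k)\<^sup>2) * quad z" for j z
  proof -
    have "(norm (U j z - T k z))\<^sup>2 <= (norm (U j z) + norm (T k z))\<^sup>2" by (intro power_mono norm_triangle_ineq4) simp
    also have "\<dots> <= 2 * (norm (U j z))\<^sup>2 + 2 * (norm (T k z))\<^sup>2"
      using sum_squares_bound[of "norm (U j z)" "norm (T k z)"] by (simp add: power2_sum)
    also have "\<dots> <= 2 * (K * quad z) + 2 * (real k)\<^sup>2"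
      using Ub[of j z] power_mono[OF Tb[of k z] norm_ge_zero, of 2] by linarith
    also have "2 * (real k)\<^sup>2 <= 2 * (real k)\<^sup>2 * quad z" using quad_pos(2)[of z] by (intro mult_le_cancel_left1[THEN iffD2]) auto
    finally show ?thesis unfolding D_def by (simp add: algebra_simps)
  qed
  have Dl: "(\<lambda>j. LINT z|meas (m j). D j z) \<longlonglongrightarrow> (LINT z|meas n. (norm (u z - T k z))\<^sup>2)"
    and Di: "integrable (meas (m j)) (D i)" for j i
    by (rule integral_conv_quad[OF _ _ Db]; use Up in \<open>auto simp: D_def intro!: tendsto_intros\<close>)+
  have "\<forall>\<^sub>F j in sequentially. (LINT z|meas (m j). D j z) < \<delta> * e / 16"
    using Dl k by (rule order_tendstoD)
  moreover have "(\<lambda>j. LINT z|meas (m j). T k z \<bullet> g j z) \<longlonglongrightarrow> (LINT z|meas n. T k z \<bullet> g' z)"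
    using wc Tm Tb unfolding weak_conv_def by blast
  then have "\<forall>\<^sub>F j in sequentially. dist (LINT z|meas (m j). T k z \<bullet> g j z) (LINT z|meas n. T k z \<bullet> g' z) < e / 4"
    by (rule tendstoD) (use e in simp)
  ultimately have "\<forall>\<^sub>F j in sequentially. norm ((LINT z|meas (m j). U j z \<bullet> g j z) - (LINT z|meas n. u z \<bullet> g' z)) < e"
  proof eventually_elim
    case (elim j)
    have T2: "integrable (meas i) (\<lambda>z. (norm (T k z))\<^sup>2)" for i
      by (rule finb_integrable_bounded[OF finb_meas, where B = "(real k)\<^sup>2"]) (use Tb in \<open>auto intro: power_mono\<close>)
    have de: "(1 / \<delta>) * (\<delta> * e / 16) = e / 16" using d by simp
    have 1: "integrable (meas (m j)) (\<lambda>z. (U j z - T k z) \<bullet> g j z)"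
      "\<bar>(LINT z|meas (m j). (U j z - T k z) \<bullet> g j z)\<bar> <= \<delta> * (LINT z|meas (m j). (norm (g j z))\<^sup>2) + (1 / \<delta>) * (LINT z|meas (m j). D j z)"
      using inner_integral_weighted[OF finb_meas[of "m j"], of "\<lambda>z. U j z - T k z" "g j"] Di[of j j] gi(1)[of j] d(1)
      unfolding D_def by auto
    have 2: "integrable (meas n) (\<lambda>z. (u z - T k z) \<bullet> g' z)"
      "\<bar>(LINT z|meas n. (u z - T k z) \<bullet> g' z)\<bar> <= \<delta> * (LINT z|meas n. (norm (g' z))\<^sup>2) + (1 / \<delta>) * (LINT z|meas n. (norm (u z - T k z))\<^sup>2)"
    proof -
      have "integrable (meas n) (\<lambda>z. (norm (u z - T k z))\<^sup>2)"
        by (rule Bochner_Integration.integrable_bound[OF Kq]) (use uT K0 in auto)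
      then show "integrable (meas n) (\<lambda>z. (u z - T k z) \<bullet> g' z)"
        "\<bar>(LINT z|meas n. (u z - T k z) \<bullet> g' z)\<bar> <= \<delta> * (LINT z|meas n. (norm (g' z))\<^sup>2) + (1 / \<delta>) * (LINT z|meas n. (norm (u z - T k z))\<^sup>2)"
        using inner_integral_weighted[OF finb_meas[of n], of "\<lambda>z. u z - T k z" g'] gi(2) d(1) by auto
    qed
    have Ti: "integrable (meas (m j)) (\<lambda>z. T k z \<bullet> g j z)" "integrable (meas n) (\<lambda>z. T k z \<bullet> g' z)"
      using inner_integral_weighted(1)[OF finb_meas Tm gm(1) T2 gi(1)] inner_integral_weighted(1)[OF finb_meas Tm gm(2) T2 gi(2)] by auto
    have e1: "(LINT z|meas (m j). U j z \<bullet> g j z) = (LINT z|meas (m j). (U j z - T k z) \<bullet> g j z) + (LINT z|meas (m j). T k z \<bullet> g j z)"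
      using 1(1) Ti(1) by (subst Bochner_Integration.integral_add[symmetric]) (auto simp: inner_diff_left)
    have e2: "(LINT z|meas n. u z \<bullet> g' z) = (LINT z|meas n. (u z - T k z) \<bullet> g' z) + (LINT z|meas n. T k z \<bullet> g' z)"
      using 2(1) Ti(2) by (subst Bochner_Integration.integral_add[symmetric]) (auto simp: inner_diff_left)
    have b1: "\<delta> * (LINT z|meas (m j). (norm (g j z))\<^sup>2) <= e / 8" "\<delta> * (LINT z|meas n. (norm (g' z))\<^sup>2) <= e / 8"
      using mult_left_mono[OF G'(2)[of j], of \<delta>] mult_left_mono[OF G'(3), of \<delta>] d by auto
    have b2: "(1 / \<delta>) * (LINT z|meas (m j). D j z) <= e / 16" "(1 / \<delta>) * (LINT z|meas n. (norm (u z - T k z))\<^sup>2) <= e / 16"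
      using mult_left_mono[OF less_imp_le[OF elim(1)], of "1 / \<delta>"] mult_left_mono[OF less_imp_le[OF k], of "1 / \<delta>"] d(1) de by auto
    show ?case using elim(2) 1(2) 2(2) b1 b2 unfolding e1 e2 dist_real_def real_norm_def by linarith
  qed
  then show "\<exists>no. \<forall>j\<ge>no. norm ((LINT z|meas (m j). U j z \<bullet> g j z) - (LINT z|meas n. u z \<bullet> g' z)) < e"
    by (simp add: eventually_sequentially)
qed

end

section \<open>Perturbed minimisation problems\<close>

text \<open>The uniform measure on the unit ball has bounded support and an almost everywhere
  constant density. Such a measure shows that the functional is not identically infinite.\<close>

lemma good_exists: "\<exists>m :: ('a::euclidean_space \<times> 'a) P2. good m"
proof -
  define A where "A = ball (0::'a \<times> 'a) 1"
  have A: "A \<in> sets borel" by (simp add: A_def)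
  define c where "c = emeasure lborel A"
  have v: "unit_ball_vol (2 * real DIM('a)) ~= 0" by (rule less_imp_neq[symmetric], rule unit_ball_vol_pos) simp
  have c: "c ~= 0" "c ~= \<infinity>"
    unfolding c_def A_def by (auto simp: v emeasure_ball ennreal_mult_eq_top_iff)
  define u where "u = uniform_measure lborel A"
  have ps: "prob_space u" unfolding u_def by (rule prob_space_uniform_measure) (use c in \<open>auto simp: c_def\<close>)
  have su: "sets u = sets borel" by (simp add: u_def)
  have fu: "finb u" using ps su by (auto simp: finb_def prob_space_def)
  note [simp] = finbD(2,3,4)[OF fu]
  have ae: "AE z in u. z \<in> A" unfolding u_def using A c by (intro AE_uniform_measureI) auto
  have wb: "AE z in u. norm (wt z) <= 2"
  proof (rule AE_mp[OF ae], rule AE_I2, rule impI)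
    fix z assume "z \<in> A"
    then have n: "norm z <= 1" by (simp add: A_def)
    have "norm (fst z) <= 1" "norm (snd z) <= 1"
      using norm_fst_le[of "fst z" "snd z"] norm_snd_le[of "snd z" "fst z"] n by auto
    then have "norm (fst z) ^ 3 <= 1" "norm (snd z) ^ 3 <= 1" by (auto intro: power_le_one)
    then show "norm (wt z) <= 2" by (simp add: wt_def)
  qed
  have wi: "integrable u wt"
    by (rule finite_measure.integrable_const_bound[OF finbD(1)[OF fu] wb]) simp
  have "(\<integral>\<^sup>+ z. ennreal ((norm z)\<^sup>2) \<partial>u) <= (\<integral>\<^sup>+ z. ennreal (2 + wt z) \<partial>u)"
    by (intro nn_integral_mono ennreal_leI norm_sq_le_wt)
  also have "\<dots> < \<infinity>"
    using wi finite_measure.integrable_const[OF finbD(1)[OF fu], of 2] by (subst nn_integral_eq_integral) auto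
  finally have "u \<in> {\<mu>. prob_space \<mu> \<and> sets \<mu> = sets borel \<and> abs_moment 2 \<mu> < \<infinity>}"
    using ps su by (simp add: abs_moment_def)
  then have eq: "meas (P2_of u) = u" by (rule P2_of_inverse)
  define q where "q z = indicator A z / c" for z
  have qm: "q \<in> borel_measurable lborel" unfolding q_def using A by measurable
  have uq: "density lborel q = u" by (simp add: u_def uniform_measure_def q_def[abs_def] c_def)
  have hd: "has_leb_density u" unfolding has_leb_density_def using qm uq by blast
  have "AE z in lborel. q z = RN_deriv lborel u z"
    by (rule sigma_finite_measure.RN_deriv_unique[OF lborel.sigma_finite_measure_axioms qm uq])
  then have "AE z in density lborel q. q z = RN_deriv lborel u z" using qm by (subst AE_density) auto
  then have "AE z in u. q z = RN_deriv lborel u z" by (simp only: uq)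
  with ae have le: "AE z in u. ln (leb_density u z) = ln (enn2real (1 / c))"
    by eventually_elim (simp add: leb_density_def q_def flip: )
  have lm: "(\<lambda>z. ln (leb_density u z)) \<in> borel_measurable u" using leb_density_props(1)[OF hd fu] by simp
  have "integrable u (\<lambda>z. ln (leb_density u z))"
    by (rule finite_measure.integrable_const_bound[OF finbD(1)[OF fu] _ lm, where B = "\<bar>ln (enn2real (1 / c))\<bar>"])
      (use le in \<open>eventually_elim, simp\<close>)
  then have "good (P2_of u)" unfolding good_def eq using wi hd by simp
  then show ?thesis by blast
qed

text \<open>A quantitative form of \<open>C2_bounded\<close> with one bound for the function and
  both derivatives: the perturbation has to be small in this norm, not merely bounded.\<close>

definition c2_bound :: "('b::euclidean_space => real) => real => bool" where
  "c2_bound f b \<longleftrightarrow> (\<exists>(Df :: 'b => 'b \<Rightarrow>\<^sub>L real) (D2f :: 'b => 'b \<Rightarrow>\<^sub>L 'b \<Rightarrow>\<^sub>L real).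
     (\<forall>z. (f has_derivative blinfun_apply (Df z)) (at z)) \<and> (\<forall>z. (Df has_derivative blinfun_apply (D2f z)) (at z)) \<and>
     continuous_on UNIV D2f \<and> (\<forall>z. \<bar>f z\<bar> <= b \<and> norm (Df z) <= b \<and> norm (D2f z) <= b))"

lemma C2_bounded_c2_bound: "C2_bounded f ==> \<exists>b\<ge>0. c2_bound f b"
proof -
  assume "C2_bounded f"
  then obtain Df D2f where f: "!!z. (f has_derivative blinfun_apply (Df z)) (at z)"
    "!!z. (Df has_derivative blinfun_apply (D2f z)) (at z)" "continuous_on UNIV D2f"
    "bounded (range f)" "bounded (range Df)" "bounded (range D2f)" unfolding C2_bounded_def by blast
  obtain b1 where b1: "!!z. norm (f z) <= b1" using f(4) unfolding bounded_iff by blast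
  obtain b2 where b2: "!!z. norm (Df z) <= b2" using f(5) unfolding bounded_iff by blast
  obtain b3 where b3: "!!z. norm (D2f z) <= b3" using f(6) unfolding bounded_iff by blast
  have "c2_bound f (max (max b1 b2) (max b3 0))"
    unfolding c2_bound_def using f(1-3) b1 b2 b3
    by (intro exI[of _ Df] exI[of _ D2f]) (auto simp: le_max_iff_disj)
  then show ?thesis by (intro exI[of _ "max (max b1 b2) (max b3 0)"]) auto
qed

lemma c2_bound_scale:
  fixes f :: "'b::euclidean_space => real"
  assumes "c2_bound f b" "0 <= c"
  shows "c2_bound (\<lambda>z. c * f z) (c * b)"
proof -
  obtain Df D2f where f: "!!z. (f has_derivative blinfun_apply (Df z)) (at z)"
    "!!z. (Df has_derivative blinfun_apply (D2f z)) (at z)" "continuous_on UNIV D2f"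
    "!!z. \<bar>f z\<bar> <= b" "!!z. norm (Df z) <= b" "!!z. norm (D2f z) <= b"
    using assms(1) unfolding c2_bound_def by blast
  show ?thesis
    unfolding c2_bound_def
  proof (intro exI[of _ "\<lambda>z. c *\<^sub>R Df z"] exI[of _ "\<lambda>z. c *\<^sub>R D2f z"] conjI allI)
    show "((\<lambda>z. c * f z) has_derivative blinfun_apply (c *\<^sub>R Df z)) (at z)" for z
      using has_derivative_mult_right[OF f(1)[of z], of c] by (rule has_derivative_eq_rhs) (auto simp: blinfun.bilinear_simps)
    show "((\<lambda>z. c *\<^sub>R Df z) has_derivative blinfun_apply (c *\<^sub>R D2f z)) (at z)" for z
      using has_derivative_scaleR_right[OF f(2)[of z], of c] by (rule has_derivative_eq_rhs) (auto simp: blinfun.bilinear_simps)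
    show "continuous_on UNIV (\<lambda>z. c *\<^sub>R D2f z)" by (intro continuous_intros f)
    show "\<bar>c * f z\<bar> <= c * b" "norm (c *\<^sub>R Df z) <= c * b" "norm (c *\<^sub>R D2f z) <= c * b" for z
      using f(4-6)[of z] assms(2) by (auto simp: abs_mult intro!: mult_left_mono)
  qed
qed

lemma not_eventually_subseq:
  assumes "\<not> (\<forall>\<^sub>F k in sequentially. P k)"
  shows "\<exists>r. strict_mono (r::nat=>nat) \<and> (\<forall>j. \<not> P (r j))"
proof -
  have "\<forall>N. \<exists>k\<ge>N. k \<in> {k. \<not> P k}" using assms by (auto simp: eventually_sequentially)
  then have "infinite {k. \<not> P k}" by (simp add: infinite_nat_iff_unbounded_le)
  then show ?thesis using infinite_enumerate by blast
qed

text \<open>Fatou gives the lower bound. If third moments stayed at or above \<open>w3 n + e\<close>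
  along a subsequence, lowering the weight from \<xi> to \<xi>/2 would push
  \<open>ent + (\<xi> / 2) * w3\<close> below its value at \<open>n\<close> by
  \<open>\<xi> * e / 4\<close>, against lower semicontinuity for the weight \<xi>/2.\<close>

lemma (in good_seq) w3_tendsto:
  assumes \<xi>: "0 < \<xi>" and X: "(\<lambda>j. ent (m j) + \<xi> * w3 (m j)) \<longlonglongrightarrow> ent n + \<xi> * w3 n"
  shows "(\<lambda>j. w3 (m j)) \<longlonglongrightarrow> w3 n"
proof (rule order_tendstoI)
  fix a assume a: "a < w3 n"
  show "\<forall>\<^sub>F j in sequentially. a < w3 (m j)"
  proof (rule ccontr)
    assume "\<not> ?thesis"
    then obtain r where r: "strict_mono (r::nat=>nat)" "!!j. \<not> a < w3 (m (r j))" using not_eventually_subseq by blast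
    have gw: "integrable (meas (m j)) wt" for j using gm by (simp add: good_def)
    have "(LINT z|meas n. wt z) <= a"
      by (rule setwise_integral_le(2)[OF setwise_subseq[OF sw r(1)] finb_meas finb_meas])
        (use gw r(2) in \<open>auto simp: w3_def not_less\<close>)
    then show False using a by (simp add: w3_def)
  qed
next
  fix a assume a: "w3 n < a"
  define e where "e = a - w3 n"
  have e: "0 < e" using a by (simp add: e_def)
  show "\<forall>\<^sub>F j in sequentially. w3 (m j) < a"
  proof (rule ccontr)
    assume "\<not> ?thesis"
    then obtain r where r: "strict_mono (r::nat=>nat)" "!!j. \<not> w3 (m (r j)) < a" using not_eventually_subseq by blast
    have Xr: "(\<lambda>j. ent (m (r j)) + \<xi> * w3 (m (r j))) \<longlonglongrightarrow> ent n + \<xi> * w3 n"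
      using LIMSEQ_subseq_LIMSEQ[OF X r(1)] by (simp add: comp_def)
    have "0 < \<xi> * e" using \<xi> e by simp
    then have "\<forall>\<^sub>F j in sequentially. ent (m (r j)) + \<xi> * w3 (m (r j)) < ent n + \<xi> * w3 n + \<xi> * e / 4"
      using Xr by (intro order_tendstoD(2)) auto
    then have "\<forall>\<^sub>F j in sequentially. ent (m (r j)) + (\<xi> / 2) * w3 (m (r j)) <= ent n + (\<xi> / 2) * w3 n - \<xi> * e / 4"
    proof eventually_elim
      case (elim j)
      have "\<xi> * a <= \<xi> * w3 (m (r j))" using r(2)[of j] \<xi> by (intro mult_left_mono) auto
      moreover have "\<xi> * a = \<xi> * w3 n + \<xi> * e" by (simp add: e_def algebra_simps)
      moreover have "(\<xi> / 2) * w3 k = (\<xi> * w3 k) / 2" for k :: "('a \<times> 'a) P2" by simp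
      ultimately show ?case using elim by linarith
    qed
    then have "ent n + (\<xi> / 2) * w3 n <= ent n + (\<xi> / 2) * w3 n - \<xi> * e / 4"
      by (rule entropy_lsc(3)[OF setwise_subseq[OF sw r(1)] gm half_gt_zero[OF \<xi>] w3R])
    then show False using \<open>0 < \<xi> * e\<close> by simp
  qed
qed

section \<open>Approximating fields and their locally uniform limit\<close>

locale approx_solutions =
  fixes T :: real and Wn :: "nat => real \<times> 'a::euclidean_space \<times> 'a P2 => 'a" and W :: "real \<times> 'a \<times> 'a P2 => 'a"
    and C :: real and V :: "'a \<times> 'a P2 => 'a" and D :: real
  assumes T: "0 < T"
    and Wnc: "!!n. continuous_on ({0..T} \<times> UNIV \<times> UNIV) (Wn n)"
    and WnW: "locally_uniform_limit ({0..T} \<times> UNIV \<times> UNIV) Wn W"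
    and Wnb: "!!n t x \<mu>. t \<in> {0..T} ==> norm (Wn n (t, x, \<mu>)) <= C * (1 + norm x + sqrt (E2 \<mu>))"
    and C0: "0 <= C"
    and Vc: "continuous_on UNIV V"
    and Vb: "!!y \<mu>. norm (V (y, \<mu>)) <= D * (1 + norm y + sqrt (E2 \<mu>))" and D0: "0 <= D"
begin

lemma Wn_tendsto:
  assumes "t \<longlonglongrightarrow> s" "x \<longlonglongrightarrow> x0" "\<mu> \<longlonglongrightarrow> \<nu>" "!!j. t j \<in> {0..T}" "s \<in> {0..T}"
  shows "(\<lambda>j. W (t j, x j, \<mu> j)) \<longlonglongrightarrow> W (s, x0, \<nu>)"
    and "filterlim k at_top sequentially ==> (\<lambda>j. Wn (k j) (t j, x j, \<mu> j)) \<longlonglongrightarrow> W (s, x0, \<nu>)"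
  by (rule locally_uniform_limit_seq[OF WnW Wnc tendsto_Pair[OF assms(1) tendsto_Pair[OF assms(2,3)]]]; use assms(4,5) in simp)+

lemma Wc: "continuous_on ({0..T} \<times> UNIV \<times> UNIV) W"
  by (rule continuous_on_sequentiallyI, rule locally_uniform_limit_seq(1)[OF WnW Wnc]) auto

lemma Wb: "norm (W (t, x, \<mu>)) <= C * (1 + norm x + sqrt (E2 \<mu>))" if "t \<in> {0..T}"
proof (rule tendsto_upperbound)
  show "(\<lambda>j. norm (Wn j (t, x, \<mu>))) \<longlonglongrightarrow> norm (W (t, x, \<mu>))"
    by (intro tendsto_norm Wn_tendsto(2)) (use that in \<open>auto simp: filterlim_ident\<close>)
qed (use Wnb[OF that] in auto)

lemma slice: "continuous_on UNIV (\<lambda>x. Wn n (t, x, \<mu>))" "continuous_on UNIV (\<lambda>x. W (t, x, \<mu>))" if "t \<in> {0..T}"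
  by (rule continuous_on_compose2[OF Wnc] continuous_on_compose2[OF Wc]; use that in \<open>auto intro!: continuous_intros\<close>)+

text \<open>Compactness by contradiction: offending times and measures have limits along a
  subsequence, and there \<open>Zfun\<close> for \<open>Wn\<close> and for \<open>W\<close> tends to
  the same value. Uniformity is essential because the index is fixed before the minimiser is
  found.\<close>

lemma Zfun_uniform:
  assumes e: "0 < e"
  shows "\<exists>N. \<forall>n\<ge>N. \<forall>t\<in>{0..T}. \<forall>m. good m --> w3 m <= R --> ent m <= R \<longrightarrow>
    \<bar>Zfun (Wn n) V t m - Zfun W V t m\<bar> <= e"
proof (rule ccontr)
  assume "\<not> ?thesis"
  then have "\<forall>j. \<exists>n t m. n >= j \<and> t \<in> {0..T} \<and> good m \<and> w3 m <= R \<and> ent m <= R \<and> e < \<bar>Zfun (Wn n) V t m - Zfun W V t m\<bar>"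
    by (force simp: not_le)
  then obtain k t m where k: "!!j. k j >= (j::nat)" "!!j. t j \<in> {0..T}" "!!j. good (m j)" "!!j. w3 (m j) <= R" "!!j. ent (m j) <= R"
    "!!j. e < \<bar>Zfun (Wn (k j)) V (t j) (m j) - Zfun W V (t j) (m j)\<bar>" by metis
  obtain r n where r: "strict_mono (r::nat=>nat)" "setwise (\<lambda>j. meas (m (r j))) (meas n)" "good n"
    using good_compact[of m R, OF k(3,4,5)] by blast
  have "seq_compact {0..T}" using compact_Icc by (simp add: compact_eq_seq_compact_metric)
  moreover have "\<forall>j. t (r j) \<in> {0..T}" using k(2) by blast
  ultimately obtain s q where q: "s \<in> {0..T}" "strict_mono (q::nat=>nat)" "((\<lambda>j. t (r j)) \<circ> q) \<longlonglongrightarrow> s"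
    by (rule seq_compactE)
  define p where "p j = r (q j)" for j
  have p: "strict_mono p" unfolding p_def using strict_mono_o[OF r(1) q(2)] by (simp add: comp_def)
  have ts: "(\<lambda>j. t (p j)) \<longlonglongrightarrow> s" using q(3) by (simp add: p_def comp_def)
  interpret good_seq "\<lambda>j. m (p j)" n R
    by unfold_locales (use setwise_subseq[OF r(2) q(2)] k r(3) in \<open>auto simp: p_def\<close>)
  have kp: "filterlim (\<lambda>j. k (p j)) at_top sequentially"
  proof (rule filterlim_at_top_mono[OF filterlim_ident])
    show "\<forall>\<^sub>F j in sequentially. j <= k (p j)"
      using k(1) seq_suble[OF p] by (auto intro!: always_eventually intro: order_trans)
  qed
  have 1: "(\<lambda>j. Zfun (Wn (k (p j))) V (t (p j)) (m (p j))) \<longlonglongrightarrow> Zfun W V s n"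
    by (rule Zfun_conv[where U = "\<lambda>j. Wn (k (p j))" and t = "\<lambda>j. t (p j)", OF _ _ _ C0 Vc Vb D0])
      (use k(2) q(1) in \<open>auto intro!: Wn_tendsto(2) slice Wnb ts marg_conv kp\<close>)
  have 2: "(\<lambda>j. Zfun W V (t (p j)) (m (p j))) \<longlonglongrightarrow> Zfun W V s n"
    by (rule Zfun_conv[where U = "\<lambda>j. W" and t = "\<lambda>j. t (p j)", OF _ _ _ C0 Vc Vb D0])
      (use k(2) q(1) in \<open>auto intro!: Wn_tendsto(1) slice Wb ts marg_conv\<close>)
  have "(\<lambda>j. \<bar>Zfun (Wn (k (p j))) V (t (p j)) (m (p j)) - Zfun W V (t (p j)) (m (p j))\<bar>) \<longlonglongrightarrow> \<bar>Zfun W V s n - Zfun W V s n\<bar>"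
    by (intro tendsto_intros 1 2)
  then have "e <= \<bar>Zfun W V s n - Zfun W V s n\<bar>"
    by (rule tendsto_lowerbound) (use k(6) in \<open>auto intro!: always_eventually less_imp_le\<close>)
  then show False using e by simp
qed

end

section \<open>The penalty in time and the perturbed test function\<close>

lemma C1_initial_continuous:
  assumes C: "C1_bounded_on_initial T \<psi>"
  shows "continuous_on {0..<T} \<psi>"
  unfolding continuous_on_eq_continuous_within
proof
  fix t assume t: "t \<in> {0..<T}"
  define \<tau> where "\<tau> = (t + T) / 2"
  have \<tau>: "0 < \<tau>" "\<tau> < T" "t < \<tau>" using t by (auto simp: \<tau>_def)
  obtain \<psi>' where "\<forall>t\<in>{0..\<tau>}. (\<psi> has_real_derivative \<psi>' t) (at t within {0..\<tau>})"
    using C \<tau> unfolding C1_bounded_on_initial_def by blast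
  then have "continuous_on {0..\<tau>} \<psi>" by (intro DERIV_continuous_on) auto
  then have c: "continuous (at t within {0..\<tau>}) \<psi>" using t \<tau> by (auto simp: continuous_on_eq_continuous_within)
  have "at t within {0..<T} = at t within {0..\<tau>}"
    by (rule at_within_nhd[of t "{..<\<tau>}"]) (use t \<tau> in auto)
  then show "continuous (at t within {0..<T}) \<psi>" using c by simp
qed

lemma C1_initial_deriv:
  assumes C: "C1_bounded_on_initial T \<psi>" and t: "0 < t" "t < T"
  shows "(\<psi> has_real_derivative deriv \<psi> t) (at t)" "isCont (deriv \<psi>) t"
proof -
  define \<tau> where "\<tau> = (t + T) / 2"
  have \<tau>: "0 < \<tau>" "\<tau> < T" "t < \<tau>" using t by (auto simp: \<tau>_def)
  obtain \<psi>' where p: "!!t. t\<in>{0..\<tau>} ==> (\<psi> has_real_derivative \<psi>' t) (at t within {0..\<tau>})" "continuous_on {0..\<tau>} \<psi>'"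
    using C \<tau> unfolding C1_bounded_on_initial_def by blast
  have d: "(\<psi> has_real_derivative \<psi>' s) (at s)" if s: "s \<in> {0<..<\<tau>}" for s
  proof -
    have "at s within {0..\<tau>} = at s" by (rule at_within_Icc_at) (use s in auto)
    then show ?thesis using p(1)[of s] s by auto
  qed
  have e: "\<psi>' s = deriv \<psi> s" if "s \<in> {0<..<\<tau>}" for s using DERIV_imp_deriv[OF d[OF that]] by simp
  show "(\<psi> has_real_derivative deriv \<psi> t) (at t)" using d[of t] e[of t] t \<tau> by simp
  have "continuous_on {0<..<\<tau>} \<psi>'" by (rule continuous_on_subset[OF p(2)]) auto
  then have "continuous_on {0<..<\<tau>} (deriv \<psi>)" by (rule continuous_on_eq) (rule e)
  then show "isCont (deriv \<psi>) t"
    using t \<tau> by (simp add: continuous_on_eq_continuous_at)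
qed

text \<open>For \<open>s < T\<close> the penalty vanishes to second order at \<open>s\<close>, so it
  leaves the time derivative unchanged in the limit, and it tends to infinity at \<open>T\<close>,
  which keeps minimising times away from the end of the interval.\<close>

definition bar :: "real => real => real => real" where "bar T s t = (t - s)\<^sup>2 / (T - t)"

definition bar' :: "real => real => real => real" where "bar' T s t = 2 * (t - s) / (T - t) + ((t - s) / (T - t))\<^sup>2"

lemma bar_deriv: "t < T ==> (bar T s has_real_derivative bar' T s t) (at t within A)"
  unfolding bar_def[abs_def] bar'_def
  by (auto intro!: derivative_eq_intros simp: power2_eq_square divide_simps) (simp add: algebra_simps)?

lemma bar'_continuous: "continuous_on {..<T} (bar' T s)"
  unfolding bar'_def[abs_def] by (auto intro!: continuous_intros)

lemma bar_nonneg: "t < T ==> 0 <= bar T s t"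
  by (simp add: bar_def)

lemma C1_initial_minus_bar:
  assumes C: "C1_bounded_on_initial T \<psi>"
  shows "C1_bounded_on_initial T (\<lambda>t. \<psi> t - bar T s t)"
  unfolding C1_bounded_on_initial_def
proof (intro allI impI)
  fix \<tau> assume \<tau>: "0 < \<tau> \<and> \<tau> < T"
  obtain \<psi>' where p: "!!t. t\<in>{0..\<tau>} ==> (\<psi> has_real_derivative \<psi>' t) (at t within {0..\<tau>})" "continuous_on {0..\<tau>} \<psi>'"
    using C \<tau> unfolding C1_bounded_on_initial_def by blast
  have d: "((\<lambda>t. \<psi> t - bar T s t) has_real_derivative \<psi>' t - bar' T s t) (at t within {0..\<tau>})" if "t \<in> {0..\<tau>}" for t
    using that \<tau> by (intro DERIV_diff p bar_deriv) auto
  have c': "continuous_on {0..\<tau>} (\<lambda>t. \<psi>' t - bar' T s t)"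
    by (intro continuous_on_diff p continuous_on_subset[OF bar'_continuous]) (use \<tau> in auto)
  have c: "continuous_on {0..\<tau>} (\<lambda>t. \<psi> t - bar T s t)" using d by (intro DERIV_continuous_on) auto
  show "\<exists>\<psi>'. (\<forall>t\<in>{0..\<tau>}. ((\<lambda>t. \<psi> t - bar T s t) has_real_derivative \<psi>' t) (at t within {0..\<tau>})) \<and>
      continuous_on {0..\<tau>} \<psi>' \<and> bounded ((\<lambda>t. \<psi> t - bar T s t) ` {0..\<tau>}) \<and> bounded (\<psi>' ` {0..\<tau>})"
    by (intro exI[of _ "\<lambda>t. \<psi>' t - bar' T s t"] conjI ballI d c' compact_imp_bounded compact_continuous_image[OF c] compact_continuous_image[OF c'])
      auto
qed

text \<open>Beyond the midpoint of \<open>s\<close> and \<open>T\<close> the numerator is at least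
  \<open>((T - s) / 2)\<^sup>2\<close>, so the penalty exceeds \<open>|b| + 1\<close> once
  \<open>T - t\<close> is small.\<close>

lemma bar_barrier:
  assumes s: "s < T"
  shows "\<exists>\<tau><T. \<forall>t\<in>{0..<T}. bar T s t <= b --> t <= \<tau>"
proof (intro exI[of _ "max ((T + s) / 2) (T - ((T - s) / 2)\<^sup>2 / (\<bar>b\<bar> + 1))"] conjI ballI impI)
  have b: "0 < \<bar>b\<bar> + 1" by simp
  then have "0 < ((T - s) / 2)\<^sup>2 / (\<bar>b\<bar> + 1)" using s by (intro divide_pos_pos) auto
  then show "max ((T + s) / 2) (T - ((T - s) / 2)\<^sup>2 / (\<bar>b\<bar> + 1)) < T" using s by simp
  fix t assume t: "t \<in> {0..<T}" and B: "bar T s t <= b"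
  show "t <= max ((T + s) / 2) (T - ((T - s) / 2)\<^sup>2 / (\<bar>b\<bar> + 1))"
  proof (rule ccontr)
    assume "\<not> ?thesis"
    then have g: "(T + s) / 2 < t" "T - t < ((T - s) / 2)\<^sup>2 / (\<bar>b\<bar> + 1)" unfolding not_le max_less_iff_conj by auto
    have "(\<bar>b\<bar> + 1) * (T - t) < ((T - s) / 2)\<^sup>2" using g(2) b by (simp add: pos_less_divide_eq mult.commute)
    also have "\<dots> <= (t - s)\<^sup>2" using g(1) s by (intro power_mono) auto
    finally have "\<bar>b\<bar> + 1 < bar T s t" using t by (simp add: bar_def pos_less_divide_eq)
    then show False using B by linarith
  qed
qed

lemma c2_boundD: "c2_bound f b ==> \<bar>f z\<bar> <= b"
  unfolding c2_bound_def by blast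

lemma c2_bound_mono: "c2_bound f b ==> b <= c ==> c2_bound f c"
  unfolding c2_bound_def by (meson order_trans)

text \<open>Adding \<epsilon> times \<open>kl\<close> to the functional amounts to this change of
  test function together with \<kappa> + \<epsilon>. The cubic coefficient of a test function
  carries \<open>exp (lam * t)\<close>; the factor \<open>exp (- (lam * s))\<close> makes the added
  coefficient equal to \<open>\<epsilon> * \<beta>\<close> at time \<open>s\<close>, and the
  mismatch at other times is the last term of \<open>Jr_perturb\<close>.\<close>

definition perturb :: "real => real => real => real => ('a \<times> 'a => real) => 'a test_fun => 'a::euclidean_space test_fun" where
  "perturb T s \<beta> \<epsilon> f \<phi> = Test (\<lambda>t. psi \<phi> t - bar T s t) (\<lambda>z. fpart \<phi> z + \<epsilon> * f z) (alpha \<phi> + \<epsilon> * \<beta> * exp (- (lam \<phi> * s))) (lam \<phi>)"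

lemma perturb_simps [simp]:
  "psi (perturb T s \<beta> \<epsilon> f \<phi>) = (\<lambda>t. psi \<phi> t - bar T s t)" "fpart (perturb T s \<beta> \<epsilon> f \<phi>) = (\<lambda>z. fpart \<phi> z + \<epsilon> * f z)"
  "alpha (perturb T s \<beta> \<epsilon> f \<phi>) = alpha \<phi> + \<epsilon> * \<beta> * exp (- (lam \<phi> * s))" "lam (perturb T s \<beta> \<epsilon> f \<phi>) = lam \<phi>"
  by (simp_all add: perturb_def)

lemma Jr_perturb:
  assumes f: "f \<in> borel_measurable borel" "!!z. \<bar>f z\<bar> <= b" and f0: "fpart \<phi> \<in> borel_measurable borel" "!!z. \<bar>fpart \<phi> z\<bar> <= B"
  shows "Jr U V (perturb T s \<beta> \<epsilon> f \<phi>) (\<kappa> + \<epsilon>) t m = Jr U V \<phi> \<kappa> t m + bar T s t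
    + \<epsilon> * (kl \<beta> f m + 1 - (LINT z|lborel. exp (f z - \<beta> * wt z)) + \<beta> * (exp (lam \<phi> * (t - s)) - 1) * w3 m)"
proof -
  have i: "integrable (meas m) (fpart \<phi>)" "integrable (meas m) f"
    using f f0 by (auto intro!: finb_integrable_bounded[OF finb_meas])
  have "(LINT z|meas m. fpart \<phi> z + \<epsilon> * f z) = (LINT z|meas m. fpart \<phi> z) + \<epsilon> * (LINT z|meas m. f z)"
    using i by simp
  moreover have "exp (lam \<phi> * (t - s)) = exp (- (lam \<phi> * s)) * exp (lam \<phi> * t)"
    by (simp add: mult_exp_exp algebra_simps)
  ultimately show ?thesis unfolding Jr_def kl_def perturb_simps by (simp add: algebra_simps)
qed

lemma perturb_H_test:
  assumes "\<phi> \<in> H_test T" "C2_bounded f" "0 <= \<epsilon>" "0 <= \<beta>"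
  shows "perturb T s \<beta> \<epsilon> f \<phi> \<in> H_test T"
  using assms by (auto simp: H_test_def intro!: C1_initial_minus_bar C2_bounded_add C2_bounded_cmult add_pos_nonneg)

context approx_solutions
begin

text \<open>\<open>R\<close> is chosen before \<delta> and \<open>n0\<close>, so all perturbed
  minimisers lie in one compact family. This rests on \<open>\<epsilon> <= \<kappa> / 4\<close>:
  with this \<beta> the added cubic term can lose at most \<open>alpha \<phi> / 8\<close> times the
  third moment, half of what coercivity provides. The last clause is the comparison with
  \<open>(ts, ms)\<close>, in which every error carries the factor \<epsilon>.\<close>

lemma perturbed_minimiser:
  assumes \<phi>: "\<phi> \<in> H_test T" and \<kappa>: "0 < \<kappa>" and mp: "is_min_point T (objective W V \<phi> \<kappa>) ts ms"
  defines "\<beta> \<equiv> alpha \<phi> / (2 * \<kappa>)"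
  shows "good ms" and "\<exists>R. \<forall>\<delta> n0. 0 < \<delta> --> \<delta> <= 1 --> (\<exists>f \<epsilon> N t m. n0 <= N \<and> 0 < \<epsilon> \<and> \<epsilon> <= \<delta> \<and> C2_bounded f \<and>
    c2_bound (\<lambda>z. \<epsilon> * f z) \<delta> \<and> kl \<beta> f ms <= \<delta> \<and> t \<in> {0..<T} \<and> good m \<and> w3 m <= R \<and> ent m <= R \<and>
    (\<forall>s\<in>{0..<T}. \<forall>\<mu>. objective (Wn N) V (perturb T ts \<beta> \<epsilon> f \<phi>) (\<kappa> + \<epsilon>) t m
        <= objective (Wn N) V (perturb T ts \<beta> \<epsilon> f \<phi>) (\<kappa> + \<epsilon>) s \<mu>) \<and>
    bar T ts t + \<epsilon> * kl \<beta> f m + (Jr W V \<phi> \<kappa> t m - Jr W V \<phi> \<kappa> ts ms)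
      <= \<epsilon> * (3 * \<delta> + \<beta> * (1 - exp (lam \<phi> * (t - ts))) * w3 m))" (is "\<exists>R. \<forall>\<delta> n0. _ --> _ --> ?P R \<delta> n0")
proof -
  have ts: "0 < ts" "ts < T" and mn: "!!s \<mu>. s \<in> {0..<T} ==> objective W V \<phi> \<kappa> ts ms <= objective W V \<phi> \<kappa> s \<mu>"
    using mp unfolding is_min_point_def by auto
  have al: "0 < alpha \<phi>" "0 < lam \<phi>" and C1: "C1_bounded_on_initial T (psi \<phi>)" and f0C: "C2_bounded (fpart \<phi>)"
    using \<phi> by (auto simp: H_test_def)
  have \<beta>: "0 < \<beta>" using al \<kappa> by (simp add: \<beta>_def)
  show gms: "good ms"
  proof (rule ccontr)
    assume "\<not> good ms"
    then have "objective W V \<phi> \<kappa> ts ms = \<infinity>" by (rule objective_not_good) (use \<kappa> al in auto)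
    moreover obtain m :: "('a \<times> 'a) P2" where "good m" using good_exists by blast
    ultimately show False using mn[of ts m] ts by (simp add: objective_Jr)
  qed
  have mnJ: "Jr W V \<phi> \<kappa> ts ms <= Jr W V \<phi> \<kappa> s \<mu>" if "s \<in> {0..<T}" "good \<mu>" for s \<mu>
    using mn[OF that(1), of \<mu>] that gms by (simp add: objective_Jr)
  have f0m: "fpart \<phi> \<in> borel_measurable borel" using f0C by (rule C2_bounded_measurable)
  obtain B where B: "!!z. \<bar>fpart \<phi> z\<bar> <= B" using C2_bounded_c2_bound[OF f0C] c2_boundD by blast
  have psic: "continuous_on {0..<T} (psi \<phi>)" by (rule C1_initial_continuous[OF C1])
  obtain c' where c': "!!U t m. good m ==> (!!x \<mu>. norm (U (t, x, \<mu>)) <= C * (1 + norm x + sqrt (E2 \<mu>))) ==> \<bar>Zfun U V t m\<bar> <= 1 * w3 m + c'"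
    using Zfun_coercive[OF Vb D0 C0 zero_less_one] by blast
  obtain c where c: "!!m :: ('a \<times> 'a) P2. good m ==> coercive_const V C (alpha \<phi>) \<kappa> c m"
    using coercive_const_exists[OF Vb D0 C0 al(1) \<kappa>] by blast
  define E0 where "E0 = alpha \<phi> * exp (lam \<phi> * T) * w3 ms"
  define F0 where "F0 = (LINT z|meas ms. fpart \<phi> z)"
  \<comment> \<open>An upper bound for \<open>psi\<close> on all of [0, T): minimality of
    \<open>(ts, ms)\<close> against \<open>(s, ms)\<close> bounds \<open>psi \<phi> s\<close> for
    every \<open>s\<close>, although test functions are controlled only away from
    \<open>T\<close>.\<close>
  define P where "P = w3 ms + c' - F0 + E0 + \<kappa> * ent ms - Jr W V \<phi> \<kappa> ts ms"
  have psiP: "psi \<phi> s <= P" if s: "s \<in> {0..<T}" for s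
  proof -
    have "exp (lam \<phi> * s) <= exp (lam \<phi> * T)" using s al by simp
    then have "alpha \<phi> * exp (lam \<phi> * s) * w3 ms <= E0" unfolding E0_def
      using al w3_nonneg by (intro mult_right_mono mult_left_mono) auto
    moreover have "\<bar>Zfun W V s ms\<bar> <= 1 * w3 ms + c'" by (rule c'[OF gms]) (use Wb s in auto)
    ultimately show ?thesis using mnJ[OF s gms] unfolding Jr_def[of W V \<phi> \<kappa> s] P_def F0_def[symmetric] by linarith
  qed
  define c1 where "c1 = w3 ms + c' - psi \<phi> ts - F0 + alpha \<phi> * exp (lam \<phi> * ts) * w3 ms + \<kappa> * ent ms"
  have c1: "Jr (Wn n) V \<phi> \<kappa> ts ms <= c1" for n
  proof -
    have "\<bar>Zfun (Wn n) V ts ms\<bar> <= 1 * w3 ms + c'" by (rule c'[OF gms]) (use Wnb ts in auto)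
    then show ?thesis unfolding Jr_def c1_def F0_def by linarith
  qed
  define Q where "Q = P + B + c + c1 + \<kappa> / 4"
  define R where "R = max (max (8 * Q / alpha \<phi>) (4 * Q / \<kappa>)) (max (w3 ms) (ent ms))"
  have Rms: "w3 ms <= R" "ent ms <= R" by (auto simp: R_def)
  show "\<exists>R. \<forall>\<delta> n0. 0 < \<delta> --> \<delta> <= 1 --> ?P R \<delta> n0"
  proof (rule exI[of _ R], intro allI impI)
    fix \<delta> :: real and n0 :: nat assume \<delta>: "0 < \<delta>" "\<delta> <= 1"
    obtain f where f: "C2_bounded f" "kl \<beta> f ms <= \<delta>" using kl_small_exists[OF gms \<beta> \<delta>(1)] by blast
    obtain b where b: "0 <= b" "c2_bound f b" using C2_bounded_c2_bound[OF f(1)] by blast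
    \<comment> \<open>The first bound protects coercivity; the second makes
      \<open>\<epsilon> * f\<close> of C^2 size at most \<delta> and also gives
      \<open>\<epsilon> <= \<delta>\<close>.\<close>
    define \<epsilon> where "\<epsilon> = min (\<kappa> / 4) (\<delta> / (b + 1))"
    have \<epsilon>: "0 < \<epsilon>" "\<epsilon> <= \<kappa> / 4" unfolding \<epsilon>_def using \<kappa> \<delta> b min.cobounded1 by (simp_all del: min_less_iff_conj add: min_def)
    have "\<epsilon> * (b + 1) <= (\<delta> / (b + 1)) * (b + 1)" using b by (intro mult_right_mono) (auto simp: \<epsilon>_def)
    also have "\<dots> = \<delta>" using b by simp
    finally have eb: "\<epsilon> * b + \<epsilon> <= \<delta>" by (simp add: algebra_simps)
    have eb0: "0 <= \<epsilon> * b" using \<epsilon> b by simp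
    have cb: "c2_bound (\<lambda>z. \<epsilon> * f z) \<delta>"
      by (rule c2_bound_mono[OF c2_bound_scale[OF b(2)]]) (use \<epsilon> eb in auto)
    have fm: "f \<in> borel_measurable borel" and fb: "!!z. \<bar>f z\<bar> <= b"
      using C2_bounded_measurable[OF f(1)] c2_boundD[OF b(2)] by auto
    have "0 < \<epsilon> * \<delta>" using \<epsilon> \<delta> by simp
    \<comment> \<open>Possible only after \<open>f\<close> and \<epsilon> are fixed. Two errors of
      this size, at \<open>m\<close> and at \<open>ms\<close>, together with
      \<open>kl \<beta> f ms <= \<delta>\<close>, make up the \<open>3 * \<delta>\<close> of the
      comparison.\<close>
    then obtain N0 where N0: "\<forall>n\<ge>N0. \<forall>t\<in>{0..T}. \<forall>m. good m --> w3 m <= R --> ent m <= R \<longrightarrow>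
        \<bar>Zfun (Wn n) V t m - Zfun W V t m\<bar> <= \<epsilon> * \<delta>" using Zfun_uniform by blast
    define N where "N = max n0 N0"
    define \<phi>' where "\<phi>' = perturb T ts \<beta> \<epsilon> f \<phi>"
    have \<phi>'H: "\<phi>' \<in> H_test T" unfolding \<phi>'_def by (rule perturb_H_test[OF \<phi> f(1)]) (use \<epsilon> \<beta> in auto)
    have "\<exists>t m. t \<in> {0..<T} \<and> good m \<and> (\<forall>s\<in>{0..<T}. \<forall>\<mu>. objective (Wn N) V \<phi>' (\<kappa> + \<epsilon>) t m <= objective (Wn N) V \<phi>' (\<kappa> + \<epsilon>) s \<mu>)"
    proof (rule minimiser_exists[OF Wnc Wnb C0 Vc Vb D0 _ _ _ _ _ _ _ _ gms T])
      show "0 < alpha \<phi>'" "0 < lam \<phi>'" "fpart \<phi>' \<in> borel_measurable borel" "continuous_on {0..<T} (psi \<phi>')"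
        using \<phi>'H by (auto simp: H_test_def intro: C2_bounded_measurable C1_initial_continuous)
      show "0 < \<kappa> + \<epsilon>" using \<kappa> \<epsilon> by simp
      show "\<bar>fpart \<phi>' z\<bar> <= B + \<epsilon> * b" for z
      proof -
        have "\<bar>\<epsilon> * f z\<bar> <= \<epsilon> * b" using fb[of z] \<epsilon> by (simp add: abs_mult)
        then show ?thesis using B[of z] unfolding \<phi>'_def perturb_simps by linarith
      qed
      show "psi \<phi>' t <= P" if t: "t \<in> {0..<T}" for t
      proof -
        have "0 <= bar T ts t" using t by (intro bar_nonneg) auto
        then show ?thesis using psiP[OF t] by (simp add: \<phi>'_def)
      qed
      show "\<exists>\<tau><T. \<forall>t\<in>{0..<T}. d <= psi \<phi>' t --> t <= \<tau>" for d
      proof -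
        obtain \<tau> where tau: "\<tau> < T" "!!t. t \<in> {0..<T} ==> bar T ts t <= P - d ==> t <= \<tau>" using bar_barrier[OF ts(2), of "P - d"] by blast
        show ?thesis
        proof (intro exI[of _ \<tau>] conjI ballI impI tau)
          fix t assume t: "t \<in> {0..<T}" "d <= psi \<phi>' t"
          show "bar T ts t <= P - d" using t(2) psiP[OF t(1)] by (simp add: \<phi>'_def)
        qed
      qed
    qed (simp_all)
    then obtain t m where tm: "t \<in> {0..<T}" "good m"
      "\<forall>s\<in>{0..<T}. \<forall>\<mu>. objective (Wn N) V \<phi>' (\<kappa> + \<epsilon>) t m <= objective (Wn N) V \<phi>' (\<kappa> + \<epsilon>) s \<mu>" by blast
    have "Jr (Wn N) V \<phi>' (\<kappa> + \<epsilon>) t m <= Jr (Wn N) V \<phi>' (\<kappa> + \<epsilon>) ts ms"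
      using tm(3)[rule_format, of ts ms] tm(2) gms ts by (simp add: objective_Jr)
    then have main: "Jr (Wn N) V \<phi> \<kappa> t m + bar T ts t + \<epsilon> * kl \<beta> f m + \<epsilon> * (\<beta> * (exp (lam \<phi> * (t - ts)) - 1) * w3 m)
        <= Jr (Wn N) V \<phi> \<kappa> ts ms + \<epsilon> * kl \<beta> f ms"
      unfolding \<phi>'_def Jr_perturb[OF fm fb f0m B] by (simp add: bar_def algebra_simps)
    have bn: "0 <= bar T ts t" using tm by (intro bar_nonneg) auto
    have "0 <= kl \<beta> f m" by (rule kl_nonneg[OF tm(2) \<beta> fm fb])
    then have kn: "0 <= \<epsilon> * kl \<beta> f m" using \<epsilon> by simp
    have ek: "\<epsilon> * kl \<beta> f ms <= \<epsilon> * \<delta>" using f(2) \<epsilon> by (intro mult_left_mono) auto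
    have ek4: "\<epsilon> * \<delta> <= \<kappa> / 4" using mult_mono[OF \<epsilon>(2) \<delta>(2)] \<epsilon> \<delta> \<kappa> by simp
    have w0: "0 <= w3 m" by (rule w3_nonneg)
    have "- (alpha \<phi> / 8) * w3 m <= \<epsilon> * (\<beta> * (exp (lam \<phi> * (t - ts)) - 1) * w3 m)"
    proof -
      have "\<epsilon> * \<beta> <= (\<kappa> / 4) * \<beta>" using \<epsilon> \<beta> by (intro mult_right_mono) auto
      also have "\<dots> = alpha \<phi> / 8" using \<kappa> by (simp add: \<beta>_def)
      finally have "\<epsilon> * \<beta> * w3 m <= (alpha \<phi> / 8) * w3 m" using w0 by (rule mult_right_mono)
      moreover have "0 <= \<epsilon> * \<beta> * exp (lam \<phi> * (t - ts)) * w3 m" using \<epsilon> \<beta> w0 by simp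
      ultimately show ?thesis by (simp add: algebra_simps)
    qed
    with main bn kn ek ek4 c1[of N] have up: "Jr (Wn N) V \<phi> \<kappa> t m <= c1 + \<kappa> / 4 + (alpha \<phi> / 8) * w3 m" by linarith
    have cc: "(alpha \<phi> / 4) * w3 m <= Jr (Wn N) V \<phi> \<kappa> t m + psi \<phi> t + B + c"
      "\<kappa> * ent m <= Jr (Wn N) V \<phi> \<kappa> t m + psi \<phi> t + B + c + (alpha \<phi> / 4) * w3 m"
      by (rule coercive_constD[OF c[OF tm(2)]]; use tm(1) Wnb al f0m B in auto)+
    have q: "(alpha \<phi> / 4) * w3 m = (alpha \<phi> / 8) * w3 m + (alpha \<phi> / 8) * w3 m" by simp
    have wQ: "(alpha \<phi> / 8) * w3 m <= Q" using cc(1) up psiP[OF tm(1)] q unfolding Q_def by linarith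
    then have "w3 m <= 8 * Q / alpha \<phi>" using al by (simp add: field_simps)
    then have wR: "w3 m <= R" by (simp add: R_def)
    define w where "w = (alpha \<phi> / 8) * w3 m"
    have w4: "(alpha \<phi> / 4) * w3 m = 2 * w" by (simp add: w_def)
    have "\<kappa> * ent m <= Q + 3 * w"
      using cc(2) up psiP[OF tm(1)] unfolding Q_def w4 w_def[symmetric] by linarith
    moreover have "w <= Q" using wQ by (simp add: w_def)
    ultimately have "\<kappa> * ent m <= 4 * Q" by linarith
    then have "ent m <= 4 * Q / \<kappa>" using \<kappa> by (simp add: pos_le_divide_eq mult.commute)
    then have eR: "ent m <= R" by (simp add: R_def)
    have Z1: "\<bar>Zfun (Wn N) V t m - Zfun W V t m\<bar> <= \<epsilon> * \<delta>" using N0 tm wR eR by (simp add: N_def)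
    have Z2: "\<bar>Zfun (Wn N) V ts ms - Zfun W V ts ms\<bar> <= \<epsilon> * \<delta>" using N0 gms Rms ts by (simp add: N_def)
    have "Jr (Wn N) V \<phi> \<kappa> t m - Jr W V \<phi> \<kappa> t m = Zfun (Wn N) V t m - Zfun W V t m"
      "Jr (Wn N) V \<phi> \<kappa> ts ms - Jr W V \<phi> \<kappa> ts ms = Zfun (Wn N) V ts ms - Zfun W V ts ms" by (simp_all add: Jr_def)
    moreover have "\<epsilon> * (3 * \<delta> + \<beta> * (1 - exp (lam \<phi> * (t - ts))) * w3 m)
      = 3 * (\<epsilon> * \<delta>) - \<epsilon> * (\<beta> * (exp (lam \<phi> * (t - ts)) - 1) * w3 m)" by (simp add: algebra_simps)
    ultimately have cmp: "bar T ts t + \<epsilon> * kl \<beta> f m + (Jr W V \<phi> \<kappa> t m - Jr W V \<phi> \<kappa> ts ms)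
      <= \<epsilon> * (3 * \<delta> + \<beta> * (1 - exp (lam \<phi> * (t - ts))) * w3 m)" using main ek Z1 Z2 by linarith
    have "n0 <= N" by (simp add: N_def)
    moreover have "\<epsilon> <= \<delta>" using eb eb0 by linarith
    ultimately show "?P R \<delta> n0"
      using \<epsilon>(1) f cb tm(1,2) wR eR tm(3)[unfolded \<phi>'_def] cmp by blast
  qed
qed

end

text \<open>With accuracy \<open>1/(j + 1)\<close> the comparison sends the penalty to zero, hence
  \<open>t j\<close> to \<open>ts\<close>. Only then does the error \<open>h\<close> vanish, and
  division by \<epsilon> sends the relative entropies to zero, which gives setwise convergence. The
  values of the functional converge too; since all terms but entropy and cubic weight are
  continuous, the weighted sum of these two converges and \<open>w3_tendsto\<close> applies.\<close>

lemma (in approx_solutions) perturbed_minimisers: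
  assumes \<phi>: "\<phi> \<in> H_test T" and \<kappa>: "0 < \<kappa>" and mp: "is_min_point T (objective W V \<phi> \<kappa>) ts ms"
  shows "\<exists>R \<beta> f \<epsilon> \<delta> N t m. good_seq m ms R \<and> (\<lambda>j. w3 (m j)) \<longlonglongrightarrow> w3 ms \<and> t \<longlonglongrightarrow> ts \<and> 0 < ts \<and> ts < T \<and>
    filterlim N at_top sequentially \<and> \<epsilon> \<longlonglongrightarrow> 0 \<and> (\<forall>j. 0 < \<epsilon> j) \<and> 0 < \<beta> \<and> \<delta> \<longlonglongrightarrow> 0 \<and>
    (\<forall>j. C2_bounded (f j)) \<and> (\<forall>j. c2_bound (\<lambda>z. \<epsilon> j * f j z) (\<delta> j)) \<and>
    (\<forall>j. is_min_point T (objective (Wn (N j)) V (perturb T ts \<beta> (\<epsilon> j) (f j) \<phi>) (\<kappa> + \<epsilon> j)) (t j) (m j))"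
proof -
  define \<beta> where "\<beta> = alpha \<phi> / (2 * \<kappa>)"
  have ts: "0 < ts" "ts < T" and mn: "!!s \<mu>. s \<in> {0..<T} ==> objective W V \<phi> \<kappa> ts ms <= objective W V \<phi> \<kappa> s \<mu>"
    using mp unfolding is_min_point_def by auto
  have al: "0 < alpha \<phi>" "0 < lam \<phi>" and C1: "C1_bounded_on_initial T (psi \<phi>)" and f0C: "C2_bounded (fpart \<phi>)"
    using \<phi> by (auto simp: H_test_def)
  have \<beta>: "0 < \<beta>" using al \<kappa> by (simp add: \<beta>_def)
  note pm = perturbed_minimiser[OF \<phi> \<kappa> mp, folded \<beta>_def]
  have gms: "good ms" by (rule pm(1))
  have f0m: "fpart \<phi> \<in> borel_measurable borel" using f0C by (rule C2_bounded_measurable)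
  obtain B where B: "!!z. \<bar>fpart \<phi> z\<bar> <= B" using C2_bounded_c2_bound[OF f0C] c2_boundD by blast
  define J where "J = Jr W V \<phi> \<kappa>"
  have mnJ: "J ts ms <= J s \<mu>" if "s \<in> {0..<T}" "good \<mu>" for s \<mu>
    using mn[OF that(1), of \<mu>] that gms by (simp add: objective_Jr J_def)
  define \<Phi> where "\<Phi> R \<delta> n0 f \<epsilon> N t m \<longleftrightarrow> n0 <= N \<and> 0 < \<epsilon> \<and> \<epsilon> <= \<delta> \<and> C2_bounded f \<and>
    c2_bound (\<lambda>z. \<epsilon> * f z) \<delta> \<and> kl \<beta> f ms <= \<delta> \<and> t \<in> {0..<T} \<and> good m \<and> w3 m <= R \<and> ent m <= R \<and>
    (\<forall>s\<in>{0..<T}. \<forall>\<mu>. objective (Wn N) V (perturb T ts \<beta> \<epsilon> f \<phi>) (\<kappa> + \<epsilon>) t m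
        <= objective (Wn N) V (perturb T ts \<beta> \<epsilon> f \<phi>) (\<kappa> + \<epsilon>) s \<mu>) \<and>
    bar T ts t + \<epsilon> * kl \<beta> f m + (J t m - J ts ms)
      <= \<epsilon> * (3 * \<delta> + \<beta> * (1 - exp (lam \<phi> * (t - ts))) * w3 m)" for R \<delta> :: real and n0 f \<epsilon> N t m
  define d where "d j = inverse (real (Suc j))" for j
  have d: "0 < d j" "d j <= 1" "d \<longlonglongrightarrow> 0" for j
    unfolding d_def[abs_def] using LIMSEQ_inverse_real_of_nat by (auto simp: inverse_le_1_iff simp del: of_nat_Suc)
  obtain R where "!!\<delta> n0. 0 < \<delta> ==> \<delta> <= 1 ==> \<exists>f \<epsilon> N t m. \<Phi> R \<delta> n0 f \<epsilon> N t m"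
    using pm(2) unfolding \<Phi>_def J_def by blast
  then have "\<forall>j. \<exists>f \<epsilon> N t m. \<Phi> R (d j) j f \<epsilon> N t m" using d by blast
  then obtain f \<epsilon> N t m where A: "!!j. \<Phi> R (d j) j (f j) (\<epsilon> j) (N j) (t j) (m j)" by metis
  have e: "j <= N j" "0 < \<epsilon> j" "\<epsilon> j <= d j" "C2_bounded (f j)" "c2_bound (\<lambda>z. \<epsilon> j * f j z) (d j)" "kl \<beta> (f j) ms <= d j"
    "t j \<in> {0..<T}" "good (m j)" "w3 (m j) <= R" "ent (m j) <= R" for j
    using A[of j] unfolding \<Phi>_def by simp_all
  have mnk: "\<forall>s\<in>{0..<T}. \<forall>\<mu>. objective (Wn (N j)) V (perturb T ts \<beta> (\<epsilon> j) (f j) \<phi>) (\<kappa> + \<epsilon> j) (t j) (m j)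
        <= objective (Wn (N j)) V (perturb T ts \<beta> (\<epsilon> j) (f j) \<phi>) (\<kappa> + \<epsilon> j) s \<mu>" for j
    using A[of j] unfolding \<Phi>_def by blast
  \<comment> \<open>The mismatch of the cubic coefficients away from \<open>ts\<close>; a priori it
    is only bounded above, by \<open>\<beta> * R\<close>.\<close>
  define h where "h j = \<beta> * (1 - exp (lam \<phi> * (t j - ts))) * w3 (m j)" for j
  have cmp: "bar T ts (t j) + \<epsilon> j * kl \<beta> (f j) (m j) + (J (t j) (m j) - J ts ms) <= \<epsilon> j * (3 * d j + h j)" for j
    using A[of j] unfolding \<Phi>_def h_def by blast
  have fm: "f j \<in> borel_measurable borel" for j using C2_bounded_measurable[OF e(4)] .
  have "\<exists>b. \<forall>z. \<bar>f j z\<bar> <= b" for j using C2_bounded_c2_bound[OF e(4)[of j]] c2_boundD by blast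
  then obtain b where fb: "!!j z. \<bar>f j z\<bar> <= b j" by metis
  have kn: "0 <= kl \<beta> (f j) (m j)" "0 <= kl \<beta> (f j) ms" for j
    using kl_nonneg[OF _ \<beta> fm fb] e(8) gms by auto
  have ekn: "0 <= \<epsilon> j * kl \<beta> (f j) (m j)" for j using kn(1)[of j] e(2)[of j] by simp
  have bn: "0 <= bar T ts (t j)" for j using e(7)[of j] by (intro bar_nonneg) auto
  have Jn: "J ts ms <= J (t j) (m j)" for j using mnJ e(7,8) by blast
  define H where "H = 3 + \<beta> * R"
  have R0: "0 <= R" using w3_nonneg[of "m 0"] e(9)[of 0] by linarith
  have hR: "h j <= \<beta> * R" for j
  proof -
    have "(1 - exp (lam \<phi> * (t j - ts))) * w3 (m j) <= 1 * R"
      by (rule mult_mono) (use e(9) w3_nonneg in auto)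
    then have "\<beta> * ((1 - exp (lam \<phi> * (t j - ts))) * w3 (m j)) <= \<beta> * (1 * R)" using \<beta> by (intro mult_left_mono) auto
    then show ?thesis by (simp add: h_def mult.assoc)
  qed
  have up: "\<epsilon> j * (3 * d j + h j) <= d j * H" for j
  proof -
    have "\<epsilon> j * (3 * d j + h j) <= \<epsilon> j * H" using hR[of j] d(2)[of j] e(2)[of j] by (intro mult_left_mono) (auto simp: H_def)
    also have "\<dots> <= d j * H" using e(3)[of j] \<beta> R0 by (intro mult_right_mono) (auto simp: H_def)
    finally show ?thesis .
  qed
  have dH: "(\<lambda>j. d j * H) \<longlonglongrightarrow> 0" using tendsto_mult_left_zero[OF d(3)] .
  have eps: "\<epsilon> \<longlonglongrightarrow> 0"
    by (rule tendsto_sandwich[OF _ _ tendsto_const d(3)]) (use e(2,3) in \<open>auto intro!: always_eventually less_imp_le\<close>)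
  have ts_lim: "t \<longlonglongrightarrow> ts"
  proof -
    have "(t j - ts)\<^sup>2 <= T * (d j * H)" for j
    proof -
      have b1: "bar T ts (t j) <= d j * H" using cmp[of j] up[of j] ekn[of j] Jn[of j] by linarith
      have "(t j - ts)\<^sup>2 = (T - t j) * bar T ts (t j)" using e(7)[of j] by (simp add: bar_def)
      also have "\<dots> <= T * bar T ts (t j)" using e(7)[of j] bn by (intro mult_right_mono) auto
      also have "\<dots> <= T * (d j * H)" using b1 T by (intro mult_left_mono) auto
      finally show ?thesis .
    qed
    then have "(\<lambda>j. (t j - ts)\<^sup>2) \<longlonglongrightarrow> 0"
      by (intro tendsto_sandwich[OF _ _ tendsto_const tendsto_mult_right_zero[OF dH, of T]]) (auto intro!: always_eventually)
    then have "(\<lambda>j. sqrt ((t j - ts)\<^sup>2)) \<longlonglongrightarrow> sqrt 0" by (rule tendsto_real_sqrt)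
    then have "(\<lambda>j. \<bar>t j - ts\<bar>) \<longlonglongrightarrow> 0" by simp
    then show ?thesis by (simp add: tendsto_rabs_zero_iff LIM_zero_iff)
  qed
  have h0: "h \<longlonglongrightarrow> 0"
  proof -
    have "(\<lambda>j. - (\<beta> * exp (- (lam \<phi> * ts))) * ((exp (lam \<phi> * t j) - exp (lam \<phi> * ts)) * w3 (m j))) \<longlonglongrightarrow> 0"
      by (intro tendsto_mult_right_zero exp_diff_w3_tendsto[OF ts_lim e(9)])
    moreover have "h j = - (\<beta> * exp (- (lam \<phi> * ts))) * ((exp (lam \<phi> * t j) - exp (lam \<phi> * ts)) * w3 (m j))" for j
    proof -
      have "exp (lam \<phi> * (t j - ts)) = exp (- (lam \<phi> * ts)) * exp (lam \<phi> * t j)" "1 = exp (- (lam \<phi> * ts)) * exp (lam \<phi> * ts)"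
        by (simp_all add: mult_exp_exp algebra_simps)
      then show ?thesis unfolding h_def by (simp only:) (simp add: algebra_simps)
    qed
    ultimately show ?thesis by (subst tendsto_cong[OF always_eventually]) auto
  qed
  have k1: "(\<lambda>j. kl \<beta> (f j) (m j)) \<longlonglongrightarrow> 0"
  proof (rule tendsto_sandwich[OF _ _ tendsto_const])
    have "(\<lambda>j. 3 * d j + h j) \<longlonglongrightarrow> 3 * 0 + 0" by (intro tendsto_intros d h0)
    then show "(\<lambda>j. 3 * d j + h j) \<longlonglongrightarrow> 0" by simp
    have "\<epsilon> j * kl \<beta> (f j) (m j) <= \<epsilon> j * (3 * d j + h j)" for j using cmp[of j] bn[of j] Jn[of j] by linarith
    then show "\<forall>\<^sub>F j in sequentially. kl \<beta> (f j) (m j) <= 3 * d j + h j"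
      using e(2) by (auto intro!: always_eventually simp: mult_le_cancel_left_pos)
  qed (use kn in auto)
  have k2: "(\<lambda>j. kl \<beta> (f j) ms) \<longlonglongrightarrow> 0"
    by (rule tendsto_sandwich[OF _ _ tendsto_const d(3)]) (use kn e(6) in auto)
  have sw: "setwise (\<lambda>j. meas (m j)) (meas ms)"
    by (rule kl_setwise[OF e(8) gms \<beta> fm fb k1 k2])
  interpret g: good_seq m ms R
    by unfold_locales (use sw e gms in auto)
  have tT: "t j \<in> {0..T}" for j using e(7)[of j] by auto
  have Zl: "(\<lambda>j. Zfun W V (t j) (m j)) \<longlonglongrightarrow> Zfun W V ts ms"
    by (rule g.Zfun_conv[where U = "\<lambda>j. W" and t = t, OF _ _ _ C0 Vc Vb D0])
      (use tT ts in \<open>auto intro!: Wn_tendsto(1) slice Wb ts_lim g.marg_conv\<close>)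
  have pl: "(\<lambda>j. psi \<phi> (t j)) \<longlonglongrightarrow> psi \<phi> ts"
    by (rule continuous_on_tendsto_compose[OF C1_initial_continuous[OF C1] ts_lim]) (use e(7) ts in auto)
  have fl: "(\<lambda>j. LINT z|meas (m j). fpart \<phi> z) \<longlonglongrightarrow> (LINT z|meas ms. fpart \<phi> z)"
    by (rule setwise_integral_bounded[OF sw finb_meas finb_meas f0m B])
  have Jl: "(\<lambda>j. J (t j) (m j)) \<longlonglongrightarrow> J ts ms"
  proof (rule tendsto_sandwich[OF _ _ tendsto_const])
    have "(\<lambda>j. J ts ms + d j * H) \<longlonglongrightarrow> J ts ms + 0" by (intro tendsto_intros dH)
    then show "(\<lambda>j. J ts ms + d j * H) \<longlonglongrightarrow> J ts ms" by simp
    have "J (t j) (m j) <= J ts ms + d j * H" for j using cmp[of j] up[of j] bn[of j] ekn[of j] by linarith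
    then show "\<forall>\<^sub>F j in sequentially. J (t j) (m j) <= J ts ms + d j * H" by simp
  qed (use Jn in auto)
  define \<xi> where "\<xi> = alpha \<phi> * exp (lam \<phi> * ts) / \<kappa>"
  have \<xi>: "0 < \<xi>" using al \<kappa> by (simp add: \<xi>_def)
  have eq: "ent (m j) + \<xi> * w3 (m j) = (J (t j) (m j) - Zfun W V (t j) (m j) + psi \<phi> (t j) + (LINT z|meas (m j). fpart \<phi> z)
      - alpha \<phi> * ((exp (lam \<phi> * t j) - exp (lam \<phi> * ts)) * w3 (m j))) / \<kappa>" for j
    using \<kappa> by (simp add: J_def Jr_def \<xi>_def field_simps)
  have eqs: "ent ms + \<xi> * w3 ms = (J ts ms - Zfun W V ts ms + psi \<phi> ts + (LINT z|meas ms. fpart \<phi> z) - alpha \<phi> * 0) / \<kappa>"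
    using \<kappa> by (simp add: J_def Jr_def \<xi>_def field_simps)
  have El: "(\<lambda>j. ent (m j) + \<xi> * w3 (m j)) \<longlonglongrightarrow> ent ms + \<xi> * w3 ms"
    unfolding eq eqs using \<kappa> by (intro tendsto_intros Jl Zl pl fl exp_diff_w3_tendsto[OF ts_lim e(9)]) auto
  have wl: "(\<lambda>j. w3 (m j)) \<longlonglongrightarrow> w3 ms" by (rule g.w3_tendsto[OF \<xi> El])
  \<comment> \<open>A minimum point requires a positive time, while a perturbed minimiser may sit at
    time zero; late indices avoid this since \<open>ts > 0\<close>.\<close>
  obtain K where K: "!!j. j >= K ==> 0 < t j"
    using order_tendstoD(1)[OF ts_lim ts(1)] unfolding eventually_sequentially by blast
  have N_lim: "filterlim (\<lambda>j. N (j + K)) at_top sequentially"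
    by (rule filterlim_at_top_mono[OF filterlim_ident]) (use e(1) in \<open>auto intro!: always_eventually intro: order_trans[OF le_add1]\<close>)
  have sm: "strict_mono (\<lambda>j. j + K)" by (simp add: strict_mono_def)
  show ?thesis
  proof (rule exI[of _ R], rule exI[of _ \<beta>], rule exI[of _ "\<lambda>j. f (j + K)"], rule exI[of _ "\<lambda>j. \<epsilon> (j + K)"], rule exI[of _ "\<lambda>j. d (j + K)"],
      rule exI[of _ "\<lambda>j. N (j + K)"], rule exI[of _ "\<lambda>j. t (j + K)"], rule exI[of _ "\<lambda>j. m (j + K)"], intro conjI allI)
    show "good_seq (\<lambda>j. m (j + K)) ms R"
      by unfold_locales (use setwise_subseq[OF sw sm] e gms in auto)
    show "is_min_point T (objective (Wn (N (j + K))) V (perturb T ts \<beta> (\<epsilon> (j + K)) (f (j + K)) \<phi>) (\<kappa> + \<epsilon> (j + K))) (t (j + K)) (m (j + K))" for j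
      using mnk[of "j + K"] K[of "j + K"] e(7)[of "j + K"] unfolding is_min_point_def by auto
  qed (use e ts \<beta> N_lim in \<open>auto intro!: LIMSEQ_ignore_initial_segment wl ts_lim eps d\<close>)
qed

section \<open>Derivatives of the test function\<close>

lemma has_derivative_quadratic_bound:
  fixes f :: "'a::real_normed_vector => 'b::real_normed_vector"
  assumes "!!v. norm (f v) <= K * (norm v)\<^sup>2"
  shows "(f has_derivative (\<lambda>_. 0)) (at 0)"
  unfolding has_derivative_at
proof
  have f0: "f 0 = 0" using assms[of 0] by simp
  show "(\<lambda>h. norm (f (0 + h) - f 0 - 0) / norm h) \<midarrow>0\<rightarrow> 0"
  proof (rule Lim_null_comparison)
    show "\<forall>\<^sub>F h in at 0. norm (norm (f (0 + h) - f 0 - 0) / norm h) <= K * norm h"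
      using assms by (intro always_eventually allI) (simp add: f0 divide_le_eq power2_eq_square mult.assoc)
    have "isCont (\<lambda>h::'a. K * norm h) 0" by (intro continuous_intros)
    then show "(\<lambda>h::'a. K * norm h) \<midarrow>0\<rightarrow> 0" by (simp add: isCont_def)
  qed
qed simp

text \<open>Away from the origin by the product rule for the norm times its square; at the origin,
  where the norm is not differentiable, from the cubic size.\<close>

lemma norm_cube_derivative:
  fixes x :: "'a::real_inner"
  shows "((\<lambda>x. norm x ^ 3) has_derivative (\<lambda>v. 3 * norm x * (x \<bullet> v))) (at x)"
proof -
  have d2: "((\<lambda>x. x \<bullet> x) has_derivative (\<lambda>v. 2 * (x \<bullet> v))) (at x)"
    by (auto intro!: derivative_eq_intros simp: inner_commute)
  have eq: "(\<lambda>x::'a. norm x ^ 3) = (\<lambda>x. norm x * (x \<bullet> x))"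
    by (simp add: power2_norm_eq_inner[symmetric] power3_eq_cube power2_eq_square mult.assoc)
  show ?thesis
  proof (cases "x = 0")
    case True
    have "((\<lambda>x::'a. norm x * (x \<bullet> x)) has_derivative (\<lambda>v. 0)) (at 0)"
    proof -
      have "((\<lambda>x::'a. (x \<bullet> x) *\<^sub>R norm x) has_derivative (\<lambda>v. 0)) (at 0)"
        unfolding has_derivative_at
      proof
        show "(\<lambda>h::'a. norm (((0 + h) \<bullet> (0 + h)) *\<^sub>R norm (0 + h) - (0 \<bullet> 0) *\<^sub>R norm 0 - 0) / norm h) \<midarrow>0\<rightarrow> 0"
        proof (rule Lim_null_comparison)
          show "\<forall>\<^sub>F h::'a in at 0. norm (norm (((0 + h) \<bullet> (0 + h)) *\<^sub>R norm (0 + h) - (0 \<bullet> 0) *\<^sub>R norm 0 - 0) / norm h) <= h \<bullet> h"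
            by (intro always_eventually allI) (simp add: divide_le_eq)
          have "isCont (\<lambda>h::'a. h \<bullet> h) 0" by (intro continuous_intros)
          then show "(\<lambda>h::'a. h \<bullet> h) \<midarrow>0\<rightarrow> 0" by (simp add: isCont_def)
        qed
      qed simp
      then show ?thesis by (simp add: mult.commute)
    qed
    then show ?thesis unfolding eq by (simp add: True)
  next
    case False
    have "((\<lambda>x. norm x * (x \<bullet> x)) has_derivative (\<lambda>v. norm x * (2 * (x \<bullet> v)) + (v \<bullet> sgn x) * (x \<bullet> x))) (at x)"
      by (rule has_derivative_mult[OF has_derivative_norm[OF False] d2])
    moreover have "norm x * (2 * (x \<bullet> v)) + (v \<bullet> sgn x) * (x \<bullet> x) = 3 * norm x * (x \<bullet> v)" for v
      using False by (simp add: sgn_div_norm inner_commute power2_norm_eq_inner[symmetric] power2_eq_square field_simps)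
    ultimately show ?thesis unfolding eq by simp
  qed
qed

text \<open>At the origin the quotient by \<open>norm x\<close> is zero by convention, and zero is
  the correct derivative because the function is of quadratic size.\<close>

lemma norm_cube_second_derivative:
  fixes x :: "'a::real_inner"
  shows "((\<lambda>x. 3 * norm x * (x \<bullet> b)) has_derivative (\<lambda>v. 3 * ((x \<bullet> v) * (x \<bullet> b) / norm x + norm x * (v \<bullet> b)))) (at x)"
proof (cases "x = 0")
  case True
  have "norm (3 * norm v * (v \<bullet> b)) <= (3 * norm b) * (norm v)\<^sup>2" for v
  proof -
    have "norm v * \<bar>v \<bullet> b\<bar> <= norm v * (norm v * norm b)" by (intro mult_left_mono Cauchy_Schwarz_ineq2) simp
    then show ?thesis by (simp add: abs_mult power2_eq_square mult_ac)
  qed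
  then have "((\<lambda>x. 3 * norm x * (x \<bullet> b)) has_derivative (\<lambda>v. 0)) (at 0)" by (rule has_derivative_quadratic_bound)
  then show ?thesis by (simp add: True)
next
  case False
  have "((\<lambda>x. x \<bullet> b) has_derivative (\<lambda>v. v \<bullet> b)) (at x)" by (auto intro!: derivative_eq_intros)
  from has_derivative_mult_right[OF has_derivative_mult[OF has_derivative_norm[OF False] this], of 3]
  have "((\<lambda>x. 3 * norm x * (x \<bullet> b)) has_derivative (\<lambda>v. 3 * (norm x * (v \<bullet> b) + (v \<bullet> sgn x) * (x \<bullet> b)))) (at x)"
    by (simp add: mult.assoc)
  moreover have "3 * (norm x * (v \<bullet> b) + (v \<bullet> sgn x) * (x \<bullet> b)) = 3 * ((x \<bullet> v) * (x \<bullet> b) / norm x + norm x * (v \<bullet> b))" for v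
    by (simp add: sgn_div_norm inner_commute divide_inverse algebra_simps)
  ultimately show ?thesis by (simp only:)
qed

text \<open>\<open>GX\<close> and \<open>LX\<close> read the gradient and the Laplacian in the first
  variable off the derivatives on the product space, so that C^2 smallness carries over to
  them.\<close>

definition GX :: "('a \<times> 'a => ('a \<times> 'a) \<Rightarrow>\<^sub>L real) => 'a \<times> 'a => 'a::euclidean_space" where
  "GX Df z = (\<Sum>b\<in>Basis. blinfun_apply (Df z) (b, 0) *\<^sub>R b)"

definition LX :: "('a \<times> 'a => ('a \<times> 'a) \<Rightarrow>\<^sub>L ('a \<times> 'a) \<Rightarrow>\<^sub>L real) => 'a::euclidean_space \<times> 'a => real" where
  "LX D2f z = (\<Sum>b\<in>Basis. blinfun_apply (blinfun_apply (D2f z) (b, 0)) (b, 0))"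

lemma norm_GX: "norm (GX Df z) <= real DIM('a) * norm (Df (z :: 'a::euclidean_space \<times> 'a))"
proof -
  have "norm (GX Df z) <= (\<Sum>b\<in>(Basis :: 'a set). norm (Df z))"
    unfolding GX_def
  proof (rule sum_norm_le)
    fix b :: 'a assume b: "b \<in> Basis"
    show "norm (blinfun_apply (Df z) (b, 0) *\<^sub>R b) <= norm (Df z)"
      using norm_blinfun[of "Df z" "(b, 0)"] b by (simp add: norm_Pair)
  qed
  then show ?thesis by simp
qed

lemma abs_LX: "\<bar>LX D2f z\<bar> <= real DIM('a) * norm (D2f (z :: 'a::euclidean_space \<times> 'a))"
proof -
  have "norm (LX D2f z) <= (\<Sum>b\<in>(Basis :: 'a set). norm (D2f z))"
    unfolding LX_def
  proof (rule sum_norm_le)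
    fix b :: 'a assume b: "b \<in> Basis"
    show "norm (blinfun_apply (blinfun_apply (D2f z) (b, 0)) (b, 0)) <= norm (D2f z)"
      using norm_blinfun[of "blinfun_apply (D2f z) (b, 0)" "(b, 0)"] norm_blinfun[of "D2f z" "(b, 0)"] b by (simp add: norm_Pair)
  qed
  then show ?thesis by simp
qed

lemma GX_add: "GX (\<lambda>z. A z + B z) z = GX A z + GX B z"
  by (simp add: GX_def blinfun.add_left scaleR_add_left sum.distrib)

lemma LX_add: "LX (\<lambda>z. A z + B z) z = LX A z + LX B z"
  by (simp add: LX_def blinfun.add_left sum.distrib)

lemma GX_continuous: "continuous_on UNIV Df ==> continuous_on UNIV (GX Df)"
  unfolding GX_def[abs_def] by (intro continuous_intros)

lemma LX_continuous: "continuous_on UNIV D2f ==> continuous_on UNIV (LX D2f)"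
  unfolding LX_def[abs_def] by (intro continuous_intros)

text \<open>The cube of the norm contributes the gradient \<open>3 |x| x\<close> and the Laplacian
  \<open>3 (1 + d) |x|\<close>; the Laplacian grows only linearly, so the quadratic growth sits in
  the gradient.\<close>

lemma test_grad_m_derivatives:
  fixes \<phi> :: "'a::euclidean_space test_fun"
  assumes D: "!!z. (fpart \<phi> has_derivative blinfun_apply (Df z)) (at z)"
    and D2: "!!z. (Df has_derivative blinfun_apply (D2f z)) (at z)"
  defines "a \<equiv> \<lambda>t. alpha \<phi> * exp (lam \<phi> * t)"
  shows "grad (\<lambda>x. test_grad_m \<phi> t (x, y)) x = GX Df (x, y) - (a t * (3 * norm x)) *\<^sub>R x"
    and "laplacian (\<lambda>x. test_grad_m \<phi> t (x, y)) x = LX D2f (x, y) - a t * (3 * (1 + real DIM('a)) * norm x)"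
proof -
  have p: "((\<lambda>x. (x, y)) has_derivative (\<lambda>v. (v, 0))) (at x)" for x :: 'a
    by (auto intro!: derivative_eq_intros)
  have d1: "((\<lambda>x. test_grad_m \<phi> t (x, y)) has_derivative (\<lambda>v. blinfun_apply (Df (x, y)) (v, 0) - a t * (3 * norm x * (x \<bullet> v)))) (at x)" for x
  proof -
    have "((\<lambda>x. fpart \<phi> (x, y)) has_derivative (\<lambda>v. blinfun_apply (Df (x, y)) (v, 0))) (at x)"
      by (rule has_derivative_compose[OF p D, unfolded comp_def])
    moreover have "((\<lambda>x. norm x ^ 3 + norm y ^ 3) has_derivative (\<lambda>v. 3 * norm x * (x \<bullet> v) + 0)) (at x)"
      by (intro has_derivative_add norm_cube_derivative has_derivative_const)
    ultimately have "((\<lambda>x. fpart \<phi> (x, y) - a t * (norm x ^ 3 + norm y ^ 3)) has_derivative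
        (\<lambda>v. blinfun_apply (Df (x, y)) (v, 0) - a t * (3 * norm x * (x \<bullet> v) + 0))) (at x)"
      by (intro has_derivative_diff has_derivative_mult_right)
    then show ?thesis by (simp add: test_grad_m_def a_def)
  qed
  note f1 = frechet_derivative_at[OF d1, symmetric]
  have "grad (\<lambda>x. test_grad_m \<phi> t (x, y)) x = (\<Sum>b\<in>Basis. (blinfun_apply (Df (x, y)) (b, 0)) *\<^sub>R b - (a t * (3 * norm x) * (x \<bullet> b)) *\<^sub>R b)"
    unfolding grad_def f1 by (simp add: scaleR_diff_left mult.assoc)
  also have "\<dots> = GX Df (x, y) - (a t * (3 * norm x)) *\<^sub>R (\<Sum>b\<in>Basis. (x \<bullet> b) *\<^sub>R b)"
    by (simp add: GX_def sum_subtractf scaleR_sum_right)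
  finally show "grad (\<lambda>x. test_grad_m \<phi> t (x, y)) x = GX Df (x, y) - (a t * (3 * norm x)) *\<^sub>R x"
    by (simp add: euclidean_representation)
  have d2: "((\<lambda>x. blinfun_apply (Df (x, y)) (b, 0) - a t * (3 * norm x * (x \<bullet> b))) has_derivative
      (\<lambda>v. blinfun_apply (blinfun_apply (D2f (x, y)) (v, 0)) (b, 0) - a t * (3 * ((x \<bullet> v) * (x \<bullet> b) / norm x + norm x * (v \<bullet> b))))) (at x)" for b
  proof (intro has_derivative_diff has_derivative_mult_right norm_cube_second_derivative)
    have "((\<lambda>x. Df (x, y)) has_derivative (\<lambda>v. blinfun_apply (D2f (x, y)) (v, 0))) (at x)"
      by (rule has_derivative_compose[OF p D2, unfolded comp_def])
    then show "((\<lambda>x. blinfun_apply (Df (x, y)) (b, 0)) has_derivative (\<lambda>v. blinfun_apply (blinfun_apply (D2f (x, y)) (v, 0)) (b, 0))) (at x)"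
      by (rule bounded_linear.has_derivative[OF blinfun.bounded_linear_left])
  qed
  note f2 = frechet_derivative_at[OF d2, symmetric]
  have n2: "(\<Sum>b\<in>Basis. (x \<bullet> b) * (x \<bullet> b)) = norm x * norm x"
    by (simp add: euclidean_inner[of x x, symmetric] power2_norm_eq_inner[symmetric] power2_eq_square)
  have "laplacian (\<lambda>x. test_grad_m \<phi> t (x, y)) x = LX D2f (x, y) -
      (\<Sum>b\<in>Basis. a t * (3 * ((x \<bullet> b) * (x \<bullet> b) / norm x + norm x * (b \<bullet> b))))"
    unfolding laplacian_def f1 f2 by (simp add: LX_def sum_subtractf)
  also have "(\<Sum>b\<in>Basis. a t * (3 * ((x \<bullet> b) * (x \<bullet> b) / norm x + norm x * (b \<bullet> b))))
    = a t * (3 * ((\<Sum>b\<in>Basis. (x \<bullet> b) * (x \<bullet> b)) / norm x + real DIM('a) * norm x))"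
    by (simp add: sum_distrib_left[symmetric] sum.distrib sum_divide_distrib[symmetric] inner_Basis)
  also have "\<dots> = a t * (3 * (1 + real DIM('a)) * norm x)"
    unfolding n2 by (cases "x = 0") (simp_all add: algebra_simps)
  finally show "laplacian (\<lambda>x. test_grad_m \<phi> t (x, y)) x = LX D2f (x, y) - a t * (3 * (1 + real DIM('a)) * norm x)" .
qed

lemma absorb_half: "y <= (a + p) * 2" if "y <= a + (y / 2 + p)" for y a p :: real
proof -
  have "y = y / 2 + y / 2" by simp
  then have "y / 2 <= a + p" using that by linarith
  then show ?thesis by simp
qed

section \<open>Limits of cubic integrands and of the Fisher information\<close>

context good_seq
begin

text \<open>The excess of \<open>g\<close> over \<open>L\<close> is \<open>g - min g L\<close>: the
  integral of \<open>g\<close> converges because third moments do, that of the truncation because it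
  is bounded. For the limit measure the excess is small when \<open>L\<close> is large, hence also
  for late \<open>j\<close>.\<close>

lemma ui_wt:
  assumes w: "(\<lambda>j. w3 (m j)) \<longlonglongrightarrow> w3 n" and K: "0 <= K"
  shows "ui (\<lambda>j. meas (m j)) (\<lambda>z. K * (1 + wt z))"
  unfolding ui_def
proof (intro conjI allI impI)
  define g where "g z = K * (1 + wt z)" for z :: "'a \<times> 'a"
  have wi: "integrable (meas k) wt" if "good k" for k using that by (simp add: good_def)
  have gi: "integrable (meas k) g" "(LINT z|meas k. g z) = K * (1 + w3 k)" if "good k" for k
  proof -
    interpret prob_space "meas k" by simp
    show "integrable (meas k) g" "(LINT z|meas k. g z) = K * (1 + w3 k)"
      unfolding g_def[abs_def] using wi[OF that] by (simp_all add: w3_def prob_space)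
  qed
  have [measurable]: "g \<in> borel_measurable borel" unfolding g_def wt_def by measurable
  have g0: "0 <= g z" for z using K by (simp add: g_def wt_def)
  show "integrable (meas (m j)) (\<lambda>z. K * (1 + wt z))" for j using gi(1)[OF gm] by (simp add: g_def[abs_def])
  fix e :: real assume e: "0 < e"
  have "(\<lambda>L. LINT z|meas n. max 0 (g z - real L)) \<longlonglongrightarrow> (LINT z|meas n. 0)"
  proof (rule integral_dominated_convergence[where w = g])
    show "AE z in meas n. (\<lambda>L. max 0 (g z - real L)) \<longlonglongrightarrow> 0"
    proof (rule AE_I2, rule tendsto_eventually)
      fix z
      obtain L0 where "g z <= real L0" using real_arch_simple by blast
      then show "\<forall>\<^sub>F L in sequentially. max 0 (g z - real L) = 0"
        unfolding eventually_sequentially by (intro exI[of _ L0]) auto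
    qed
  qed (use gi(1)[OF gn] g0 in auto)
  then have "\<forall>\<^sub>F L in sequentially. (LINT z|meas n. max 0 (g z - real L)) < e" using e by (intro order_tendstoD(2)) auto
  then obtain L where L: "(LINT z|meas n. max 0 (g z - real L)) < e" by (auto simp: eventually_sequentially)
  have mi: "integrable (meas k) (\<lambda>z. min (g z) (real L))" for k
    by (rule finb_integrable_bounded[OF finb_meas, where B = "real L"]) (use g0 in \<open>auto simp: abs_le_iff le_max_iff_disj min_def intro: order_trans[of _ 0]\<close>)
  have sp: "(LINT z|meas k. max 0 (g z - real L)) = K * (1 + w3 k) - (LINT z|meas k. min (g z) (real L))" if "good k" for k
  proof -
    have "max 0 (g z - real L) = g z - min (g z) (real L)" for z by (simp add: max_def min_def)
    then show ?thesis using gi[OF that] mi[of k] by simp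
  qed
  have "(\<lambda>j. LINT z|meas (m j). min (g z) (real L)) \<longlonglongrightarrow> (LINT z|meas n. min (g z) (real L))"
    by (rule setwise_integral_bounded[OF sw finb_meas finb_meas, where B = "real L"])
      (use g0 in \<open>auto simp: abs_le_iff min_def intro: order_trans[of _ 0]\<close>)
  then have "(\<lambda>j. LINT z|meas (m j). max 0 (g z - real L)) \<longlonglongrightarrow> (LINT z|meas n. max 0 (g z - real L))"
    unfolding sp[OF gm] sp[OF gn] by (intro tendsto_intros w)
  then have "\<forall>\<^sub>F j in sequentially. (LINT z|meas (m j). max 0 (g z - real L)) < e" using L by (rule order_tendstoD(2))
  then show "\<exists>L. \<forall>\<^sub>F j in sequentially. (LINT z|meas (m j). max 0 (K * (1 + wt z) - L)) <= e"
    unfolding g_def by (intro exI[of _ "real L"]) (auto elim: eventually_mono)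
qed

lemma subseq_good: "strict_mono (r::nat=>nat) ==> good_seq (\<lambda>j. m (r j)) n R"
  by unfold_locales (auto intro: setwise_subseq[OF sw] gm gn w3R entR)

text \<open>The coefficient \<open>s j * k j\<close> of the Fisher information is eventually bounded
  below, so this term absorbs the two linear gradient terms by Young's inequality. The resulting
  bound gives weakly convergent gradients along a subsequence; the linear terms then converge by
  \<open>weak_strong\<close>, and the quadratic one is lower semicontinuous.\<close>

lemma fisher_limit:
  assumes g: "!!j. is_grad_x_log (meas (m j)) (g j)" and gi: "!!j. integrable (meas (m j)) (\<lambda>z. (norm (g j z))\<^sup>2)"
    and U: "!!j. U j \<in> borel_measurable borel" "!!z. (\<lambda>j. U j z) \<longlonglongrightarrow> u z" "!!j z. (norm (U j z))\<^sup>2 <= K * quad z"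
    and H: "!!j. H j \<in> borel_measurable borel" "!!z. (\<lambda>j. H j z) \<longlonglongrightarrow> h z" "!!j z. (norm (H j z))\<^sup>2 <= K * quad z"
    and X: "X \<longlonglongrightarrow> X'" and s: "s \<longlonglongrightarrow> s'" "0 < s'" "!!j. 0 <= s j" and k: "k \<longlonglongrightarrow> k'" "0 < k'" "!!j. 0 <= k j"
    and ineq: "!!j. s j * k j * (LINT z|meas (m j). (norm (g j z))\<^sup>2)
       <= X j - 2 * s j * (LINT z|meas (m j). U j z \<bullet> g j z) - k j * (LINT z|meas (m j). H j z \<bullet> g j z)"
  shows "\<exists>g'. is_grad_x_log (meas n) g' \<and> integrable (meas n) (\<lambda>z. (norm (g' z))\<^sup>2) \<and>
     s' * k' * (LINT z|meas n. (norm (g' z))\<^sup>2) <= X' - 2 * s' * (LINT z|meas n. u z \<bullet> g' z) - k' * (LINT z|meas n. h z \<bullet> g' z)"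
proof -
  have gm': "g j \<in> borel_measurable borel" for j using is_grad_x_logD(2)[OF g finb_meas] .
  define I where "I j = (LINT z|meas (m j). (norm (g j z))\<^sup>2)" for j
  have I0: "0 <= I j" for j unfolding I_def by (rule integral_nonneg_AE) simp
  have K0: "0 <= K" using order_trans[OF zero_le_power2 U(3)[of 0 0]] by (simp add: quad_def)
  define Q where "Q = K * (R + 3)"
  have Q0: "0 <= Q" using K0 R0 by (simp add: Q_def)
  have cs: "\<bar>(LINT z|meas (m j). Y z \<bullet> g j z)\<bar> <= \<theta> * I j + (1 / \<theta>) * Q"
    if Y: "Y \<in> borel_measurable borel" "!!z. (norm (Y z))\<^sup>2 <= K * quad z" and \<theta>: "0 < \<theta>" for Y j \<theta>
  proof -
    note [measurable] = Y(1)
    have qi: "integrable (meas (m j)) (\<lambda>z. K * quad z)" using good_quad(1)[OF gm] by simp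
    have ym: "(\<lambda>z. (norm (Y z))\<^sup>2) \<in> borel_measurable borel" by measurable
    have yi: "integrable (meas (m j)) (\<lambda>z. (norm (Y z))\<^sup>2)"
      by (rule Bochner_Integration.integrable_bound[OF qi]) (use ym Y(2) in \<open>auto intro!: AE_I2 order_trans[OF Y(2)]\<close>)
    have "(LINT z|meas (m j). (norm (Y z))\<^sup>2) <= (LINT z|meas (m j). K * quad z)" by (rule integral_mono[OF yi qi Y(2)])
    also have "\<dots> = K * (LINT z|meas (m j). quad z)" by simp
    also have "\<dots> <= Q" unfolding Q_def
      using good_quad(2)[OF gm, of 1 j] w3R[of j] K0 by (intro mult_left_mono) auto
    finally have "(1 / \<theta>) * (LINT z|meas (m j). (norm (Y z))\<^sup>2) <= (1 / \<theta>) * Q" using \<theta> by (intro mult_left_mono) auto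
    then show ?thesis using inner_integral_weighted(2)[OF finb_meas Y(1) gm' yi gi \<theta>] unfolding I_def by linarith
  qed
  \<comment> \<open>Eventually \<open>s j > s' / 2\<close> and \<open>k j > k' / 2\<close>, so
    \<open>c\<close> bounds the Fisher coefficient from below; \<open>b\<close> bounds
    \<open>2 * s j + k j\<close> from above, each factor being at most doubled. With
    \<open>b * \<theta> = c / 2\<close> half of the Fisher term survives absorption.\<close>
  define c where "c = s' * k' / 4"
  have c: "0 < c" using s k by (simp add: c_def)
  define b where "b = 4 * s' + 2 * k'"
  have b: "0 < b" using s k by (simp add: b_def)
  define \<theta> where "\<theta> = c / (2 * b)"
  have \<theta>: "0 < \<theta>" "b * \<theta> = c / 2" using b c by (auto simp: \<theta>_def)
  define G where "G = (X' + 1 + b * ((1 / \<theta>) * Q)) * 2 / c"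
  have "\<forall>\<^sub>F j in sequentially. s' / 2 < s j \<and> s j < 2 * s' \<and> k' / 2 < k j \<and> k j < 2 * k' \<and> X j < X' + 1"
    using s k X by (intro eventually_conj order_tendstoD(1)[OF s(1)] order_tendstoD(2)[OF s(1)] order_tendstoD(1)[OF k(1)]
      order_tendstoD(2)[OF k(1)] order_tendstoD(2)[OF X]) auto
  then have "\<forall>\<^sub>F j in sequentially. I j <= G"
  proof eventually_elim
    case (elim j)
    define E where "E = \<theta> * I j + (1 / \<theta>) * Q"
    have E0: "0 <= E" using \<theta> I0 Q0 by (simp add: E_def)
    have u1: "- (2 * s j * (LINT z|meas (m j). U j z \<bullet> g j z)) <= 4 * s' * E"
    proof -
      have "- (2 * s j * (LINT z|meas (m j). U j z \<bullet> g j z)) <= 2 * s j * \<bar>(LINT z|meas (m j). U j z \<bullet> g j z)\<bar>"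
        using s(3)[of j] by (metis abs_ge_minus_self abs_mult abs_of_nonneg mult_nonneg_nonneg zero_le_numeral)
      also have "\<dots> <= (4 * s') * E" using cs[OF U(1,3) \<theta>(1), of j j] elim s(2) s(3)[of j] E0 by (intro mult_mono[of "2 * s j" "4 * s'"]) (auto simp: E_def)
      finally show ?thesis .
    qed
    have u2: "- (k j * (LINT z|meas (m j). H j z \<bullet> g j z)) <= 2 * k' * E"
    proof -
      have "- (k j * (LINT z|meas (m j). H j z \<bullet> g j z)) <= k j * \<bar>(LINT z|meas (m j). H j z \<bullet> g j z)\<bar>"
        using k(3)[of j] by (metis abs_ge_minus_self abs_mult abs_of_nonneg)
      also have "\<dots> <= (2 * k') * E" using cs[OF H(1,3) \<theta>(1), of j j] elim k(3)[of j] k(2) E0 by (intro mult_mono[of "k j" "2 * k'"]) (auto simp: E_def)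
      finally show ?thesis .
    qed
    have "c <= s j * k j" using mult_mono[of "s' / 2" "s j" "k' / 2" "k j"] elim s k by (simp add: c_def)
    then have "c * I j <= s j * k j * I j" using I0 by (rule mult_right_mono)
    then have "c * I j <= X' + 1 + b * E" using ineq[of j, folded I_def] u1 u2 elim unfolding b_def distrib_right by linarith
    also have "b * E = (c * I j) / 2 + b * ((1 / \<theta>) * Q)" unfolding E_def distrib_left mult.assoc[symmetric] \<theta>(2) by simp
    finally have "c * I j <= (X' + 1 + b * ((1 / \<theta>) * Q)) * 2" by (rule absorb_half)
    then show "I j <= G" using c by (simp add: G_def pos_le_divide_eq mult.commute)
  qed
  then obtain J where J: "!!j. j >= J ==> I j <= G" unfolding eventually_sequentially by blast
  have sm: "strict_mono (\<lambda>j. j + J)" by (simp add: strict_mono_def)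
  interpret s1: good_seq "\<lambda>j. m (j + J)" n R by (rule subseq_good[OF sm])
  obtain r g' where r: "strict_mono (r::nat=>nat)" "is_grad_x_log (meas n) g'" "g' \<in> borel_measurable borel"
     "weak_conv (\<lambda>j. meas (m (r j + J))) (\<lambda>j. g (r j + J)) (meas n) g'"
    using s1.grad_limit[of "\<lambda>j. g (j + J)" G] g gi J unfolding I_def by auto
  define q where "q j = r j + J" for j
  have q: "strict_mono q" using r(1) by (simp add: q_def strict_mono_def)
  interpret s2: good_seq "\<lambda>j. m (q j)" n R by (rule subseq_good[OF q])
  have wc: "weak_conv (\<lambda>j. meas (m (q j))) (\<lambda>j. g (q j)) (meas n) g'" using r(4) by (simp add: q_def)
  have IG: "(LINT z|meas (m (q j)). (norm (g (q j) z))\<^sup>2) <= G" for j using J[of "q j"] by (simp add: I_def q_def)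
  note sub = LIMSEQ_subseq_LIMSEQ[OF _ q, unfolded comp_def]
  have g'i: "integrable (meas n) (\<lambda>z. (norm (g' z))\<^sup>2)"
    by (rule s2.weak_conv_lsc(1)[OF wc gm' r(3) gi IG])
  have l1: "(\<lambda>j. LINT z|meas (m (q j)). U (q j) z \<bullet> g (q j) z) \<longlonglongrightarrow> (LINT z|meas n. u z \<bullet> g' z)"
    by (rule s2.weak_strong[OF wc gm' r(3) gi g'i IG U(1) sub[OF U(2)] U(3)])
  have l2: "(\<lambda>j. LINT z|meas (m (q j)). H (q j) z \<bullet> g (q j) z) \<longlonglongrightarrow> (LINT z|meas n. h z \<bullet> g' z)"
    by (rule s2.weak_strong[OF wc gm' r(3) gi g'i IG H(1) sub[OF H(2)] H(3)])
  have xl: "(\<lambda>j. X (q j) - 2 * s (q j) * (LINT z|meas (m (q j)). U (q j) z \<bullet> g (q j) z) - k (q j) * (LINT z|meas (m (q j)). H (q j) z \<bullet> g (q j) z))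
      \<longlonglongrightarrow> X' - 2 * s' * (LINT z|meas n. u z \<bullet> g' z) - k' * (LINT z|meas n. h z \<bullet> g' z)"
    by (intro tendsto_diff tendsto_mult tendsto_const sub[OF X] sub[OF s(1)] sub[OF k(1)] l1 l2)
  have sl: "(\<lambda>j. s (q j) * k (q j)) \<longlonglongrightarrow> s' * k'" by (intro tendsto_mult sub[OF s(1)] sub[OF k(1)])
  have "s' * k' * (LINT z|meas n. (norm (g' z))\<^sup>2) <= X' - 2 * s' * (LINT z|meas n. u z \<bullet> g' z) - k' * (LINT z|meas n. h z \<bullet> g' z)"
    by (rule s2.weak_conv_lsc(2)[OF wc gm' r(3) gi IG sl xl]) (use s(3) k(3) ineq in auto)
  then show ?thesis using r(2) g'i by blast
qed

end

text \<open>Linear growth of the drift times quadratic growth of the gradient of the cubic weight: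
  the product reaches third order and does not exceed it.\<close>

lemma cubic_growth:
  fixes r :: real
  assumes "0 <= r" "0 <= c" "0 <= A"
  shows "(1 + r) * (c + 3 * A * r\<^sup>2) <= (2 * c + 6 * A) * (1 + r ^ 3)"
proof -
  have r: "r <= 1 + r ^ 3" "r\<^sup>2 <= 1 + r ^ 3"
  proof -
    have "r <= 1 + r ^ 3 \<and> r\<^sup>2 <= 1 + r ^ 3"
    proof (cases "r <= 1")
      case True
      then have "r\<^sup>2 <= 1" using assms(1) by (simp add: power_le_one)
      moreover have "0 <= r ^ 3" using assms(1) by simp
      ultimately show ?thesis using True by linarith
    next
      case False
      then have "r ^ 1 <= r ^ 3" "r ^ 2 <= r ^ 3" by (rule_tac power_increasing; simp)+
      then show ?thesis by simp
    qed
    then show "r <= 1 + r ^ 3" "r\<^sup>2 <= 1 + r ^ 3" by auto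
  qed
  have "(1 + r) * (c + 3 * A * r\<^sup>2) = c + c * r + 3 * A * r\<^sup>2 + 3 * A * r ^ 3"
    by (simp add: algebra_simps power2_eq_square power3_eq_cube)
  also have "\<dots> <= c * (1 + r ^ 3) + c * (1 + r ^ 3) + 3 * A * (1 + r ^ 3) + 3 * A * (1 + r ^ 3)"
    using assms r by (intro add_mono mult_left_mono) (auto intro: mult_left_mono[of 1 "1 + r ^ 3" c, simplified])
  also have "\<dots> = (2 * c + 6 * A) * (1 + r ^ 3)" by (simp add: algebra_simps)
  finally show ?thesis .
qed

lemma sqrt_quad:
  fixes z :: "'b::euclidean_space \<times> 'b"
  shows "1 <= sqrt (quad z)" "norm (fst z) <= sqrt (quad z)" "norm (snd z) <= sqrt (quad z)"
    "sqrt (quad z) * sqrt (quad z) = quad z" "sqrt (quad z) <= quad z"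
proof -
  have q: "1 <= quad z" by (simp add: quad_def)
  show 1: "1 <= sqrt (quad z)" using q by simp
  have "norm z <= sqrt (quad z)" by (rule real_le_rsqrt) (simp add: quad_def)
  then show "norm (fst z) <= sqrt (quad z)" "norm (snd z) <= sqrt (quad z)"
    using norm_fst_le[of "fst z" "snd z"] norm_snd_le[of "snd z" "fst z"] by auto
  show 2: "sqrt (quad z) * sqrt (quad z) = quad z" using q by simp
  show "sqrt (quad z) <= quad z" using mult_left_mono[OF 1, of "sqrt (quad z)"] 1 unfolding 2 by simp
qed

lemma growth_sqrt_quad:
  fixes z :: "'b::euclidean_space \<times> 'b"
  assumes "x <= L * (1 + r + S)" "r <= sqrt (quad z)" "0 <= L" "0 <= S"
  shows "x <= L * (2 + S) * sqrt (quad z)"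
proof -
  have "S * 1 <= S * sqrt (quad z)" by (rule mult_left_mono[OF sqrt_quad(1) assms(4)])
  then have "1 + r + S <= (2 + S) * sqrt (quad z)" using assms(2) sqrt_quad(1)[of z] unfolding distrib_right by linarith
  then have "L * (1 + r + S) <= L * ((2 + S) * sqrt (quad z))" using assms(3) by (rule mult_left_mono)
  then show ?thesis using assms(1) by (simp add: mult.assoc)
qed

lemma inner_diff_quad_bound:
  fixes u v w :: "'a::real_inner" and z :: "'b::euclidean_space \<times> 'b"
  assumes "norm u <= a * sqrt (quad z)" "norm v <= b * sqrt (quad z)" "norm w <= c * sqrt (quad z)"
  shows "\<bar>u \<bullet> (v - w)\<bar> <= a * (b + c) * quad z"
proof -
  have "norm (v - w) <= (b + c) * sqrt (quad z)" using norm_triangle_ineq4[of v w] assms(2,3) by (simp add: distrib_right)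
  then have "norm u * norm (v - w) <= (a * sqrt (quad z)) * ((b + c) * sqrt (quad z))"
    by (rule mult_mono[OF assms(1)]) (use order_trans[OF norm_ge_zero assms(1)] in auto)
  also have "\<dots> = a * (b + c) * (sqrt (quad z) * sqrt (quad z))" by (simp only: mult_ac)
  finally show ?thesis using Cauchy_Schwarz_ineq2[of u "v - w"] unfolding sqrt_quad(4) by linarith
qed

lemma norm_sq_quad_bound:
  fixes z :: "'b::euclidean_space \<times> 'b"
  assumes "norm u <= a * sqrt (quad z)"
  shows "(norm u)\<^sup>2 <= a\<^sup>2 * quad z"
proof -
  have "norm u * norm u <= (a * sqrt (quad z)) * (a * sqrt (quad z))"
    by (rule mult_mono[OF assms assms]) (use order_trans[OF norm_ge_zero assms] in auto)
  also have "\<dots> = a\<^sup>2 * (sqrt (quad z) * sqrt (quad z))" by (simp only: power2_eq_square mult_ac)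
  finally show ?thesis unfolding sqrt_quad(4) by (simp add: power2_eq_square)
qed

lemma deriv_test_val:
  assumes g: "good m" and d: "(psi \<phi> has_real_derivative p) (at t)"
  shows "deriv (\<lambda>s. real_of_ereal (test_val \<phi> s m)) t = p - alpha \<phi> * exp (lam \<phi> * t) * (lam \<phi> * w3 m)"
proof (rule DERIV_imp_deriv)
  have "((\<lambda>s. psi \<phi> s + (LINT z|meas m. fpart \<phi> z) - alpha \<phi> * exp (lam \<phi> * s) * w3 m)
      has_real_derivative p - alpha \<phi> * exp (lam \<phi> * t) * (lam \<phi> * w3 m)) (at t)"
    by (auto intro!: derivative_eq_intros d)
  then show "((\<lambda>s. real_of_ereal (test_val \<phi> s m)) has_real_derivative p - alpha \<phi> * exp (lam \<phi> * t) * (lam \<phi> * w3 m)) (at t)"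
    unfolding objective_good(2)[OF g] real_of_ereal.simps .
qed

lemma convergent_bound:
  fixes a :: "nat => real"
  assumes "a \<longlonglongrightarrow> l"
  shows "\<exists>A\<ge>0. \<forall>j. \<bar>a j\<bar> <= A"
proof -
  have "Bseq a" using assms by (intro convergent_imp_Bseq convergentI)
  then obtain K where "0 < K" "\<forall>j. norm (a j) <= K" by (rule BseqE)
  then show ?thesis by (intro exI[of _ K]) auto
qed

section \<open>The inequality in the limit\<close>

text \<open>Terms without logarithmic gradients have at most quadratic growth, where bounded third
  moments suffice, with two exceptions: the drift against the gradient of the test function, which
  is cubic and passes through \<open>ui_wt\<close>, and the time derivative, which contains the
  third moment itself. The gradient terms are left to \<open>fisher_limit\<close>.\<close>

lemma (in approx_solutions) limit_inequality:
  assumes \<phi>: "\<phi> \<in> H_test T" and \<kappa>: "0 < \<kappa>" and mp: "is_min_point T (objective W V \<phi> \<kappa>) ts ms"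
    and Fnc: "!!n. continuous_on UNIV (Fn n)" and Gnc: "!!n. continuous_on UNIV (Gn n)"
    and FnF: "locally_uniform_limit UNIV Fn F" and GnG: "locally_uniform_limit UNIV Gn G"
    and FG: "!!n x \<mu> u. norm (Fn n (x, \<mu>, u)) + norm (Gn n (x, \<mu>, u)) <= E * (1 + norm x + norm u + sqrt (E2 \<mu>))" and E0: "0 <= E"
    and \<sigma>n: "!!n. 0 <= \<sigma>n n" "\<sigma>n \<longlonglongrightarrow> \<sigma>" and \<sigma>: "0 < \<sigma>"
    and sol: "!!n. monotone_solution T (Fn n) (Gn n) (\<sigma>n n) (Wn n)" and lg: "linear_growth V"
  shows "\<exists>g. is_grad_x_log (meas ms) g \<and> integrable (meas ms) (\<lambda>z. (norm (g z))\<^sup>2) \<and> monotone_ineq F G \<sigma> W V \<phi> \<kappa> ts ms g"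
proof -
  obtain R \<beta> f \<epsilon> \<delta> N t m where gs: "good_seq m ms R" and wl: "(\<lambda>j. w3 (m j)) \<longlonglongrightarrow> w3 ms" and tl: "t \<longlonglongrightarrow> ts"
    and ts: "0 < ts" "ts < T" and Nl: "filterlim N at_top sequentially" and el: "\<epsilon> \<longlonglongrightarrow> 0" and e0: "!!j. 0 < \<epsilon> j"
    and \<beta>: "0 < \<beta>" and dl: "\<delta> \<longlonglongrightarrow> 0" and fC: "!!j. C2_bounded (f j)" and fb: "!!j. c2_bound (\<lambda>z. \<epsilon> j * f j z) (\<delta> j)"
    and mpj: "!!j. is_min_point T (objective (Wn (N j)) V (perturb T ts \<beta> (\<epsilon> j) (f j) \<phi>) (\<kappa> + \<epsilon> j)) (t j) (m j)"
    using perturbed_minimisers[OF \<phi> \<kappa> mp] by blast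
  interpret g: good_seq m ms R by (rule gs)
  have tT: "0 < t j" "t j < T" for j using mpj[of j] unfolding is_min_point_def by auto
  then have tT': "t j \<in> {0..T}" for j using less_imp_le by (simp add: less_imp_le)
  have ts': "ts \<in> {0..T}" using ts by simp
  define \<phi>' where "\<phi>' j = perturb T ts \<beta> (\<epsilon> j) (f j) \<phi>" for j
  have \<phi>'H: "\<phi>' j \<in> H_test T" for j unfolding \<phi>'_def by (rule perturb_H_test[OF \<phi> fC]) (use e0 \<beta> in \<open>auto intro: less_imp_le\<close>)
  define k where "k j = \<kappa> + \<epsilon> j" for j
  have k0: "0 < k j" for j using \<kappa> e0[of j] by (simp add: k_def)
  have "\<exists>g. is_grad_x_log (meas (m j)) g \<and> integrable (meas (m j)) (\<lambda>z. (norm (g z))\<^sup>2) \<and>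
      monotone_ineq (Fn (N j)) (Gn (N j)) (\<sigma>n (N j)) (Wn (N j)) V (\<phi>' j) (k j) (t j) (m j) g" for j
    using sol[of "N j"] Vc lg \<phi>'H[of j] k0[of j] mpj[of j, folded \<phi>'_def k_def] unfolding monotone_solution_def by blast
  then obtain h where h: "!!j. is_grad_x_log (meas (m j)) (h j)" "!!j. integrable (meas (m j)) (\<lambda>z. (norm (h j z))\<^sup>2)"
    "!!j. monotone_ineq (Fn (N j)) (Gn (N j)) (\<sigma>n (N j)) (Wn (N j)) V (\<phi>' j) (k j) (t j) (m j) (h j)" by metis
  define Wj where "Wj j x = Wn (N j) (t j, x, marg1 (m j))" for j x
  define Wl where "Wl x = W (ts, x, marg1 ms)" for x
  define Fj where "Fj j x = Fn (N j) (x, marg1 (m j), Wj j x)" for j x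
  define Fl where "Fl x = F (x, marg1 ms, Wl x)" for x
  define Gj where "Gj j x = Gn (N j) (x, marg1 (m j), Wj j x)" for j x
  define Gl where "Gl x = G (x, marg1 ms, Wl x)" for x
  define Vj where "Vj j y = V (y, marg2 (m j))" for j y
  define Vl where "Vl y = V (y, marg2 ms)" for y
  have Wp: "(\<lambda>j. Wj j x) \<longlonglongrightarrow> Wl x" for x
    unfolding Wj_def Wl_def by (rule Wn_tendsto(2)[OF tl tendsto_const g.marg_conv(1) tT' ts' Nl])
  have tup: "(\<lambda>j. (x, marg1 (m j), Wj j x)) \<longlonglongrightarrow> (x, marg1 ms, Wl x)" for x
    by (intro tendsto_Pair tendsto_const g.marg_conv(1) Wp)
  have Fp: "(\<lambda>j. Fj j x) \<longlonglongrightarrow> Fl x" for x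
    unfolding Fj_def Fl_def by (rule locally_uniform_limit_seq(2)[OF FnF Fnc tup UNIV_I UNIV_I Nl])
  have Gp: "(\<lambda>j. Gj j x) \<longlonglongrightarrow> Gl x" for x
    unfolding Gj_def Gl_def by (rule locally_uniform_limit_seq(2)[OF GnG Gnc tup UNIV_I UNIV_I Nl])
  have Vp: "(\<lambda>j. Vj j y) \<longlonglongrightarrow> Vl y" for y
    unfolding Vj_def Vl_def by (rule continuous_on_tendsto_compose[OF Vc]) (auto intro!: tendsto_Pair g.marg_conv)
  have Wcj: "continuous_on UNIV (Wj j)" for j unfolding Wj_def[abs_def] by (rule slice(1)[OF tT'])
  have tc: "continuous_on UNIV (\<lambda>x. (x, marg1 (m j), Wj j x))" for j
    by (intro continuous_on_Pair continuous_on_id continuous_on_const Wcj)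
  have cm: "(\<lambda>z. Y (fst z)) \<in> borel_measurable borel" "(\<lambda>z. Y (snd z)) \<in> borel_measurable borel" if "continuous_on UNIV Y" for Y :: "'a => 'a"
    by (rule borel_measurable_continuous_onI, rule continuous_on_compose2[OF that]; auto intro!: continuous_intros)+
  have Wm [measurable]: "(\<lambda>z. Wj j (fst z)) \<in> borel_measurable borel" for j by (rule cm(1)[OF Wcj])
  have Fm [measurable]: "(\<lambda>z. Fj j (fst z)) \<in> borel_measurable borel" for j
    by (rule cm(1), unfold Fj_def, rule continuous_on_compose2[OF Fnc tc]) auto
  have Gm [measurable]: "(\<lambda>z. Gj j (fst z)) \<in> borel_measurable borel" for j
    by (rule cm(1), unfold Gj_def, rule continuous_on_compose2[OF Gnc tc]) auto
  have Vm [measurable]: "(\<lambda>z. Vj j (snd z)) \<in> borel_measurable borel" for j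
    by (rule cm(2), unfold Vj_def, rule continuous_on_compose2[OF Vc]) (auto intro!: continuous_intros)
  define S where "S = g.SR"
  have S0: "0 <= S" and S1: "sqrt (E2 (marg1 (m j))) <= S" and S2: "sqrt (E2 (marg2 (m j))) <= S" for j
    unfolding S_def by (rule g.sqrt_E2_le)+
  have Wg: "norm (Wj j x) <= C * (1 + norm x + S)" for j x
    unfolding Wj_def using S1[of j] C0 by (intro order_trans[OF Wnb[OF tT']] mult_left_mono) auto
  define L where "L = E * (1 + C)"
  have L0: "0 <= L" using E0 C0 by (simp add: L_def)
  have FGg: "norm (Fj j x) + norm (Gj j x) <= L * (1 + norm x + S)" for j x
  proof -
    have "norm (Fj j x) + norm (Gj j x) <= E * (1 + norm x + norm (Wj j x) + sqrt (E2 (marg1 (m j))))"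
      unfolding Fj_def Gj_def by (rule FG)
    also have "\<dots> <= E * (1 + norm x + C * (1 + norm x + S) + S)"
      using Wg[of j x] S1[of j] E0 by (intro mult_left_mono add_mono) auto
    also have "\<dots> = L * (1 + norm x + S)" by (simp add: L_def algebra_simps)
    finally show ?thesis .
  qed
  have Fg: "norm (Fj j x) <= L * (1 + norm x + S)" and Gg: "norm (Gj j x) <= L * (1 + norm x + S)" for j x
    using FGg[of j x] norm_ge_zero[of "Fj j x"] norm_ge_zero[of "Gj j x"] by linarith+
  have Vg: "norm (Vj j x) <= D * (1 + norm x + S)" for j x
    unfolding Vj_def using S2[of j] D0 by (intro order_trans[OF Vb] mult_left_mono) auto
  define cW where "cW = C * (2 + S)"
  define cF where "cF = L * (2 + S)"
  define cV where "cV = D * (2 + S)"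
  have Wq: "norm (Wj j (fst z)) <= cW * sqrt (quad z)" for j and z :: "'a \<times> 'a"
    unfolding cW_def by (rule growth_sqrt_quad[OF Wg sqrt_quad(2) C0 S0])
  have Fq: "norm (Fj j (fst z)) <= cF * sqrt (quad z)" for j and z :: "'a \<times> 'a"
    unfolding cF_def by (rule growth_sqrt_quad[OF Fg sqrt_quad(2) L0 S0])
  have Gq: "norm (Gj j (fst z)) <= cF * sqrt (quad z)" for j and z :: "'a \<times> 'a"
    unfolding cF_def by (rule growth_sqrt_quad[OF Gg sqrt_quad(2) L0 S0])
  have Vq: "norm (Vj j (snd z)) <= cV * sqrt (quad z)" for j and z :: "'a \<times> 'a"
    unfolding cV_def by (rule growth_sqrt_quad[OF Vg sqrt_quad(3) D0 S0])
  have xq: "norm (fst z) <= 1 * sqrt (quad z)" "norm (snd z) <= 1 * sqrt (quad z)" for z :: "'a \<times> 'a"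
    using sqrt_quad(2,3)[of z] by auto
  have I6: "(\<lambda>j. LINT z|meas (m j). Fj j (fst z) \<bullet> (Wj j (fst z) - Vj j (snd z))) \<longlonglongrightarrow> (LINT z|meas ms. Fl (fst z) \<bullet> (Wl (fst z) - Vl (snd z)))"
    by (rule g.integral_conv_quad(1)[OF _ _ inner_diff_quad_bound[OF Fq Wq Vq]])
      (measurable, intro tendsto_inner tendsto_diff Fp Wp Vp)
  have I7: "(\<lambda>j. LINT z|meas (m j). Gj j (fst z) \<bullet> (fst z - snd z)) \<longlonglongrightarrow> (LINT z|meas ms. Gl (fst z) \<bullet> (fst z - snd z))"
    by (rule g.integral_conv_quad(1)[OF _ _ inner_diff_quad_bound[OF Gq xq]])
      (measurable, intro tendsto_inner tendsto_const Gp)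
  have f0C: "C2_bounded (fpart \<phi>)" and C1: "C1_bounded_on_initial T (psi \<phi>)" using \<phi> by (auto simp: H_test_def)
  obtain b0 where b0: "0 <= b0" "c2_bound (fpart \<phi>) b0" using C2_bounded_c2_bound[OF f0C] by blast
  obtain Df D2f where D: "!!z. (fpart \<phi> has_derivative blinfun_apply (Df z)) (at z)"
    "!!z. (Df has_derivative blinfun_apply (D2f z)) (at z)" "continuous_on UNIV D2f" "!!z. norm (Df z) <= b0" "!!z. norm (D2f z) <= b0"
    using b0(2) unfolding c2_bound_def by blast
  have "\<forall>j. \<exists>A B. (\<forall>z. ((\<lambda>z. \<epsilon> j * f j z) has_derivative blinfun_apply (A z)) (at z)) \<and> (\<forall>z. (A has_derivative blinfun_apply (B z)) (at z)) \<and>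
     continuous_on UNIV B \<and> (\<forall>z. \<bar>\<epsilon> j * f j z\<bar> <= \<delta> j \<and> norm (A z) <= \<delta> j \<and> norm (B z) <= \<delta> j)"
    using fb unfolding c2_bound_def by blast
  then obtain A B where AB: "\<forall>j. (\<forall>z. ((\<lambda>z. \<epsilon> j * f j z) has_derivative blinfun_apply (A j z)) (at z)) \<and> (\<forall>z. (A j has_derivative blinfun_apply (B j z)) (at z)) \<and>
     continuous_on UNIV (B j) \<and> (\<forall>z. \<bar>\<epsilon> j * f j z\<bar> <= \<delta> j \<and> norm (A j z) <= \<delta> j \<and> norm (B j z) <= \<delta> j)"
    unfolding choice_iff by blast
  then have A1: "((\<lambda>z. \<epsilon> j * f j z) has_derivative blinfun_apply (A j z)) (at z)" and A2: "(A j has_derivative blinfun_apply (B j z)) (at z)"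
    and Bc: "continuous_on UNIV (B j)" and A\<delta>: "norm (A j z) <= \<delta> j" and B\<delta>: "norm (B j z) <= \<delta> j" for j z by blast+
  have Dc: "continuous_on UNIV Df" and Ac: "continuous_on UNIV (A j)" for j
    unfolding continuous_on_eq_continuous_at[OF open_UNIV] using D(2) A2 has_derivative_continuous by blast+
  have d1: "(fpart (\<phi>' j) has_derivative blinfun_apply (Df z + A j z)) (at z)" for j z
    unfolding \<phi>'_def perturb_simps plus_blinfun.rep_eq by (rule has_derivative_add[OF D(1) A1])
  have d2: "((\<lambda>z. Df z + A j z) has_derivative blinfun_apply (D2f z + B j z)) (at z)" for j z
    unfolding plus_blinfun.rep_eq by (rule has_derivative_add[OF D(2) A2])
  define a where "a j = alpha (\<phi>' j) * exp (lam (\<phi>' j) * t j)" for j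
  define al where "al = alpha \<phi> * exp (lam \<phi> * ts)"
  define d where "d = real DIM('a)"
  \<comment> \<open>The cubic coefficient is raised only by a multiple of \<epsilon>, which
    disappears in the limit.\<close>
  have apl: "(\<lambda>j. alpha (\<phi>' j)) \<longlonglongrightarrow> alpha \<phi> + 0 * \<beta> * exp (- (lam \<phi> * ts))"
    unfolding \<phi>'_def perturb_simps by (intro tendsto_add tendsto_mult tendsto_const el)
  have all: "a \<longlonglongrightarrow> al"
  proof -
    have "(\<lambda>j. alpha (\<phi>' j) * exp (lam \<phi> * t j)) \<longlonglongrightarrow> (alpha \<phi> + 0 * \<beta> * exp (- (lam \<phi> * ts))) * exp (lam \<phi> * ts)"
      by (intro tendsto_mult tendsto_exp tendsto_const tl apl)
    then show ?thesis by (simp add: a_def[abs_def] al_def \<phi>'_def)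
  qed
  obtain Aa where Aa: "0 <= Aa" "!!j. \<bar>a j\<bar> <= Aa" using convergent_bound[OF all] by blast
  obtain \<Delta> where \<Delta>: "0 <= \<Delta>" "!!j. \<bar>\<delta> j\<bar> <= \<Delta>" using convergent_bound[OF dl] by blast
  have d0: "0 <= d" by (simp add: d_def)
  have ddl: "(\<lambda>j. d * \<delta> j) \<longlonglongrightarrow> 0" using dl by (rule tendsto_mult_right_zero)
  have gA: "norm (GX (A j) z) <= d * \<delta> j" and lB: "\<bar>LX (B j) z\<bar> <= d * \<delta> j" for j z
    using order_trans[OF norm_GX[of "A j" z] mult_left_mono[OF A\<delta>[of j z] d0[unfolded d_def]]]
      order_trans[OF abs_LX[of "B j" z] mult_left_mono[OF B\<delta>[of j z] d0[unfolded d_def]]] unfolding d_def .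
  have gD: "norm (GX Df z) <= d * b0" and lD: "\<bar>LX D2f z\<bar> <= d * b0" for z
    using order_trans[OF norm_GX[of Df z] mult_left_mono[OF D(4)[of z] d0[unfolded d_def]]]
      order_trans[OF abs_LX[of D2f z] mult_left_mono[OF D(5)[of z] d0[unfolded d_def]]] unfolding d_def .
  have d\<Delta>: "d * \<delta> j <= d * \<Delta>" for j using \<Delta>(2)[of j] d0 by (intro mult_left_mono) auto
  have gAl: "(\<lambda>j. GX (A j) z) \<longlonglongrightarrow> 0" and lBl: "(\<lambda>j. LX (B j) z) \<longlonglongrightarrow> 0" for z
    using Lim_null_comparison[OF always_eventually ddl, of "\<lambda>j. GX (A j) z"] Lim_null_comparison[OF always_eventually ddl, of "\<lambda>j. LX (B j) z"]
      gA lB by auto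
  define P where "P j z = GX Df z + GX (A j) z - (a j * (3 * norm (fst z))) *\<^sub>R fst z" for j z
  define Pl where "Pl z = GX Df z - (al * (3 * norm (fst z))) *\<^sub>R fst z" for z
  define Lp where "Lp j z = LX D2f z + LX (B j) z - a j * (3 * (1 + d) * norm (fst z))" for j z
  define Ll where "Ll z = LX D2f z - al * (3 * (1 + d) * norm (fst z))" for z
  have Peq: "grad (\<lambda>x. test_grad_m (\<phi>' j) (t j) (x, snd z)) (fst z) = P j z"
    and Leq: "laplacian (\<lambda>x. test_grad_m (\<phi>' j) (t j) (x, snd z)) (fst z) = Lp j z" for j z
    unfolding test_grad_m_derivatives[OF d1 d2] P_def Lp_def a_def GX_add LX_add d_def prod.collapse by simp_all
  have Pleq: "grad (\<lambda>x. test_grad_m \<phi> ts (x, snd z)) (fst z) = Pl z"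
    and Lleq: "laplacian (\<lambda>x. test_grad_m \<phi> ts (x, snd z)) (fst z) = Ll z" for z
    unfolding test_grad_m_derivatives[OF D(1,2)] Pl_def Ll_def al_def d_def prod.collapse by simp_all
  have Gc: "continuous_on UNIV (GX Df)" "continuous_on UNIV (GX (A j))" "continuous_on UNIV (LX D2f)" "continuous_on UNIV (LX (B j))" for j
    by (intro GX_continuous LX_continuous Dc Ac D(3) Bc)+
  have Pm [measurable]: "P j \<in> borel_measurable borel" and Lm [measurable]: "Lp j \<in> borel_measurable borel" for j
    unfolding P_def[abs_def] Lp_def[abs_def] by (rule borel_measurable_continuous_onI, intro continuous_intros Gc)+
  have Pp: "(\<lambda>j. P j z) \<longlonglongrightarrow> Pl z" for z
  proof -
    have "(\<lambda>j. P j z) \<longlonglongrightarrow> GX Df z + 0 - (al * (3 * norm (fst z))) *\<^sub>R fst z"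
      unfolding P_def by (intro tendsto_diff tendsto_add tendsto_scaleR tendsto_mult tendsto_const gAl all)
    then show ?thesis by (simp add: Pl_def)
  qed
  have Lpp: "(\<lambda>j. Lp j z) \<longlonglongrightarrow> Ll z" for z
  proof -
    have "(\<lambda>j. Lp j z) \<longlonglongrightarrow> LX D2f z + 0 - al * (3 * (1 + d) * norm (fst z))"
      unfolding Lp_def by (intro tendsto_diff tendsto_add tendsto_mult tendsto_const lBl all)
    then show ?thesis by (simp add: Ll_def)
  qed
  define c where "c = d * b0 + d * \<Delta>"
  have c0: "0 <= c" using d0 b0 \<Delta> by (simp add: c_def)
  have I2: "(\<lambda>j. LINT z|meas (m j). Lp j z) \<longlonglongrightarrow> (LINT z|meas ms. Ll z)"
  proof (rule g.integral_conv_quad(1)[OF Lm Lpp])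
    fix j and z :: "'a \<times> 'a"
    have "\<bar>a j * (3 * (1 + d) * norm (fst z))\<bar> = \<bar>a j\<bar> * (3 * (1 + d) * norm (fst z))" using d0 by (simp add: abs_mult)
    also have "\<dots> <= Aa * (3 * (1 + d) * quad z)"
      using Aa d0 order_trans[OF sqrt_quad(2,5), of z] by (intro mult_mono mult_left_mono) auto
    finally have "\<bar>a j * (3 * (1 + d) * norm (fst z))\<bar> <= (Aa * 3 * (1 + d)) * quad z" by (simp only: mult_ac)
    moreover have "c * 1 <= c * quad z" using c0 by (intro mult_left_mono) (auto simp: quad_def)
    ultimately show "\<bar>Lp j z\<bar> <= (c + Aa * 3 * (1 + d)) * quad z"
      using lD[of z] lB[of j z] d\<Delta>[of j] unfolding Lp_def c_def distrib_right by linarith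
  qed
  define K where "K = L * (1 + S) * (2 * c + 6 * Aa)"
  have K0: "0 <= K" using L0 S0 c0 Aa by (simp add: K_def)
  have FP: "\<bar>Fj j (fst z) \<bullet> P j z\<bar> <= K * (1 + wt z)" for j z
  proof -
    define r where "r = norm (fst z)"
    have r0: "0 <= r" by (simp add: r_def)
    have "norm ((a j * (3 * r)) *\<^sub>R fst z) = \<bar>a j\<bar> * (3 * r * r)" using r0 by (simp add: abs_mult r_def)
    also have "\<dots> <= Aa * (3 * r * r)" using Aa r0 by (intro mult_right_mono) auto
    also have "\<dots> = 3 * Aa * r\<^sup>2" by (simp add: power2_eq_square)
    finally have p: "norm (P j z) <= c + 3 * Aa * r\<^sup>2"
      using norm_triangle_ineq4[of "GX Df z + GX (A j) z" "(a j * (3 * r)) *\<^sub>R fst z"] norm_triangle_ineq[of "GX Df z" "GX (A j) z"]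
        gD[of z] gA[of j z] d\<Delta>[of j] unfolding P_def r_def[symmetric] c_def by linarith
    have "1 + r + S <= (1 + S) * (1 + r)" using r0 S0 by (simp add: algebra_simps)
    then have "L * (1 + r + S) <= L * ((1 + S) * (1 + r))" using L0 by (rule mult_left_mono)
    then have f: "norm (Fj j (fst z)) <= L * (1 + S) * (1 + r)" using Fg[of j "fst z"] unfolding r_def[symmetric] by (simp add: mult.assoc)
    have "\<bar>Fj j (fst z) \<bullet> P j z\<bar> <= norm (Fj j (fst z)) * norm (P j z)" by (rule Cauchy_Schwarz_ineq2)
    also have "\<dots> <= (L * (1 + S) * (1 + r)) * (c + 3 * Aa * r\<^sup>2)" by (rule mult_mono[OF f p]) (use L0 S0 r0 in auto)
    also have "\<dots> = L * (1 + S) * ((1 + r) * (c + 3 * Aa * r\<^sup>2))" by (simp only: mult.assoc)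
    also have "\<dots> <= L * (1 + S) * ((2 * c + 6 * Aa) * (1 + r ^ 3))"
      using L0 S0 by (intro mult_left_mono cubic_growth r0 c0 Aa) auto
    also have "\<dots> = K * (1 + r ^ 3)" by (simp only: K_def mult.assoc)
    also have "\<dots> <= K * (1 + wt z)" using K0 by (intro mult_left_mono) (auto simp: wt_def r_def)
    finally show ?thesis .
  qed
  have wtm: "(\<lambda>z. K * (1 + wt z)) \<in> borel_measurable borel" unfolding wt_def by measurable
  have FPm: "(\<lambda>z. Fj j (fst z) \<bullet> P j z) \<in> borel_measurable borel" for j by measurable
  have FPp: "(\<lambda>j. Fj j (fst z) \<bullet> P j z) \<longlonglongrightarrow> Fl (fst z) \<bullet> Pl z" for z by (intro tendsto_inner Fp Pp)
  have I1: "(\<lambda>j. LINT z|meas (m j). Fj j (fst z) \<bullet> P j z) \<longlonglongrightarrow> (LINT z|meas ms. Fl (fst z) \<bullet> Pl z)"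
    by (rule setwise_integral_pointwise(1)[OF g.sw g.uc finb_meas finb_meas FPm borel_measurable_LIMSEQ_metric[OF FPm FPp] FPp FP wtm g.ui_wt[OF wl K0]])
  define T0 where "T0 j = deriv (psi \<phi>) (t j) - bar' T ts (t j) - a j * (lam \<phi> * w3 (m j))" for j
  define Tl where "Tl = deriv (psi \<phi>) ts - al * (lam \<phi> * w3 ms)"
  have T0eq: "deriv (\<lambda>s. real_of_ereal (test_val (\<phi>' j) s (m j))) (t j) = T0 j" for j
  proof -
    have "(psi (\<phi>' j) has_real_derivative deriv (psi \<phi>) (t j) - bar' T ts (t j)) (at (t j))"
      unfolding \<phi>'_def perturb_simps by (intro DERIV_diff C1_initial_deriv(1)[OF C1] bar_deriv tT)
    from deriv_test_val[OF g.gm this] show ?thesis by (simp add: T0_def a_def \<phi>'_def)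
  qed
  have Tleq: "deriv (\<lambda>s. real_of_ereal (test_val \<phi> s ms)) ts = Tl"
    using deriv_test_val[OF g.gn C1_initial_deriv(1)[OF C1 ts]] by (simp add: Tl_def al_def)
  have Tlim: "T0 \<longlonglongrightarrow> Tl"
  proof -
    \<comment> \<open>The penalty has zero derivative at \<open>ts\<close>, so the time derivatives
      converge to that of the original test function.\<close>
    have "(\<lambda>j. bar' T ts (t j)) \<longlonglongrightarrow> bar' T ts ts"
      by (rule continuous_on_tendsto_compose[OF bar'_continuous tl]) (use ts tT in auto)
    then have "(\<lambda>j. T0 j) \<longlonglongrightarrow> deriv (psi \<phi>) ts - bar' T ts ts - al * (lam \<phi> * w3 ms)"
      unfolding T0_def by (intro tendsto_diff tendsto_mult tendsto_const all wl isCont_tendsto_compose[OF C1_initial_deriv(2)[OF C1 ts] tl])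
    then show ?thesis by (simp add: Tl_def bar'_def)
  qed
  define s where "s j = \<sigma>n (N j)" for j
  have sl: "s \<longlonglongrightarrow> \<sigma>" unfolding s_def using filterlim_compose[OF \<sigma>n(2) Nl] .
  have s0: "0 <= s j" for j unfolding s_def by (rule \<sigma>n)
  have kl: "k \<longlonglongrightarrow> \<kappa>"
  proof -
    have "(\<lambda>j. \<kappa> + \<epsilon> j) \<longlonglongrightarrow> \<kappa> + 0" by (intro tendsto_add tendsto_const el)
    then show ?thesis by (simp add: k_def[abs_def])
  qed
  define X where "X j = T0 j + (LINT z|meas (m j). Fj j (fst z) \<bullet> P j z) - s j * (LINT z|meas (m j). Lp j z)
    - (LINT z|meas (m j). Fj j (fst z) \<bullet> (Wj j (fst z) - Vj j (snd z))) - (LINT z|meas (m j). Gj j (fst z) \<bullet> (fst z - snd z))" for j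
  define Xl where "Xl = Tl + (LINT z|meas ms. Fl (fst z) \<bullet> Pl z) - \<sigma> * (LINT z|meas ms. Ll z)
    - (LINT z|meas ms. Fl (fst z) \<bullet> (Wl (fst z) - Vl (snd z))) - (LINT z|meas ms. Gl (fst z) \<bullet> (fst z - snd z))"
  have XX: "X \<longlonglongrightarrow> Xl" unfolding X_def[abs_def] Xl_def by (intro tendsto_diff tendsto_add tendsto_mult Tlim I1 sl I2 I6 I7)
  \<comment> \<open>Solved for the Fisher information, with all terms free of logarithmic gradients
    collected in \<open>X\<close>, as \<open>fisher_limit\<close> expects.\<close>
  have ineq: "s j * k j * (LINT z|meas (m j). (norm (h j z))\<^sup>2)
       <= X j - 2 * s j * (LINT z|meas (m j). Wj j (fst z) \<bullet> h j z) - k j * (LINT z|meas (m j). Fj j (fst z) \<bullet> h j z)" for j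
    using h(3)[of j] unfolding monotone_ineq_def Let_def T0eq Peq Leq
    unfolding Wj_def[symmetric] Vj_def[symmetric] s_def[symmetric] 
    unfolding Fj_def[symmetric] Gj_def[symmetric] X_def by linarith
  have q1: "(norm (Wj j (fst z)))\<^sup>2 <= (cW\<^sup>2 + cF\<^sup>2) * quad z" "(norm (Fj j (fst z)))\<^sup>2 <= (cW\<^sup>2 + cF\<^sup>2) * quad z" for j and z :: "'a \<times> 'a"
  proof -
    have "0 <= cW\<^sup>2 * quad z" "0 <= cF\<^sup>2 * quad z" by (auto simp: quad_def)
    then show "(norm (Wj j (fst z)))\<^sup>2 <= (cW\<^sup>2 + cF\<^sup>2) * quad z" "(norm (Fj j (fst z)))\<^sup>2 <= (cW\<^sup>2 + cF\<^sup>2) * quad z"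
      using norm_sq_quad_bound[OF Wq[of j z]] norm_sq_quad_bound[OF Fq[of j z]] unfolding distrib_right by linarith+
  qed
  obtain g' where g': "is_grad_x_log (meas ms) g'" "integrable (meas ms) (\<lambda>z. (norm (g' z))\<^sup>2)"
    "\<sigma> * \<kappa> * (LINT z|meas ms. (norm (g' z))\<^sup>2) <= Xl - 2 * \<sigma> * (LINT z|meas ms. Wl (fst z) \<bullet> g' z) - \<kappa> * (LINT z|meas ms. Fl (fst z) \<bullet> g' z)"
    using g.fisher_limit[OF h(1,2) Wm Wp q1(1) Fm Fp q1(2) XX sl \<sigma> s0 kl \<kappa> less_imp_le[OF k0] ineq] by blast
  have "monotone_ineq F G \<sigma> W V \<phi> \<kappa> ts ms g'"
    unfolding monotone_ineq_def Let_def Tleq Pleq Lleq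
    unfolding Wl_def[symmetric] Vl_def[symmetric]
    unfolding Fl_def[symmetric] Gl_def[symmetric] using g'(3) unfolding Xl_def by linarith
  then show ?thesis using g'(1,2) by blast
qed

theorem theorem4p7:
  fixes F G :: "(real^'d) \<times> (real^'d) P2 \<times> (real^'d) \<Rightarrow> real^'d"
    and Fn Gn :: "nat \<Rightarrow> (real^'d) \<times> (real^'d) P2 \<times> (real^'d) \<Rightarrow> real^'d"
    and W :: "real \<times> (real^'d) \<times> (real^'d) P2 \<Rightarrow> real^'d"
    and Wn :: "nat \<Rightarrow> real \<times> (real^'d) \<times> (real^'d) P2 \<Rightarrow> real^'d"
    and T \<sigma>x :: real and \<sigma>n :: "nat \<Rightarrow> real"
  assumes "0 < T" and "0 < \<sigma>x"
    and "\<And>n. continuous_on UNIV (Fn n)" and "\<And>n. continuous_on UNIV (Gn n)"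
    and "\<exists>C. \<forall>n x \<mu> u. norm (Fn n (x, \<mu>, u)) + norm (Gn n (x, \<mu>, u))
           \<le> C * (1 + norm x + norm u + sqrt (E2 \<mu>))"
    and "\<And>n. 0 \<le> \<sigma>n n"
    and "\<And>n. monotone_solution T (Fn n) (Gn n) (\<sigma>n n) (Wn n)"
    and "locally_uniform_limit UNIV Fn F" and "locally_uniform_limit UNIV Gn G"
    and "\<sigma>n \<longlonglongrightarrow> \<sigma>x"
    and "locally_uniform_limit ({0..T} \<times> UNIV \<times> UNIV) Wn W"
    and "\<exists>C>0. \<forall>n. \<forall>t\<in>{0..T}. \<forall>x \<mu>.
           norm (Wn n (t, x, \<mu>)) \<le> C * (1 + norm x + sqrt (E2 \<mu>))"
  shows "monotone_solution T F G \<sigma>x W"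
proof -
  obtain E where E: "\<And>n x \<mu> u. norm (Fn n (x, \<mu>, u)) + norm (Gn n (x, \<mu>, u)) \<le> E * (1 + norm x + norm u + sqrt (E2 \<mu>))"
    using assms(5) by blast
  have "0 \<le> E"
    using E[of 0 0 undefined 0] norm_ge_zero[of "Fn 0 (0, undefined, 0)"] norm_ge_zero[of "Gn 0 (0, undefined, 0)"]
    by (smt (verit) E2_def enn2real_nonneg norm_zero real_sqrt_ge_zero zero_le_mult_iff)
  obtain C where C: "0 < C" "\<And>n t x \<mu>. t \<in> {0..T} \<Longrightarrow> norm (Wn n (t, x, \<mu>)) \<le> C * (1 + norm x + sqrt (E2 \<mu>))"
    using assms(12) by blast
  have Wnc: "continuous_on ({0..T} \<times> UNIV \<times> UNIV) (Wn n)" for n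
    using assms(7)[of n] unfolding monotone_solution_def by blast
  have sol: "approx_solutions T Wn W C V D"
    if "continuous_on UNIV V" "\<forall>y \<mu>. norm (V (y, \<mu>)) \<le> D * (1 + norm y + sqrt (E2 \<mu>))" "0 \<le> D" for V D
    using that assms(1,11) C Wnc by unfold_locales auto
  \<comment> \<open>The zero field instantiates the locale, because continuity of \<open>W\<close>
    has to be shown before any \<open>V\<close> is given.\<close>
  have "approx_solutions T Wn W C (\<lambda>_. 0) 0" by (rule sol) auto
  then have "continuous_on ({0..T} \<times> UNIV \<times> UNIV) W" by (rule approx_solutions.Wc)
  moreover have "\<exists>g. is_grad_x_log (meas m) g \<and> integrable (meas m) (\<lambda>z. (norm (g z))\<^sup>2) \<and> monotone_ineq F G \<sigma>x W V \<phi> \<kappa> t m g"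
    if V: "continuous_on UNIV V" "linear_growth V" and "\<phi> \<in> H_test T" "0 < \<kappa>" "is_min_point T (objective W V \<phi> \<kappa>) t m" for V \<phi> \<kappa> t m
  proof -
    obtain D where D: "0 \<le> D" "\<forall>y \<mu>. norm (V (y, \<mu>)) \<le> D * (1 + norm y + sqrt (E2 \<mu>))"
      using linear_growth_nonneg[OF V(2)] by blast
    show ?thesis
      by (rule approx_solutions.limit_inequality[OF sol[OF V(1) D(2,1)] that(3,4,5) assms(3,4,8,9) E \<open>0 \<le> E\<close> assms(6,10,2,7) V(2)])
  qed
  ultimately show ?thesis unfolding monotone_solution_def by blast
qed

end
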